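(* Let $p\in(0,1)$ be arbitrary and let $k\ge 2$ be an integer. Consider the zero-temperature Glauber dynamics on the slab $S_k=\mathbb{Z}^2\times\{0,1,\dots,k-1\}$ started from the i.i.d. product measure with density $p$ of $+1$ spins. With free boundary conditions, $S_k$ fixates if and only if $k=2$. With periodic boundary conditions, $S_k$ fixates if and only if $k\le 3$.
   Context: Slabs: for $k\ge2$ the vertex set of $S_k$ is $\mathbb{Z}^2\times\{0,1,\dots,k-1\}$. With free boundary conditions the edges are $\mathcal{E}_k=\{\{x,y\}:\|x-y\|_1=1\}$. With periodic boundary conditions one additionally declares $(x,y,k-1)$ and $(x,y,0)$ to be neighbors for every $(x,y)\in\mathbb{Z}^2$; when $k=2$ this produces two edges between $(x,y,0)$ and $(x,y,1)$, so that in the computation of the energy this neighbor is counted twice. Dynamics: spins are $\sigma_v(t)\in\{-1,+1\}$, $v\in S_k$, $t\ge 0$. The initial spins $\sigma_v(0)$ are i.i.d. with probability $p$ of being $+1$ and $1-p$ of being $-1$. Each vertex has an independent rate-one exponential clock (Poisson process). The energy of $v$ at time $t$ is $e_v(t)=-\sum_{w:\{v,w\}\in\mathcal{E}_k}\sigma_v(t)\sigma_w(t)$ (sum over edges, with multiplicity). When the clock at $v$ rings at time $t$, the spin at $v$ is updated: $\sigma_v(t)=-\sigma_v(t^-)$ if $e_v(t^-)>0$; $\sigma_v(t)=\pm1$ with probability $1/2$ each (independent fair coin) if $e_v(t^-)=0$; $\sigma_v(t)=\sigma_v(t^-)$ if $e_v(t^-)<0$. $\mathbb{P}_p$ denotes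 the joint law of the initial spins and the dynamics realization. Fixation: a site $v$ fixates if there is a (random) $T<\infty$ with $\sigma_v(t)=\sigma_v(T)$ for all $t\ge T$. The slab $S_k$ fixates if, with $\mathbb{P}_p$-probability one, all sites of $S_k$ fixate. *)

theory Defs
  imports "HOL-Probability.Probability"
begin

type_synonym vertex = "int \<times> int \<times> nat"

datatype boundary = Free | Periodic

definition slab :: "nat \<Rightarrow> vertex set" where
  "slab k = {(x, y, z). z < k}"

fun l1_dist :: "vertex \<Rightarrow> vertex \<Rightarrow> int" where
  "l1_dist (x, y, z) (x', y', z') = \<bar>x - x'\<bar> + \<bar>y - y'\<bar> + \<bar>int z - int z'\<bar>"

fun wraps :: "nat \<Rightarrow> vertex \<Rightarrow> vertex \<Rightarrow> bool" where
  "wraps k (x, y, z) (x', y', z') \<longleftrightarrow>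
     x = x' \<and> y = y' \<and> (z = 0 \<and> z' = k - 1 \<or> z = k - 1 \<and> z' = 0)"

(* The number of edges between two vertices of the slab of width k.  The value 2 occurs
   exactly for periodic boundary conditions with k = 2, on vertical pairs. *)
definition edge_mult :: "boundary \<Rightarrow> nat \<Rightarrow> vertex \<Rightarrow> vertex \<Rightarrow> nat" where
  "edge_mult b k v w =
     of_bool (l1_dist v w = 1) + of_bool (b = Periodic \<and> wraps k v w)"

definition neighbours :: "boundary \<Rightarrow> nat \<Rightarrow> vertex \<Rightarrow> vertex set" where
  "neighbours b k v = {w \<in> slab k. edge_mult b k v w > 0}"

lemma finite_neighbours: "finite (neighbours b k v)"
proof -
  obtain x y z where v: "v = (x, y, z)" by (cases v)
  have "neighbours b k v \<subseteq> {x - 1..x + 1} \<times> {y - 1..y + 1} \<times> {..<k}"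
    by (auto simp: neighbours_def slab_def edge_mult_def v split: if_splits)
  then show ?thesis by (rule finite_subset) auto
qed

lemma edge_mult_periodic_2: "edge_mult Periodic 2 (x, y, 0) (x, y, 1) = 2"
  by (simp add: edge_mult_def)

definition energy :: "boundary \<Rightarrow> nat \<Rightarrow> (vertex \<Rightarrow> int) \<Rightarrow> vertex \<Rightarrow> int" where
  "energy b k s v = - (\<Sum>w\<in>neighbours b k v. int (edge_mult b k v w) * (s v * s w))"

definition spin_pmf :: "real \<Rightarrow> int pmf" where
  "spin_pmf p = map_pmf (\<lambda>b. if b then 1 else -1) (bernoulli_pmf p)"

(* A sample assigns to each vertex its initial spin and, for each n, the waiting time
   before its n-th clock ring (counted from 0) together with the coin tossed at that ring. *)
type_synonym sample = "vertex \<Rightarrow> int \<times> (nat \<Rightarrow> real \<times> int)"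

definition glauber_measure :: "nat \<Rightarrow> real \<Rightarrow> sample measure" where
  "glauber_measure k p =
     (\<Pi>\<^sub>M v\<in>slab k. measure_pmf (spin_pmf p) \<Otimes>\<^sub>M
        (\<Pi>\<^sub>M n\<in>UNIV. density lborel (exponential_density 1) \<Otimes>\<^sub>M measure_pmf (spin_pmf (1/2))))"

lemma prob_space_glauber_measure: "prob_space (glauber_measure k p)"
  unfolding glauber_measure_def
  by (intro prob_space_PiM prob_space_pair prob_space_measure_pmf
        prob_space_exponential_density) simp

definition initial_spin :: "sample \<Rightarrow> vertex \<Rightarrow> int" where
  "initial_spin \<omega> v = fst (\<omega> v)"

definition ring_time :: "sample \<Rightarrow> vertex \<Rightarrow> nat \<Rightarrow> real" where
  "ring_time \<omega> v n = (\<Sum>i\<le>n. fst (snd (\<omega> v) i))"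

definition coin :: "sample \<Rightarrow> vertex \<Rightarrow> nat \<Rightarrow> int" where
  "coin \<omega> v n = snd (snd (\<omega> v) n)"

definition updated_spin :: "int \<Rightarrow> int \<Rightarrow> int \<Rightarrow> int" where
  "updated_spin s e c = (if e > 0 then - s else if e = 0 then c else s)"

definition left_limit :: "(vertex \<Rightarrow> real \<Rightarrow> int) \<Rightarrow> real \<Rightarrow> vertex \<Rightarrow> int" where
  "left_limit \<sigma> t w = Lim (at_left t) (\<sigma> w)"

definition glauber_trajectory ::
  "boundary \<Rightarrow> nat \<Rightarrow> sample \<Rightarrow> (vertex \<Rightarrow> real \<Rightarrow> int) \<Rightarrow> bool" where
  "glauber_trajectory b k \<omega> \<sigma> \<longleftrightarrow>
     (\<forall>v\<in>slab k.
        \<sigma> v 0 = initial_spin \<omega> v \<and>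
        (\<forall>s t. 0 \<le> s \<and> s \<le> t \<and> (\<forall>n. ring_time \<omega> v n \<notin> {s<..t}) \<longrightarrow> \<sigma> v t = \<sigma> v s) \<and>
        (\<forall>n. let t = ring_time \<omega> v n; \<eta> = left_limit \<sigma> t in
           \<sigma> v t = updated_spin (\<eta> v) (energy b k \<eta> v) (coin \<omega> v n)))"

(* By Harris' graphical construction, almost every sample has a trajectory, and its values
   at the vertices of the slab and at times t \<ge> 0 are unique; the choice only matters on a
   null set and at irrelevant arguments. *)
definition spin :: "boundary \<Rightarrow> nat \<Rightarrow> sample \<Rightarrow> vertex \<Rightarrow> real \<Rightarrow> int" where
  "spin b k \<omega> = (SOME \<sigma>. glauber_trajectory b k \<omega> \<sigma>)"

definition site_fixates :: "(real \<Rightarrow> int) \<Rightarrow> bool" where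
  "site_fixates f \<longleftrightarrow> (\<exists>T\<ge>0. \<forall>t\<ge>T. f t = f T)"

definition slab_fixates :: "boundary \<Rightarrow> nat \<Rightarrow> real \<Rightarrow> bool" where
  "slab_fixates b k p \<longleftrightarrow>
     (AE \<omega> in glauber_measure k p. \<forall>v\<in>slab k. site_fixates (spin b k \<omega> v))"

end

theory Submission
  imports Defs
begin

text \<open>In a sample without infinite chains of influence the dynamics is determined by recursion along the rings. The
  expected number of energy-lowering flips per site is finite, by translation invariance and a comparison of the energy
  of a large box with its boundary. By memorylessness of the clocks, a pattern that recurs in a finite window is infinitely
  often followed by a prescribed ring with a prescribed coin. Hence the limit configurations of a trajectory admit no
  energy-lowering flip and are closed under the flips of ties, and a site fixates unless some limit configuration has a tie
  there.

  With an odd number of edge ends (free boundary, width two) there is no tie. For periodic boundary conditions and width two,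
  and for the ties of width three in which the two vertical neighbours agree, every tie leads to an energy-lowering flip
  nearby or moves along a half line; the latter is stopped by a column contained in a block of plus spins, which never flips.
  The other ties of width three are corners of a contour in a planar region and can be pushed along a half line as well.

  Conversely, a finite initial pattern of spins that never flip, with one vertex (width four: a row of four vertices)
  surrounded by as many plus as minus spins, prevents fixation.\<close>

section \<open>The graphical construction\<close>

text \<open>The passage to limit configurations separates chance from combinatorics: any legal chain
  of tie flips that ends at a site of positive energy refutes the configuration it starts from, and
  from there on no probability is involved. Two facts carry the passage. The bound on the expected
  number of energy-lowering flips must not depend on time, which is achieved by letting the box grow
  with the time horizon. And a prescribed ring must follow a recurring pattern with a conditional
  probability bounded below, although the state of a finite window depends on the whole sample
  around it; therefore everything outside the window is held fixed and only the running waits inside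
  it are averaged. In the other direction, fixation would leave a single limit configuration, hence
  one without ties, so it is enough to freeze surroundings in which some site cannot have negative
  energy. In a periodic slab every vertex has six edge ends, so parity excludes ties in no
  width.\<close>

lemma neighbours_subset_slab: "neighbours b k v \<subseteq> slab k"
  by (auto simp: neighbours_def)

lemma energy_cong:
  assumes "s v = s' v" "\<And>w. w \<in> neighbours b k v \<Longrightarrow> s w = s' w"
  shows "energy b k s v = energy b k s' v"
  unfolding energy_def using assms by (auto intro!: sum.cong)

definition rings_before :: "sample \<Rightarrow> vertex \<Rightarrow> real \<Rightarrow> nat" where
  "rings_before \<omega> v t = card {i. ring_time \<omega> v i < t}"

definition rings_until :: "sample \<Rightarrow> vertex \<Rightarrow> real \<Rightarrow> nat" where
  "rings_until \<omega> v t = card {i. ring_time \<omega> v i \<le> t}"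

text \<open>The spin of \<^term>\<open>v\<close> after \<^term>\<open>m\<close> rings, computed by tracing influences back through at most
  \<^term>\<open>n\<close> rings; beyond that depth the initial spin is used.\<close>

fun approx_spin :: "boundary \<Rightarrow> nat \<Rightarrow> nat \<Rightarrow> sample \<Rightarrow> vertex \<Rightarrow> nat \<Rightarrow> int" where
  "approx_spin b k (Suc n) \<omega> v (Suc m) =
     (let \<eta> = (\<lambda>u. approx_spin b k n \<omega> u (rings_before \<omega> u (ring_time \<omega> v m)))
      in updated_spin (\<eta> v) (energy b k \<eta> v) (coin \<omega> v m))"
| "approx_spin b k _ \<omega> v _ = initial_spin \<omega> v"

lemma approx_spin_0 [simp]: "approx_spin b k n \<omega> v 0 = initial_spin \<omega> v"
  by (cases n) auto

text \<open>The limit of \<open>approx_spin\<close> as the depth grows. The fallback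
  \<open>-1\<close> keeps the value in {-1, 1} at every sample and every vertex, and the countable
  quantifiers keep it measurable in \<open>\<omega>\<close>.\<close>

definition ring_spin :: "boundary \<Rightarrow> nat \<Rightarrow> sample \<Rightarrow> vertex \<Rightarrow> nat \<Rightarrow> int" where
  "ring_spin b k \<omega> v m = (if \<exists>N. \<forall>n\<ge>N. approx_spin b k n \<omega> v m = 1 then 1 else -1)"

definition config_before :: "boundary \<Rightarrow> nat \<Rightarrow> sample \<Rightarrow> real \<Rightarrow> vertex \<Rightarrow> int" where
  "config_before b k \<omega> t u = ring_spin b k \<omega> u (rings_before \<omega> u t)"

definition config_at :: "boundary \<Rightarrow> nat \<Rightarrow> sample \<Rightarrow> real \<Rightarrow> vertex \<Rightarrow> int" where
  "config_at b k \<omega> t u = ring_spin b k \<omega> u (rings_until \<omega> u t)"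

text \<open>A state is a vertex with a number of completed rings; a pair leads from a state to one
  whose computation reads it. The vertex itself is among those read, since its old spin enters the
  update. Well-foundedness is Harris' condition that no influence can be traced back for
  ever.\<close>

definition influence :: "boundary \<Rightarrow> nat \<Rightarrow> sample \<Rightarrow> ((vertex \<times> nat) \<times> (vertex \<times> nat)) set" where
  "influence b k \<omega> = {((u, rings_before \<omega> u (ring_time \<omega> v m)), (v, Suc m)) | u v m.
     v \<in> slab k \<and> u \<in> insert v (neighbours b k v)}"

lemma influenceI:
  "v \<in> slab k \<Longrightarrow> u \<in> insert v (neighbours b k v) \<Longrightarrow>
     ((u, rings_before \<omega> u (ring_time \<omega> v m)), (v, Suc m)) \<in> influence b k \<omega>"
  unfolding influence_def by blast

definition good_sample :: "boundary \<Rightarrow> nat \<Rightarrow> sample \<Rightarrow> bool" where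
  "good_sample b k \<omega> \<longleftrightarrow>
     (\<forall>v\<in>slab k. initial_spin \<omega> v \<in> {-1, 1} \<and> (\<forall>n. coin \<omega> v n \<in> {-1, 1}) \<and>
        (\<forall>n. 0 < fst (snd (\<omega> v) n)) \<and> (\<forall>t. \<exists>n. t < ring_time \<omega> v n)) \<and>
     (\<forall>u\<in>slab k. \<forall>v\<in>slab k. \<forall>i j. u \<noteq> v \<longrightarrow> ring_time \<omega> u i \<noteq> ring_time \<omega> v j) \<and>
     wf (influence b k \<omega>)"

lemma ring_time_Suc: "ring_time \<omega> v (Suc n) = ring_time \<omega> v n + fst (snd (\<omega> v) (Suc n))"
  by (simp add: ring_time_def)

section \<open>Counting the rings of a single clock\<close>

locale ring_clock =
  fixes \<omega> :: sample and v :: vertex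
  assumes wait_pos: "\<And>n. 0 < fst (snd (\<omega> v) n)"
    and unbounded: "\<And>t. \<exists>n. t < ring_time \<omega> v n"
begin

lemma strict_mono_ring: "strict_mono (ring_time \<omega> v)"
  using wait_pos by (auto simp: strict_mono_Suc_iff ring_time_Suc)

lemma ring_less_iff: "ring_time \<omega> v i < ring_time \<omega> v j \<longleftrightarrow> i < j"
  using strict_mono_ring by (simp add: strict_mono_less)

lemma ring_le_iff: "ring_time \<omega> v i \<le> ring_time \<omega> v j \<longleftrightarrow> i \<le> j"
  using strict_mono_ring by (simp add: strict_mono_less_eq)

lemma ring_pos: "0 < ring_time \<omega> v n"
proof -
  have "0 < ring_time \<omega> v 0" using wait_pos by (simp add: ring_time_def)
  also have "\<dots> \<le> ring_time \<omega> v n" by (simp add: ring_le_iff)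
  finally show ?thesis .
qed

lemma rings_before_eq: "{i. ring_time \<omega> v i < t} = {..<rings_before \<omega> v t}"
proof -
  obtain n where n: "t < ring_time \<omega> v n" using unbounded by blast
  define m where "m = (LEAST n. t \<le> ring_time \<omega> v n)"
  have m: "t \<le> ring_time \<omega> v m" unfolding m_def by (rule LeastI[of _ n]) (use n in simp)
  have "{i. ring_time \<omega> v i < t} = {..<m}"
  proof (intro equalityI subsetI)
    fix i assume "i \<in> {i. ring_time \<omega> v i < t}"
    then have "ring_time \<omega> v i < ring_time \<omega> v m" using m by simp
    then show "i \<in> {..<m}" by (simp add: ring_less_iff)
  next
    fix i assume "i \<in> {..<m}"
    then have "\<not> t \<le> ring_time \<omega> v i" unfolding m_def by (auto dest: not_less_Least)
    then show "i \<in> {i. ring_time \<omega> v i < t}" by simp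
  qed
  then show ?thesis by (simp add: rings_before_def)
qed

lemma rings_until_eq: "{i. ring_time \<omega> v i \<le> t} = {..<rings_until \<omega> v t}"
proof -
  obtain n where n: "t < ring_time \<omega> v n" using unbounded by blast
  define m where "m = (LEAST n. t < ring_time \<omega> v n)"
  have m: "t < ring_time \<omega> v m" unfolding m_def by (rule LeastI[of _ n]) (use n in simp)
  have "{i. ring_time \<omega> v i \<le> t} = {..<m}"
  proof (intro equalityI subsetI)
    fix i assume "i \<in> {i. ring_time \<omega> v i \<le> t}"
    then have "ring_time \<omega> v i < ring_time \<omega> v m" using m by simp
    then show "i \<in> {..<m}" by (simp add: ring_less_iff)
  next
    fix i assume "i \<in> {..<m}"
    then have "\<not> t < ring_time \<omega> v i" unfolding m_def by (auto dest: not_less_Least)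
    then show "i \<in> {i. ring_time \<omega> v i \<le> t}" by simp
  qed
  then show ?thesis by (simp add: rings_until_def)
qed

lemma less_rings_before: "i < rings_before \<omega> v t \<longleftrightarrow> ring_time \<omega> v i < t"
  using rings_before_eq[of t] by auto

lemma less_rings_until: "i < rings_until \<omega> v t \<longleftrightarrow> ring_time \<omega> v i \<le> t"
  using rings_until_eq[of t] by auto

lemma rings_before_ring [simp]: "rings_before \<omega> v (ring_time \<omega> v m) = m"
proof -
  have "{..<rings_before \<omega> v (ring_time \<omega> v m)} = {..<m}"
    unfolding rings_before_eq[symmetric] by (auto simp: ring_less_iff)
  then show ?thesis by simp
qed

lemma rings_until_ring [simp]: "rings_until \<omega> v (ring_time \<omega> v m) = Suc m"
proof -
  have "{..<rings_until \<omega> v (ring_time \<omega> v m)} = {..<Suc m}"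
    unfolding rings_until_eq[symmetric] by (auto simp: ring_le_iff)
  then show ?thesis by simp
qed

lemma rings_until_zero [simp]: "t \<le> 0 \<Longrightarrow> rings_until \<omega> v t = 0"
  using less_rings_until[of 0 t] ring_pos[of 0] by (cases "rings_until \<omega> v t") auto

lemma rings_until_mono: "s \<le> t \<Longrightarrow> rings_until \<omega> v s \<le> rings_until \<omega> v t"
  using less_rings_until[of "rings_until \<omega> v t" s] less_rings_until[of "rings_until \<omega> v t" t]
  by (cases "rings_until \<omega> v s \<le> rings_until \<omega> v t") auto

lemma rings_before_le_until: "s < t \<Longrightarrow> rings_until \<omega> v s \<le> rings_before \<omega> v t"
  using less_rings_until[of "rings_before \<omega> v t" s] less_rings_before[of "rings_before \<omega> v t" t]
  by (cases "rings_until \<omega> v s \<le> rings_before \<omega> v t") auto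

lemma rings_until_ge: "\<exists>t\<ge>T. m \<le> rings_until \<omega> v t"
proof (intro exI conjI)
  show "T \<le> max T (ring_time \<omega> v m)" by simp
  have "m < rings_until \<omega> v (max T (ring_time \<omega> v m))" by (simp add: less_rings_until)
  then show "m \<le> rings_until \<omega> v (max T (ring_time \<omega> v m))" by simp
qed

lemma rings_until_before:
  "\<exists>a<t. \<forall>s. a \<le> s \<longrightarrow> s < t \<longrightarrow> rings_until \<omega> v s = rings_before \<omega> v t"
proof (cases "rings_before \<omega> v t")
  case 0
  then have "rings_until \<omega> v s = rings_before \<omega> v t" if "s < t" for s
    using rings_before_le_until[OF that] by simp
  then show ?thesis by (intro exI[of _ "t - 1"]) auto
next
  case (Suc j)
  have j: "ring_time \<omega> v j < t" using less_rings_before[of j t] Suc by simp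
  have "rings_until \<omega> v s = rings_before \<omega> v t" if s: "ring_time \<omega> v j \<le> s" "s < t" for s
    using rings_before_le_until[OF s(2)] less_rings_until[of j s] s Suc by simp
  then show ?thesis using j by blast
qed

end

section \<open>Existence and uniqueness of the trajectory of a good sample\<close>

locale good_path =
  fixes b k \<omega>
  assumes good: "good_sample b k \<omega>"
begin

lemma clock: "v \<in> slab k \<Longrightarrow> ring_clock \<omega> v"
  using good by unfold_locales (auto simp: good_sample_def)

lemma ring_time_distinct: "u \<in> slab k \<Longrightarrow> v \<in> slab k \<Longrightarrow> u \<noteq> v \<Longrightarrow> ring_time \<omega> u i \<noteq> ring_time \<omega> v j"
  using good by (auto simp: good_sample_def)

lemma wf_influence: "wf (influence b k \<omega>)"
  using good by (simp add: good_sample_def)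

text \<open>Well-founded induction along influences: an update reads only finitely many states, and
  beyond the largest of their thresholds, \<open>M\<close>, additional depth has no effect.\<close>

lemma approx_spin_eventually_const:
  "v \<in> slab k \<Longrightarrow> \<exists>N. \<forall>n\<ge>N. approx_spin b k n \<omega> v m = approx_spin b k N \<omega> v m"
proof (induction "(v, m)" arbitrary: v m rule: wf_induct_rule[OF wf_influence])
  case (1 v m)
  show ?case
  proof (cases m)
    case 0 then show ?thesis by simp
  next
    case (Suc j)
    define c where "c u = rings_before \<omega> u (ring_time \<omega> v j)" for u
    define U where "U = insert v (neighbours b k v)"
    have U: "finite U" "U \<subseteq> slab k"
      using finite_neighbours neighbours_subset_slab 1 by (auto simp: U_def)
    have "\<exists>N. \<forall>n\<ge>N. approx_spin b k n \<omega> u (c u) = approx_spin b k N \<omega> u (c u)" if "u \<in> U" for u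
    proof (rule 1(1))
      show "((u, c u), (v, m)) \<in> influence b k \<omega>"
        unfolding c_def Suc by (rule influenceI) (use that 1 in \<open>auto simp: U_def\<close>)
      show "u \<in> slab k" using that U by auto
    qed
    then obtain N where N: "\<And>u n. u \<in> U \<Longrightarrow> n \<ge> N u \<Longrightarrow> approx_spin b k n \<omega> u (c u) = approx_spin b k (N u) \<omega> u (c u)"
      by metis
    define M where "M = Max (N ` U)"
    have M: "N u \<le> M" if "u \<in> U" for u unfolding M_def using that U by auto
    have step: "approx_spin b k (Suc n) \<omega> v m = approx_spin b k (Suc M) \<omega> v m" if "n \<ge> M" for n
    proof -
      have *: "approx_spin b k n \<omega> u (c u) = approx_spin b k M \<omega> u (c u)" if "u \<in> U" for u
        using N[OF that, of n] N[OF that, of M] M[OF that] \<open>n \<ge> M\<close> by simp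
      then have "energy b k (\<lambda>u. approx_spin b k n \<omega> u (c u)) v = energy b k (\<lambda>u. approx_spin b k M \<omega> u (c u)) v"
        by (intro energy_cong) (auto simp: U_def)
      then show ?thesis using * by (simp add: Suc Let_def c_def[symmetric] U_def)
    qed
    show ?thesis
    proof (intro exI[of _ "Suc M"] allI impI)
      fix n assume "Suc M \<le> n"
      then show "approx_spin b k n \<omega> v m = approx_spin b k (Suc M) \<omega> v m" using step[of "n - 1"] by (cases n) auto
    qed
  qed
qed

lemma approx_spin_values: "v \<in> slab k \<Longrightarrow> approx_spin b k n \<omega> v m \<in> {-1, 1}"
proof (induction n arbitrary: v m)
  case 0 then show ?case using good by (simp add: good_sample_def)
next
  case (Suc n)
  show ?case
  proof (cases m)
    case 0 then show ?thesis using good Suc.prems by (simp add: good_sample_def)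
  next
    case (Suc j)
    have "coin \<omega> v j \<in> {-1, 1}" using good Suc.prems by (simp add: good_sample_def)
    then show ?thesis using Suc.IH[OF Suc.prems, of "rings_before \<omega> v (ring_time \<omega> v j)"] Suc
      by (auto simp: updated_spin_def Let_def)
  qed
qed

lemma approx_spin_tendsto:
  assumes "v \<in> slab k"
  shows "\<exists>N. \<forall>n\<ge>N. approx_spin b k n \<omega> v m = ring_spin b k \<omega> v m"
proof -
  obtain N where N: "\<And>n. n \<ge> N \<Longrightarrow> approx_spin b k n \<omega> v m = approx_spin b k N \<omega> v m"
    using approx_spin_eventually_const[OF assms] by blast
  have "ring_spin b k \<omega> v m = approx_spin b k N \<omega> v m"
    using approx_spin_values[OF assms, of N m] N unfolding ring_spin_def
    by (metis (full_types) insertE linorder_le_cases singletonD)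
  then show ?thesis using N by metis
qed

lemma ring_spin_0: "v \<in> slab k \<Longrightarrow> ring_spin b k \<omega> v 0 = initial_spin \<omega> v"
  using approx_spin_tendsto[of v 0] by auto

lemma ring_spin_Suc:
  fixes m
  assumes v: "v \<in> slab k"
  defines "\<eta> \<equiv> config_before b k \<omega> (ring_time \<omega> v m)"
  shows "ring_spin b k \<omega> v (Suc m) = updated_spin (\<eta> v) (energy b k \<eta> v) (coin \<omega> v m)"
proof -
  define c where "c u = rings_before \<omega> u (ring_time \<omega> v m)" for u
  define U where "U = insert v (neighbours b k v)"
  have U: "finite U" "U \<subseteq> slab k"
    using finite_neighbours neighbours_subset_slab v by (auto simp: U_def)
  have "\<forall>u\<in>U. \<exists>N. \<forall>n\<ge>N. approx_spin b k n \<omega> u (c u) = ring_spin b k \<omega> u (c u)"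
    using approx_spin_tendsto U by auto
  then obtain N where N: "\<And>u n. u \<in> U \<Longrightarrow> n \<ge> N u \<Longrightarrow> approx_spin b k n \<omega> u (c u) = ring_spin b k \<omega> u (c u)"
    by metis
  obtain N' where N': "\<And>n. n \<ge> N' \<Longrightarrow> approx_spin b k n \<omega> v (Suc m) = ring_spin b k \<omega> v (Suc m)"
    using approx_spin_tendsto[OF v] by blast
  define M where "M = Max (insert N' (N ` U))"
  have M: "N u \<le> M" if "u \<in> U" for u unfolding M_def using that U by auto
  have "N' \<le> M" unfolding M_def using U by auto
  then have eq: "ring_spin b k \<omega> v (Suc m) = approx_spin b k (Suc M) \<omega> v (Suc m)" using N'[of "Suc M"] by simp
  have *: "approx_spin b k M \<omega> u (c u) = \<eta> u" if "u \<in> U" for u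
    using N[OF that M[OF that]] by (simp add: \<eta>_def config_before_def c_def)
  have "energy b k (\<lambda>u. approx_spin b k M \<omega> u (c u)) v = energy b k \<eta> v"
    by (intro energy_cong *) (auto simp: U_def)
  moreover have "approx_spin b k M \<omega> v (c v) = \<eta> v" by (rule *) (simp add: U_def)
  ultimately show ?thesis unfolding eq by (simp only: approx_spin.simps Let_def c_def)
qed

lemma ring_spin_values: "ring_spin b k \<omega> v m \<in> {-1, 1}"
  by (simp add: ring_spin_def)

text \<open>Shortly before \<open>t\<close> the ring count of \<open>w\<close> is constant, so the
  limit is taken of an eventually constant function.\<close>

lemma left_limit_eq:
  assumes w: "w \<in> slab k" and t: "0 < t"
    and \<sigma>: "\<And>s. 0 \<le> s \<Longrightarrow> s < t \<Longrightarrow> rings_until \<omega> w s = rings_before \<omega> w t \<Longrightarrow> \<sigma> w s = c"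
  shows "left_limit \<sigma> t w = c"
proof -
  interpret ring_clock \<omega> w by (rule clock[OF w])
  obtain a where a: "a < t" "\<And>s. a \<le> s \<Longrightarrow> s < t \<Longrightarrow> rings_until \<omega> w s = rings_before \<omega> w t"
    using rings_until_before[of t] by blast
  have "eventually (\<lambda>s. s \<in> {max a 0<..<t}) (at_left t)"
    by (rule eventually_at_left_real) (use a t in auto)
  then have "eventually (\<lambda>s. \<sigma> w s = c) (at_left t)"
    by eventually_elim (rule \<sigma>, use a in auto)
  then have "(\<sigma> w \<longlongrightarrow> c) (at_left t)" by (rule tendsto_eventually)
  then show ?thesis unfolding left_limit_def by (intro tendsto_Lim) simp_all
qed

lemma glauber_trajectory_config_at: "glauber_trajectory b k \<omega> (\<lambda>v t. config_at b k \<omega> t v)"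
  unfolding glauber_trajectory_def
proof (intro ballI conjI allI impI)
  fix v assume v: "v \<in> slab k"
  interpret ring_clock \<omega> v by (rule clock[OF v])
  show "config_at b k \<omega> 0 v = initial_spin \<omega> v" by (simp add: config_at_def ring_spin_0 v)
  { fix s t assume "0 \<le> s \<and> s \<le> t \<and> (\<forall>n. ring_time \<omega> v n \<notin> {s<..t})"
    then have "ring_time \<omega> v i \<le> t \<longleftrightarrow> ring_time \<omega> v i \<le> s" for i
      by (meson greaterThanAtMost_iff linorder_not_less order.trans)
    then have "{i. ring_time \<omega> v i \<le> t} = {i. ring_time \<omega> v i \<le> s}" by simp
    then show "config_at b k \<omega> t v = config_at b k \<omega> s v" by (simp add: config_at_def rings_until_def) }
  fix n
  define t where "t = ring_time \<omega> v n"
  have t: "0 < t" using ring_pos by (simp add: t_def)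
  have ll: "left_limit (\<lambda>v t. config_at b k \<omega> t v) t w = config_before b k \<omega> t w" if "w \<in> slab k" for w
    by (rule left_limit_eq[OF that t]) (simp add: config_at_def config_before_def)
  have "energy b k (left_limit (\<lambda>v t. config_at b k \<omega> t v) t) v = energy b k (config_before b k \<omega> t) v"
    using v neighbours_subset_slab[of b k v] by (intro energy_cong ll) blast+
  then show "let t = ring_time \<omega> v n; \<eta> = left_limit (\<lambda>v t. config_at b k \<omega> t v) t
       in config_at b k \<omega> t v = updated_spin (\<eta> v) (energy b k \<eta> v) (coin \<omega> v n)"
    using ring_spin_Suc[OF v, of n] ll[OF v] by (simp add: Let_def t_def config_at_def)
qed

text \<open>The value at time \<open>t\<close> is the value at the last ring, which is computed from
  left limits at that ring. These belong to states that precede in \<open>influence\<close>, so the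
  induction runs along influences and needs no enumeration of all rings in temporal order.\<close>

lemma trajectory_unique:
  assumes \<sigma>: "glauber_trajectory b k \<omega> \<sigma>"
  shows "v \<in> slab k \<Longrightarrow> 0 \<le> t \<Longrightarrow> \<sigma> v t = config_at b k \<omega> t v"
proof (induction "(v, rings_until \<omega> v t)" arbitrary: v t rule: wf_induct_rule[OF wf_influence])
  case (1 v t)
  interpret ring_clock \<omega> v by (rule clock[OF 1(2)])
  have const: "\<sigma> v t = \<sigma> v s" if "0 \<le> s" "s \<le> t" "\<And>n. ring_time \<omega> v n \<notin> {s<..t}" for s
    using \<sigma> that 1(2) unfolding glauber_trajectory_def by blast
  show ?case
  proof (cases "rings_until \<omega> v t")
    case 0
    then have "\<sigma> v t = \<sigma> v 0" using less_rings_until[of _ t] by (intro const) (auto simp: 1)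
    moreover have "\<sigma> v 0 = initial_spin \<omega> v" using \<sigma> 1(2) unfolding glauber_trajectory_def by blast
    ultimately show ?thesis using 0 1(2) by (simp add: config_at_def ring_spin_0)
  next
    case (Suc j)
    define s where "s = ring_time \<omega> v j"
    have s: "s \<le> t" "0 < s" using less_rings_until[of j t] Suc ring_pos by (auto simp: s_def)
    have "\<sigma> v t = \<sigma> v s"
    proof (intro const)
      fix n
      show "ring_time \<omega> v n \<notin> {s<..t}"
        using less_rings_until[of n t] less_rings_until[of n s] Suc by (auto simp: s_def)
    qed (use s in auto)
    also have "\<sigma> v s = updated_spin (left_limit \<sigma> s v) (energy b k (left_limit \<sigma> s) v) (coin \<omega> v j)"
    proof -
      have "let t = ring_time \<omega> v j; \<eta> = left_limit \<sigma> t in \<sigma> v t = updated_spin (\<eta> v) (energy b k \<eta> v) (coin \<omega> v j)"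
        using \<sigma> 1(2) unfolding glauber_trajectory_def by blast
      then show ?thesis by (simp add: Let_def s_def)
    qed
    also have "\<dots> = updated_spin (config_before b k \<omega> s v) (energy b k (config_before b k \<omega> s) v) (coin \<omega> v j)"
    proof -
      have ll: "left_limit \<sigma> s w = config_before b k \<omega> s w" if w: "w \<in> insert v (neighbours b k v)" for w
      proof (rule left_limit_eq[OF _ s(2)])
        show ws: "w \<in> slab k" using w 1(2) neighbours_subset_slab[of b k v] by auto
        fix r assume r: "0 \<le> r" "r < s" "rings_until \<omega> w r = rings_before \<omega> w s"
        have "\<sigma> w r = config_at b k \<omega> r w"
          by (rule 1(1)[OF _ ws r(1)]) (use influenceI[OF 1(2) w, of \<omega> j] r Suc in \<open>simp add: s_def\<close>)
        then show "\<sigma> w r = config_before b k \<omega> s w" using r by (simp add: config_at_def config_before_def)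
      qed
      then have "energy b k (left_limit \<sigma> s) v = energy b k (config_before b k \<omega> s) v" by (intro energy_cong) auto
      then show ?thesis using ll by simp
    qed
    also have "\<dots> = ring_spin b k \<omega> v (Suc j)" using ring_spin_Suc[OF 1(2), of j] by (simp add: s_def)
    finally show ?thesis using Suc by (simp add: config_at_def)
  qed
qed

lemma spin_eq: "v \<in> slab k \<Longrightarrow> 0 \<le> t \<Longrightarrow> spin b k \<omega> v t = config_at b k \<omega> t v"
  unfolding spin_def
  by (rule trajectory_unique[OF someI[of "glauber_trajectory b k \<omega>", OF glauber_trajectory_config_at]])

text \<open>Clocks are unbounded, so every ring number is attained at some time; constancy from some
  time on and constancy from some ring on are therefore the same.\<close>

lemma site_fixates_iff:
  assumes v: "v \<in> slab k"
  shows "site_fixates (spin b k \<omega> v) \<longleftrightarrow> (\<exists>M. \<forall>m\<ge>M. ring_spin b k \<omega> v m = ring_spin b k \<omega> v M)"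
proof
  interpret ring_clock \<omega> v by (rule clock[OF v])
  { assume "site_fixates (spin b k \<omega> v)"
    then obtain T where T: "T \<ge> 0" "\<And>t. t \<ge> T \<Longrightarrow> spin b k \<omega> v t = spin b k \<omega> v T"
      unfolding site_fixates_def by blast
    have "ring_spin b k \<omega> v m = ring_spin b k \<omega> v (rings_until \<omega> v T)" if "m \<ge> rings_until \<omega> v T" for m
    proof (cases m)
      case (Suc j)
      show ?thesis
      proof (cases "m = rings_until \<omega> v T")
        case False
        then have "\<not> ring_time \<omega> v j < T" using that Suc less_rings_until[of j T] by auto
        then have "spin b k \<omega> v (ring_time \<omega> v j) = spin b k \<omega> v T" by (intro T) auto
        then have "config_at b k \<omega> (ring_time \<omega> v j) v = config_at b k \<omega> T v"
          using T(1) v ring_pos[of j] by (simp add: spin_eq)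
        then show ?thesis using Suc by (simp add: config_at_def)
      qed simp
    qed (use that in simp)
    then show "\<exists>M. \<forall>m\<ge>M. ring_spin b k \<omega> v m = ring_spin b k \<omega> v M"
      by (intro exI[of _ "rings_until \<omega> v T"] allI impI) }
  assume "\<exists>M. \<forall>m\<ge>M. ring_spin b k \<omega> v m = ring_spin b k \<omega> v M"
  then obtain M where M: "\<And>m. m \<ge> M \<Longrightarrow> ring_spin b k \<omega> v m = ring_spin b k \<omega> v M" by blast
  obtain T where T: "T \<ge> 0" "M \<le> rings_until \<omega> v T" using rings_until_ge by blast
  have "spin b k \<omega> v t = spin b k \<omega> v T" if "t \<ge> T" for t
  proof -
    have "M \<le> rings_until \<omega> v t" using T rings_until_mono[OF that] by simp
    then have "config_at b k \<omega> t v = config_at b k \<omega> T v"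
      unfolding config_at_def using M[of "rings_until \<omega> v t"] M[of "rings_until \<omega> v T"] T(2) by argo
    then show ?thesis using that T(1) v by (simp add: spin_eq)
  qed
  then show "site_fixates (spin b k \<omega> v)"
    unfolding site_fixates_def by (intro exI[of _ T] conjI allI impI T(1))
qed

end

section \<open>Measurability and distributions\<close>

definition ring_measure :: "(real \<times> int) measure" where
  "ring_measure = density lborel (exponential_density 1) \<Otimes>\<^sub>M measure_pmf (spin_pmf (1/2))"

definition site_measure :: "real \<Rightarrow> (int \<times> (nat \<Rightarrow> real \<times> int)) measure" where
  "site_measure p = measure_pmf (spin_pmf p) \<Otimes>\<^sub>M (\<Pi>\<^sub>M n\<in>UNIV. ring_measure)"

lemma glauber_measure_eq: "glauber_measure k p = (\<Pi>\<^sub>M v\<in>slab k. site_measure p)"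
  by (simp add: glauber_measure_def site_measure_def ring_measure_def)

lemma prob_space_exponential: "prob_space (density lborel (exponential_density 1))"
  by (rule prob_space_exponential_density) simp

lemma prob_space_ring_measure: "prob_space ring_measure"
  unfolding ring_measure_def
  by (intro prob_space_pair prob_space_measure_pmf prob_space_exponential)

lemma prob_space_site_measure: "prob_space (site_measure p)"
  unfolding site_measure_def
  by (intro prob_space_pair prob_space_measure_pmf prob_space_PiM prob_space_ring_measure)

lemma sets_ring_measure [measurable_cong]: "sets ring_measure = sets (borel \<Otimes>\<^sub>M count_space UNIV)"
  unfolding ring_measure_def by (intro sets_pair_measure_cong) auto

lemma sets_site_measure [measurable_cong]:
  "sets (site_measure p) = sets (count_space UNIV \<Otimes>\<^sub>M (\<Pi>\<^sub>M n\<in>UNIV. borel \<Otimes>\<^sub>M count_space UNIV))"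
  unfolding site_measure_def
  by (intro sets_pair_measure_cong sets_PiM_cong sets_ring_measure) auto

lemma space_ring_measure [simp]: "space ring_measure = UNIV"
  by (simp add: ring_measure_def space_pair_measure)

lemma space_site_measure [simp]: "space (site_measure p) = UNIV"
  by (simp add: site_measure_def space_pair_measure space_PiM)

lemma space_glauber_measure: "space (glauber_measure k p) = extensional (slab k)"
  by (simp add: glauber_measure_eq space_PiM PiE_def)

section \<open>Measurability of the graphical construction\<close>

lemma measurable_site: "v \<in> slab k \<Longrightarrow> (\<lambda>\<omega>. \<omega> v) \<in> measurable (glauber_measure k p) (site_measure p)"
  unfolding glauber_measure_eq by measurable

lemma measurable_initial_spin [measurable]:
  "v \<in> slab k \<Longrightarrow> (\<lambda>\<omega>. initial_spin \<omega> v) \<in> measurable (glauber_measure k p) (count_space UNIV)"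
  unfolding initial_spin_def by (rule measurable_compose[OF measurable_site]) measurable

lemma measurable_wait [measurable]:
  "v \<in> slab k \<Longrightarrow> (\<lambda>\<omega>. fst (snd (\<omega> v) i)) \<in> borel_measurable (glauber_measure k p)"
  by (rule measurable_compose[OF measurable_site]) measurable

lemma measurable_coin [measurable]:
  "v \<in> slab k \<Longrightarrow> (\<lambda>\<omega>. coin \<omega> v i) \<in> measurable (glauber_measure k p) (count_space UNIV)"
  unfolding coin_def by (rule measurable_compose[OF measurable_site]) measurable

lemma measurable_ring_time [measurable]:
  assumes [simp]: "v \<in> slab k"
  shows "(\<lambda>\<omega>. ring_time \<omega> v i) \<in> borel_measurable (glauber_measure k p)"
  unfolding ring_time_def by measurable

lemma measurable_rings_before [measurable]:
  assumes [simp]: "v \<in> slab k" and [measurable]: "f \<in> borel_measurable (glauber_measure k p)"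
  shows "(\<lambda>\<omega>. rings_before \<omega> v (f \<omega>)) \<in> measurable (glauber_measure k p) (count_space UNIV)"
  unfolding rings_before_def by measurable

lemma measurable_rings_until [measurable]:
  assumes [simp]: "v \<in> slab k" and [measurable]: "f \<in> borel_measurable (glauber_measure k p)"
  shows "(\<lambda>\<omega>. rings_until \<omega> v (f \<omega>)) \<in> measurable (glauber_measure k p) (count_space UNIV)"
  unfolding rings_until_def not_less[symmetric] by measurable

text \<open>The tuple \<open>h\<close> takes values in a countable discrete space, on which every
  function is measurable, and \<open>g\<close> factors through it via a chosen preimage. This spares
  an explicit formula for functions such as the energy.\<close>

lemma measurable_finitely_many:
  fixes f :: "'i \<Rightarrow> 'a \<Rightarrow> 'b :: countable"
  assumes "finite U" "\<And>u. u \<in> U \<Longrightarrow> f u \<in> measurable M (count_space UNIV)"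
    and "\<And>x y. (\<And>u. u \<in> U \<Longrightarrow> f u x = f u y) \<Longrightarrow> g x = g y"
  shows "g \<in> measurable M (count_space UNIV)"
proof -
  define h where "h x = (\<lambda>u\<in>U. f u x)" for x
  have "h \<in> measurable M (\<Pi>\<^sub>M u\<in>U. count_space UNIV)"
    unfolding h_def by (rule measurable_restrict) (use assms in auto)
  then have h: "h \<in> measurable M (count_space (PiE U (\<lambda>_. UNIV)))"
    using assms(1) by (simp add: count_space_PiM_finite)
  have "g = (\<lambda>\<xi>. g (SOME x. h x = \<xi>)) \<circ> h"
  proof
    fix x
    have "h (SOME y. h y = h x) = h x" by (rule someI) simp
    then have "g (SOME y. h y = h x) = g x"
      by (intro assms(3)) (metis h_def restrict_apply')
    then show "g x = ((\<lambda>\<xi>. g (SOME x. h x = \<xi>)) \<circ> h) x" by simp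
  qed
  moreover have "(\<lambda>\<xi>. g (SOME x. h x = \<xi>)) \<circ> h \<in> measurable M (count_space UNIV)"
    by (rule measurable_comp[OF h]) simp
  ultimately show ?thesis by simp
qed

lemma measurable_energy:
  assumes v: "v \<in> slab k" and "\<And>u. u \<in> slab k \<Longrightarrow> (\<lambda>\<omega>. \<eta> \<omega> u) \<in> measurable M (count_space UNIV)"
  shows "(\<lambda>\<omega>. energy b k (\<eta> \<omega>) v) \<in> measurable M (count_space UNIV)"
proof (rule measurable_finitely_many[of "insert v (neighbours b k v)" "\<lambda>u \<omega>. \<eta> \<omega> u"])
  show "finite (insert v (neighbours b k v))" using finite_neighbours by simp
  fix u assume "u \<in> insert v (neighbours b k v)"
  then show "(\<lambda>\<omega>. \<eta> \<omega> u) \<in> measurable M (count_space UNIV)"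
    using v neighbours_subset_slab[of b k v] by (intro assms) auto
qed (rule energy_cong; blast)

lemma measurable_approx_spin [measurable]:
  "v \<in> slab k \<Longrightarrow> (\<lambda>\<omega>. approx_spin b k n \<omega> v m) \<in> measurable (glauber_measure k p) (count_space UNIV)"
proof (induction n arbitrary: v m)
  case 0 then show ?case by simp
next
  case (Suc n)
  show ?case
  proof (cases m)
    case 0 then show ?thesis using Suc.prems by simp
  next
    case (Suc j)
    define \<eta> where "\<eta> \<omega> u = approx_spin b k n \<omega> u (rings_before \<omega> u (ring_time \<omega> v j))" for \<omega> u
    have \<eta>: "(\<lambda>\<omega>. \<eta> \<omega> u) \<in> measurable (glauber_measure k p) (count_space UNIV)" if u: "u \<in> slab k" for u
      unfolding \<eta>_def
      by (rule measurable_compose_countable)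
         (use Suc.IH[OF u] Suc.prems u in measurable)
    have [measurable]: "(\<lambda>\<omega>. energy b k (\<eta> \<omega>) v) \<in> measurable (glauber_measure k p) (count_space UNIV)"
      using \<eta> Suc.prems by (intro measurable_energy) auto
    have [measurable]: "(\<lambda>\<omega>. \<eta> \<omega> v) \<in> measurable (glauber_measure k p) (count_space UNIV)"
      "(\<lambda>\<omega>. coin \<omega> v j) \<in> measurable (glauber_measure k p) (count_space UNIV)"
      using \<eta> Suc.prems by auto
    have "(\<lambda>\<omega>. updated_spin (\<eta> \<omega> v) (energy b k (\<eta> \<omega>) v) (coin \<omega> v j))
        \<in> measurable (glauber_measure k p) (count_space UNIV)"
      unfolding updated_spin_def by measurable
    then show ?thesis by (simp add: Suc Let_def \<eta>_def[abs_def])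
  qed
qed

lemma measurable_ring_spin [measurable]:
  assumes [simp]: "v \<in> slab k"
  shows "(\<lambda>\<omega>. ring_spin b k \<omega> v m) \<in> measurable (glauber_measure k p) (count_space UNIV)"
  unfolding ring_spin_def by measurable

lemma measurable_config_before [measurable]:
  assumes [simp]: "v \<in> slab k" and [measurable]: "f \<in> borel_measurable (glauber_measure k p)"
  shows "(\<lambda>\<omega>. config_before b k \<omega> (f \<omega>) v) \<in> measurable (glauber_measure k p) (count_space UNIV)"
  unfolding config_before_def
  by (rule measurable_compose_countable) measurable

lemma measurable_config_at [measurable]:
  assumes [simp]: "v \<in> slab k" and [measurable]: "f \<in> borel_measurable (glauber_measure k p)"
  shows "(\<lambda>\<omega>. config_at b k \<omega> (f \<omega>) v) \<in> measurable (glauber_measure k p) (count_space UNIV)"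
  unfolding config_at_def
  by (rule measurable_compose_countable) measurable

subsection \<open>Laws of the ring times\<close>

lemma indep_vars_PiM_coordinates:
  assumes M: "\<And>i. i \<in> I \<Longrightarrow> prob_space (M i)" and I: "I \<noteq> {}"
  shows "prob_space.indep_vars (PiM I M) M (\<lambda>i x. x i) I"
proof -
  interpret prob_space "PiM I M" by (rule prob_space_PiM) (use M in auto)
  have "distr (PiM I M) (PiM I M) (\<lambda>x. \<lambda>i\<in>I. x i) = distr (PiM I M) (PiM I M) (\<lambda>x. x)"
    by (rule distr_cong) (auto simp: space_PiM PiE_def extensional_restrict)
  also have "\<dots> = PiM I M" by simp
  also have "\<dots> = (\<Pi>\<^sub>M i\<in>I. distr (PiM I M) (M i) (\<lambda>x. x i))"
    by (rule PiM_cong) (use M in \<open>auto simp: distr_PiM_component\<close>)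
  finally show ?thesis using I by (subst indep_vars_iff_distr_eq_PiM') auto
qed

lemma distr_pair_snd:
  assumes "prob_space M" "prob_space N"
  shows "distr (M \<Otimes>\<^sub>M N) N snd = N"
proof (rule measure_eqI)
  interpret M: prob_space M by fact
  interpret N: prob_space N by fact
  fix A assume A: "A \<in> sets (distr (M \<Otimes>\<^sub>M N) N snd)"
  then have "snd -` A \<inter> space (M \<Otimes>\<^sub>M N) = space M \<times> A"
    using sets.sets_into_space[of A N] by (auto simp: space_pair_measure)
  then show "emeasure (distr (M \<Otimes>\<^sub>M N) N snd) A = emeasure N A"
    using A by (simp add: emeasure_distr N.emeasure_pair_measure_Times M.emeasure_space_1)
qed simp

lemma distributed_ring_sum:
  "distributed (\<Pi>\<^sub>M n\<in>UNIV. ring_measure) lborel (\<lambda>x. \<Sum>i\<le>n. fst (x i)) (erlang_density n 1)"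
proof -
  interpret R: prob_space ring_measure by (rule prob_space_ring_measure)
  interpret E: prob_space "density lborel (exponential_density 1)" by (rule prob_space_exponential)
  let ?W = "\<Pi>\<^sub>M n\<in>(UNIV :: nat set). ring_measure"
  interpret W: prob_space ?W by (intro prob_space_PiM prob_space_ring_measure)
  have 1: "distributed ?W lborel (\<lambda>x. fst (x i)) (exponential_density 1)" for i
  proof -
    have "distr ?W lborel (\<lambda>x. fst (x i)) = distr (distr ?W ring_measure (\<lambda>x. x i)) lborel fst"
      by (subst distr_distr) (auto simp: comp_def)
    also have "\<dots> = distr ring_measure lborel fst"
      by (subst distr_PiM_component) (auto intro: prob_space_ring_measure)
    also have "\<dots> = distr ring_measure (density lborel (exponential_density 1)) fst"
      by (rule distr_cong) auto
    also have "\<dots> = density lborel (exponential_density 1)"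
      unfolding ring_measure_def by (rule prob_space.distr_pair_fst[OF prob_space_measure_pmf])
    finally show ?thesis by (auto simp: distributed_def)
  qed
  have ind: "W.indep_vars (\<lambda>_. borel) (\<lambda>i x. fst (x i)) {..n}"
  proof -
    have "W.indep_vars (\<lambda>_. ring_measure) (\<lambda>i x. x i) UNIV"
      by (rule indep_vars_PiM_coordinates) (use prob_space_ring_measure in auto)
    then have "W.indep_vars (\<lambda>_. ring_measure) (\<lambda>i x. x i) {..n}" by (rule W.indep_vars_subset) simp
    then show ?thesis by (rule W.indep_vars_compose2) simp
  qed
  have "distributed ?W lborel (\<lambda>x. \<Sum>i\<in>{..n}. fst (x i)) (erlang_density (card {..n} - 1) 1)"
    by (rule W.exponential_distributed_sum) (use 1 ind in auto)
  then show ?thesis by simp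
qed

lemma distr_site: "v \<in> slab k \<Longrightarrow> distr (glauber_measure k p) (site_measure p) (\<lambda>\<omega>. \<omega> v) = site_measure p"
  unfolding glauber_measure_eq by (rule distr_PiM_component) (rule prob_space_site_measure)

lemma distributed_ring_time:
  assumes v: "v \<in> slab k"
  shows "distributed (glauber_measure k p) lborel (\<lambda>\<omega>. ring_time \<omega> v n) (erlang_density n 1)"
proof -
  let ?W = "\<Pi>\<^sub>M n\<in>(UNIV :: nat set). ring_measure"
  interpret W: prob_space ?W by (intro prob_space_PiM prob_space_ring_measure)
  have "distr (glauber_measure k p) lborel (\<lambda>\<omega>. ring_time \<omega> v n)
      = distr (distr (glauber_measure k p) (site_measure p) (\<lambda>\<omega>. \<omega> v)) lborel (\<lambda>y. \<Sum>i\<le>n. fst (snd y i))"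
    using v by (subst distr_distr) (auto simp: comp_def ring_time_def intro: measurable_site)
  also have "\<dots> = distr (distr (site_measure p) ?W snd) lborel (\<lambda>x. \<Sum>i\<le>n. fst (x i))"
    using v by (subst distr_distr) (auto simp: comp_def distr_site)
  also have "distr (site_measure p) ?W snd = ?W"
    unfolding site_measure_def by (intro distr_pair_snd prob_space_measure_pmf W.prob_space_axioms)
  also have "distr ?W lborel (\<lambda>x. \<Sum>i\<le>n. fst (x i)) = density lborel (erlang_density n 1)"
    using distributed_ring_sum[of n] by (simp add: distributed_def)
  finally show ?thesis using v by (auto simp: distributed_def)
qed

text \<open>At a fixed \<open>x\<close> the Erlang densities of rate one are the Poisson weights
  with mean \<open>x\<close>.\<close>

lemma sum_erlang_density: "0 \<le> x \<Longrightarrow> (\<Sum>n. ennreal (erlang_density n 1 x)) = 1"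
proof -
  assume x: "0 \<le> x"
  have "(\<lambda>n. exp (- x) * (x ^ n /\<^sub>R fact n)) sums (exp (- x) * exp x)"
    by (intro sums_mult exp_converges)
  then have "(\<lambda>n. erlang_density n 1 x) sums 1"
    using x by (simp add: erlang_density_def exp_minus field_simps)
  then show ?thesis
    by (subst suminf_ennreal_eq[of _ 1]) auto
qed

text \<open>The superposition of all the Erlang laws is Lebesgue measure: the rings have intensity one.\<close>

lemma sum_emeasure_ring_time:
  assumes v: "v \<in> slab k" and B[measurable]: "B \<in> sets borel" "B \<subseteq> {0..}"
  shows "(\<Sum>n. emeasure (glauber_measure k p) {\<omega> \<in> space (glauber_measure k p). ring_time \<omega> v n \<in> B})
           = emeasure lborel B"
proof -
  have "emeasure (glauber_measure k p) {\<omega> \<in> space (glauber_measure k p). ring_time \<omega> v n \<in> B}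
      = (\<integral>\<^sup>+x. ennreal (erlang_density n 1 x) * indicator B x \<partial>lborel)" for n
  proof -
    have "{\<omega> \<in> space (glauber_measure k p). ring_time \<omega> v n \<in> B}
        = (\<lambda>\<omega>. ring_time \<omega> v n) -` B \<inter> space (glauber_measure k p)" by auto
    then show ?thesis
      using distributed_emeasure[OF distributed_ring_time[OF v]] B(1) by (simp only: sets_lborel)
  qed
  then have "(\<Sum>n. emeasure (glauber_measure k p) {\<omega> \<in> space (glauber_measure k p). ring_time \<omega> v n \<in> B})
     = (\<integral>\<^sup>+x. (\<Sum>n. ennreal (erlang_density n 1 x) * indicator B x) \<partial>lborel)"
    by (subst nn_integral_suminf) auto
  also have "\<dots> = (\<integral>\<^sup>+x. indicator B x \<partial>lborel)"
  proof (rule nn_integral_cong)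
    fix x :: real
    show "(\<Sum>n. ennreal (erlang_density n 1 x) * indicator B x) = indicator B x"
      using B(2) sum_erlang_density[of x] by (cases "x \<in> B") auto
  qed
  finally show ?thesis by simp
qed

section \<open>Almost sure properties of samples\<close>

lemma AE_site: "v \<in> slab k \<Longrightarrow> AE y in site_measure p. P y \<Longrightarrow> AE \<omega> in glauber_measure k p. P (\<omega> v)"
  unfolding glauber_measure_eq by (rule AE_PiM_component) (rule prob_space_site_measure)

lemma AE_of_distr:
  "f \<in> measurable M N \<Longrightarrow> distr M N f = N \<Longrightarrow> AE x in N. P x \<Longrightarrow> AE x in M. P (f x)"
  by (metis AE_distrD)

lemma AE_ring:
  assumes "v \<in> slab k" "AE y in ring_measure. P y"
  shows "AE \<omega> in glauber_measure k p. P (snd (\<omega> v) n)"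
proof (rule AE_site[OF assms(1)])
  have "AE x in (\<Pi>\<^sub>M n\<in>UNIV. ring_measure). P (x n)"
    by (rule AE_PiM_component) (use assms prob_space_ring_measure in auto)
  moreover have "distr (site_measure p) (\<Pi>\<^sub>M n\<in>UNIV. ring_measure) snd = (\<Pi>\<^sub>M n\<in>UNIV. ring_measure)"
    unfolding site_measure_def
    by (intro distr_pair_snd prob_space_measure_pmf prob_space_PiM prob_space_ring_measure)
  ultimately show "AE y in site_measure p. P (snd y n)"
    by (intro AE_of_distr[of snd "site_measure p" "\<Pi>\<^sub>M n\<in>UNIV. ring_measure" "\<lambda>x. P (x n)"])
       (simp_all add: site_measure_def)
qed

lemma set_spin_pmf: "set_pmf (spin_pmf p) \<subseteq> {-1, 1}"
  by (auto simp: spin_pmf_def)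

lemma AE_initial_spin: "v \<in> slab k \<Longrightarrow> AE \<omega> in glauber_measure k p. initial_spin \<omega> v \<in> {-1, 1}"
  unfolding initial_spin_def
proof (rule AE_site)
  have "AE x in measure_pmf (spin_pmf p). x \<in> {-1, 1}"
    using set_spin_pmf by (auto simp: AE_measure_pmf_iff)
  moreover have "distr (site_measure p) (measure_pmf (spin_pmf p)) fst = measure_pmf (spin_pmf p)"
    unfolding site_measure_def
    by (intro prob_space.distr_pair_fst prob_space_PiM prob_space_ring_measure)
  ultimately show "AE y in site_measure p. fst y \<in> {-1, 1}"
    by (intro AE_of_distr[of fst "site_measure p" "measure_pmf (spin_pmf p)"]) (simp_all add: site_measure_def)
qed

lemma AE_coin: "v \<in> slab k \<Longrightarrow> AE \<omega> in glauber_measure k p. coin \<omega> v n \<in> {-1, 1}"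
  unfolding coin_def
proof (rule AE_ring)
  have "AE x in measure_pmf (spin_pmf (1/2)). x \<in> {-1, 1}"
    using set_spin_pmf by (auto simp: AE_measure_pmf_iff)
  moreover have "distr ring_measure (measure_pmf (spin_pmf (1/2))) snd = measure_pmf (spin_pmf (1/2))"
    unfolding ring_measure_def
    by (intro distr_pair_snd prob_space_measure_pmf prob_space_exponential)
  ultimately show "AE y in ring_measure. snd y \<in> {-1, 1}"
    by (intro AE_of_distr[of snd ring_measure "measure_pmf (spin_pmf (1/2))"]) (simp_all add: ring_measure_def)
qed

lemma AE_wait_pos: "v \<in> slab k \<Longrightarrow> AE \<omega> in glauber_measure k p. 0 < fst (snd (\<omega> v) n)"
proof (rule AE_ring)
  let ?E = "density lborel (exponential_density 1)"
  have "AE x in lborel. (x :: real) \<noteq> 0" by (rule AE_lborel_singleton)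
  then have "AE x in lborel. 0 < ennreal (exponential_density 1 x) \<longrightarrow> 0 < x"
    by eventually_elim (auto simp: exponential_density_def split: if_splits)
  then have "AE x in ?E. 0 < x"
    by (subst AE_density) auto
  moreover have "distr ring_measure ?E fst = ?E"
    unfolding ring_measure_def by (rule prob_space.distr_pair_fst[OF prob_space_measure_pmf])
  ultimately show "AE y in ring_measure. 0 < fst y"
    by (intro AE_of_distr[of fst ring_measure ?E]) (simp_all add: ring_measure_def)
qed

lemma (in prob_space) AE_eventually_not_in:
  assumes [measurable]: "\<And>n. A n \<in> events" and fin: "(\<Sum>n. emeasure M (A n)) < \<infinity>"
  shows "AE x in M. eventually (\<lambda>n. x \<notin> A n) sequentially"
proof -
  have "AE x in M. eventually (\<lambda>n. x \<in> space M - A n) sequentially"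
  proof (rule borel_cantelli_AE1)
    show "summable (\<lambda>n. prob (A n))"
      by (rule summable_suminf_not_top) (use fin in \<open>auto simp: emeasure_eq_measure\<close>)
  qed (auto simp: emeasure_eq_measure)
  then show ?thesis by eventually_elim (auto elim: eventually_mono)
qed

lemma ring_time_ge_0: "(\<And>i. 0 < fst (snd (\<omega> v) i)) \<Longrightarrow> 0 \<le> ring_time \<omega> v n"
  unfolding ring_time_def by (intro sum_nonneg) (simp add: less_imp_le)

text \<open>The expected number of rings in \<open>[0, T]\<close> is \<open>T\<close>, so by
  Borel-Cantelli only finitely many of the ring times lie there.\<close>

lemma AE_ring_time_unbounded:
  assumes v: "v \<in> slab k"
  shows "AE \<omega> in glauber_measure k p. \<forall>t. \<exists>n. t < ring_time \<omega> v n"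
proof -
  let ?M = "glauber_measure k p"
  interpret prob_space ?M by (rule prob_space_glauber_measure)
  note [measurable] = measurable_ring_time[OF v]
  have "AE \<omega> in ?M. eventually (\<lambda>n. \<omega> \<notin> {\<omega> \<in> space ?M. ring_time \<omega> v n \<in> {0..real T}}) sequentially" for T :: nat
    by (rule AE_eventually_not_in) (use sum_emeasure_ring_time[OF v, of "{0..real T}"] in auto)
  then have "AE \<omega> in ?M. \<forall>T::nat. eventually (\<lambda>n. \<omega> \<notin> {\<omega> \<in> space ?M. ring_time \<omega> v n \<in> {0..real T}}) sequentially"
    by (simp add: AE_all_countable)
  moreover have "AE \<omega> in ?M. \<forall>n. 0 < fst (snd (\<omega> v) n)"
    using AE_wait_pos[OF v] by (simp add: AE_all_countable)
  moreover have "AE \<omega> in ?M. \<omega> \<in> space ?M" by simp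
  ultimately show ?thesis
  proof eventually_elim
    case (elim \<omega>)
    show "\<forall>t. \<exists>n. t < ring_time \<omega> v n"
    proof
      fix t :: real
      obtain T :: nat where T: "t \<le> real T" using real_arch_simple by blast
      obtain n where "\<omega> \<notin> {\<omega> \<in> space ?M. ring_time \<omega> v n \<in> {0..real T}}"
        using elim(1) by (auto simp: eventually_sequentially)
      moreover have "0 \<le> ring_time \<omega> v n" using elim(2) by (intro ring_time_ge_0) auto
      ultimately show "\<exists>n. t < ring_time \<omega> v n" using T elim(3) by (intro exI[of _ n]) auto
    qed
  qed
qed

lemma indep_vars_sites: "slab k \<noteq> {} \<Longrightarrow>
    prob_space.indep_vars (glauber_measure k p) (\<lambda>_. site_measure p) (\<lambda>v \<omega>. \<omega> v) (slab k)"
  unfolding glauber_measure_eq by (rule indep_vars_PiM_coordinates) (rule prob_space_site_measure)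

text \<open>The two ring times are independent and the second one has a density, so by Fubini the
  diagonal is a null set of their joint law.\<close>

lemma AE_ring_time_neq:
  assumes u: "u \<in> slab k" and v: "v \<in> slab k" and uv: "u \<noteq> v"
  shows "AE \<omega> in glauber_measure k p. ring_time \<omega> u i \<noteq> ring_time \<omega> v j"
proof -
  let ?M = "glauber_measure k p"
  interpret prob_space ?M by (rule prob_space_glauber_measure)
  define R where "R n y = (\<Sum>i\<le>n. fst (snd y i))" for n and y :: "int \<times> (nat \<Rightarrow> real \<times> int)"
  have R[measurable]: "R n \<in> borel_measurable (site_measure p)" for n
    unfolding R_def by measurable
  have m: "(\<lambda>f. R n (f w)) \<in> borel_measurable (\<Pi>\<^sub>M w\<in>{w}. site_measure p)" for n and w :: vertex
    by (rule measurable_compose[OF _ R]) simp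
  have R_ring: "R n (\<omega> w) = ring_time \<omega> w n" for n w \<omega> by (simp add: R_def ring_time_def)
  have "indep_vars (\<lambda>_. site_measure p) (\<lambda>v \<omega>. \<omega> v) (slab k)" using indep_vars_sites u by auto
  then have "indep_var (\<Pi>\<^sub>M w\<in>{u}. site_measure p) (\<lambda>\<omega>. \<lambda>w\<in>{u}. \<omega> w)
      (\<Pi>\<^sub>M w\<in>{v}. site_measure p) (\<lambda>\<omega>. \<lambda>w\<in>{v}. \<omega> w)"
    by (rule indep_var_restrict) (use u v uv in auto)
  then have "indep_var borel ((\<lambda>f. R i (f u)) \<circ> (\<lambda>\<omega>. \<lambda>w\<in>{u}. \<omega> w)) borel ((\<lambda>f. R j (f v)) \<circ> (\<lambda>\<omega>. \<lambda>w\<in>{v}. \<omega> w))"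
    by (rule indep_var_compose) (rule m)+
  then have "indep_var borel (\<lambda>\<omega>. ring_time \<omega> u i) borel (\<lambda>\<omega>. ring_time \<omega> v j)"
    by (simp add: comp_def flip: R_ring)
  then have distr: "distr ?M borel (\<lambda>\<omega>. ring_time \<omega> u i) \<Otimes>\<^sub>M distr ?M borel (\<lambda>\<omega>. ring_time \<omega> v j)
      = distr ?M (borel \<Otimes>\<^sub>M borel) (\<lambda>\<omega>. (ring_time \<omega> u i, ring_time \<omega> v j))" (is "?D1 \<Otimes>\<^sub>M ?D2 = _")
    by (simp add: indep_var_distribution_eq)
  interpret D1: prob_space ?D1 by (rule prob_space_distr) (use u in simp)
  interpret D2: prob_space ?D2 by (rule prob_space_distr) (use v in simp)
  interpret D12: pair_sigma_finite ?D1 ?D2 ..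
  have "?D2 = distr ?M lborel (\<lambda>\<omega>. ring_time \<omega> v j)" by (rule distr_cong) auto
  also have "\<dots> = density lborel (erlang_density j 1)"
    using distributed_ring_time[OF v] by (simp add: distributed_def)
  finally have D2: "?D2 = density lborel (erlang_density j 1)" .
  have "AE z in ?D1 \<Otimes>\<^sub>M ?D2. fst z \<noteq> snd z"
  proof (rule D12.AE_pair_measure)
    show "AE x in ?D1. AE y in ?D2. fst (x, y) \<noteq> snd (x, y)"
    proof (rule AE_I2)
      fix x :: real
      have "AE y in lborel. y \<noteq> x" by (rule AE_lborel_singleton)
      then show "AE y in ?D2. fst (x, y) \<noteq> snd (x, y)"
        unfolding D2 by (subst AE_density) auto
    qed
  qed measurable
  then show ?thesis
    unfolding distr by (subst (asm) AE_distr_iff) (use u v in measurable)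
qed

section \<open>Ringing paths in short time slices\<close>

fun nb_paths :: "boundary \<Rightarrow> nat \<Rightarrow> nat \<Rightarrow> vertex \<Rightarrow> vertex list set" where
  "nb_paths b k 0 v = {[v]}"
| "nb_paths b k (Suc n) v = (\<Union>u\<in>neighbours b k v. (#) v ` nb_paths b k n u)"

text \<open>The bound is the size of the surrounding box of 3 by 3 by \<open>k\<close> vertices. It
  is the source of the constants 9, 18, 36 and 72 below.\<close>

lemma card_neighbours_le: "card (neighbours b k v) \<le> 9 * k"
proof -
  obtain x y z where v: "v = (x, y, z)" by (cases v)
  have "neighbours b k v \<subseteq> {x - 1..x + 1} \<times> {y - 1..y + 1} \<times> {..<k}"
    by (auto simp: neighbours_def slab_def edge_mult_def v split: if_splits)
  then have "card (neighbours b k v) \<le> card ({x - 1..x + 1} \<times> {y - 1..y + 1} \<times> {..<k})"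
    by (intro card_mono) auto
  then show ?thesis by (simp add: card_cartesian_product)
qed

lemma finite_nb_paths: "finite (nb_paths b k n v)"
  by (induction n arbitrary: v) (auto simp: finite_neighbours)

lemma card_nb_paths_le: "card (nb_paths b k n v) \<le> (9 * k) ^ n"
proof (induction n arbitrary: v)
  case (Suc n)
  have "card (nb_paths b k (Suc n) v) \<le> (\<Sum>u\<in>neighbours b k v. card ((#) v ` nb_paths b k n u))"
    by (simp add: card_UN_le finite_neighbours)
  also have "\<dots> \<le> (\<Sum>u\<in>neighbours b k v. (9 * k) ^ n)"
    by (intro sum_mono order.trans[OF card_image_le Suc.IH] finite_nb_paths)
  also have "\<dots> \<le> (9 * k) * (9 * k) ^ n" using card_neighbours_le[of b k v] by simp
  finally show ?case by simp
qed simp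

lemma nb_paths_hd: "xs \<in> nb_paths b k n v \<Longrightarrow> xs \<noteq> [] \<and> hd xs = v \<and> length xs = Suc n"
  by (induction n arbitrary: v xs) auto

lemma nb_paths_slab: "v \<in> slab k \<Longrightarrow> xs \<in> nb_paths b k n v \<Longrightarrow> set xs \<subseteq> slab k"
proof (induction n arbitrary: v xs)
  case (Suc n)
  from Suc.prems(2) obtain u ys where "u \<in> neighbours b k v" "ys \<in> nb_paths b k n u" "xs = v # ys" by auto
  then show ?case using Suc.IH[of u ys] Suc.prems(1) neighbours_subset_slab[of b k v] by auto
qed simp

lemma nb_paths_snoc:
  "xs \<in> nb_paths b k n v \<Longrightarrow> u \<in> neighbours b k (last xs) \<Longrightarrow> xs @ [u] \<in> nb_paths b k (Suc n) v"
proof (induction n arbitrary: v xs)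
  case (Suc n)
  from Suc.prems(1) obtain w ys where w: "w \<in> neighbours b k v" "ys \<in> nb_paths b k n w" "xs = v # ys" by auto
  then have "ys @ [u] \<in> nb_paths b k (Suc n) w" using Suc.IH[of ys w] Suc.prems(2) nb_paths_hd[OF w(2)] by simp
  then show ?case using w by auto
qed simp

lemma nb_paths_take: "xs \<in> nb_paths b k n v \<Longrightarrow> m \<le> n \<Longrightarrow> take (Suc m) xs \<in> nb_paths b k m v"
proof (induction n arbitrary: v xs m)
  case (Suc n)
  from Suc.prems(1) obtain w ys where w: "w \<in> neighbours b k v" "ys \<in> nb_paths b k n w" "xs = v # ys" by auto
  show ?case
  proof (cases m)
    case (Suc j)
    then have "take (Suc j) ys \<in> nb_paths b k j w" using Suc.IH[OF w(2), of j] Suc.prems(2) by simp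
    then show ?thesis using w Suc by auto
  qed (use w in simp)
qed simp

definition rings_in :: "real set \<Rightarrow> sample \<Rightarrow> vertex \<Rightarrow> bool" where
  "rings_in I \<omega> v \<longleftrightarrow> (\<exists>i. ring_time \<omega> v i \<in> I)"

definition ringing_path :: "boundary \<Rightarrow> nat \<Rightarrow> nat \<Rightarrow> real set \<Rightarrow> sample \<Rightarrow> vertex \<Rightarrow> bool" where
  "ringing_path b k n I \<omega> v \<longleftrightarrow> (\<exists>xs\<in>nb_paths b k n v. distinct xs \<and> (\<forall>u\<in>set xs. rings_in I \<omega> u))"

text \<open>Different sites are independent, and the probability of a ring in an interval is at most
  the expected number of rings there, which is the length \<open>d\<close>.\<close>

lemma emeasure_rings_in_all_le:
  assumes J: "finite J" "J \<subseteq> slab k" and a: "0 \<le> a" and d: "0 \<le> d"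
  shows "emeasure (glauber_measure k p) {\<omega> \<in> space (glauber_measure k p). \<forall>v\<in>J. rings_in {a..a + d} \<omega> v}
          \<le> ennreal (d ^ card J)"
proof -
  let ?M = "glauber_measure k p"
  interpret product_prob_space "\<lambda>_. site_measure p" "slab k"
    by (intro product_prob_spaceI prob_space_site_measure)
  define Y :: "(int \<times> (nat \<Rightarrow> real \<times> int)) set" where "Y = {y. \<exists>n. (\<Sum>i\<le>n. fst (snd y i)) \<in> {a..a + d}}"
  have Y[measurable]: "Y \<in> sets (site_measure p)"
  proof -
    have "{y \<in> space (site_measure p). \<exists>n. (\<Sum>i\<le>n. fst (snd y i)) \<in> {a..a + d}} \<in> sets (site_measure p)"
      by measurable
    then show ?thesis by (simp add: Y_def)
  qed
  have iff: "rings_in {a..a + d} \<omega> v \<longleftrightarrow> \<omega> v \<in> Y" for \<omega> v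
    by (simp add: rings_in_def Y_def ring_time_def)
  have le: "emeasure (site_measure p) Y \<le> ennreal d" if v: "v \<in> slab k" for v
  proof -
    note [measurable] = measurable_ring_time[OF v]
    have meas: "{\<omega> \<in> space ?M. ring_time \<omega> v n \<in> {a..a + d}} \<in> sets ?M" for n by measurable
    have "emeasure (site_measure p) Y = emeasure ?M {\<omega> \<in> space ?M. \<omega> v \<in> Y}"
      using emeasure_PiM_Collect_single[OF v, of Y] Y by (simp add: glauber_measure_eq)
    also have "\<dots> = emeasure ?M (\<Union>n. {\<omega> \<in> space ?M. ring_time \<omega> v n \<in> {a..a + d}})"
      by (rule arg_cong[where f = "emeasure ?M"]) (auto simp: iff[symmetric] rings_in_def)
    also have "\<dots> \<le> (\<Sum>n. emeasure ?M {\<omega> \<in> space ?M. ring_time \<omega> v n \<in> {a..a + d}})"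
      by (rule emeasure_subadditive_countably) (use meas in blast)
    also have "\<dots> = ennreal d"
      using a d by (subst sum_emeasure_ring_time[OF v]) auto
    finally show ?thesis .
  qed
  have "emeasure ?M {\<omega> \<in> space ?M. \<forall>v\<in>J. rings_in {a..a + d} \<omega> v} = (\<Prod>v\<in>J. emeasure (site_measure p) Y)"
    unfolding glauber_measure_eq iff by (rule emeasure_PiM_Collect) (use J in auto)
  also have "\<dots> \<le> (\<Prod>v\<in>J. ennreal d)"
    by (rule prod_mono_ennreal) (use le J in auto)
  also have "\<dots> = ennreal (d ^ card J)" using d by (simp add: ennreal_power)
  finally show ?thesis .
qed

lemma measurable_rings_in [measurable]:
  assumes "v \<in> slab k"
  shows "Measurable.pred (glauber_measure k p) (\<lambda>\<omega>. rings_in {a..c} \<omega> v)"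
proof -
  note [measurable] = measurable_ring_time[OF assms]
  show ?thesis unfolding rings_in_def atLeastAtMost_iff not_less[symmetric] by measurable
qed

text \<open>Union bound over at most \<open>(9 * k) ^ n\<close> paths. Each of them has
  \<open>n + 1\<close> distinct vertices, whose independent clocks all have to ring; the smallness
  of \<open>d\<close> leaves a factor 1/2 per step.\<close>

lemma emeasure_ringing_path_le:
  assumes v: "v \<in> slab k" and a: "0 \<le> a" and d: "0 \<le> d" "9 * real k * d \<le> 1 / 2"
  shows "emeasure (glauber_measure k p) {\<omega> \<in> space (glauber_measure k p). ringing_path b k n {a..a + d} \<omega> v}
          \<le> ennreal (d * (1 / 2) ^ n)"
proof -
  let ?M = "glauber_measure k p"
  let ?D = "{xs \<in> nb_paths b k n v. distinct xs}"
  have fin: "finite ?D" by (simp add: finite_nb_paths)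
  have slab: "set xs \<subseteq> slab k" if "xs \<in> ?D" for xs using that nb_paths_slab[OF v] by auto
  have "emeasure ?M {\<omega> \<in> space ?M. ringing_path b k n {a..a + d} \<omega> v}
      = emeasure ?M (\<Union>xs\<in>?D. {\<omega> \<in> space ?M. \<forall>u\<in>set xs. rings_in {a..a + d} \<omega> u})"
    by (rule arg_cong[where f = "emeasure ?M"]) (auto simp: ringing_path_def)
  also have "\<dots> \<le> (\<Sum>xs\<in>?D. emeasure ?M {\<omega> \<in> space ?M. \<forall>u\<in>set xs. rings_in {a..a + d} \<omega> u})"
  proof (rule emeasure_subadditive_finite[OF fin], safe)
    fix xs assume "xs \<in> nb_paths b k n v" "distinct xs"
    then have "set xs \<subseteq> slab k" using slab by auto
    then show "{\<omega> \<in> space ?M. \<forall>u\<in>set xs. rings_in {a..a + d} \<omega> u} \<in> sets ?M"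
      unfolding Measurable.pred_def[symmetric] by (intro pred_intros_finite measurable_rings_in) auto
  qed
  also have "\<dots> \<le> (\<Sum>xs\<in>?D. ennreal (d ^ Suc n))"
  proof (rule sum_mono)
    fix xs assume xs: "xs \<in> ?D"
    then have "length xs = Suc n" "distinct xs" using nb_paths_hd by blast+
    then have "card (set xs) = Suc n" by (metis distinct_card)
    then show "emeasure ?M {\<omega> \<in> space ?M. \<forall>u\<in>set xs. rings_in {a..a + d} \<omega> u} \<le> ennreal (d ^ Suc n)"
      using emeasure_rings_in_all_le[of "set xs" k a d p] slab[OF xs] a d by simp
  qed
  also have "\<dots> = ennreal (real (card ?D) * d ^ Suc n)"
    using d by (simp add: ennreal_mult ennreal_of_nat_eq_real_of_nat)
  also have "\<dots> \<le> ennreal (d * (1 / 2) ^ n)"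
  proof (rule ennreal_leI)
    have "real (card ?D) \<le> real ((9 * k) ^ n)"
      using card_mono[OF finite_nb_paths, of ?D b k n v] card_nb_paths_le[of b k n v] by (intro of_nat_mono) auto
    then have "real (card ?D) * d ^ Suc n \<le> (9 * real k) ^ n * d ^ Suc n"
      using d by (intro mult_right_mono) auto
    also have "\<dots> = d * (9 * real k * d) ^ n" by (simp add: power_mult_distrib)
    also have "\<dots> \<le> d * (1 / 2) ^ n" using d by (intro mult_left_mono power_mono) auto
    finally show "real (card ?D) * d ^ Suc n \<le> d * (1 / 2) ^ n" .
  qed
  finally show ?thesis .
qed

lemma AE_no_ringing_path:
  assumes v: "v \<in> slab k" and a: "0 \<le> a" and d: "0 \<le> d" "9 * real k * d \<le> 1 / 2"
  shows "AE \<omega> in glauber_measure k p. \<exists>n. \<not> ringing_path b k n {a..a + d} \<omega> v"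
proof -
  let ?M = "glauber_measure k p"
  interpret prob_space ?M by (rule prob_space_glauber_measure)
  have meas[measurable]: "{\<omega> \<in> space ?M. ringing_path b k n {a..a + d} \<omega> v} \<in> sets ?M" for n
  proof -
    have *: "Measurable.pred ?M (\<lambda>\<omega>. distinct xs \<and> (\<forall>u\<in>set xs. rings_in {a..a + d} \<omega> u))" if "xs \<in> nb_paths b k n v" for xs
      using nb_paths_slab[OF v that] by (intro pred_intros_logic pred_intros_finite) auto
    show ?thesis unfolding ringing_path_def Measurable.pred_def[symmetric]
      by (intro pred_intros_finite finite_nb_paths *)
  qed
  have "AE \<omega> in ?M. eventually (\<lambda>n. \<omega> \<notin> {\<omega> \<in> space ?M. ringing_path b k n {a..a + d} \<omega> v}) sequentially"
  proof (rule AE_eventually_not_in)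
    have "(\<Sum>n. emeasure ?M {\<omega> \<in> space ?M. ringing_path b k n {a..a + d} \<omega> v}) \<le> (\<Sum>n. ennreal (d * (1 / 2) ^ n))"
      by (intro suminf_le emeasure_ringing_path_le assms) auto
    also have "\<dots> < \<infinity>"
      using d by (subst suminf_ennreal2) (auto intro!: summable_mult summable_geometric)
    finally show "(\<Sum>n. emeasure ?M {\<omega> \<in> space ?M. ringing_path b k n {a..a + d} \<omega> v}) < \<infinity>" .
  qed measurable
  moreover have "AE \<omega> in ?M. \<omega> \<in> space ?M" by simp
  ultimately show ?thesis by eventually_elim (auto simp: eventually_sequentially)
qed

lemma influenceD:
  "(x, y) \<in> influence b k \<omega> \<Longrightarrow>
     \<exists>v u m. v \<in> slab k \<and> u \<in> insert v (neighbours b k v) \<and>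
       x = (u, rings_before \<omega> u (ring_time \<omega> v m)) \<and> y = (v, Suc m)"
  unfolding influence_def by blast

text \<open>An infinite chain of influences runs through infinitely many rings at decreasing times, hence
  ends up in a single short time slice, during which it visits infinitely many vertices.\<close>

lemma ringing_paths_of_infinite_chain:
  assumes clock: "\<And>v. v \<in> slab k \<Longrightarrow> ring_clock \<omega> v" and d: "0 < d"
    and not_wf: "\<not> wf (influence b k \<omega>)"
  shows "\<exists>v\<in>slab k. \<exists>i::nat. \<forall>n. ringing_path b k n {real i * d..real i * d + d} \<omega> v"
proof -
  obtain f where f: "\<And>i. (f (Suc i), f i) \<in> influence b k \<omega>"
    using not_wf unfolding wf_iff_no_infinite_down_chain by auto
  define v where "v i = fst (f i)" for i
  define m where "m i = snd (f i) - 1" for i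
  define \<tau> where "\<tau> i = ring_time \<omega> (v i) (m i)" for i
  have chain: "v i \<in> slab k \<and> v (Suc i) \<in> insert (v i) (neighbours b k (v i)) \<and>
      snd (f (Suc i)) = rings_before \<omega> (v (Suc i)) (\<tau> i)" for i
    using influenceD[OF f[of i]] unfolding v_def m_def \<tau>_def by (elim exE conjE) simp
  have Suc_m: "snd (f i) = Suc (m i)" for i
    using influenceD[OF f[of i]] unfolding m_def by (elim exE conjE) simp
  have slab: "v i \<in> slab k" for i using chain by blast
  have dec: "\<tau> (Suc i) < \<tau> i" for i
  proof -
    interpret ring_clock \<omega> "v (Suc i)" by (rule clock[OF slab])
    have "m (Suc i) < rings_before \<omega> (v (Suc i)) (\<tau> i)" using chain[of i] Suc_m[of "Suc i"] by simp
    then show ?thesis by (simp add: less_rings_before \<tau>_def)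
  qed
  have anti: "\<tau> j < \<tau> i" if "i < j" for i j
    using that by (induction rule: less_Suc_induct) (use dec in auto)
  have pos: "0 < \<tau> i" for i using ring_clock.ring_pos[OF clock[OF slab]] by (simp add: \<tau>_def)
  \<comment> \<open>The number of the time slice that contains \<open>\<tau> i\<close>. It never
    increases along the chain, so it is constant from some \<open>N\<close> on.\<close>
  define s where "s i = nat \<lfloor>\<tau> i / d\<rfloor>" for i
  have s_antimono: "s j \<le> s i" if "i \<le> j" for i j
    using that anti[of i j] d by (cases "i = j") (auto simp: s_def intro!: nat_mono floor_mono divide_right_mono)
  obtain N where N: "\<And>i. s N \<le> s i"
    using ex_has_least_nat[of "\<lambda>_. True" 0 s] by auto
  have s_eq: "s i = s N" if "N \<le> i" for i using s_antimono[OF that] N[of i] by simp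
  define I where "I = {real (s N) * d..real (s N) * d + d}"
  have \<tau>_I: "\<tau> i \<in> I" if "N \<le> i" for i
  proof -
    have "real (s i) = of_int \<lfloor>\<tau> i / d\<rfloor>" using pos[of i] d by (simp add: s_def)
    then have "real (s i) \<le> \<tau> i / d" "\<tau> i / d \<le> real (s i) + 1" by linarith+
    then have "real (s i) * d \<le> \<tau> i" "\<tau> i \<le> (real (s i) + 1) * d"
      using d by (auto simp: field_simps)
    then show ?thesis using s_eq[OF that] by (simp add: I_def algebra_simps)
  qed
  define V where "V = v ` {N..}"
  have ring: "rings_in I \<omega> u" if "u \<in> V" for u
    using that \<tau>_I unfolding V_def rings_in_def \<tau>_def by auto
  \<comment> \<open>One clock rings only finitely often up to time \<open>\<tau> N\<close>, and the
    times along the chain are distinct, so no vertex is visited infinitely often.\<close>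
  have "infinite V"
  proof
    assume "finite V"
    then obtain i0 where i0: "N \<le> i0" "infinite {i \<in> {N..}. v i = v i0}"
      using pigeonhole_infinite[of "{N..}" v] by (auto simp: V_def infinite_Ici)
    interpret ring_clock \<omega> "v i0" by (rule clock[OF slab])
    have "inj_on m {i \<in> {N..}. v i = v i0}"
    proof (rule inj_onI)
      fix i j assume ij: "i \<in> {i \<in> {N..}. v i = v i0}" "j \<in> {i \<in> {N..}. v i = v i0}" "m i = m j"
      then have "\<tau> i = \<tau> j" by (simp add: \<tau>_def)
      then show "i = j" using anti[of i j] anti[of j i] by (cases i j rule: linorder_cases) auto
    qed
    moreover have "m ` {i \<in> {N..}. v i = v i0} \<subseteq> {..<rings_until \<omega> (v i0) (\<tau> N)}"
    proof
      fix y assume "y \<in> m ` {i \<in> {N..}. v i = v i0}"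
      then obtain i where i: "N \<le> i" "v i = v i0" "y = m i" by auto
      then have "\<tau> i \<le> \<tau> N" using anti[of N i] by (cases "i = N") auto
      then show "y \<in> {..<rings_until \<omega> (v i0) (\<tau> N)}" using i by (simp add: less_rings_until \<tau>_def)
    qed
    ultimately show False using i0(2) finite_imageD finite_subset[OF _ finite_lessThan] by blast
  qed
  have reach: "\<exists>n. \<exists>xs\<in>nb_paths b k n (v N). distinct xs \<and> set xs \<subseteq> V \<and> last xs = v i" if "N \<le> i" for i
    using that
  proof (induction i rule: dec_induct)
    case base
    show ?case by (intro exI[of _ 0] bexI[of _ "[v N]"]) (auto simp: V_def)
  next
    case (step i)
    then obtain n xs where xs: "xs \<in> nb_paths b k n (v N)" "distinct xs" "set xs \<subseteq> V" "last xs = v i" by blast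
    show ?case
    \<comment> \<open>Loop erasure: when the chain returns to a vertex of the path, the path is cut
      back to that vertex and so stays distinct.\<close>
    proof (cases "v (Suc i) \<in> set xs")
      case True
      then obtain j where j: "j < length xs" "xs ! j = v (Suc i)" by (auto simp: in_set_conv_nth)
      have len: "length xs = Suc n" using nb_paths_hd[OF xs(1)] by simp
      have "take (Suc j) xs \<in> nb_paths b k j (v N)" using j len by (intro nb_paths_take[OF xs(1)]) simp
      moreover have "last (take (Suc j) xs) = v (Suc i)" using j by (simp add: take_Suc_conv_app_nth)
      ultimately show ?thesis using xs set_take_subset[of "Suc j" xs] by (intro exI[of _ j] bexI) auto
    next
      case False
      have "xs \<noteq> []" using nb_paths_hd[OF xs(1)] by simp
      then have "v (Suc i) \<noteq> v i" using False xs(4) by (metis last_in_set)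
      then have "xs @ [v (Suc i)] \<in> nb_paths b k (Suc n) (v N)"
        using chain[of i] xs
        by (intro nb_paths_snoc) auto
      then show ?thesis using xs False step(1) by (intro exI[of _ "Suc n"] bexI) (auto simp: V_def)
    qed
  qed
  have "ringing_path b k n I \<omega> (v N)" for n
  proof -
    \<comment> \<open>Paths with at most \<open>n\<close> steps end in finitely many vertices. Since
      \<open>V\<close> is infinite, some vertex of the chain is reached by a longer path, of which
      the first \<open>n + 1\<close> vertices are kept.\<close>
    have "finite (\<Union>l\<in>{..n}. last ` nb_paths b k l (v N))" by (simp add: finite_nb_paths)
    then obtain i where i: "N \<le> i" "v i \<notin> (\<Union>l\<in>{..n}. last ` nb_paths b k l (v N))"
      using \<open>infinite V\<close> finite_subset[of V] unfolding V_def by blast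
    obtain l xs where xs: "xs \<in> nb_paths b k l (v N)" "distinct xs" "set xs \<subseteq> V" "last xs = v i"
      using reach[OF i(1)] by blast
    then have "\<not> l \<le> n" using i(2) by force
    then have "take (Suc n) xs \<in> nb_paths b k n (v N)" by (intro nb_paths_take[OF xs(1)]) simp
    moreover have "\<forall>u\<in>set (take (Suc n) xs). rings_in I \<omega> u"
      using ring xs(3) set_take_subset[of "Suc n" xs] by blast
    ultimately show ?thesis unfolding ringing_path_def using xs(2) by (intro bexI) auto
  qed
  then show ?thesis using slab unfolding I_def by blast
qed

lemma AE_good_sample: "AE \<omega> in glauber_measure k p. good_sample b k \<omega>"
proof -
  let ?M = "glauber_measure k p"
  \<comment> \<open>Chosen to make \<open>9 * k * d\<close> at most 1/2; the summand 1 keeps the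
    denominator positive for \<open>k = 0\<close> as well.\<close>
  define d where "d = 1 / (18 * real k + 1)"
  have d: "0 < d" "9 * real k * d \<le> 1 / 2" by (auto simp: d_def field_simps)
  have all: "(AE \<omega> in ?M. \<forall>v\<in>slab k. P v \<omega>)" if "\<And>v. v \<in> slab k \<Longrightarrow> AE \<omega> in ?M. P v \<omega>" for P
    using that by (subst AE_ball_countable) auto
  have "AE \<omega> in ?M. \<forall>v\<in>slab k. initial_spin \<omega> v \<in> {-1, 1}" by (intro all AE_initial_spin)
  moreover have "AE \<omega> in ?M. \<forall>v\<in>slab k. \<forall>n. coin \<omega> v n \<in> {-1, 1}"
    by (intro all) (subst AE_all_countable, intro allI AE_coin)
  moreover have "AE \<omega> in ?M. \<forall>v\<in>slab k. \<forall>n. 0 < fst (snd (\<omega> v) n)"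
    by (intro all) (subst AE_all_countable, intro allI AE_wait_pos)
  moreover have "AE \<omega> in ?M. \<forall>v\<in>slab k. \<forall>t. \<exists>n. t < ring_time \<omega> v n"
    by (intro all AE_ring_time_unbounded)
  moreover have "AE \<omega> in ?M. \<forall>u\<in>slab k. \<forall>v\<in>slab k. \<forall>i j. u \<noteq> v \<longrightarrow> ring_time \<omega> u i \<noteq> ring_time \<omega> v j"
  proof (intro all)
    fix u v assume "u \<in> slab k" "v \<in> slab k"
    then have "AE \<omega> in ?M. u \<noteq> v \<longrightarrow> ring_time \<omega> u i \<noteq> ring_time \<omega> v j" for i j
      using AE_ring_time_neq[of u k v i j p] by (cases "u = v") auto
    then show "AE \<omega> in ?M. \<forall>i j. u \<noteq> v \<longrightarrow> ring_time \<omega> u i \<noteq> ring_time \<omega> v j"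
      unfolding AE_all_countable by blast
  qed
  moreover have "AE \<omega> in ?M. \<forall>v\<in>slab k. \<forall>i. \<exists>n. \<not> ringing_path b k n {real i * d..real i * d + d} \<omega> v"
  proof (intro all)
    fix v assume "v \<in> slab k"
    then show "AE \<omega> in ?M. \<forall>i. \<exists>n. \<not> ringing_path b k n {real i * d..real i * d + d} \<omega> v"
      unfolding AE_all_countable using d by (intro allI AE_no_ringing_path) auto
  qed
  ultimately show ?thesis
  proof eventually_elim
    case (elim \<omega>)
    have clock: "ring_clock \<omega> v" if "v \<in> slab k" for v
      using elim(3,4) that by unfold_locales auto
    have "wf (influence b k \<omega>)"
      using ringing_paths_of_infinite_chain[OF clock d(1)] elim(6) by blast
    then show ?case using elim unfolding good_sample_def by blast
  qed
qed

lemma slab_fixates_iff: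
  "slab_fixates b k p \<longleftrightarrow>
     (AE \<omega> in glauber_measure k p. \<forall>v\<in>slab k. \<exists>M. \<forall>m\<ge>M. ring_spin b k \<omega> v m = ring_spin b k \<omega> v M)"
proof -
  have *: "AE \<omega> in glauber_measure k p. (\<forall>v\<in>slab k. site_fixates (spin b k \<omega> v)) \<longleftrightarrow>
      (\<forall>v\<in>slab k. \<exists>M. \<forall>m\<ge>M. ring_spin b k \<omega> v m = ring_spin b k \<omega> v M)"
    using AE_good_sample[where b = b]
    by eventually_elim (simp add: good_path.site_fixates_iff[OF good_path.intro])
  show ?thesis
  proof
    assume "slab_fixates b k p"
    then show "AE \<omega> in glauber_measure k p. \<forall>v\<in>slab k. \<exists>M. \<forall>m\<ge>M. ring_spin b k \<omega> v m = ring_spin b k \<omega> v M"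
      unfolding slab_fixates_def using * by eventually_elim blast
  next
    assume "AE \<omega> in glauber_measure k p. \<forall>v\<in>slab k. \<exists>M. \<forall>m\<ge>M. ring_spin b k \<omega> v m = ring_spin b k \<omega> v M"
    then show "slab_fixates b k p" unfolding slab_fixates_def using * by eventually_elim blast
  qed
qed

section \<open>Energy-lowering flips\<close>

lemma l1_dist_sym: "l1_dist v w = l1_dist w v"
  by (cases v; cases w) auto

lemma wraps_sym: "wraps k v w \<longleftrightarrow> wraps k w v"
  by (cases v; cases w) auto

lemma edge_mult_sym: "edge_mult b k v w = edge_mult b k w v"
  by (simp add: edge_mult_def l1_dist_sym[of v w] wraps_sym[of k v w])

lemma edge_mult_self: "2 \<le> k \<Longrightarrow> edge_mult b k v v = 0"
  by (cases v) (auto simp: edge_mult_def)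

lemma edge_mult_le_2: "edge_mult b k v w \<le> 2"
  by (simp add: edge_mult_def)

lemma energy_eq_sum:
  assumes "finite B" "neighbours b k v \<subseteq> B" "B \<subseteq> slab k"
  shows "energy b k s v = - (s v * (\<Sum>w\<in>B. int (edge_mult b k v w) * s w))"
proof -
  have "energy b k s v = - (\<Sum>w\<in>neighbours b k v. s v * (int (edge_mult b k v w) * s w))"
    unfolding energy_def by (simp add: mult.left_commute)
  also have "(\<Sum>w\<in>neighbours b k v. s v * (int (edge_mult b k v w) * s w)) = (\<Sum>w\<in>B. s v * (int (edge_mult b k v w) * s w))"
    by (rule sum.mono_neutral_left) (use assms in \<open>auto simp: neighbours_def\<close>)
  finally show ?thesis by (simp add: sum_distrib_left)
qed

lemma sum_edge_mult_le:
  assumes "finite B" "B \<subseteq> slab k"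
  shows "(\<Sum>w\<in>B. edge_mult b k v w) \<le> 18 * k"
proof -
  have "(\<Sum>w\<in>B. edge_mult b k v w) = (\<Sum>w\<in>B \<inter> neighbours b k v. edge_mult b k v w)"
    by (rule sum.mono_neutral_right) (use assms in \<open>auto simp: neighbours_def\<close>)
  also have "\<dots> \<le> (\<Sum>w\<in>B \<inter> neighbours b k v. 2)" by (intro sum_mono edge_mult_le_2)
  also have "\<dots> \<le> 2 * card (neighbours b k v)"
    using card_mono[OF finite_neighbours[of b k v], of "B \<inter> neighbours b k v"] by simp
  also have "\<dots> \<le> 18 * k" using card_neighbours_le[of b k v] by simp
  finally show ?thesis .
qed

text \<open>Twice the energy of the edges inside \<^term>\<open>B\<close>: every such edge is counted from both ends.\<close>

definition box_energy :: "boundary \<Rightarrow> nat \<Rightarrow> vertex set \<Rightarrow> (vertex \<Rightarrow> int) \<Rightarrow> int" where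
  "box_energy b k B s = - (\<Sum>v\<in>B. \<Sum>w\<in>B. int (edge_mult b k v w) * (s v * s w))"

lemma box_energy_cong: "(\<And>v. v \<in> B \<Longrightarrow> s v = s' v) \<Longrightarrow> box_energy b k B s = box_energy b k B s'"
  unfolding box_energy_def by (auto intro!: sum.cong)

text \<open>The flip reverses the sign of the terms with exactly one end at \<open>v\<close>. Each
  edge at \<open>v\<close> gives two such terms, one for either order of its ends, and a reversal
  changes a term by twice its size: hence the factor 4.\<close>

lemma box_energy_flip:
  assumes k: "2 \<le> k" and B: "finite B" "v \<in> B"
  shows "box_energy b k B (s(v := - s v)) = box_energy b k B s + 4 * (s v * (\<Sum>w\<in>B. int (edge_mult b k v w) * s w))"
proof -
  define s' where "s' = s(v := - s v)"
  define h where "h u = (\<Sum>w\<in>B. int (edge_mult b k u w) * s w)" for u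
  have h': "(\<Sum>w\<in>B. int (edge_mult b k u w) * s' w) = h u - 2 * (int (edge_mult b k u v) * s v)" for u
  proof -
    have "(\<Sum>w\<in>B. int (edge_mult b k u w) * s' w)
        = (\<Sum>w\<in>B. int (edge_mult b k u w) * s w - (if w = v then 2 * (int (edge_mult b k u v) * s v) else 0))"
      by (intro sum.cong) (auto simp: s'_def)
    then show ?thesis using B by (simp add: sum_subtractf h_def)
  qed
  have E: "box_energy b k B t = - (\<Sum>u\<in>B. t u * (\<Sum>w\<in>B. int (edge_mult b k u w) * t w))" for t
    unfolding box_energy_def by (simp add: sum_distrib_left mult.left_commute)
  have "(\<Sum>u\<in>B. s' u * (h u - 2 * (int (edge_mult b k u v) * s v)))
      = (\<Sum>u\<in>B. s u * h u - 2 * s v * (int (edge_mult b k v u) * s u) - (if u = v then 2 * (s v * h v) else 0))"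
  proof (intro sum.cong refl)
    fix u
    show "s' u * (h u - 2 * (int (edge_mult b k u v) * s v))
        = s u * h u - 2 * s v * (int (edge_mult b k v u) * s u) - (if u = v then 2 * (s v * h v) else 0)"
    proof (cases "u = v")
      case True
      then show ?thesis using edge_mult_self[OF k, of b v] by (simp add: s'_def)
    next
      case False
      then show ?thesis using edge_mult_sym[of b k u v] by (simp add: s'_def right_diff_distrib)
    qed
  qed
  also have "\<dots> = (\<Sum>u\<in>B. s u * h u) - 2 * s v * h v - 2 * (s v * h v)"
    using B by (simp add: sum_subtractf sum_distrib_left[symmetric] h_def)
  finally show ?thesis unfolding s'_def[symmetric] E h' h_def[symmetric] by simp
qed

lemma abs_weighted_sum_le:
  assumes B: "finite B" "B \<subseteq> slab k" and s: "\<And>w. w \<in> B \<Longrightarrow> s w \<in> {-1, 1 :: int}"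
  shows "\<bar>\<Sum>w\<in>B. int (edge_mult b k v w) * s w\<bar> \<le> 18 * int k"
proof -
  have "\<bar>\<Sum>w\<in>B. int (edge_mult b k v w) * s w\<bar> \<le> (\<Sum>w\<in>B. \<bar>int (edge_mult b k v w) * s w\<bar>)" by (rule sum_abs)
  also have "\<dots> = (\<Sum>w\<in>B. int (edge_mult b k v w))"
  proof (intro sum.cong refl)
    fix w assume "w \<in> B"
    then have "\<bar>s w\<bar> = 1" using s[of w] by auto
    then show "\<bar>int (edge_mult b k v w) * s w\<bar> = int (edge_mult b k v w)" by (simp add: abs_mult)
  qed
  also have "\<dots> = int (\<Sum>w\<in>B. edge_mult b k v w)" by simp
  also have "\<dots> \<le> int (18 * k)" by (rule of_nat_mono) (rule sum_edge_mult_le[OF B])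
  finally show ?thesis by simp
qed

lemma abs_box_energy_le:
  assumes B: "finite B" "B \<subseteq> slab k" and s: "\<And>w. w \<in> B \<Longrightarrow> s w \<in> {-1, 1 :: int}"
  shows "\<bar>box_energy b k B s\<bar> \<le> 18 * int k * int (card B)"
proof -
  have "\<bar>box_energy b k B s\<bar> = \<bar>\<Sum>u\<in>B. s u * (\<Sum>w\<in>B. int (edge_mult b k u w) * s w)\<bar>"
    unfolding box_energy_def by (simp add: sum_distrib_left mult.left_commute)
  also have "\<dots> \<le> (\<Sum>u\<in>B. \<bar>s u * (\<Sum>w\<in>B. int (edge_mult b k u w) * s w)\<bar>)" by (rule sum_abs)
  also have "\<dots> \<le> (\<Sum>u\<in>B. 18 * int k)"
  proof (rule sum_mono)
    fix u assume "u \<in> B"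
    then have "\<bar>s u\<bar> = 1" using s[of u] by auto
    then show "\<bar>s u * (\<Sum>w\<in>B. int (edge_mult b k u w) * s w)\<bar> \<le> 18 * int k"
      using abs_weighted_sum_le[OF B s, where b = b and v = u] by (simp add: abs_mult)
  qed
  finally show ?thesis by (simp add: mult.commute)
qed

text \<open>\<^term>\<open>reached \<omega> B c\<close> says that at some moment each \<^term>\<open>u \<in> B\<close> has rung exactly \<^term>\<open>c u\<close> times.\<close>

definition reached :: "sample \<Rightarrow> vertex set \<Rightarrow> (vertex \<Rightarrow> nat) \<Rightarrow> bool" where
  "reached \<omega> B c \<longleftrightarrow> (\<forall>u\<in>B. \<forall>w\<in>B. 0 < c u \<longrightarrow> ring_time \<omega> u (c u - 1) < ring_time \<omega> w (c w))"

definition lowering :: "boundary \<Rightarrow> nat \<Rightarrow> sample \<Rightarrow> vertex \<Rightarrow> nat \<Rightarrow> bool" where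
  "lowering b k \<omega> v m \<longleftrightarrow> 0 < energy b k (config_before b k \<omega> (ring_time \<omega> v m)) v"

context good_path
begin

lemma reached_rings_until: "B \<subseteq> slab k \<Longrightarrow> reached \<omega> B (\<lambda>u. rings_until \<omega> u t)"
  unfolding reached_def
proof (intro ballI impI)
  fix u w assume "B \<subseteq> slab k" "u \<in> B" "w \<in> B" "0 < rings_until \<omega> u t"
  then interpret U: ring_clock \<omega> u + W: ring_clock \<omega> w by (auto intro: clock)
  have "ring_time \<omega> u (rings_until \<omega> u t - 1) \<le> t"
    using \<open>0 < rings_until \<omega> u t\<close> by (simp add: U.less_rings_until[symmetric])
  moreover have "t < ring_time \<omega> w (rings_until \<omega> w t)"
    using W.less_rings_until[of "rings_until \<omega> w t" t] by simp
  ultimately show "ring_time \<omega> u (rings_until \<omega> u t - 1) < ring_time \<omega> w (rings_until \<omega> w t)" by simp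
qed

text \<open>The vertex is the one whose last counted ring is the latest. Different clocks never ring
  together, so strictly before this ring every other vertex of \<open>B\<close> has made exactly its
  \<open>c u\<close> rings.\<close>

lemma reached_pred:
  assumes B: "finite B" "B \<subseteq> slab k" and c: "reached \<omega> B c" and nz: "\<exists>u\<in>B. 0 < c u"
  obtains v where "v \<in> B" "0 < c v" "reached \<omega> B (c(v := c v - 1))"
    "\<And>u. u \<in> B \<Longrightarrow> rings_before \<omega> u (ring_time \<omega> v (c v - 1)) = (c(v := c v - 1)) u"
proof -
  define P where "P = {u \<in> B. 0 < c u}"
  define T where "T u = ring_time \<omega> u (c u - 1)" for u
  have P: "finite P" "P \<noteq> {}" using B nz by (auto simp: P_def)
  have "Max (T ` P) \<in> T ` P" using P by (intro Max_in) auto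
  then obtain v where vP: "v \<in> P" "T v = Max (T ` P)" by (metis imageE)
  have v: "v \<in> P" "\<And>u. u \<in> P \<Longrightarrow> T u \<le> T v" using vP P by auto
  have vB: "v \<in> B" "0 < c v" "v \<in> slab k" using vP(1) B by (auto simp: P_def)
  have less: "T u < T v" if "u \<in> B" "0 < c u" "u \<noteq> v" for u
  proof -
    have "u \<in> slab k" using that(1) B(2) by (rule subsetD[rotated])
    then have "T u \<noteq> T v" unfolding T_def by (intro ring_time_distinct vB(3) that(3))
    moreover have "T u \<le> T v" by (rule v(2)) (simp add: P_def that)
    ultimately show ?thesis by simp
  qed
  have next_ring: "T v < ring_time \<omega> u (c u)" if "u \<in> B" for u
    using c that vB unfolding reached_def T_def by blast
  define c' where "c' = c(v := c v - 1)"
  have before: "rings_before \<omega> u (T v) = c' u" if u: "u \<in> B" for u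
  proof (cases "u = v")
    case True
    then show ?thesis using ring_clock.rings_before_ring[OF clock[OF vB(3)]] by (simp add: T_def c'_def)
  next
    case False
    interpret ring_clock \<omega> u by (rule clock) (use u B in blast)
    have "\<not> c u < rings_before \<omega> u (T v)" using next_ring[OF u] by (simp add: less_rings_before)
    moreover have "c u \<le> rings_before \<omega> u (T v)"
    proof (cases "c u")
      case (Suc j)
      then have "j < rings_before \<omega> u (T v)" using less[OF u _ False] by (simp add: less_rings_before T_def)
      then show ?thesis using Suc by simp
    qed simp
    ultimately show ?thesis using False by (simp add: c'_def)
  qed
  have lt: "ring_time \<omega> u (c' u - 1) < T v" if "u \<in> B" "0 < c' u" for u
  proof -
    interpret ring_clock \<omega> u by (rule clock) (use that B in blast)
    have "c' u - 1 < rings_before \<omega> u (T v)" using before[OF that(1)] that by simp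
    then show ?thesis by (simp add: less_rings_before)
  qed
  have ge: "T v \<le> ring_time \<omega> u (c' u)" if "u \<in> B" for u
  proof -
    interpret ring_clock \<omega> u by (rule clock) (use that B in blast)
    have "\<not> c' u < rings_before \<omega> u (T v)" using before[OF that(1)] that by simp
    then show ?thesis by (simp add: less_rings_before)
  qed
  have "reached \<omega> B c'"
    unfolding reached_def using lt ge by fastforce
  then show thesis using that[OF vB(1,2)] before by (simp add: c'_def T_def)
qed

text \<open>Every reached state arises from the empty one by the rings of \<open>B\<close> in their
  temporal order. Rings outside \<open>B\<close> are passed over, since they change no spin of
  \<open>B\<close>; thus the infinite system is followed through a finite box without ordering all
  of its rings.\<close>

lemma reached_induct [consumes 3, case_names zero step]:
  assumes B: "finite B" "B \<subseteq> slab k" and c: "reached \<omega> B c"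
    and zero: "\<And>c. (\<And>u. u \<in> B \<Longrightarrow> c u = 0) \<Longrightarrow> P c"
    and step: "\<And>c v. reached \<omega> B c \<Longrightarrow> v \<in> B \<Longrightarrow>
      (\<And>u. u \<in> B \<Longrightarrow> rings_before \<omega> u (ring_time \<omega> v (c v)) = c u) \<Longrightarrow> P c \<Longrightarrow> P (c(v := Suc (c v)))"
  shows "P c"
  using c
proof (induction "sum c B" arbitrary: c)
  case 0
  then show ?case using B by (intro zero) auto
next
  case (Suc n)
  have "\<exists>u\<in>B. 0 < c u" using Suc(2) B by (metis gr0I sum.neutral nat.distinct(1))
  then obtain v where v: "v \<in> B" "0 < c v" "reached \<omega> B (c(v := c v - 1))"
    "\<And>u. u \<in> B \<Longrightarrow> rings_before \<omega> u (ring_time \<omega> v (c v - 1)) = (c(v := c v - 1)) u"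
    using reached_pred[OF B Suc(3)] by metis
  define c' where "c' = c(v := c v - 1)"
  have "sum c B = c v + sum c (B - {v})" using B v by (simp add: sum.remove)
  moreover have "sum c' B = c' v + sum c' (B - {v})" using B v by (simp add: sum.remove)
  moreover have "sum c (B - {v}) = sum c' (B - {v})" by (intro sum.cong) (auto simp: c'_def)
  moreover have c'v: "c' v = c v - 1" by (simp add: c'_def)
  ultimately have "n = sum c' B" using Suc(2) v(2) by linarith
  then have "P c'" using Suc(1)[of c'] v(3) unfolding c'_def[symmetric] by blast
  moreover have "rings_before \<omega> u (ring_time \<omega> v (c' v)) = c' u" if "u \<in> B" for u
    using v(4)[OF that] unfolding c'_def[symmetric] c'v .
  ultimately have "P (c'(v := Suc (c' v)))"
    using v(1,3) unfolding c'_def[symmetric] by (intro step)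
  moreover have "c'(v := Suc (c' v)) = c" using v(2) by (auto simp: c'_def)
  ultimately show ?case by simp
qed

text \<open>Energy balance in the box. All neighbours of \<open>A\<close> lie in \<open>B\<close>
  and energies are integers, so a lowering flip in \<open>A\<close> decreases the doubled box energy
  by at least 4, while other rings in \<open>A\<close> do not raise it. A ring in
  \<open>B - A\<close> raises it by at most \<open>4 * 18 * k\<close>. The doubled energy stays
  within \<open>18 * k * card B\<close> of zero, which bounds its total drop by
  \<open>36 * k * card B\<close> plus what the rings in \<open>B - A\<close> add.\<close>

lemma lowering_bound:
  assumes k: "2 \<le> k" and B: "finite B" "B \<subseteq> slab k" and A: "A \<subseteq> B" "\<And>v. v \<in> A \<Longrightarrow> neighbours b k v \<subseteq> B"
  shows "4 * (\<Sum>v\<in>A. card {m. m < rings_until \<omega> v t \<and> lowering b k \<omega> v m})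
           \<le> 36 * k * card B + 72 * k * (\<Sum>v\<in>B - A. rings_until \<omega> v t)"
proof -
  define E where "E c = box_energy b k B (\<lambda>u. ring_spin b k \<omega> u (c u))" for c
  define low where "low v n = card {m. m < n \<and> lowering b k \<omega> v m}" for v n
  have low_Suc: "low v (Suc n) = low v n + of_bool (lowering b k \<omega> v n)" for v n
  proof -
    have "{m. m < Suc n \<and> lowering b k \<omega> v m}
        = {m. m < n \<and> lowering b k \<omega> v m} \<union> (if lowering b k \<omega> v n then {n} else {})"
      by (auto simp: less_Suc_eq)
    then show ?thesis by (auto simp: low_def)
  qed
  have fin: "finite A" using A B finite_subset by blast
  have E_bound: "\<bar>E c\<bar> \<le> 18 * int k * int (card B)" for c
    unfolding E_def by (rule abs_box_energy_le[OF B ring_spin_values])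
  have "E c + 4 * (\<Sum>v\<in>A. int (low v (c v))) \<le> E (\<lambda>_. 0) + 72 * int k * (\<Sum>v\<in>B - A. int (c v))"
    if "reached \<omega> B c" for c
    using B that
  proof (induction rule: reached_induct)
    case (zero c)
    then have "E c = E (\<lambda>_. 0)" unfolding E_def by (intro box_energy_cong) simp
    moreover have "(\<Sum>v\<in>A. int (low v (c v))) = 0" using zero A by (intro sum.neutral) (auto simp: low_def)
    ultimately show ?case by (simp add: sum_nonneg)
  next
    case (step c v)
    define c' where "c' = c(v := Suc (c v))"
    define \<eta> where "\<eta> = config_before b k \<omega> (ring_time \<omega> v (c v))"
    define s where "s u = ring_spin b k \<omega> u (c u)" for u
    define s' where "s' u = ring_spin b k \<omega> u (c' u)" for u
    define H where "H = (\<Sum>w\<in>B. int (edge_mult b k v w) * s w)"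
    have \<eta>: "\<eta> u = s u" if "u \<in> B" for u using step(3)[OF that] by (simp add: \<eta>_def s_def config_before_def)
    have vs: "v \<in> slab k" using step(2) B by auto
    have pm: "s v \<in> {-1, 1}" "s' v \<in> {-1, 1}" unfolding s_def s'_def by (rule ring_spin_values)+
    have s'_upd: "s' v = updated_spin (s v) (energy b k \<eta> v) (coin \<omega> v (c v))"
      using ring_spin_Suc[OF vs, of "c v"] \<eta>[OF step(2)] by (simp add: s'_def c'_def \<eta>_def)
    have flip: "E c' = E c + 4 * (s v * H)" if "s' v \<noteq> s v"
    proof -
      have "s' v = - s v" using that pm by auto
      then have "E c' = box_energy b k B (s(v := - s v))"
        unfolding E_def by (intro box_energy_cong) (auto simp: s_def s'_def c'_def)
      then show ?thesis using box_energy_flip[OF k B(1) step(2), of b s] by (simp add: E_def s_def[abs_def] H_def)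
    qed
    have same: "E c' = E c" if "s' v = s v"
      unfolding E_def using that by (intro box_energy_cong) (auto simp: s_def s'_def c'_def)
    show ?case
    proof (cases "v \<in> A")
      case True
      have en: "energy b k \<eta> v = - (s v * H)"
      proof -
        have "energy b k \<eta> v = energy b k s v"
          using \<eta> step(2) A(2)[OF True] by (intro energy_cong) auto
        also have "\<dots> = - (s v * H)" unfolding H_def by (rule energy_eq_sum[OF B(1) A(2)[OF True] B(2)])
        finally show ?thesis .
      qed
      have "E c' + 4 * int (of_bool (lowering b k \<omega> v (c v))) \<le> E c"
      proof -
        consider "energy b k \<eta> v > 0" | "energy b k \<eta> v = 0" | "energy b k \<eta> v < 0" by linarith
        then show ?thesis
        proof cases
          case 1
          then have "s' v \<noteq> s v" using s'_upd pm by (auto simp: updated_spin_def)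
          then show ?thesis using flip 1 en by (simp add: lowering_def \<eta>_def)
        next
          case 2
          then have "E c' = E c" using flip same en by (cases "s' v = s v") linarith+
          then show ?thesis using 2 by (simp add: lowering_def \<eta>_def)
        next
          case 3
          then have "s' v = s v" using s'_upd by (simp add: updated_spin_def)
          then show ?thesis using same 3 by (simp add: lowering_def \<eta>_def)
        qed
      qed
      moreover have "(\<Sum>u\<in>A. int (low u (c' u))) = (\<Sum>u\<in>A. int (low u (c u))) + int (of_bool (lowering b k \<omega> v (c v)))"
      proof -
        have "(\<Sum>u\<in>A. int (low u (c' u)))
            = (\<Sum>u\<in>A. int (low u (c u)) + (if u = v then int (of_bool (lowering b k \<omega> v (c v))) else 0))"
          by (intro sum.cong) (auto simp: c'_def low_Suc)
        then show ?thesis using fin True by (simp add: sum.distrib)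
      qed
      moreover have eq: "(\<Sum>u\<in>B - A. int (c' u)) = (\<Sum>u\<in>B - A. int (c u))"
        using True by (intro sum.cong) (auto simp: c'_def)
      ultimately show ?thesis using step(4) unfolding c'_def[symmetric] eq by linarith
    next
      case False
      have "E c' \<le> E c + 72 * int k"
      proof (cases "s' v = s v")
        case False
        have "\<bar>H\<bar> \<le> 18 * int k"
          unfolding H_def s_def by (rule abs_weighted_sum_le[OF B ring_spin_values])
        then have "s v * H \<le> 18 * int k" using pm by auto
        then show ?thesis using flip[OF False] by linarith
      qed (simp add: same)
      moreover have "(\<Sum>u\<in>B - A. int (c' u)) = (\<Sum>u\<in>B - A. int (c u)) + 1"
      proof -
        have "(\<Sum>u\<in>B - A. int (c' u)) = (\<Sum>u\<in>B - A. int (c u) + (if u = v then 1 else 0))"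
          by (intro sum.cong) (auto simp: c'_def)
        then show ?thesis using B step(2) False by (simp add: sum.distrib)
      qed
      moreover have "(\<Sum>u\<in>A. int (low u (c' u))) = (\<Sum>u\<in>A. int (low u (c u)))"
        using False by (intro sum.cong) (auto simp: c'_def)
      ultimately show ?thesis using step(4) unfolding c'_def[symmetric] by (simp add: algebra_simps)
    qed
  qed
  from this[OF reached_rings_until[OF B(2)], of t]
  have "int (4 * (\<Sum>v\<in>A. low v (rings_until \<omega> v t)))
      \<le> int (36 * k * card B + 72 * k * (\<Sum>v\<in>B - A. rings_until \<omega> v t))"
    using E_bound[of "\<lambda>_. 0"] E_bound[of "\<lambda>u. rings_until \<omega> u t"] by (simp add: algebra_simps)
  then show ?thesis unfolding low_def by (simp only: zle_int)
qed

end

section \<open>Translation invariance and the expected number of energy-lowering flips\<close>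

definition translate :: "int \<Rightarrow> int \<Rightarrow> vertex \<Rightarrow> vertex" where
  "translate a c v = (case v of (x, y, z) \<Rightarrow> (x + a, y + c, z))"

definition translate_sample :: "nat \<Rightarrow> int \<Rightarrow> int \<Rightarrow> sample \<Rightarrow> sample" where
  "translate_sample k a c \<omega> = (\<lambda>v\<in>slab k. \<omega> (translate a c v))"

lemma translate_slab [simp]: "translate a c v \<in> slab k \<longleftrightarrow> v \<in> slab k"
  by (cases v) (simp add: translate_def slab_def)

lemma inj_translate: "inj (translate a c)"
  by (auto simp: inj_def translate_def)

lemma translate_translate: "translate a c (translate (- a) (- c) v) = v"
  by (cases v) (simp add: translate_def)

lemma edge_mult_translate: "edge_mult b k (translate a c v) (translate a c w) = edge_mult b k v w"
  by (cases v; cases w) (simp add: edge_mult_def translate_def)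

lemma neighbours_translate: "neighbours b k (translate a c v) = translate a c ` neighbours b k v"
proof (intro equalityI subsetI)
  fix w assume w: "w \<in> neighbours b k (translate a c v)"
  define u where "u = translate (- a) (- c) w"
  have "translate a c u = w" by (simp add: u_def translate_translate)
  then show "w \<in> translate a c ` neighbours b k v"
    using w edge_mult_translate[of b k a c v u] by (intro image_eqI[of _ _ u]) (auto simp: neighbours_def)
qed (auto simp: neighbours_def edge_mult_translate)

lemma energy_translate: "energy b k (\<lambda>u. s (translate a c u)) v = energy b k s (translate a c v)"
  unfolding energy_def neighbours_translate
  by (simp add: sum.reindex[OF inj_on_subset[OF inj_translate subset_UNIV]] edge_mult_translate)

lemma translate_sample_site:
  assumes "v \<in> slab k"
  shows "ring_time (translate_sample k a c \<omega>) v m = ring_time \<omega> (translate a c v) m"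
    and "coin (translate_sample k a c \<omega>) v m = coin \<omega> (translate a c v) m"
    and "initial_spin (translate_sample k a c \<omega>) v = initial_spin \<omega> (translate a c v)"
    and "rings_before (translate_sample k a c \<omega>) v t = rings_before \<omega> (translate a c v) t"
    and "rings_until (translate_sample k a c \<omega>) v t = rings_until \<omega> (translate a c v) t"
  using assms
  by (simp_all add: ring_time_def coin_def initial_spin_def rings_before_def rings_until_def translate_sample_def)

lemma approx_spin_translate:
  "v \<in> slab k \<Longrightarrow> approx_spin b k n (translate_sample k a c \<omega>) v m = approx_spin b k n \<omega> (translate a c v) m"
proof (induction n arbitrary: v m)
  case 0 then show ?case by (simp add: translate_sample_site)
next
  case (Suc n)
  show ?case
  proof (cases m)
    case 0 then show ?thesis using Suc.prems by (simp add: translate_sample_site)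
  next
    case (Suc j)
    let ?\<omega> = "translate_sample k a c \<omega>"
    define \<eta> where "\<eta> u = approx_spin b k n \<omega> u (rings_before \<omega> u (ring_time \<omega> (translate a c v) j))" for u
    have *: "approx_spin b k n ?\<omega> u (rings_before ?\<omega> u (ring_time ?\<omega> v j)) = \<eta> (translate a c u)"
      if "u \<in> slab k" for u
      using Suc.IH[OF that] that Suc.prems by (simp add: \<eta>_def translate_sample_site)
    have "energy b k (\<lambda>u. approx_spin b k n ?\<omega> u (rings_before ?\<omega> u (ring_time ?\<omega> v j))) v
        = energy b k (\<lambda>u. \<eta> (translate a c u)) v"
      by (intro energy_cong *) (use Suc.prems neighbours_subset_slab[of b k v] in blast)+
    also have "\<dots> = energy b k \<eta> (translate a c v)" by (rule energy_translate)
    finally show ?thesis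
      using *[OF Suc.prems] Suc.prems by (simp add: Suc Let_def translate_sample_site flip: \<eta>_def)
  qed
qed

lemma config_before_translate:
  "v \<in> slab k \<Longrightarrow> config_before b k (translate_sample k a c \<omega>) t v = config_before b k \<omega> t (translate a c v)"
  by (simp add: config_before_def ring_spin_def approx_spin_translate translate_sample_site)

lemma lowering_translate:
  assumes v: "v \<in> slab k"
  shows "lowering b k (translate_sample k a c \<omega>) v m \<longleftrightarrow> lowering b k \<omega> (translate a c v) m"
proof -
  let ?t = "ring_time \<omega> (translate a c v) m"
  have "energy b k (config_before b k (translate_sample k a c \<omega>) ?t) v
      = energy b k (\<lambda>u. config_before b k \<omega> ?t (translate a c u)) v"
    by (intro energy_cong config_before_translate) (use v neighbours_subset_slab[of b k v] in blast)+
  then show ?thesis using v by (simp add: lowering_def translate_sample_site energy_translate)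
qed

lemma distr_translate_sample:
  "distr (glauber_measure k p) (glauber_measure k p) (translate_sample k a c) = glauber_measure k p"
  unfolding glauber_measure_eq translate_sample_def
  using distr_PiM_reindex[of "slab k" "\<lambda>_. site_measure p" "translate a c" "slab k"]
  by (simp add: prob_space_site_measure inj_on_subset[OF inj_translate subset_UNIV] Pi_iff)

definition lowering_count :: "boundary \<Rightarrow> nat \<Rightarrow> sample \<Rightarrow> real \<Rightarrow> vertex \<Rightarrow> nat" where
  "lowering_count b k \<omega> t v = card {m. m < rings_until \<omega> v t \<and> lowering b k \<omega> v m}"

lemma measurable_lowering [measurable]:
  assumes v: "v \<in> slab k"
  shows "Measurable.pred (glauber_measure k p) (\<lambda>\<omega>. lowering b k \<omega> v m)"
proof -
  have "(\<lambda>\<omega>. energy b k (config_before b k \<omega> (ring_time \<omega> v m)) v)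
      \<in> measurable (glauber_measure k p) (count_space UNIV)"
    by (rule measurable_energy[OF v]) (intro measurable_config_before measurable_ring_time v)
  then show ?thesis unfolding lowering_def by (rule measurable_compose) simp
qed

lemma measurable_lowering_count [measurable]:
  assumes v: "v \<in> slab k"
  shows "(\<lambda>\<omega>. lowering_count b k \<omega> t v) \<in> measurable (glauber_measure k p) (count_space UNIV)"
proof -
  note [measurable] = measurable_lowering[OF v] measurable_rings_until[OF v]
  show ?thesis unfolding lowering_count_def by measurable
qed

lemma nn_integral_lowering_count_translate:
  assumes v: "v \<in> slab k"
  shows "(\<integral>\<^sup>+\<omega>. of_nat (lowering_count b k \<omega> t (translate a c v)) \<partial>glauber_measure k p)
           = (\<integral>\<^sup>+\<omega>. of_nat (lowering_count b k \<omega> t v) \<partial>glauber_measure k p)"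
proof -
  let ?M = "glauber_measure k p"
  have [measurable]: "translate_sample k a c \<in> measurable ?M ?M"
    unfolding glauber_measure_eq translate_sample_def
    by (intro measurable_restrict measurable_component_singleton) simp
  have "(\<integral>\<^sup>+\<omega>. of_nat (lowering_count b k \<omega> t v) \<partial>?M)
      = (\<integral>\<^sup>+\<omega>. of_nat (lowering_count b k \<omega> t v) \<partial>distr ?M ?M (translate_sample k a c))"
    by (simp add: distr_translate_sample)
  also have "\<dots> = (\<integral>\<^sup>+\<omega>. of_nat (lowering_count b k (translate_sample k a c \<omega>) t v) \<partial>?M)"
    using v by (intro nn_integral_distr) measurable
  also have "\<dots> = (\<integral>\<^sup>+\<omega>. of_nat (lowering_count b k \<omega> t (translate a c v)) \<partial>?M)"
    using v by (simp add: lowering_count_def lowering_translate translate_sample_site)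
  finally show ?thesis by simp
qed

lemma nn_integral_rings_until:
  assumes v: "v \<in> slab k" and t: "0 \<le> t"
  shows "(\<integral>\<^sup>+\<omega>. of_nat (rings_until \<omega> v t) \<partial>glauber_measure k p) = ennreal t"
proof -
  let ?M = "glauber_measure k p"
  note [measurable] = measurable_ring_time[OF v]
  have "AE \<omega> in ?M. of_nat (rings_until \<omega> v t) = (\<Sum>n. indicator {\<omega> \<in> space ?M. ring_time \<omega> v n \<in> {0..t}} \<omega> :: ennreal)"
    using AE_good_sample[where b = Free] AE_space
  proof eventually_elim
    case (elim \<omega>)
    interpret good_path Free k \<omega> by unfold_locales fact
    interpret ring_clock \<omega> v by (rule clock[OF v])
    have "(\<Sum>n. indicator {\<omega> \<in> space ?M. ring_time \<omega> v n \<in> {0..t}} \<omega> :: ennreal)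
        = (\<Sum>n\<in>{..<rings_until \<omega> v t}. indicator {\<omega> \<in> space ?M. ring_time \<omega> v n \<in> {0..t}} \<omega>)"
      by (rule suminf_finite) (auto simp: less_rings_until)
    also have "\<dots> = (\<Sum>n\<in>{..<rings_until \<omega> v t}. 1)"
      using elim(2) ring_pos by (intro sum.cong) (auto simp: less_rings_until less_imp_le)
    finally show ?case by simp
  qed
  then have "(\<integral>\<^sup>+\<omega>. of_nat (rings_until \<omega> v t) \<partial>?M)
      = (\<integral>\<^sup>+\<omega>. (\<Sum>n. indicator {\<omega> \<in> space ?M. ring_time \<omega> v n \<in> {0..t}} \<omega>) \<partial>?M)"
    by (rule nn_integral_cong_AE)
  also have "\<dots> = (\<Sum>n. emeasure ?M {\<omega> \<in> space ?M. ring_time \<omega> v n \<in> {0..t}})"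
    by (subst nn_integral_suminf) auto
  also have "\<dots> = ennreal t"
    using t by (subst sum_emeasure_ring_time[OF v]) auto
  finally show ?thesis .
qed

definition slab_box :: "nat \<Rightarrow> nat \<Rightarrow> vertex set" where
  "slab_box k L = {- int L..int L} \<times> {- int L..int L} \<times> {..<k}"

lemma slab_box: "finite (slab_box k L)" "slab_box k L \<subseteq> slab k" "card (slab_box k L) = (2 * L + 1)\<^sup>2 * k"
  "slab_box k L \<subseteq> slab_box k (Suc L)"
  by (auto simp: slab_box_def slab_def card_cartesian_product power2_eq_square nat_add_distrib nat_mult_distrib
      algebra_simps)

lemma neighbours_slab_box: "v \<in> slab_box k L \<Longrightarrow> neighbours b k v \<subseteq> slab_box k (Suc L)"
  by (cases v) (auto simp: slab_box_def neighbours_def edge_mult_def slab_def split: if_splits)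

lemma sum_slab_box_translation_invariant:
  fixes f :: "vertex \<Rightarrow> ennreal"
  assumes f: "\<And>a c v. v \<in> slab k \<Longrightarrow> f (translate a c v) = f v"
  shows "(\<Sum>v\<in>slab_box k L. f v) = of_nat ((2 * L + 1)\<^sup>2) * (\<Sum>z<k. f (0, 0, z))"
proof -
  have "f (x, y, z) = f (0, 0, z)" if "z < k" for x y z
    using f[of "(0, 0, z)" x y] that by (simp add: translate_def slab_def)
  then have "(\<Sum>v\<in>slab_box k L. f v) = (\<Sum>(x, y, z)\<in>slab_box k L. f (0, 0, z))"
    by (intro sum.cong) (auto simp: slab_box_def)
  also have "\<dots> = (\<Sum>x\<in>{- int L..int L}. \<Sum>y\<in>{- int L..int L}. \<Sum>z<k. f (0, 0, z))"
    unfolding slab_box_def by (simp add: sum.cartesian_product' del: sum_constant)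
  also have "\<dots> = of_nat ((2 * L + 1)\<^sup>2) * (\<Sum>z<k. f (0, 0, z))"
  proof -
    have c: "card {- int L..int L} = 2 * L + 1" by (simp add: nat_add_distrib nat_mult_distrib)
    show ?thesis by (simp only: sum_constant c power2_eq_square of_nat_mult mult.assoc)
  qed
  finally show ?thesis .
qed

text \<open>The radius \<open>L\<close> of the box is at least \<open>t\<close>. The rings in the
  boundary of the box then number at most about \<open>L * t\<close> on average, which is no more
  than the order of the volume, so the bound per site does not depend on \<open>t\<close>. The
  constant is \<open>(36 * 9 + 72 * 8) / 4\<close>, where 9 compares the volumes of the two boxes
  and 8 comes from the size of the boundary.\<close>

lemma nn_integral_lowering_count_bound:
  assumes k: "2 \<le> k" and v: "v \<in> slab k" and t: "0 \<le> t"
  shows "(\<integral>\<^sup>+\<omega>. of_nat (lowering_count b k \<omega> t v) \<partial>glauber_measure k p) \<le> 225 * of_nat (k\<^sup>2)"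
proof -
  let ?M = "glauber_measure k p"
  interpret prob_space ?M by (rule prob_space_glauber_measure)
  define f where "f v = (\<integral>\<^sup>+\<omega>. of_nat (lowering_count b k \<omega> t v) \<partial>?M)" for v
  define S where "S = (\<Sum>z<k. f (0, 0, z))"
  define L where "L = nat \<lceil>t\<rceil>"
  define A where "A = slab_box k L"
  define B where "B = slab_box k (Suc L)"
  define n where "n = (2 * L + 1)\<^sup>2"
  have L: "t \<le> real L" unfolding L_def by linarith
  have AB: "finite A" "finite B" "B \<subseteq> slab k" "A \<subseteq> B" "A \<subseteq> slab k" unfolding A_def B_def using slab_box by auto
  have inv: "f (translate a c w) = f w" if "w \<in> slab k" for a c w
    unfolding f_def by (rule nn_integral_lowering_count_translate[OF that])
  have meas: "(\<lambda>\<omega>. of_nat (lowering_count b k \<omega> t w) :: ennreal) \<in> borel_measurable ?M"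
    "(\<lambda>\<omega>. of_nat (rings_until \<omega> w t) :: ennreal) \<in> borel_measurable ?M" if "w \<in> slab k" for w
    using that by measurable
  have "4 * (of_nat n * S) = 4 * (\<Sum>w\<in>A. f w)"
    unfolding S_def A_def n_def by (subst sum_slab_box_translation_invariant[OF inv]) auto
  also have "\<dots> = (\<integral>\<^sup>+\<omega>. of_nat (4 * (\<Sum>w\<in>A. lowering_count b k \<omega> t w)) \<partial>?M)"
  proof -
    have "(\<lambda>\<omega>. \<Sum>w\<in>A. of_nat (lowering_count b k \<omega> t w) :: ennreal) \<in> borel_measurable ?M"
      by (intro borel_measurable_sum meas) (use AB in blast)
    moreover have "(\<Sum>w\<in>A. f w) = (\<integral>\<^sup>+\<omega>. (\<Sum>w\<in>A. of_nat (lowering_count b k \<omega> t w)) \<partial>?M)"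
      unfolding f_def by (rule nn_integral_sum[symmetric]) (use meas AB in blast)
    ultimately show ?thesis by (simp add: nn_integral_cmult)
  qed
  also have "\<dots> \<le> (\<integral>\<^sup>+\<omega>. of_nat (36 * k * card B + 72 * k * (\<Sum>w\<in>B - A. rings_until \<omega> w t)) \<partial>?M)"
  proof (rule nn_integral_mono_AE)
    show "AE \<omega> in ?M. (of_nat (4 * (\<Sum>w\<in>A. lowering_count b k \<omega> t w)) :: ennreal)
        \<le> of_nat (36 * k * card B + 72 * k * (\<Sum>w\<in>B - A. rings_until \<omega> w t))"
      using AE_good_sample[where b = b]
    proof eventually_elim
      case (elim \<omega>)
      interpret good_path b k \<omega> by unfold_locales fact
      have "4 * (\<Sum>w\<in>A. lowering_count b k \<omega> t w) \<le> 36 * k * card B + 72 * k * (\<Sum>w\<in>B - A. rings_until \<omega> w t)"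
        unfolding lowering_count_def
        by (rule lowering_bound[OF k AB(2,3,4)]) (auto simp: A_def B_def dest: neighbours_slab_box)
      then show ?case by (rule of_nat_mono)
    qed
  qed
  also have "\<dots> = of_nat (36 * k * card B) + of_nat (72 * k) * (\<Sum>w\<in>B - A. ennreal t)"
  proof -
    have "(\<integral>\<^sup>+\<omega>. (\<Sum>w\<in>B - A. of_nat (rings_until \<omega> w t)) \<partial>?M) = (\<Sum>w\<in>B - A. ennreal t)"
    proof (subst nn_integral_sum)
      show "(\<Sum>w\<in>B - A. \<integral>\<^sup>+\<omega>. of_nat (rings_until \<omega> w t) \<partial>?M) = (\<Sum>w\<in>B - A. ennreal t)"
        by (intro sum.cong refl nn_integral_rings_until t) (use AB in blast)
    qed (use AB meas in blast)
    moreover have "(\<lambda>\<omega>. \<Sum>w\<in>B - A. of_nat (rings_until \<omega> w t) :: ennreal) \<in> borel_measurable ?M"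
      by (intro borel_measurable_sum meas) (use AB in blast)
    ultimately show ?thesis
      by (simp add: nn_integral_add nn_integral_cmult emeasure_space_1)
  qed
  also have "\<dots> = ennreal (real (36 * k * card B) + real (72 * k) * (real (card (B - A)) * t))"
    using t by (simp add: ennreal_of_nat_eq_real_of_nat ennreal_mult ennreal_plus)
  also have "\<dots> \<le> ennreal (4 * (real n * real (225 * k\<^sup>2)))"
  proof (rule ennreal_leI)
    have card: "card B = (2 * L + 3)\<^sup>2 * k" "card (B - A) = 8 * (L + 1) * k"
      using card_Diff_subset[OF AB(1,4)] slab_box(3)[of k L] slab_box(3)[of k "Suc L"]
      by (simp_all add: A_def B_def power2_eq_square algebra_simps)
    have 1: "(2 * real L + 3)\<^sup>2 \<le> 9 * real n" by (simp add: n_def power2_eq_square algebra_simps)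
    have 2: "(real L + 1) * t \<le> real n"
    proof -
      have "(real L + 1) * t \<le> (real L + 1) * real L" using L by (intro mult_left_mono) auto
      also have "\<dots> \<le> real n" by (simp add: n_def power2_eq_square algebra_simps)
      finally show ?thesis .
    qed
    have "real (36 * k * card B) + real (72 * k) * (real (card (B - A)) * t)
        = 36 * (real k)\<^sup>2 * (2 * real L + 3)\<^sup>2 + 576 * (real k)\<^sup>2 * ((real L + 1) * t)"
      by (simp add: card power2_eq_square algebra_simps)
    also have "\<dots> \<le> 36 * (real k)\<^sup>2 * (9 * real n) + 576 * (real k)\<^sup>2 * real n"
      using 1 2 by (intro add_mono mult_left_mono) auto
    also have "\<dots> = 4 * (real n * real (225 * k\<^sup>2))" by (simp add: algebra_simps)
    finally show "real (36 * k * card B) + real (72 * k) * (real (card (B - A)) * t) \<le> 4 * (real n * real (225 * k\<^sup>2))" .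
  qed
  also have "\<dots> = of_nat (4 * (n * (225 * k\<^sup>2)))"
    unfolding ennreal_of_nat_eq_real_of_nat by (rule arg_cong[where f = ennreal]) simp
  also have "\<dots> = 4 * (of_nat n * of_nat (225 * k\<^sup>2))" by (simp only: of_nat_mult of_nat_numeral)
  finally have "4 * (of_nat n * S) \<le> 4 * (of_nat n * (of_nat (225 * k\<^sup>2) :: ennreal))" .
  then have "S \<le> of_nat (225 * k\<^sup>2)"
  proof -
    assume le: "4 * (of_nat n * S) \<le> 4 * (of_nat n * (of_nat (225 * k\<^sup>2) :: ennreal))"
    have "n \<noteq> 0" by (simp add: n_def)
    then have "(4 * of_nat n :: ennreal) \<noteq> 0" "(4 * of_nat n :: ennreal) < top"
      by (auto simp: ennreal_mult_less_top of_nat_less_top)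
    then show ?thesis using le unfolding mult.assoc[symmetric] by (subst (asm) ennreal_mult_le_mult_iff) auto
  qed
  moreover have "f v \<le> S"
  proof -
    obtain x y z where v_eq: "v = (x, y, z)" by (cases v)
    then have z: "z < k" using v by (simp add: slab_def)
    then have "f v = f (0, 0, z)" using inv[of "(0, 0, z)" x y] by (simp add: v_eq translate_def slab_def)
    also have "\<dots> \<le> S" unfolding S_def using z by (intro member_le_sum) auto
    finally show ?thesis .
  qed
  ultimately show ?thesis unfolding f_def by simp
qed

text \<open>Since the bound on the expectation is uniform in time, monotone convergence gives the
  total number of lowering rings of a site a finite expectation.\<close>

lemma AE_finite_lowering:
  assumes k: "2 \<le> k"
  shows "AE \<omega> in glauber_measure k p. \<forall>v\<in>slab k. finite {m. lowering b k \<omega> v m}"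
proof -
  let ?M = "glauber_measure k p"
  have "AE \<omega> in ?M. finite {m. lowering b k \<omega> v m}" if v: "v \<in> slab k" for v
  proof -
    note [measurable] = measurable_lowering_count[OF v]
    define F :: "nat \<Rightarrow> sample \<Rightarrow> ennreal" where "F n \<omega> = of_nat (lowering_count b k \<omega> (real n) v)" for n \<omega>
    have [measurable]: "F n \<in> borel_measurable ?M" for n unfolding F_def by measurable
    have mono: "AE \<omega> in ?M. F n \<omega> \<le> F (Suc n) \<omega>" for n
      using AE_good_sample[where b = b]
    proof eventually_elim
      case (elim \<omega>)
      interpret good_path b k \<omega> by unfold_locales fact
      interpret ring_clock \<omega> v by (rule clock[OF v])
      have "lowering_count b k \<omega> (real n) v \<le> lowering_count b k \<omega> (real (Suc n)) v"
        unfolding lowering_count_def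
        using rings_until_mono[of "real n" "real (Suc n)"] by (intro card_mono) auto
      then show ?case unfolding F_def by (rule of_nat_mono)
    qed
    have "(\<integral>\<^sup>+\<omega>. (SUP n. F n \<omega>) \<partial>?M) = (SUP n. \<integral>\<^sup>+\<omega>. F n \<omega> \<partial>?M)"
      by (rule nn_integral_monotone_convergence_SUP_AE) (use mono in auto)
    also have "\<dots> \<le> 225 * of_nat (k\<^sup>2)"
      unfolding F_def by (intro SUP_least nn_integral_lowering_count_bound k v) simp
    also have "\<dots> = of_nat (225 * k\<^sup>2)" by (simp only: of_nat_mult of_nat_numeral)
    also have "\<dots> < \<infinity>" unfolding infinity_ennreal_def by (rule of_nat_less_top)
    finally have "AE \<omega> in ?M. (SUP n. F n \<omega>) \<noteq> \<infinity>"
      by (intro nn_integral_PInf_AE) (auto simp: less_top)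
    then show ?thesis
      using AE_good_sample[where b = b]
    proof eventually_elim
      case (elim \<omega>)
      interpret good_path b k \<omega> by unfold_locales fact
      interpret ring_clock \<omega> v by (rule clock[OF v])
      show ?case
      proof (rule ccontr)
        assume inf: "infinite {m. lowering b k \<omega> v m}"
        have "of_nat N \<le> (SUP n. F n \<omega>)" for N
        proof -
          obtain X where X: "X \<subseteq> {m. lowering b k \<omega> v m}" "finite X" "card X = N"
            using infinite_arbitrarily_large[OF inf] by blast
          obtain j where j: "\<forall>m\<in>X. m < j" using X(2) by (auto simp: finite_nat_set_iff_bounded)
          obtain T where T: "0 \<le> T" "j \<le> rings_until \<omega> v T" using rings_until_ge by blast
          have "X \<subseteq> {m. m < rings_until \<omega> v (real (nat \<lceil>T\<rceil>)) \<and> lowering b k \<omega> v m}"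
          proof
            fix m assume "m \<in> X"
            then have "m < j" using j by blast
            moreover have "T \<le> real (nat \<lceil>T\<rceil>)" by linarith
            ultimately show "m \<in> {m. m < rings_until \<omega> v (real (nat \<lceil>T\<rceil>)) \<and> lowering b k \<omega> v m}"
              using rings_until_mono[of T "real (nat \<lceil>T\<rceil>)"] T X \<open>m \<in> X\<close> by auto
          qed
          then have "N \<le> lowering_count b k \<omega> (real (nat \<lceil>T\<rceil>)) v"
            unfolding lowering_count_def X(3)[symmetric] by (intro card_mono) auto
          then have "of_nat N \<le> F (nat \<lceil>T\<rceil>) \<omega>" unfolding F_def by (rule of_nat_mono)
          also have "\<dots> \<le> (SUP n. F n \<omega>)" by (intro SUP_upper) simp
          finally show ?thesis .
        qed
        then have "(SUP N. of_nat N :: ennreal) \<le> (SUP n. F n \<omega>)" by (intro SUP_least) auto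
        then show False using elim(1) by (simp add: ennreal_SUP_of_nat_eq_top top_unique)
      qed
    qed
  qed
  then show ?thesis by (subst AE_ball_countable) auto
qed

section \<open>Resampling\<close>

lemma nn_integral_PiM_fun_upd:
  assumes M: "\<And>i. i \<in> I \<Longrightarrow> prob_space (M i)" and i: "i \<in> I" and f: "f \<in> borel_measurable (PiM I M)"
  shows "(\<integral>\<^sup>+x. f x \<partial>PiM I M) = (\<integral>\<^sup>+x. \<integral>\<^sup>+y. f (x(i := y)) \<partial>M i \<partial>PiM I M)"
proof -
  interpret P: prob_space "PiM I M" by (rule prob_space_PiM) (rule M)
  interpret Mi: prob_space "M i" by (rule M[OF i])
  interpret pair_sigma_finite "M i" "PiM I M" ..
  have ins: "insert i I = I" using i by auto
  have m: "(\<lambda>(y, x). x(i := y)) \<in> measurable (M i \<Otimes>\<^sub>M PiM I M) (PiM I M)"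
    unfolding case_prod_beta' by (rule measurable_fun_upd[where J = I]) (use i in auto)
  have "(\<integral>\<^sup>+x. f x \<partial>PiM I M) = (\<integral>\<^sup>+x. f x \<partial>distr (M i \<Otimes>\<^sub>M PiM I M) (PiM I M) (\<lambda>(y, x). x(i := y)))"
    using distr_pair_PiM_eq_PiM[of I M i] M i by (simp add: ins)
  also have "\<dots> = (\<integral>\<^sup>+z. f (case z of (y, x) \<Rightarrow> x(i := y)) \<partial>(M i \<Otimes>\<^sub>M PiM I M))"
    by (rule nn_integral_distr[OF m]) (simp add: f)
  also have "\<dots> = (\<integral>\<^sup>+x. \<integral>\<^sup>+y. f (x(i := y)) \<partial>M i \<partial>PiM I M)"
    using nn_integral_snd[of "\<lambda>z. f ((snd z)(i := fst z))"] measurable_compose[OF m f]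
    by (simp add: case_prod_beta')
  finally show ?thesis .
qed

definition resample :: "vertex \<Rightarrow> nat \<Rightarrow> sample \<Rightarrow> real \<times> int \<Rightarrow> sample" where
  "resample v i s r = s(v := (fst (s v), (snd (s v))(i := r)))"

lemma resample_same [simp]: "snd (resample v i s r v) i = r"
  by (simp add: resample_def)

lemma nn_integral_resample_site:
  assumes f: "f \<in> borel_measurable (site_measure p)"
  shows "(\<integral>\<^sup>+y. f y \<partial>site_measure p) = (\<integral>\<^sup>+y. \<integral>\<^sup>+r. f (fst y, (snd y)(i := r)) \<partial>ring_measure \<partial>site_measure p)"
proof -
  let ?W = "\<Pi>\<^sub>M n\<in>(UNIV :: nat set). ring_measure"
  interpret R: prob_space ring_measure by (rule prob_space_ring_measure)
  interpret W: prob_space ?W by (intro prob_space_PiM prob_space_ring_measure)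
  have f': "f \<in> borel_measurable (measure_pmf (spin_pmf p) \<Otimes>\<^sub>M ?W)" using f by (simp add: site_measure_def)
  have u: "(\<lambda>z. (fst (fst z), (snd (fst z))(i := snd z)))
      \<in> measurable ((measure_pmf (spin_pmf p) \<Otimes>\<^sub>M ?W) \<Otimes>\<^sub>M ring_measure) (measure_pmf (spin_pmf p) \<Otimes>\<^sub>M ?W)"
    by (intro measurable_Pair measurable_fun_upd[where J = UNIV]) auto
  have "(\<lambda>z. f (fst (fst z), (snd (fst z))(i := snd z)))
      \<in> borel_measurable ((measure_pmf (spin_pmf p) \<Otimes>\<^sub>M ?W) \<Otimes>\<^sub>M ring_measure)"
    by (rule measurable_compose[OF u f'])
  then have g: "(\<lambda>y. \<integral>\<^sup>+r. f (fst y, (snd y)(i := r)) \<partial>ring_measure) \<in> borel_measurable (measure_pmf (spin_pmf p) \<Otimes>\<^sub>M ?W)"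
    by (intro R.borel_measurable_nn_integral) (simp add: case_prod_beta')
  have "(\<integral>\<^sup>+y. f y \<partial>site_measure p) = (\<integral>\<^sup>+a. \<integral>\<^sup>+w. f (a, w) \<partial>?W \<partial>measure_pmf (spin_pmf p))"
    unfolding site_measure_def by (rule W.nn_integral_fst[symmetric]) (rule f')
  also have "\<dots> = (\<integral>\<^sup>+a. \<integral>\<^sup>+w. \<integral>\<^sup>+r. f (a, w(i := r)) \<partial>ring_measure \<partial>?W \<partial>measure_pmf (spin_pmf p))"
  proof (rule nn_integral_cong)
    fix a assume "a \<in> space (measure_pmf (spin_pmf p))"
    have "(\<lambda>w. f (a, w)) \<in> borel_measurable ?W"
      by (rule measurable_compose[OF _ f']) auto
    then show "(\<integral>\<^sup>+w. f (a, w) \<partial>?W) = (\<integral>\<^sup>+w. \<integral>\<^sup>+r. f (a, w(i := r)) \<partial>ring_measure \<partial>?W)"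
      by (intro nn_integral_PiM_fun_upd) (auto intro: prob_space_ring_measure)
  qed
  also have "\<dots> = (\<integral>\<^sup>+y. \<integral>\<^sup>+r. f (fst y, (snd y)(i := r)) \<partial>ring_measure \<partial>site_measure p)"
    unfolding site_measure_def
    using W.nn_integral_fst[OF g] by simp
  finally show ?thesis .
qed

lemma measurable_resample:
  assumes v: "v \<in> slab k"
  shows "(\<lambda>(s, r). resample v i s r) \<in> measurable (glauber_measure k p \<Otimes>\<^sub>M ring_measure) (glauber_measure k p)"
proof -
  let ?P = "glauber_measure k p \<Otimes>\<^sub>M ring_measure"
  have fst: "fst \<in> measurable ?P (\<Pi>\<^sub>M v\<in>slab k. site_measure p)"
    unfolding glauber_measure_eq by measurable
  have site: "(\<lambda>x. fst x v) \<in> measurable ?P (site_measure p)"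
    by (rule measurable_compose[OF fst]) (use v in measurable)
  have "(\<lambda>x. (fst x)(v := (fst (fst x v), (snd (fst x v))(i := snd x)))) \<in> measurable ?P (\<Pi>\<^sub>M v\<in>slab k. site_measure p)"
  proof (rule measurable_fun_upd[where J = "slab k"])
    show "slab k = slab k \<union> {v}" using v by auto
    have [measurable]: "(\<lambda>x. snd (fst x v)) \<in> measurable ?P (\<Pi>\<^sub>M n\<in>UNIV. ring_measure)"
      by (rule measurable_compose[OF site]) (simp add: site_measure_def)
    have [measurable]: "(\<lambda>x. fst (fst x v)) \<in> measurable ?P (measure_pmf (spin_pmf p))"
      by (rule measurable_compose[OF site]) (simp add: site_measure_def)
    have "(\<lambda>x. (snd (fst x v))(i := snd x)) \<in> measurable ?P (\<Pi>\<^sub>M n\<in>UNIV. ring_measure)"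
      by (rule measurable_fun_upd[where J = UNIV]) auto
    then show "(\<lambda>x. (fst (fst x v), (snd (fst x v))(i := snd x))) \<in> measurable ?P (site_measure p)"
      unfolding site_measure_def by measurable
  qed (fact fst)
  then show ?thesis
    unfolding glauber_measure_eq resample_def by (simp add: case_prod_beta')
qed

text \<open>The whole site is replaced by a fresh one, whose ring \<open>i\<close> is resampled by
  the one-site version; then the fresh site is integrated back into the sample.\<close>

lemma nn_integral_resample:
  assumes v: "v \<in> slab k" and f: "f \<in> borel_measurable (glauber_measure k p)"
  shows "(\<integral>\<^sup>+\<omega>. f \<omega> \<partial>glauber_measure k p)
           = (\<integral>\<^sup>+\<omega>. \<integral>\<^sup>+r. f (resample v i \<omega> r) \<partial>ring_measure \<partial>glauber_measure k p)"
proof -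
  let ?M = "glauber_measure k p"
  interpret R: prob_space ring_measure by (rule prob_space_ring_measure)
  define F where "F s = (\<integral>\<^sup>+r. f (resample v i s r) \<partial>ring_measure)" for s
  have "(\<lambda>z. f (resample v i (fst z) (snd z))) \<in> borel_measurable (?M \<Otimes>\<^sub>M ring_measure)"
    using measurable_compose[OF measurable_resample[OF v] f] by (simp add: case_prod_beta')
  then have F: "F \<in> borel_measurable ?M"
    unfolding F_def by (intro R.borel_measurable_nn_integral) (simp add: case_prod_beta')
  have upd: "(\<integral>\<^sup>+s. g s \<partial>?M) = (\<integral>\<^sup>+s. \<integral>\<^sup>+y. g (s(v := y)) \<partial>site_measure p \<partial>?M)"
    if "g \<in> borel_measurable ?M" for g
    using that v unfolding glauber_measure_eq by (intro nn_integral_PiM_fun_upd prob_space_site_measure)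
  have "(\<integral>\<^sup>+s. f s \<partial>?M) = (\<integral>\<^sup>+s. \<integral>\<^sup>+y. f (s(v := y)) \<partial>site_measure p \<partial>?M)" by (rule upd[OF f])
  also have "\<dots> = (\<integral>\<^sup>+s. \<integral>\<^sup>+y. F (s(v := y)) \<partial>site_measure p \<partial>?M)"
  proof (rule nn_integral_cong)
    fix s assume s: "s \<in> space ?M"
    have "(\<lambda>y. s(v := y)) \<in> measurable (site_measure p) (\<Pi>\<^sub>M v\<in>slab k. site_measure p)"
      by (rule measurable_fun_upd[where J = "slab k"]) (use v s in \<open>auto simp: glauber_measure_eq\<close>)
    then have "(\<lambda>y. f (s(v := y))) \<in> borel_measurable (site_measure p)"
      using f unfolding glauber_measure_eq by (rule measurable_compose)
    from nn_integral_resample_site[OF this, of i]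
    show "(\<integral>\<^sup>+y. f (s(v := y)) \<partial>site_measure p) = (\<integral>\<^sup>+y. F (s(v := y)) \<partial>site_measure p)"
      by (simp add: F_def resample_def)
  qed
  also have "\<dots> = (\<integral>\<^sup>+s. F s \<partial>?M)" by (rule upd[OF F, symmetric])
  finally show ?thesis by (simp add: F_def)
qed

lemma emeasure_exponential_greaterThan:
  assumes "0 \<le> a"
  shows "emeasure (density lborel (exponential_density 1)) {a<..} = ennreal (exp (- a))"
proof -
  interpret E: prob_space "density lborel (exponential_density 1)" by (rule prob_space_exponential)
  have "distributed (density lborel (exponential_density 1)) lborel (\<lambda>x. x) (exponential_density 1)"
    by (simp add: distributed_def distr_id2)
  from E.exponential_distributedD_gt[OF this assms]
  show ?thesis by (simp add: E.emeasure_eq_measure greaterThan_def)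
qed

lemma emeasure_ring_measure_Times:
  "A \<in> sets borel \<Longrightarrow> emeasure ring_measure (A \<times> C)
     = emeasure (density lborel (exponential_density 1)) A * emeasure (measure_pmf (spin_pmf (1/2))) C"
  unfolding ring_measure_def
  by (rule sigma_finite_measure.emeasure_pair_measure_Times)
     (auto intro: prob_space_imp_sigma_finite prob_space_measure_pmf)

lemma emeasure_ring_wait_gt:
  "0 \<le> a \<Longrightarrow> emeasure ring_measure {x. a < fst x} = ennreal (exp (- a))"
proof -
  assume a: "0 \<le> a"
  have "{x. a < fst x} = {a<..} \<times> (UNIV :: int set)" by auto
  then show ?thesis
    using emeasure_ring_measure_Times[of "{a<..}" UNIV] emeasure_exponential_greaterThan[OF a]
      measure_pmf.emeasure_space_1[of "spin_pmf (1/2)"] by simp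
qed

lemma emeasure_spin_pmf_half:
  assumes "c \<in> {-1, 1}"
  shows "emeasure (measure_pmf (spin_pmf (1/2))) {c} = ennreal (1 / 2)"
proof -
  have "pmf (spin_pmf (1/2)) c = 1 / 2"
  proof -
    have inj: "inj (\<lambda>b. if b then 1 else -1 :: int)" by (auto simp: inj_def split: if_splits)
    have "c = (if c = 1 then 1 else -1)" using assms by auto
    then have "pmf (spin_pmf (1/2)) c = pmf (bernoulli_pmf (1/2)) (c = 1)"
      unfolding spin_pmf_def using pmf_map_inj'[OF inj, of "bernoulli_pmf (1/2)" "c = 1"] by simp
    then show ?thesis by (cases "c = 1") simp_all
  qed
  then show ?thesis by (simp only: emeasure_pmf_single)
qed

text \<open>The factor \<open>exp (- a)\<close> is the probability that the wait exceeds
  \<open>a\<close>; the other factor is the conditional probability that it then ends within one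
  time unit with coin \<open>c\<close>, and it does not depend on \<open>a\<close>.\<close>

lemma emeasure_ring_wait_coin:
  assumes a: "0 \<le> a" and c: "c \<in> {-1, 1}"
  shows "emeasure ring_measure {x. a < fst x \<and> fst x \<le> a + 1 \<and> snd x = c}
           = ennreal ((1 - exp (- 1)) / 2) * ennreal (exp (- a))"
proof -
  let ?E = "density lborel (exponential_density 1)"
  have "{a<..a + 1} = {a<..} - {a + 1<..}" by auto
  moreover have "emeasure ?E ({a<..} - {a + 1<..}) = emeasure ?E {a<..} - emeasure ?E {a + 1<..}"
  proof (rule emeasure_Diff)
    show "emeasure ?E {a + 1<..} \<noteq> \<infinity>" using emeasure_exponential_greaterThan[of "a + 1"] a by simp
  qed auto
  ultimately have "emeasure ?E {a<..a + 1} = emeasure ?E {a<..} - emeasure ?E {a + 1<..}" by (simp only:)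
  also have "\<dots> = ennreal (exp (- a)) - ennreal (exp (- (a + 1)))"
    using a by (simp only: emeasure_exponential_greaterThan)
  also have "\<dots> = ennreal (exp (- a) - exp (- (a + 1)))" by (rule ennreal_minus) simp
  also have "exp (- a) - exp (- (a + 1)) = exp (- a) * (1 - exp (- 1 :: real))"
    by (simp add: right_diff_distrib exp_add[symmetric])
  finally have E: "emeasure ?E {a<..a + 1} = ennreal (exp (- a) * (1 - exp (- 1)))" .
  have "{x. a < fst x \<and> fst x \<le> a + 1 \<and> snd x = c} = {a<..a + 1} \<times> {c}" by auto
  then have "emeasure ring_measure {x. a < fst x \<and> fst x \<le> a + 1 \<and> snd x = c}
      = ennreal (exp (- a) * (1 - exp (- 1))) * ennreal (1 / 2)"
    using emeasure_ring_measure_Times[of "{a<..a + 1}" "{c}"] emeasure_spin_pmf_half[OF c] E by (simp only:) simp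
  also have "\<dots> = ennreal (exp (- a) * (1 - exp (- 1)) * (1 / 2))" by (rule ennreal_mult[symmetric]) auto
  also have "\<dots> = ennreal ((1 - exp (- 1)) / 2 * exp (- a))" by (rule arg_cong[where f = ennreal]) simp
  also have "\<dots> = ennreal ((1 - exp (- 1)) / 2) * ennreal (exp (- a))" by (rule ennreal_mult) auto
  finally show ?thesis .
qed

text \<open>Memorylessness: if \<^term>\<open>D\<close> constrains the \<^term>\<open>i\<close>-th waiting time of \<^term>\<open>v\<close> only from below,
  by \<^term>\<open>q\<close>, then given \<^term>\<open>D\<close> its excess over \<^term>\<open>q\<close> is a fresh exponential variable.\<close>

lemma emeasure_memoryless:
  assumes v: "v \<in> slab k" and D: "D \<in> sets (glauber_measure k p)"
    and q: "q \<in> borel_measurable (glauber_measure k p)" "\<And>\<omega>. 0 \<le> q \<omega>"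
    and q_upd: "\<And>\<omega> r. q (resample v i \<omega> r) = q \<omega>"
    and D_gt: "\<And>\<omega>. \<omega> \<in> D \<Longrightarrow> q \<omega> < fst (snd (\<omega> v) i)"
    and D_upd: "\<And>\<omega> r r'. \<omega> \<in> space (glauber_measure k p) \<Longrightarrow> q \<omega> < fst r \<Longrightarrow> q \<omega> < fst r' \<Longrightarrow>
      resample v i \<omega> r \<in> D \<Longrightarrow> resample v i \<omega> r' \<in> D"
    and C: "C \<in> sets (borel \<Otimes>\<^sub>M count_space UNIV)"
    and C_meas: "\<And>a. 0 \<le> a \<Longrightarrow> emeasure ring_measure {x. a < fst x \<and> (fst x - a, snd x) \<in> C} = ennreal (e * exp (- a))"
    and e: "0 \<le> e"
  shows "emeasure (glauber_measure k p) {\<omega> \<in> D. (fst (snd (\<omega> v) i) - q \<omega>, snd (snd (\<omega> v) i)) \<in> C}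
           = ennreal e * emeasure (glauber_measure k p) D"
proof -
  let ?M = "glauber_measure k p"
  \<comment> \<open>Membership in \<open>D'\<close> does not look at ring \<open>i\<close> of
    \<open>v\<close>: that ring is overwritten by an admissible one, with excess 1 and coin 1. By
    \<open>in_D\<close>, the event \<open>D\<close> is then the conjunction of \<open>D'\<close> and
    the lower bound on the wait.\<close>
  define D' where "D' = {\<omega> \<in> space ?M. resample v i \<omega> (q \<omega> + 1, 1) \<in> D}"
  have pair: "(\<lambda>\<omega>. (\<omega>, (q \<omega> + 1, 1 :: int))) \<in> measurable ?M (?M \<Otimes>\<^sub>M ring_measure)"
    using q(1) by measurable
  have D'[measurable]: "D' \<in> sets ?M"
    using measurable_sets[OF measurable_compose[OF pair measurable_resample[OF v, of i p]] D]
    by (simp add: D'_def vimage_def Int_def conj_commute)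
  have in_D: "resample v i \<omega> r \<in> D \<longleftrightarrow> \<omega> \<in> D' \<and> q \<omega> < fst r" if "\<omega> \<in> space ?M" for \<omega> r
  proof
    assume r: "resample v i \<omega> r \<in> D"
    then have "q \<omega> < fst r" using D_gt[OF r] by (simp only: q_upd resample_same)
    moreover have "resample v i \<omega> (q \<omega> + 1, 1) \<in> D" by (rule D_upd[OF that _ _ r]) (use calculation in simp_all)
    ultimately show "\<omega> \<in> D' \<and> q \<omega> < fst r" using that by (simp add: D'_def)
  next
    assume r: "\<omega> \<in> D' \<and> q \<omega> < fst r"
    then have "resample v i \<omega> (q \<omega> + 1, 1) \<in> D" by (simp add: D'_def)
    then show "resample v i \<omega> r \<in> D" by (rule D_upd[OF that, rotated 2]) (use r in simp_all)
  qed
  \<comment> \<open>Both sides of the claim are multiples of the same integral over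
    \<open>D'\<close>; the measure of \<open>D\<close> itself is the case where \<open>C'\<close> is
    the whole space and \<open>e' = 1\<close>.\<close>
  have gen: "emeasure ?M {\<omega> \<in> D. (fst (snd (\<omega> v) i) - q \<omega>, snd (snd (\<omega> v) i)) \<in> C'}
      = ennreal e' * (\<integral>\<^sup>+\<omega>. indicator D' \<omega> * ennreal (exp (- q \<omega>)) \<partial>?M)"
    if C': "C' \<in> sets (borel \<Otimes>\<^sub>M count_space UNIV)" and e': "0 \<le> e'"
      and m: "\<And>a. 0 \<le> a \<Longrightarrow> emeasure ring_measure {x. a < fst x \<and> (fst x - a, snd x) \<in> C'} = ennreal (e' * exp (- a))"
    for C' e'
  proof -
    define X where "X = {\<omega> \<in> D. (fst (snd (\<omega> v) i) - q \<omega>, snd (snd (\<omega> v) i)) \<in> C'}"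
    note [measurable] = q(1) measurable_wait[OF v, of i p] measurable_coin[OF v, of i p, unfolded coin_def] D C'
    have X_eq: "X = D \<inter> {\<omega> \<in> space ?M. (fst (snd (\<omega> v) i) - q \<omega>, snd (snd (\<omega> v) i)) \<in> C'}"
      using sets.sets_into_space[OF D] by (auto simp: X_def)
    have X[measurable]: "X \<in> sets ?M" unfolding X_eq by measurable
    have "emeasure ?M X = (\<integral>\<^sup>+\<omega>. \<integral>\<^sup>+r. indicator X (resample v i \<omega> r) \<partial>ring_measure \<partial>?M)"
      using X by (subst nn_integral_indicator[symmetric, OF X], subst nn_integral_resample[OF v, of _ _ i]) auto
    also have "\<dots> = (\<integral>\<^sup>+\<omega>. indicator D' \<omega> * ennreal (e' * exp (- q \<omega>)) \<partial>?M)"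
    proof (rule nn_integral_cong)
      fix \<omega> assume \<omega>: "\<omega> \<in> space ?M"
      have "resample v i \<omega> r \<in> X \<longleftrightarrow> \<omega> \<in> D' \<and> r \<in> {x. q \<omega> < fst x \<and> (fst x - q \<omega>, snd x) \<in> C'}" for r
        using in_D[OF \<omega>, of r] unfolding X_def mem_Collect_eq resample_same q_upd by blast
      then have "(\<integral>\<^sup>+r. indicator X (resample v i \<omega> r) \<partial>ring_measure)
          = (\<integral>\<^sup>+r. indicator D' \<omega> * indicator {x. q \<omega> < fst x \<and> (fst x - q \<omega>, snd x) \<in> C'} r \<partial>ring_measure)"
        by (intro nn_integral_cong) (auto split: split_indicator)
      also have "\<dots> = indicator D' \<omega> * emeasure ring_measure {x. q \<omega> < fst x \<and> (fst x - q \<omega>, snd x) \<in> C'}"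
      proof (rule nn_integral_cmult_indicator)
        have "{x \<in> space ring_measure. q \<omega> < fst x \<and> (fst x - q \<omega>, snd x) \<in> C'} \<in> sets ring_measure" by measurable
        then show "{x. q \<omega> < fst x \<and> (fst x - q \<omega>, snd x) \<in> C'} \<in> sets ring_measure" by simp
      qed
      also have "\<dots> = indicator D' \<omega> * ennreal (e' * exp (- q \<omega>))" using m[OF q(2)] by simp
      finally show "(\<integral>\<^sup>+r. indicator X (resample v i \<omega> r) \<partial>ring_measure) = indicator D' \<omega> * ennreal (e' * exp (- q \<omega>))" .
    qed
    also have "\<dots> = ennreal e' * (\<integral>\<^sup>+\<omega>. indicator D' \<omega> * ennreal (exp (- q \<omega>)) \<partial>?M)"
      using e' by (subst nn_integral_cmult[symmetric]) (auto simp: ennreal_mult mult_ac)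
    finally show ?thesis unfolding X_def .
  qed
  have "emeasure ?M D = emeasure ?M {\<omega> \<in> D. (fst (snd (\<omega> v) i) - q \<omega>, snd (snd (\<omega> v) i)) \<in> UNIV}" by simp
  also have "\<dots> = ennreal 1 * (\<integral>\<^sup>+\<omega>. indicator D' \<omega> * ennreal (exp (- q \<omega>)) \<partial>?M)"
  proof (rule gen)
    show "UNIV \<in> sets (borel \<Otimes>\<^sub>M count_space UNIV :: (real \<times> int) measure)"
      using sets.top[of "borel \<Otimes>\<^sub>M count_space UNIV :: (real \<times> int) measure"] by (simp add: space_pair_measure)
  qed (auto simp: emeasure_ring_wait_gt)
  finally show ?thesis using gen[OF C e C_meas] by simp
qed

section \<open>Recurring patterns\<close>

definition prev_ring :: "sample \<Rightarrow> vertex \<Rightarrow> nat \<Rightarrow> real" where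
  "prev_ring \<omega> u n = (if n = 0 then 0 else ring_time \<omega> u (n - 1))"

definition last_ring :: "sample \<Rightarrow> vertex set \<Rightarrow> (vertex \<Rightarrow> nat) \<Rightarrow> real" where
  "last_ring \<omega> B c = Max ((\<lambda>u. prev_ring \<omega> u (c u)) ` B)"

text \<open>If the window is ever in state \<open>c\<close>, it enters it at
  \<open>last_ring \<omega> B c\<close>. The condition says that at this time no vertex of
  \<open>B\<close> has yet made its next ring, so the state is indeed visited.\<close>

definition current :: "sample \<Rightarrow> vertex set \<Rightarrow> (vertex \<Rightarrow> nat) \<Rightarrow> bool" where
  "current \<omega> B c \<longleftrightarrow> (\<forall>w\<in>B. last_ring \<omega> B c < ring_time \<omega> w (c w))"

definition positive_waits :: "nat \<Rightarrow> sample \<Rightarrow> bool" where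
  "positive_waits k \<omega> \<longleftrightarrow> (\<forall>v\<in>slab k. \<forall>n. 0 < fst (snd (\<omega> v) n))"

text \<open>Off the window the sites agree entirely, future rings included: the outside is held
  fixed, and only the rings of \<open>B\<close> not counted by \<open>c\<close> are free.\<close>

definition same_past :: "nat \<Rightarrow> vertex set \<Rightarrow> (vertex \<Rightarrow> nat) \<Rightarrow> sample \<Rightarrow> sample \<Rightarrow> bool" where
  "same_past k B c \<omega> \<omega>' \<longleftrightarrow> (\<forall>u\<in>slab k. if u \<in> B
     then fst (\<omega> u) = fst (\<omega>' u) \<and> (\<forall>i<c u. snd (\<omega> u) i = snd (\<omega>' u) i) else \<omega> u = \<omega>' u)"

lemma ring_time_prev: "ring_time \<omega> u n = prev_ring \<omega> u n + fst (snd (\<omega> u) n)"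
  by (cases n) (simp_all add: prev_ring_def ring_time_def)

lemma positive_waits_strict_mono: "positive_waits k \<omega> \<Longrightarrow> v \<in> slab k \<Longrightarrow> strict_mono (ring_time \<omega> v)"
  by (auto simp: strict_mono_Suc_iff ring_time_Suc positive_waits_def)

lemma positive_waits_ring_pos:
  assumes "positive_waits k \<omega>" "v \<in> slab k"
  shows "0 < ring_time \<omega> v n"
  unfolding ring_time_def by (rule sum_pos) (use assms in \<open>auto simp: positive_waits_def\<close>)

lemma prev_ring_nonneg: "positive_waits k \<omega> \<Longrightarrow> v \<in> slab k \<Longrightarrow> 0 \<le> prev_ring \<omega> v n"
  using positive_waits_ring_pos[of k \<omega> v "n - 1"] by (simp add: prev_ring_def)

lemma prev_ring_mono:
  assumes "positive_waits k \<omega>" "v \<in> slab k" "m \<le> n"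
  shows "prev_ring \<omega> v m \<le> prev_ring \<omega> v n"
proof (cases "m = 0")
  case True
  then show ?thesis using prev_ring_nonneg[OF assms(1,2)] by (simp add: prev_ring_def)
next
  case False
  then have "ring_time \<omega> v (m - 1) \<le> ring_time \<omega> v (n - 1)"
    using positive_waits_strict_mono[OF assms(1,2)] assms(3) by (simp add: strict_mono_less_eq)
  then show ?thesis using False assms(3) by (simp add: prev_ring_def)
qed

lemma ring_le_prev_ring:
  assumes "positive_waits k \<omega>" "v \<in> slab k" "m < n"
  shows "ring_time \<omega> v m \<le> prev_ring \<omega> v n"
  using prev_ring_mono[OF assms(1,2), of "Suc m" n] assms(3) by (simp add: prev_ring_def)

lemma same_past_ring_time:
  assumes "same_past k B c \<omega> \<omega>'" "u \<in> slab k" "u \<in> B \<longrightarrow> i < c u"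
  shows "ring_time \<omega> u i = ring_time \<omega>' u i" "coin \<omega> u i = coin \<omega>' u i"
proof -
  have "snd (\<omega> u) j = snd (\<omega>' u) j" if "j \<le> i" for j
    using assms that unfolding same_past_def by (cases "u \<in> B") auto
  then show "ring_time \<omega> u i = ring_time \<omega>' u i" "coin \<omega> u i = coin \<omega>' u i"
    by (simp_all add: ring_time_def coin_def)
qed

lemma same_past_prev_ring:
  "same_past k B c \<omega> \<omega>' \<Longrightarrow> u \<in> slab k \<Longrightarrow> u \<in> B \<longrightarrow> i \<le> c u \<Longrightarrow> prev_ring \<omega> u i = prev_ring \<omega>' u i"
  using same_past_ring_time(1)[of k B c \<omega> \<omega>' u "i - 1"] by (cases i) (auto simp: prev_ring_def)

lemma same_past_initial_spin: "same_past k B c \<omega> \<omega>' \<Longrightarrow> u \<in> slab k \<Longrightarrow> initial_spin \<omega> u = initial_spin \<omega>' u"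
  by (auto simp: same_past_def initial_spin_def split: if_splits)

section \<open>States of a finite window and the events determined by its past\<close>

locale finite_window =
  fixes k :: nat and B :: "vertex set"
  assumes B: "finite B" "B \<noteq> {}" "B \<subseteq> slab k"
begin

lemma prev_ring_le_last: "u \<in> B \<Longrightarrow> prev_ring \<omega> u (c u) \<le> last_ring \<omega> B c"
  unfolding last_ring_def using B by (intro Max_ge) auto

lemma last_ring_le: "(\<And>u. u \<in> B \<Longrightarrow> prev_ring \<omega> u (c u) \<le> t) \<Longrightarrow> last_ring \<omega> B c \<le> t"
  unfolding last_ring_def using B by (subst Max_le_iff) auto

lemma last_ring_nonneg: "positive_waits k \<omega> \<Longrightarrow> 0 \<le> last_ring \<omega> B c"
  using B prev_ring_nonneg prev_ring_le_last by (metis all_not_in_conv order.trans subsetD)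

lemma last_ring_mono:
  "positive_waits k \<omega> \<Longrightarrow> (\<And>u. u \<in> B \<Longrightarrow> c' u \<le> c u) \<Longrightarrow> last_ring \<omega> B c' \<le> last_ring \<omega> B c"
  using B by (intro last_ring_le order.trans[OF prev_ring_mono prev_ring_le_last]) auto

lemma same_past_last_ring:
  assumes "same_past k B c \<omega> \<omega>'" "\<And>u. u \<in> B \<Longrightarrow> c' u \<le> c u"
  shows "last_ring \<omega> B c' = last_ring \<omega>' B c'"
proof -
  have "(\<lambda>u. prev_ring \<omega> u (c' u)) ` B = (\<lambda>u. prev_ring \<omega>' u (c' u)) ` B"
    using assms B by (intro image_cong same_past_prev_ring) auto
  then show ?thesis by (simp add: last_ring_def)
qed

lemma currentD: "current \<omega> B c \<Longrightarrow> u \<in> B \<Longrightarrow> last_ring \<omega> B c < ring_time \<omega> u (c u)"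
  by (simp add: current_def)

lemma same_past_rings_before:
  assumes past: "same_past k B c \<omega> \<omega>'" and pos: "positive_waits k \<omega>" "positive_waits k \<omega>'"
    and cur: "current \<omega> B c" "current \<omega>' B c" and w: "w \<in> slab k" and t: "t \<le> last_ring \<omega> B c"
  shows "rings_before \<omega> w t = rings_before \<omega>' w t" "w \<in> B \<longrightarrow> rings_before \<omega> w t \<le> c w"
    "prev_ring \<omega> w (rings_before \<omega> w t) \<le> max 0 t"
proof -
  have t': "t \<le> last_ring \<omega>' B c" using t same_past_last_ring[OF past] by simp
  have sub: "{i. ring_time \<sigma> w i < t} \<subseteq> {..<c w}"
    if "w \<in> B" "positive_waits k \<sigma>" "current \<sigma> B c" "t \<le> last_ring \<sigma> B c" for \<sigma>
  proof
    fix i assume "i \<in> {i. ring_time \<sigma> w i < t}"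
    then have "ring_time \<sigma> w i < ring_time \<sigma> w (c w)" using currentD[OF that(3,1)] that(4) by simp
    then show "i \<in> {..<c w}" using positive_waits_strict_mono[OF that(2) w] by (simp add: strict_mono_less)
  qed
  show "rings_before \<omega> w t = rings_before \<omega>' w t"
  proof (cases "w \<in> B")
    case True
    have "{i. ring_time \<omega> w i < t} = {i. ring_time \<omega>' w i < t}"
      using sub[OF True pos(1) cur(1) t] sub[OF True pos(2) cur(2) t'] same_past_ring_time(1)[OF past w] by fastforce
    then show ?thesis by (simp add: rings_before_def)
  next
    case False
    then show ?thesis using same_past_ring_time(1)[OF past w] by (simp add: rings_before_def)
  qed
  show "w \<in> B \<longrightarrow> rings_before \<omega> w t \<le> c w"
    using card_mono[OF _ sub[OF _ pos(1) cur(1) t]] by (auto simp: rings_before_def)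
  show "prev_ring \<omega> w (rings_before \<omega> w t) \<le> max 0 t"
  proof (cases "rings_before \<omega> w t")
    case (Suc j)
    have "ring_time \<omega> w j < t"
    proof (rule ccontr)
      assume j: "\<not> ring_time \<omega> w j < t"
      have "{i. ring_time \<omega> w i < t} \<subseteq> {..<j}"
      proof
        fix i assume "i \<in> {i. ring_time \<omega> w i < t}"
        then have "ring_time \<omega> w i < ring_time \<omega> w j" using j by simp
        then show "i \<in> {..<j}" using positive_waits_strict_mono[OF pos(1) w] by (simp add: strict_mono_less)
      qed
      then have "card {i. ring_time \<omega> w i < t} \<le> card {..<j}" by (rule card_mono[rotated]) simp
      then show False using Suc by (simp add: rings_before_def)
    qed
    then show ?thesis using Suc by (simp add: prev_ring_def)
  qed (simp add: prev_ring_def)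
qed

text \<open>All rings read by the recursion occur no later than the entry into \<open>c\<close>. In
  \<open>B\<close> these are rings counted by \<open>c\<close>, because \<open>c\<close> is current
  in both samples; off \<open>B\<close> the samples agree anyway. The time bound for
  \<open>u\<close> off \<open>B\<close> is what passes through the induction.\<close>

lemma same_past_approx_spin:
  assumes past: "same_past k B c \<omega> \<omega>'" and pos: "positive_waits k \<omega>" "positive_waits k \<omega>'"
    and cur: "current \<omega> B c" "current \<omega>' B c"
  shows "u \<in> slab k \<Longrightarrow> u \<in> B \<longrightarrow> i \<le> c u \<Longrightarrow> u \<notin> B \<longrightarrow> prev_ring \<omega> u i \<le> last_ring \<omega> B c \<Longrightarrow>
    approx_spin b k n \<omega> u i = approx_spin b k n \<omega>' u i"
proof (induction n arbitrary: u i)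
  case 0
  then show ?case using same_past_initial_spin[OF past] by simp
next
  case (Suc n)
  show ?case
  proof (cases i)
    case 0
    then show ?thesis using same_past_initial_spin[OF past] Suc.prems by simp
  next
    case (Suc j)
    define s where "s = ring_time \<omega> u j"
    have j: "u \<in> B \<longrightarrow> j < c u" using Suc.prems Suc by auto
    have s': "ring_time \<omega>' u j = s" "coin \<omega>' u j = coin \<omega> u j"
      using same_past_ring_time[OF past Suc.prems(1) j] by (simp_all add: s_def)
    have s: "s \<le> last_ring \<omega> B c"
    proof (cases "u \<in> B")
      case True
      then have "s \<le> prev_ring \<omega> u (c u)" unfolding s_def
        using j by (intro ring_le_prev_ring[OF pos(1) Suc.prems(1)]) simp
      also have "\<dots> \<le> last_ring \<omega> B c" by (rule prev_ring_le_last[OF True])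
      finally show ?thesis .
    next
      case False
      then show ?thesis using Suc.prems Suc by (simp add: s_def prev_ring_def)
    qed
    have IH: "approx_spin b k n \<omega> w (rings_before \<omega> w s) = approx_spin b k n \<omega>' w (rings_before \<omega>' w s)"
      if "w \<in> slab k" for w
    proof -
      note r = same_past_rings_before[OF past pos cur that s]
      have "prev_ring \<omega> w (rings_before \<omega> w s) \<le> last_ring \<omega> B c"
        using r(3) s last_ring_nonneg[OF pos(1), of c] by linarith
      then show ?thesis using Suc.IH[OF that r(2)] r(1) by simp
    qed
    have "energy b k (\<lambda>w. approx_spin b k n \<omega> w (rings_before \<omega> w s)) u
        = energy b k (\<lambda>w. approx_spin b k n \<omega>' w (rings_before \<omega>' w s)) u"
      by (intro energy_cong IH) (use Suc.prems neighbours_subset_slab[of b k u] in blast)+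
    then show ?thesis using IH[OF Suc.prems(1)] s' by (simp add: Suc Let_def flip: s_def)
  qed
qed

lemma same_past_ring_spin:
  assumes "same_past k B c \<omega> \<omega>'" "positive_waits k \<omega>" "positive_waits k \<omega>'"
    "current \<omega> B c" "current \<omega>' B c" "u \<in> B" "i \<le> c u"
  shows "ring_spin b k \<omega> u i = ring_spin b k \<omega>' u i"
proof -
  have "u \<in> slab k" using assms(6) B by blast
  then have "approx_spin b k n \<omega> u i = approx_spin b k n \<omega>' u i" for n
    using assms(6,7) by (intro same_past_approx_spin[OF assms(1-5)]) auto
  then show ?thesis by (simp add: ring_spin_def)
qed

text \<open>The part of the running wait of \<open>u\<close> that has elapsed when the window enters
  \<open>c\<close>. By \<open>current_slack\<close>, the state is visited exactly if every running
  wait exceeds its slack.\<close>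

definition slack :: "sample \<Rightarrow> (vertex \<Rightarrow> nat) \<Rightarrow> vertex \<Rightarrow> real" where
  "slack \<omega> c u = last_ring \<omega> B c - prev_ring \<omega> u (c u)"

lemma current_slack: "current \<omega> B c \<longleftrightarrow> (\<forall>u\<in>B. slack \<omega> c u < fst (snd (\<omega> u) (c u)))"
  by (simp add: current_def slack_def ring_time_prev[of \<omega> _ "c _"] algebra_simps)

lemma measurable_prev_ring: "v \<in> slab k \<Longrightarrow> (\<lambda>\<omega>. prev_ring \<omega> v n) \<in> borel_measurable (glauber_measure k p)"
  unfolding prev_ring_def by (auto intro: measurable_ring_time)

lemma measurable_last_ring [measurable]: "(\<lambda>\<omega>. last_ring \<omega> B c) \<in> borel_measurable (glauber_measure k p)"
  unfolding last_ring_def using B by (intro borel_measurable_Max measurable_prev_ring) auto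

lemma measurable_slack: "u \<in> B \<Longrightarrow> (\<lambda>\<omega>. slack \<omega> c u) \<in> borel_measurable (glauber_measure k p)"
  unfolding slack_def using B(3) by (intro borel_measurable_diff measurable_last_ring measurable_prev_ring) blast

lemma slack_nonneg: "u \<in> B \<Longrightarrow> 0 \<le> slack \<omega> c u"
  using prev_ring_le_last by (simp add: slack_def)

lemma prev_ring_resample: "prev_ring (resample u (c u) \<omega> r) w (c w) = prev_ring \<omega> w (c w)"
  by (auto simp: prev_ring_def ring_time_def resample_def intro!: sum.cong)

lemma slack_resample: "slack (resample u (c u) \<omega> r) c w = slack \<omega> c w"
  by (simp add: slack_def last_ring_def prev_ring_resample)

text \<open>An event is past-determined at \<^term>\<open>c\<close> if, among the samples in which the state \<^term>\<open>c\<close> is reached,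
  it only depends on the rings of \<^term>\<open>B\<close> counted by \<^term>\<open>c\<close>, and on the sample outside \<^term>\<open>B\<close>.\<close>

definition past_event :: "real \<Rightarrow> (vertex \<Rightarrow> nat) \<Rightarrow> sample set \<Rightarrow> bool" where
  "past_event p c D \<longleftrightarrow> D \<in> sets (glauber_measure k p) \<and> (\<forall>\<omega>\<in>D. positive_waits k \<omega> \<and> current \<omega> B c) \<and>
     (\<forall>\<omega>\<in>D. \<forall>\<omega>'\<in>space (glauber_measure k p).
        same_past k B c \<omega> \<omega>' \<and> positive_waits k \<omega>' \<and> current \<omega>' B c \<longrightarrow> \<omega>' \<in> D)"

lemma space_resample: "u \<in> slab k \<Longrightarrow> \<omega> \<in> space (glauber_measure k p) \<Longrightarrow> resample u i \<omega> r \<in> space (glauber_measure k p)"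
  by (auto simp: space_glauber_measure resample_def extensional_def)

text \<open>The running ring of \<open>u\<close> does not belong to the past, so all that a past
  event can ask of it is a wait above the slack. This is the form required by
  \<open>emeasure_memoryless\<close>.\<close>

lemma past_event_resample:
  assumes D: "past_event p c D" and u: "u \<in> B" and \<omega>: "\<omega> \<in> space (glauber_measure k p)"
    and r: "slack \<omega> c u < fst r'" "resample u (c u) \<omega> r \<in> D"
  shows "resample u (c u) \<omega> r' \<in> D"
proof -
  let ?\<omega> = "resample u (c u) \<omega> r" and ?\<omega>' = "resample u (c u) \<omega> r'"
  have us: "u \<in> slab k" using u B by auto
  have past: "same_past k B c ?\<omega> ?\<omega>'" using u by (auto simp: same_past_def resample_def)
  have pos: "positive_waits k ?\<omega>" and cur: "current ?\<omega> B c" using D r(2) by (auto simp: past_event_def)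
  have "0 < fst r'" using slack_nonneg[OF u, of \<omega> c] r(1) by linarith
  have pos': "positive_waits k ?\<omega>'"
    unfolding positive_waits_def
  proof (intro ballI allI)
    fix w n assume w: "w \<in> slab k"
    show "0 < fst (snd (?\<omega>' w) n)"
    proof (cases "w = u \<and> n = c u")
      case True
      then show ?thesis using \<open>0 < fst r'\<close> by (simp only: resample_same)
    next
      case False
      then have "snd (?\<omega>' w) n = snd (?\<omega> w) n" by (cases "w = u") (simp_all add: resample_def)
      then show ?thesis using pos w by (simp add: positive_waits_def)
    qed
  qed
  have cur': "current ?\<omega>' B c"
    unfolding current_slack
  proof
    fix w assume w: "w \<in> B"
    show "slack ?\<omega>' c w < fst (snd (?\<omega>' w) (c w))"
    proof (cases "w = u")
      case True then show ?thesis using r(1) by (simp only: slack_resample resample_same)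
    next
      case False
      then have "?\<omega>' w = ?\<omega> w" by (simp add: resample_def)
      moreover have "slack ?\<omega> c w < fst (snd (?\<omega> w) (c w))" using cur w unfolding current_slack by blast
      ultimately show ?thesis by (simp only: slack_resample)
    qed
  qed
  show ?thesis using D r(2) past pos' cur' space_resample[OF us \<omega>] unfolding past_event_def by blast
qed

text \<open>Bounds from below the chance that a given vertex rings next, with a given coin: its
  excess wait is at most 1 and its coin is right, while all other excess waits exceed 1. The
  exponent counts the vertex itself too, so that the bound does not depend on it.\<close>

definition eps :: real where "eps = (1 - exp (- 1)) / 2 * exp (- real (card B))"

lemma eps: "0 < eps" "eps < 1"
proof -
  define a :: real where "a = (1 - exp (- 1)) / 2"
  have "exp (- 1 :: real) < 1" "0 < exp (- 1 :: real)" by simp_all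
  then have "0 < a" "2 * a = 1 - exp (- 1)" by (simp_all add: a_def)
  then have a: "0 < a" "a < 1" using \<open>0 < exp (- 1 :: real)\<close> by (simp_all, linarith)
  show "0 < eps" unfolding eps_def a_def[symmetric] using a by simp
  have "eps \<le> a" unfolding eps_def a_def[symmetric] using a by (intro mult_right_le_one_le) auto
  then show "eps < 1" using a by simp
qed

definition rings_next :: "sample \<Rightarrow> (vertex \<Rightarrow> nat) \<Rightarrow> vertex \<Rightarrow> bool" where
  "rings_next \<omega> c v \<longleftrightarrow> (\<forall>u\<in>B - {v}. ring_time \<omega> v (c v) < ring_time \<omega> u (c u))"

text \<open>Given the past, the excess waits in the window behave like independent exponential
  variables. They are treated one vertex at a time: \<open>DU U\<close> is the part of
  \<open>D\<close> where the excess at every vertex of \<open>U\<close> is above 1, each new vertex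
  contributes a factor \<open>exp (- 1)\<close>, and \<open>v\<close> comes last.\<close>

lemma emeasure_rings_next:
  assumes D: "past_event p c D" and v: "v \<in> B" and x: "x \<in> {-1, 1}"
  shows "ennreal eps * emeasure (glauber_measure k p) D
           \<le> emeasure (glauber_measure k p) {\<omega> \<in> D. rings_next \<omega> c v \<and> coin \<omega> v (c v) = x}"
proof -
  let ?M = "glauber_measure k p"
  let ?w = "\<lambda>\<omega> u. fst (snd (\<omega> u) (c u))"
  define DU where "DU U = {\<omega> \<in> D. \<forall>u\<in>U. slack \<omega> c u + 1 < ?w \<omega> u}" for U
  have Ds: "D \<in> sets ?M" using D by (simp add: past_event_def)
  have DU_sets: "DU U \<in> sets ?M" if "U \<subseteq> B" for U
  proof -
    have "finite U" using that B finite_subset by auto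
    have "DU U = D \<inter> {\<omega> \<in> space ?M. \<forall>u\<in>U. slack \<omega> c u + 1 < ?w \<omega> u}"
      using sets.sets_into_space[OF Ds] by (auto simp: DU_def)
    moreover have "{\<omega> \<in> space ?M. \<forall>u\<in>U. slack \<omega> c u + 1 < ?w \<omega> u} \<in> sets ?M"
      unfolding Measurable.pred_def[symmetric]
    proof (intro pred_intros_finite \<open>finite U\<close>)
      fix u assume "u \<in> U"
      then have u: "u \<in> B" "u \<in> slab k" using that B by auto
      note [measurable] = measurable_slack[OF u(1)] measurable_wait[OF u(2)]
      show "Measurable.pred ?M (\<lambda>\<omega>. slack \<omega> c u + 1 < ?w \<omega> u)" by measurable
    qed
    ultimately show ?thesis using Ds by auto
  qed
  have memoryless: "emeasure ?M {\<omega> \<in> DU U. (?w \<omega> u - slack \<omega> c u, snd (snd (\<omega> u) (c u))) \<in> C}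
      = ennreal e * emeasure ?M (DU U)"
    if U: "U \<subseteq> B" "u \<in> B" "u \<notin> U" and "C \<in> sets (borel \<Otimes>\<^sub>M count_space UNIV)"
      and "\<And>a. 0 \<le> a \<Longrightarrow> emeasure ring_measure {x. a < fst x \<and> (fst x - a, snd x) \<in> C} = ennreal (e * exp (- a))"
      and "0 \<le> e" for U u C e
  proof (rule emeasure_memoryless[OF _ DU_sets[OF U(1)] measurable_slack[OF U(2)] slack_nonneg[OF U(2)] slack_resample])
    show "u \<in> slab k" using U B by auto
    show "slack \<omega> c u < ?w \<omega> u" if "\<omega> \<in> DU U" for \<omega>
      using that D U(2) unfolding DU_def past_event_def current_slack by blast
    show "resample u (c u) \<omega> r' \<in> DU U"
      if "\<omega> \<in> space ?M" "slack \<omega> c u < fst r" "slack \<omega> c u < fst r'" "resample u (c u) \<omega> r \<in> DU U" for \<omega> r r'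
    proof -
      have "resample u (c u) \<omega> r' \<in> D"
        using past_event_resample[OF D U(2) that(1,3)] that(4) unfolding DU_def by blast
      moreover have "slack (resample u (c u) \<omega> r') c w + 1 < ?w (resample u (c u) \<omega> r') w" if "w \<in> U" for w
      proof -
        have "resample u (c u) \<omega> r' w = resample u (c u) \<omega> r w" using U(3) that by (auto simp: resample_def)
        moreover have "slack (resample u (c u) \<omega> r) c w + 1 < ?w (resample u (c u) \<omega> r) w"
          using \<open>resample u (c u) \<omega> r \<in> DU U\<close> that by (simp add: DU_def)
        ultimately show ?thesis by (simp only: slack_resample)
      qed
      ultimately show ?thesis by (simp add: DU_def)
    qed
  qed (use that in auto)
  have DU_emeasure: "emeasure ?M (DU U) = ennreal (exp (- real (card U))) * emeasure ?M D" if "U \<subseteq> B" for U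
    using finite_subset[OF that B(1)] that
  proof (induction U rule: finite_induct)
    case empty
    then show ?case by (simp add: DU_def)
  next
    case (insert u U)
    have C: "{1<..} \<times> UNIV \<in> sets (borel \<Otimes>\<^sub>M count_space UNIV :: (real \<times> int) measure)" by auto
    have "DU (insert u U) = {\<omega> \<in> DU U. (?w \<omega> u - slack \<omega> c u, snd (snd (\<omega> u) (c u))) \<in> {1<..} \<times> UNIV}"
      by (auto simp: DU_def)
    also have "emeasure ?M \<dots> = ennreal (exp (- 1)) * emeasure ?M (DU U)"
    proof (rule memoryless[OF _ _ insert(2) C])
      fix a :: real assume a: "0 \<le> a"
      have "{x :: real \<times> int. a < fst x \<and> (fst x - a, snd x) \<in> {1<..} \<times> UNIV} = {x. a + 1 < fst x}" by auto
      then show "emeasure ring_measure {x. a < fst x \<and> (fst x - a, snd x) \<in> {1<..} \<times> UNIV} = ennreal (exp (- 1) * exp (- a))"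
        using emeasure_ring_wait_gt[of "a + 1"] a by (simp add: exp_add[symmetric])
    qed (use insert in auto)
    also have "\<dots> = ennreal (exp (- real (card (insert u U)))) * emeasure ?M D"
      using insert by (simp add: mult.assoc[symmetric] ennreal_mult[symmetric] exp_add[symmetric])
    finally show ?case .
  qed
  have C: "{..1} \<times> {x} \<in> sets (borel \<Otimes>\<^sub>M count_space UNIV :: (real \<times> int) measure)" by auto
  have vs: "v \<in> slab k" using v B by auto
  have "ennreal eps * emeasure ?M D \<le> ennreal ((1 - exp (- 1)) / 2) * (ennreal (exp (- real (card (B - {v})))) * emeasure ?M D)"
  proof -
    have "card (B - {v}) \<le> card B" using B by (intro card_mono) auto
    then have "eps \<le> (1 - exp (- 1)) / 2 * exp (- real (card (B - {v})))"
      unfolding eps_def by (intro mult_left_mono) auto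
    then have "ennreal eps \<le> ennreal ((1 - exp (- 1)) / 2) * ennreal (exp (- real (card (B - {v}))))"
      by (subst ennreal_mult[symmetric]) (auto intro: ennreal_leI)
    then show ?thesis unfolding mult.assoc[symmetric] by (rule mult_right_mono) simp
  qed
  also have "\<dots> = ennreal ((1 - exp (- 1)) / 2) * emeasure ?M (DU (B - {v}))"
    by (subst DU_emeasure) auto
  also have "\<dots> = emeasure ?M {\<omega> \<in> DU (B - {v}). (?w \<omega> v - slack \<omega> c v, snd (snd (\<omega> v) (c v))) \<in> {..1} \<times> {x}}"
  proof (rule memoryless[OF _ v _ C, symmetric])
    fix a :: real assume a: "0 \<le> a"
    have "{y :: real \<times> int. a < fst y \<and> (fst y - a, snd y) \<in> {..1} \<times> {x}} = {y. a < fst y \<and> fst y \<le> a + 1 \<and> snd y = x}"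
      by auto
    moreover have "ennreal ((1 - exp (- 1)) / 2 * exp (- a)) = ennreal ((1 - exp (- 1)) / 2) * ennreal (exp (- a))"
      by (rule ennreal_mult) auto
    ultimately show "emeasure ring_measure {y. a < fst y \<and> (fst y - a, snd y) \<in> {..1} \<times> {x}} = ennreal ((1 - exp (- 1)) / 2 * exp (- a))"
      using emeasure_ring_wait_coin[OF a x] by (simp only:)
  qed auto
  also have "\<dots> \<le> emeasure ?M {\<omega> \<in> D. rings_next \<omega> c v \<and> coin \<omega> v (c v) = x}"
  proof (rule emeasure_mono)
    show "{\<omega> \<in> DU (B - {v}). (?w \<omega> v - slack \<omega> c v, snd (snd (\<omega> v) (c v))) \<in> {..1} \<times> {x}}
        \<subseteq> {\<omega> \<in> D. rings_next \<omega> c v \<and> coin \<omega> v (c v) = x}"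
    proof
      fix \<omega> assume \<omega>: "\<omega> \<in> {\<omega> \<in> DU (B - {v}). (?w \<omega> v - slack \<omega> c v, snd (snd (\<omega> v) (c v))) \<in> {..1} \<times> {x}}"
      have "ring_time \<omega> v (c v) < ring_time \<omega> u (c u)" if u: "u \<in> B - {v}" for u
      proof -
        have "slack \<omega> c u + 1 < ?w \<omega> u" "?w \<omega> v \<le> slack \<omega> c v + 1" using \<omega> u by (auto simp: DU_def)
        then show ?thesis unfolding ring_time_prev[of \<omega> _ "c _"] slack_def by linarith
      qed
      then show "\<omega> \<in> {\<omega> \<in> D. rings_next \<omega> c v \<and> coin \<omega> v (c v) = x}"
        using \<omega> by (auto simp: DU_def rings_next_def coin_def)
    qed
    have "{\<omega> \<in> space ?M. rings_next \<omega> c v \<and> coin \<omega> v (c v) = x} \<in> sets ?M"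
      unfolding rings_next_def Measurable.pred_def[symmetric]
    proof (intro pred_intros_logic pred_intros_finite)
      show "finite (B - {v})" using B by simp
      fix u assume "u \<in> B - {v}"
      then have "u \<in> slab k" using B by auto
      note [measurable] = measurable_ring_time[OF this] measurable_ring_time[OF vs]
      show "Measurable.pred ?M (\<lambda>\<omega>. ring_time \<omega> v (c v) < ring_time \<omega> u (c u))" by measurable
    next
      note [measurable] = measurable_coin[OF vs]
      show "Measurable.pred ?M (\<lambda>\<omega>. coin \<omega> v (c v) = x)" by measurable
    qed
    then have "D \<inter> {\<omega> \<in> space ?M. rings_next \<omega> c v \<and> coin \<omega> v (c v) = x} \<in> sets ?M" using Ds by blast
    moreover have "D \<inter> {\<omega> \<in> space ?M. rings_next \<omega> c v \<and> coin \<omega> v (c v) = x} = {\<omega> \<in> D. rings_next \<omega> c v \<and> coin \<omega> v (c v) = x}"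
      using sets.sets_into_space[OF Ds] by auto
    ultimately show "{\<omega> \<in> D. rings_next \<omega> c v \<and> coin \<omega> v (c v) = x} \<in> sets ?M" by simp
  qed
  finally show ?thesis .
qed

end

section \<open>Occurrences of a pattern and the geometric decay of failures\<close>

lemma ex_element_with_card_below:
  fixes A :: "nat set"
  assumes A: "infinite A"
  shows "\<exists>a\<in>A. card {x \<in> A. x < a} = q"
proof (induction q)
  case 0
  have "A \<noteq> {}" using A by auto
  then obtain a where a: "a \<in> A" "\<And>x. x \<in> A \<Longrightarrow> a \<le> x" using ex_has_least_nat[of "\<lambda>x. x \<in> A" _ id] by auto
  then have "{x \<in> A. x < a} = {}" by (auto simp: not_less)
  then show ?case using a by auto
next
  case (Suc q)
  then obtain a where a: "a \<in> A" "card {x \<in> A. x < a} = q" by blast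
  have "infinite (A - {..a})" using A by simp
  then have "A - {..a} \<noteq> {}" by (metis finite.emptyI)
  then obtain a' where a': "a' \<in> A - {..a}" "\<And>x. x \<in> A - {..a} \<Longrightarrow> a' \<le> x"
    using ex_has_least_nat[of "\<lambda>x. x \<in> A - {..a}" _ id] by auto
  have "{x \<in> A. x < a'} = insert a {x \<in> A. x < a}" 
  proof (intro equalityI subsetI)
    fix x assume "x \<in> {x \<in> A. x < a'}"
    then show "x \<in> insert a {x \<in> A. x < a}" using a'(2)[of x] by (cases "x \<le> a") auto
  qed (use a a' in auto)
  then have "card {x \<in> A. x < a'} = Suc q" using a by (simp add: card_insert_if)
  then show ?case using a' by blast
qed

context finite_window
begin

definition occurs :: "boundary \<Rightarrow> (vertex \<Rightarrow> int) \<Rightarrow> sample \<Rightarrow> (vertex \<Rightarrow> nat) \<Rightarrow> bool" where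
  "occurs b \<xi> \<omega> c \<longleftrightarrow> current \<omega> B c \<and> (\<forall>u\<in>B. ring_spin b k \<omega> u (c u) = \<xi> u)"

definition succeeds :: "boundary \<Rightarrow> (vertex \<Rightarrow> int) \<Rightarrow> vertex \<Rightarrow> int \<Rightarrow> sample \<Rightarrow> (vertex \<Rightarrow> nat) \<Rightarrow> bool" where
  "succeeds b \<xi> v x \<omega> c \<longleftrightarrow> occurs b \<xi> \<omega> c \<and> rings_next \<omega> c v \<and> coin \<omega> v (c v) = x"

definition counts :: "(vertex \<Rightarrow> nat) set" where
  "counts = (\<Pi>\<^sub>E u\<in>B. UNIV)"

text \<open>All states pointwise below \<open>c\<close>, visited or not: a finite set that does not
  depend on the sample, as measurability requires. The level, the total number of rings in the
  window, must be at least \<open>N\<close>, so that successes can be asked for arbitrarily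
  late.\<close>

definition earlier :: "nat \<Rightarrow> (vertex \<Rightarrow> nat) \<Rightarrow> (vertex \<Rightarrow> nat) set" where
  "earlier N c = {c' \<in> counts. (\<forall>u\<in>B. c' u \<le> c u) \<and> c' \<noteq> c \<and> N \<le> sum c' B}"

text \<open>The event that \<^term>\<open>c\<close> is the \<^term>\<open>q\<close>-th occurrence of the pattern \<^term>\<open>\<xi>\<close> from level \<^term>\<open>N\<close> on, and that
  none of the previous ones was followed by the ring of \<^term>\<open>v\<close> with coin \<^term>\<open>x\<close>.\<close>

definition late_occurrence ::
  "boundary \<Rightarrow> (vertex \<Rightarrow> int) \<Rightarrow> vertex \<Rightarrow> int \<Rightarrow> real \<Rightarrow> nat \<Rightarrow> nat \<Rightarrow> (vertex \<Rightarrow> nat) \<Rightarrow> sample set" where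
  "late_occurrence b \<xi> v x p N q c = {\<omega> \<in> space (glauber_measure k p). positive_waits k \<omega> \<and> occurs b \<xi> \<omega> c \<and>
     card {c' \<in> earlier N c. occurs b \<xi> \<omega> c'} = q \<and> (\<forall>c'\<in>earlier N c. \<not> succeeds b \<xi> v x \<omega> c')}"

lemma countable_counts: "countable counts"
  unfolding counts_def using B by (intro countable_PiE) auto

lemma finite_earlier: "finite (earlier N c)"
proof (rule finite_subset)
  show "earlier N c \<subseteq> (\<Pi>\<^sub>E u\<in>B. {..c u})"
    unfolding earlier_def counts_def PiE_iff subset_iff mem_Collect_eq atMost_iff by blast
  show "finite (\<Pi>\<^sub>E u\<in>B. {..c u})" using B by (intro finite_PiE) auto
qed

lemma counts_eqI: "c \<in> counts \<Longrightarrow> c' \<in> counts \<Longrightarrow> (\<And>u. u \<in> B \<Longrightarrow> c u = c' u) \<Longrightarrow> c = c'"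
  unfolding counts_def by (rule PiE_ext)

lemma measurable_occurs: "Measurable.pred (glauber_measure k p) (\<lambda>\<omega>. occurs b \<xi> \<omega> c)"
  unfolding occurs_def current_def
proof (intro pred_intros_logic pred_intros_finite)
  fix u assume "u \<in> B"
  then have u: "u \<in> slab k" using B by blast
  note [measurable] = measurable_ring_time[OF u] measurable_ring_spin[OF u]
  show "Measurable.pred (glauber_measure k p) (\<lambda>\<omega>. last_ring \<omega> B c < ring_time \<omega> u (c u))"
    "Measurable.pred (glauber_measure k p) (\<lambda>\<omega>. ring_spin b k \<omega> u (c u) = \<xi> u)" by measurable
qed (use B in auto)

lemma measurable_succeeds:
  assumes v: "v \<in> B"
  shows "Measurable.pred (glauber_measure k p) (\<lambda>\<omega>. succeeds b \<xi> v x \<omega> c)"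
  unfolding succeeds_def rings_next_def
proof (intro pred_intros_logic pred_intros_finite measurable_occurs)
  have vs: "v \<in> slab k" using v B by blast
  { fix u assume "u \<in> B - {v}"
    then have u: "u \<in> slab k" using B by blast
    note [measurable] = measurable_ring_time[OF u] measurable_ring_time[OF vs]
    show "Measurable.pred (glauber_measure k p) (\<lambda>\<omega>. ring_time \<omega> v (c v) < ring_time \<omega> u (c u))" by measurable }
  note [measurable] = measurable_coin[OF vs]
  show "Measurable.pred (glauber_measure k p) (\<lambda>\<omega>. coin \<omega> v (c v) = x)" by measurable
qed (use B in auto)

lemma measurable_positive_waits: "Measurable.pred (glauber_measure k p) (positive_waits k)"
  unfolding positive_waits_def
proof (intro pred_intros_countable_bounded pred_intros_countable)
  fix v n assume v: "v \<in> slab k"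
  note [measurable] = measurable_wait[OF v]
  show "Measurable.pred (glauber_measure k p) (\<lambda>\<omega>. 0 < fst (snd (\<omega> v) n))" by measurable
qed

lemma sets_late_occurrence:
  assumes v: "v \<in> B"
  shows "late_occurrence b \<xi> v x p N q c \<in> sets (glauber_measure k p)"
  unfolding late_occurrence_def Measurable.pred_def[symmetric]
proof (intro pred_intros_logic pred_intros_finite measurable_positive_waits measurable_occurs finite_earlier)
  have "(\<lambda>\<omega>. card {c' \<in> earlier N c. occurs b \<xi> \<omega> c'}) \<in> measurable (glauber_measure k p) (count_space UNIV)"
  proof (rule measurable_finitely_many[where U = "earlier N c" and f = "\<lambda>c' \<omega>. occurs b \<xi> \<omega> c'"])
    fix \<omega> \<omega>' assume "\<And>u. u \<in> earlier N c \<Longrightarrow> occurs b \<xi> \<omega> u = occurs b \<xi> \<omega>' u"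
    then show "card {c' \<in> earlier N c. occurs b \<xi> \<omega> c'} = card {c' \<in> earlier N c. occurs b \<xi> \<omega>' c'}"
      by (intro arg_cong[where f = card]) auto
  qed (use finite_earlier measurable_occurs in auto)
  then show "Measurable.pred (glauber_measure k p) (\<lambda>\<omega>. card {c' \<in> earlier N c. occurs b \<xi> \<omega> c'} = q)"
    by (rule measurable_compose) simp
qed (use measurable_succeeds[OF v] in simp)

lemma same_past_current:
  assumes past: "same_past k B c \<omega> \<omega>'" and pos: "positive_waits k \<omega>" "positive_waits k \<omega>'"
    and cur: "current \<omega> B c" "current \<omega>' B c" and le: "\<And>u. u \<in> B \<Longrightarrow> c' u \<le> c u"
  shows "current \<omega> B c' \<longleftrightarrow> current \<omega>' B c'"
proof -
  have "last_ring \<omega> B c' < ring_time \<omega> u (c' u) \<longleftrightarrow> last_ring \<omega>' B c' < ring_time \<omega>' u (c' u)" if u: "u \<in> B" for u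
  proof (cases "c' u = c u")
    case True
    have "last_ring \<sigma> B c' < ring_time \<sigma> u (c u)" if "positive_waits k \<sigma>" "current \<sigma> B c" for \<sigma>
      using last_ring_mono[OF that(1) le] currentD[OF that(2) u] by fastforce
    then show ?thesis using True pos cur by simp
  next
    case False
    then have "c' u < c u" using le[OF u] by simp
    then have "ring_time \<omega> u (c' u) = ring_time \<omega>' u (c' u)"
      by (intro same_past_ring_time[OF past]) (use u B in blast)+
    then show ?thesis using same_past_last_ring[OF past le] by simp
  qed
  then show ?thesis by (simp add: current_def)
qed

lemma same_past_occurs:
  assumes past: "same_past k B c \<omega> \<omega>'" and pos: "positive_waits k \<omega>" "positive_waits k \<omega>'"
    and cur: "current \<omega> B c" "current \<omega>' B c" and le: "\<And>u. u \<in> B \<Longrightarrow> c' u \<le> c u"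
  shows "occurs b \<xi> \<omega> c' \<longleftrightarrow> occurs b \<xi> \<omega>' c'"
  unfolding occurs_def
  using same_past_current[OF past pos cur le] same_past_ring_spin[OF past pos cur _ le] by simp

text \<open>A visited state strictly below \<open>c\<close> is left before \<open>c\<close> is
  entered, so the ring that ends it belongs to the past. If \<open>c'\<close> and \<open>c\<close>
  have the same count at \<open>v\<close>, that ring is not one of \<open>v\<close>, and there is
  success in neither sample.\<close>

lemma same_past_succeeds:
  assumes past: "same_past k B c \<omega> \<omega>'" and pos: "positive_waits k \<omega>" "positive_waits k \<omega>'"
    and cur: "current \<omega> B c" "current \<omega>' B c" and le: "\<And>u. u \<in> B \<Longrightarrow> c' u \<le> c u"
    and neq: "\<exists>u\<in>B. c' u \<noteq> c u" and v: "v \<in> B"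
  shows "succeeds b \<xi> v x \<omega> c' \<longleftrightarrow> succeeds b \<xi> v x \<omega>' c'"
proof (cases "c' v = c v")
  case True
  obtain u where u: "u \<in> B" "c' u < c u" using neq le by (metis le_neq_implies_less)
  have "\<not> rings_next \<sigma> c' v" if \<sigma>: "positive_waits k \<sigma>" "current \<sigma> B c" for \<sigma>
  proof -
    have "ring_time \<sigma> u (c' u) \<le> prev_ring \<sigma> u (c u)"
      by (rule ring_le_prev_ring[OF \<sigma>(1) _ u(2)]) (use u B in blast)
    also have "\<dots> < ring_time \<sigma> v (c v)" using prev_ring_le_last[OF u(1)] currentD[OF \<sigma>(2) v] by (rule le_less_trans)
    finally show ?thesis using True u unfolding rings_next_def by force
  qed
  then show ?thesis using pos cur by (simp add: succeeds_def)
next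
  case False
  then have v': "c' v < c v" using le[OF v] by simp
  have vs: "v \<in> slab k" using v B by blast
  have same: "ring_time \<omega> v (c' v) = ring_time \<omega>' v (c' v)" "coin \<omega> v (c' v) = coin \<omega>' v (c' v)"
    using same_past_ring_time[OF past vs] v' by auto
  have "ring_time \<omega> v (c' v) < ring_time \<omega> u (c' u) \<longleftrightarrow> ring_time \<omega>' v (c' v) < ring_time \<omega>' u (c' u)" if u: "u \<in> B" for u
  proof (cases "c' u = c u")
    case True
    have "ring_time \<sigma> v (c' v) < ring_time \<sigma> u (c u)" if \<sigma>: "positive_waits k \<sigma>" "current \<sigma> B c" for \<sigma>
    proof -
      have "ring_time \<sigma> v (c' v) \<le> prev_ring \<sigma> v (c v)" by (rule ring_le_prev_ring[OF \<sigma>(1) vs v'])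
      also have "\<dots> < ring_time \<sigma> u (c u)" using prev_ring_le_last[OF v] currentD[OF \<sigma>(2) u] by (rule le_less_trans)
      finally show ?thesis .
    qed
    then show ?thesis using True pos cur by simp
  next
    case False
    then have "c' u < c u" using le[OF u] by simp
    then have "ring_time \<omega> u (c' u) = ring_time \<omega>' u (c' u)"
      by (intro same_past_ring_time[OF past]) (use u B in blast)+
    then show ?thesis using same by simp
  qed
  then have "rings_next \<omega> c' v \<longleftrightarrow> rings_next \<omega>' c' v" by (simp add: rings_next_def)
  then show ?thesis using same same_past_occurs[OF past pos cur le] by (simp add: succeeds_def)
qed

lemma earlier_neq: "c \<in> counts \<Longrightarrow> c' \<in> earlier N c \<Longrightarrow> \<exists>u\<in>B. c' u \<noteq> c u"
  unfolding earlier_def using counts_eqI[of c' c] by auto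

lemma past_event_late_occurrence:
  assumes c: "c \<in> counts" and v: "v \<in> B"
  shows "past_event p c (late_occurrence b \<xi> v x p N q c)"
  unfolding past_event_def
proof (intro conjI ballI impI sets_late_occurrence v)
  fix \<omega> assume \<omega>: "\<omega> \<in> late_occurrence b \<xi> v x p N q c"
  then show pos: "positive_waits k \<omega>" and cur: "current \<omega> B c" by (auto simp: late_occurrence_def occurs_def)
  fix \<omega>' assume sp: "\<omega>' \<in> space (glauber_measure k p)"
    and *: "same_past k B c \<omega> \<omega>' \<and> positive_waits k \<omega>' \<and> current \<omega>' B c"
  then have past: "same_past k B c \<omega> \<omega>'" and pos': "positive_waits k \<omega>'" and cur': "current \<omega>' B c" by auto
  have "occurs b \<xi> \<omega> c \<longleftrightarrow> occurs b \<xi> \<omega>' c"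
    by (rule same_past_occurs[OF past pos pos' cur cur']) simp
  moreover have "occurs b \<xi> \<omega> c' \<longleftrightarrow> occurs b \<xi> \<omega>' c'" if "c' \<in> earlier N c" for c'
    by (rule same_past_occurs[OF past pos pos' cur cur']) (use that in \<open>simp add: earlier_def\<close>)
  moreover have "succeeds b \<xi> v x \<omega> c' \<longleftrightarrow> succeeds b \<xi> v x \<omega>' c'" if "c' \<in> earlier N c" for c'
    by (rule same_past_succeeds[OF past pos pos' cur cur' _ earlier_neq[OF c that] v])
       (use that in \<open>simp add: earlier_def\<close>)
  ultimately show "\<omega>' \<in> late_occurrence b \<xi> v x p N q c"
    using \<omega> sp pos' by (auto simp: late_occurrence_def cong: conj_cong)
qed

text \<open>If neither state dominated the other, each of them would be entered only after the other
  had been left.\<close>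

lemma current_chain:
  assumes pos: "positive_waits k \<omega>" and cur: "current \<omega> B c" "current \<omega> B c'"
  shows "(\<forall>u\<in>B. c u \<le> c' u) \<or> (\<forall>u\<in>B. c' u \<le> c u)"
proof (rule ccontr)
  assume "\<not> ?thesis"
  then obtain u w where uw: "u \<in> B" "c' u < c u" "w \<in> B" "c w < c' w" by (auto simp: not_le)
  have s: "u \<in> slab k" "w \<in> slab k" using uw B by auto
  have "ring_time \<omega> u (c' u) \<le> last_ring \<omega> B c"
    using ring_le_prev_ring[OF pos s(1) uw(2)] prev_ring_le_last[OF uw(1)] by (rule order.trans)
  also have "\<dots> < ring_time \<omega> w (c w)" by (rule currentD[OF cur(1) uw(3)])
  also have "\<dots> \<le> last_ring \<omega> B c'"
    using ring_le_prev_ring[OF pos s(2) uw(4)] prev_ring_le_last[OF uw(3)] by (rule order.trans)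
  also have "\<dots> < ring_time \<omega> u (c' u)" by (rule currentD[OF cur(2) uw(1)])
  finally show False .
qed

lemma sum_less_of_le:
  assumes "\<And>u. u \<in> B \<Longrightarrow> c u \<le> c' u" "\<exists>u\<in>B. c u \<noteq> c' u"
  shows "sum c B < sum (c' :: vertex \<Rightarrow> nat) B"
proof (rule sum_strict_mono_ex1)
  show "\<exists>u\<in>B. c u < c' u" using assms le_neq_implies_less by blast
qed (use assms B in blast)+

lemma earlier_iff_sum_less:
  assumes pos: "positive_waits k \<omega>" and cur: "current \<omega> B c" "current \<omega> B c'" and c: "c \<in> counts" "c' \<in> counts"
  shows "c' \<in> earlier N c \<longleftrightarrow> N \<le> sum c' B \<and> sum c' B < sum c B"
proof
  assume *: "c' \<in> earlier N c"
  have "sum c' B < sum c B"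
    using * earlier_neq[OF c(1) *] by (intro sum_less_of_le) (auto simp: earlier_def)
  then show "N \<le> sum c' B \<and> sum c' B < sum c B" using * by (simp add: earlier_def)
next
  assume *: "N \<le> sum c' B \<and> sum c' B < sum c B"
  then have "\<not> (\<forall>u\<in>B. c u \<le> c' u)" using sum_mono[of B c c'] by force
  then have "\<forall>u\<in>B. c' u \<le> c u" using current_chain[OF pos cur] by blast
  then show "c' \<in> earlier N c" using * c by (auto simp: earlier_def)
qed

text \<open>The pattern occurs at least \<open>q + 1\<close> times from level \<open>N\<close> on,
  and the first \<open>q\<close> of these occurrences fail.\<close>

definition late :: "boundary \<Rightarrow> (vertex \<Rightarrow> int) \<Rightarrow> vertex \<Rightarrow> int \<Rightarrow> real \<Rightarrow> nat \<Rightarrow> nat \<Rightarrow> sample set" where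
  "late b \<xi> v x p N q = (\<Union>c\<in>{c \<in> counts. N \<le> sum c B}. late_occurrence b \<xi> v x p N q c)"

lemma countable_late_index: "countable {c \<in> counts. N \<le> sum c B}"
  by (rule countable_subset[OF _ countable_counts]) auto

lemma earlier_occurrences:
  assumes pos: "positive_waits k \<omega>" and c: "c \<in> counts" "current \<omega> B c"
  shows "{c' \<in> earlier N c. occurs b \<xi> \<omega> c'}
    = {c' \<in> counts. occurs b \<xi> \<omega> c' \<and> N \<le> sum c' B \<and> sum c' B < sum c B}"
proof -
  have "c' \<in> earlier N c \<longleftrightarrow> N \<le> sum c' B \<and> sum c' B < sum c B" if "c' \<in> counts" "occurs b \<xi> \<omega> c'" for c'
    using that by (intro earlier_iff_sum_less[OF pos c(2) _ c(1)]) (simp_all add: occurs_def)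
  then show ?thesis by (auto simp: earlier_def)
qed

lemma sum_inj_on_current:
  assumes pos: "positive_waits k \<omega>" and c: "c \<in> counts" "current \<omega> B c" "c' \<in> counts" "current \<omega> B c'"
    and eq: "sum c B = sum c' B"
  shows "c = c'"
proof (rule ccontr)
  assume "c \<noteq> c'"
  then have neq: "\<exists>u\<in>B. c u \<noteq> c' u" "\<exists>u\<in>B. c' u \<noteq> c u" using counts_eqI[OF c(1,3)] by force+
  from current_chain[OF pos c(2,4)] show False
  proof (elim disjE)
    assume "\<forall>u\<in>B. c u \<le> c' u"
    then have "sum c B < sum c' B" using neq by (intro sum_less_of_le) auto
    then show False using eq by simp
  next
    assume "\<forall>u\<in>B. c' u \<le> c u"
    then have "sum c' B < sum c B" using neq by (intro sum_less_of_le) auto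
    then show False using eq by simp
  qed
qed

lemma disjoint_late_occurrence:
  "disjoint_family_on (late_occurrence b \<xi> v x p N q) {c \<in> counts. N \<le> sum c B}"
proof -
  have *: False
    if c: "c \<in> counts" "c' \<in> counts" "N \<le> sum c B" "sum c B < sum c' B"
      and \<omega>: "\<omega> \<in> late_occurrence b \<xi> v x p N q c" "\<omega> \<in> late_occurrence b \<xi> v x p N q c'" for c c' \<omega>
  proof -
    have pos: "positive_waits k \<omega>" and occ: "occurs b \<xi> \<omega> c" "occurs b \<xi> \<omega> c'"
      and card: "card {d \<in> earlier N c. occurs b \<xi> \<omega> d} = q" "card {d \<in> earlier N c'. occurs b \<xi> \<omega> d} = q"
      using \<omega> by (auto simp: late_occurrence_def)
    have cur: "current \<omega> B c" "current \<omega> B c'" using occ by (auto simp: occurs_def)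
    note e = earlier_occurrences[OF pos c(1) cur(1)] earlier_occurrences[OF pos c(2) cur(2)]
    have "insert c {d \<in> earlier N c. occurs b \<xi> \<omega> d} \<subseteq> {d \<in> earlier N c'. occurs b \<xi> \<omega> d}"
      unfolding e using c occ by auto
    then have "card (insert c {d \<in> earlier N c. occurs b \<xi> \<omega> d}) \<le> q"
      unfolding card(2)[symmetric] using finite_earlier by (intro card_mono) auto
    moreover have "c \<notin> {d \<in> earlier N c. occurs b \<xi> \<omega> d}" by (simp add: earlier_def)
    ultimately show False using card(1) finite_earlier by simp
  qed
  show ?thesis
    unfolding disjoint_family_on_def
  proof (intro ballI impI)
    fix c c' assume c: "c \<in> {c \<in> counts. N \<le> sum c B}" "c' \<in> {c \<in> counts. N \<le> sum c B}" "c \<noteq> c'"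
    show "late_occurrence b \<xi> v x p N q c \<inter> late_occurrence b \<xi> v x p N q c' = {}"
    proof (rule ccontr)
      assume "late_occurrence b \<xi> v x p N q c \<inter> late_occurrence b \<xi> v x p N q c' \<noteq> {}"
      then obtain \<omega> where \<omega>: "\<omega> \<in> late_occurrence b \<xi> v x p N q c" "\<omega> \<in> late_occurrence b \<xi> v x p N q c'" by auto
      then have "sum c B \<noteq> sum c' B"
        using sum_inj_on_current[of \<omega> c c'] c by (auto simp: late_occurrence_def occurs_def)
      then show False using *[of c c' \<omega>] *[of c' c \<omega>] c \<omega> by (auto simp: neq_iff)
    qed
  qed
qed

text \<open>Among the \<open>q + 1\<close> occurrences before \<open>c\<close> the last one,
  \<open>d\<close>, has exactly \<open>q\<close> predecessors, and it fails. The level serves as a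
  clock: by \<open>sum_inj_on_current\<close> it separates the states visited by one sample.\<close>

lemma late_Suc_subset:
  "late b \<xi> v x p N (Suc q)
     \<subseteq> (\<Union>c\<in>{c \<in> counts. N \<le> sum c B}. {\<omega> \<in> late_occurrence b \<xi> v x p N q c. \<not> succeeds b \<xi> v x \<omega> c})"
proof
  fix \<omega> assume "\<omega> \<in> late b \<xi> v x p N (Suc q)"
  then obtain c where c: "c \<in> counts" "N \<le> sum c B" "\<omega> \<in> late_occurrence b \<xi> v x p N (Suc q) c"
    by (auto simp: late_def)
  have pos: "positive_waits k \<omega>" and occ: "occurs b \<xi> \<omega> c" and sp: "\<omega> \<in> space (glauber_measure k p)"
    and fail: "\<And>d. d \<in> earlier N c \<Longrightarrow> \<not> succeeds b \<xi> v x \<omega> d"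
    and card: "card {d \<in> earlier N c. occurs b \<xi> \<omega> d} = Suc q"
    using c(3) by (auto simp: late_occurrence_def)
  have cur: "current \<omega> B c" using occ by (simp add: occurs_def)
  define Oc where "Oc = {d \<in> earlier N c. occurs b \<xi> \<omega> d}"
  have Oc: "Oc = {d \<in> counts. occurs b \<xi> \<omega> d \<and> N \<le> sum d B \<and> sum d B < sum c B}"
    unfolding Oc_def by (rule earlier_occurrences[OF pos c(1) cur])
  have "card Oc = Suc q" using card by (simp add: Oc_def)
  then have fin: "finite Oc" "Oc \<noteq> {}" by (auto intro: card_ge_0_finite)
  obtain d where d: "d \<in> Oc" "\<And>d'. d' \<in> Oc \<Longrightarrow> sum d' B \<le> sum d B"
  proof -
    have "Max ((\<lambda>d. sum d B) ` Oc) \<in> (\<lambda>d. sum d B) ` Oc" using fin by (intro Max_in) auto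
    then obtain d where "d \<in> Oc" "sum d B = Max ((\<lambda>d. sum d B) ` Oc)" by (metis imageE)
    then show thesis using that fin by auto
  qed
  have d': "d \<in> counts" "occurs b \<xi> \<omega> d" "N \<le> sum d B" "sum d B < sum c B" using d(1) by (auto simp: Oc)
  have curd: "current \<omega> B d" using d'(2) by (simp add: occurs_def)
  have Od: "{d' \<in> earlier N d. occurs b \<xi> \<omega> d'} = Oc - {d}"
  proof -
    have uniq: "d' = d" if "d' \<in> Oc" "sum d' B = sum d B" for d'
    proof (rule sum_inj_on_current[OF pos _ _ d'(1) curd that(2)])
      show "d' \<in> counts" "current \<omega> B d'" using that(1) unfolding Oc occurs_def by blast+
    qed
    have "Oc - {d} = {d' \<in> Oc. sum d' B < sum d B}"
    proof (intro equalityI subsetI)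
      fix d' assume d': "d' \<in> Oc - {d}"
      then have "sum d' B \<noteq> sum d B" "sum d' B \<le> sum d B" using uniq d(2) by blast+
      then show "d' \<in> {d' \<in> Oc. sum d' B < sum d B}" using d' by simp
    qed auto
    also have "\<dots> = {d' \<in> counts. occurs b \<xi> \<omega> d' \<and> N \<le> sum d' B \<and> sum d' B < sum d B}"
      unfolding Oc using d'(4) by auto
    finally show ?thesis unfolding earlier_occurrences[OF pos d'(1) curd] by (rule sym)
  qed
  have "card {d' \<in> earlier N d. occurs b \<xi> \<omega> d'} = q"
    unfolding Od using card d(1) fin(1) by (simp add: Oc_def)
  moreover have "\<not> succeeds b \<xi> v x \<omega> d" using d(1) fail by (auto simp: Oc_def)
  moreover have "\<not> succeeds b \<xi> v x \<omega> d'" if "d' \<in> earlier N d" for d'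
  proof
    assume s: "succeeds b \<xi> v x \<omega> d'"
    then have "d' \<in> {d' \<in> earlier N d. occurs b \<xi> \<omega> d'}" using that by (simp add: succeeds_def)
    then have "d' \<in> Oc" unfolding Od by simp
    then show False using fail s by (auto simp: Oc_def)
  qed
  ultimately have "\<omega> \<in> late_occurrence b \<xi> v x p N q d"
    using pos sp d'(2) by (simp add: late_occurrence_def)
  then show "\<omega> \<in> (\<Union>c\<in>{c \<in> counts. N \<le> sum c B}. {\<omega> \<in> late_occurrence b \<xi> v x p N q c. \<not> succeeds b \<xi> v x \<omega> c})"
    using d' \<open>\<not> succeeds b \<xi> v x \<omega> d\<close> by blast
qed

lemma emeasure_late_occurrence_fails:
  assumes c: "c \<in> counts" and v: "v \<in> B" and x: "x \<in> {-1, 1}"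
  shows "emeasure (glauber_measure k p) {\<omega> \<in> late_occurrence b \<xi> v x p N q c. \<not> succeeds b \<xi> v x \<omega> c}
     \<le> ennreal (1 - eps) * emeasure (glauber_measure k p) (late_occurrence b \<xi> v x p N q c)"
proof -
  let ?M = "glauber_measure k p"
  interpret prob_space ?M by (rule prob_space_glauber_measure)
  define D where "D = late_occurrence b \<xi> v x p N q c"
  define S where "S = {\<omega> \<in> D. succeeds b \<xi> v x \<omega> c}"
  have D[measurable]: "D \<in> sets ?M" unfolding D_def by (rule sets_late_occurrence[OF v])
  have S: "S \<in> sets ?M"
  proof -
    have "S = D \<inter> {\<omega> \<in> space ?M. succeeds b \<xi> v x \<omega> c}" using sets.sets_into_space[OF D] by (auto simp: S_def)
    also have "\<dots> \<in> sets ?M" using measurable_succeeds[OF v] D by (auto simp: Measurable.pred_def)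
    finally show ?thesis .
  qed
  have "{\<omega> \<in> D. rings_next \<omega> c v \<and> coin \<omega> v (c v) = x} = S"
    by (auto simp: S_def succeeds_def D_def late_occurrence_def)
  then have "ennreal eps * emeasure ?M D \<le> emeasure ?M S"
    using emeasure_rings_next[OF past_event_late_occurrence[OF c v,
        where p = p and b = b and \<xi> = \<xi> and x = x and N = N and q = q] v x] by (simp add: D_def)
  then have "eps * prob D \<le> prob S"
    using eps by (simp add: emeasure_eq_measure ennreal_mult[symmetric])
  moreover have "{\<omega> \<in> D. \<not> succeeds b \<xi> v x \<omega> c} = D - S" by (auto simp: S_def)
  moreover have "prob (D - S) = prob D - prob S" using D S by (intro finite_measure_Diff) (auto simp: S_def)
  ultimately have "prob {\<omega> \<in> D. \<not> succeeds b \<xi> v x \<omega> c} \<le> (1 - eps) * prob D" by (simp add: algebra_simps)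
  then show ?thesis
    unfolding D_def[symmetric] using eps by (simp add: emeasure_eq_measure ennreal_mult[symmetric])
qed

text \<open>An occurrence fails with conditional probability at most \<open>1 - eps\<close>,
  whatever came before it. For fixed \<open>q\<close> the events of different states
  \<open>c\<close> are disjoint, so these bounds add up to one for their union.\<close>

lemma emeasure_late_le:
  assumes v: "v \<in> B" and x: "x \<in> {-1, 1}"
  shows "emeasure (glauber_measure k p) (late b \<xi> v x p N q) \<le> ennreal ((1 - eps) ^ q)"
proof (induction q)
  case 0
  interpret prob_space "glauber_measure k p" by (rule prob_space_glauber_measure)
  show ?case by (simp add: emeasure_le_1)
next
  case (Suc q)
  let ?M = "glauber_measure k p" and ?I = "{c \<in> counts. N \<le> sum c B}"
  let ?D = "late_occurrence b \<xi> v x p N q"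
  let ?F = "\<lambda>c. {\<omega> \<in> ?D c. \<not> succeeds b \<xi> v x \<omega> c}"
  have D: "?D c \<in> sets ?M" for c by (rule sets_late_occurrence[OF v])
  have F: "?F c \<in> sets ?M" for c
  proof -
    have "?F c = ?D c - {\<omega> \<in> space ?M. succeeds b \<xi> v x \<omega> c}" using sets.sets_into_space[OF D] by auto
    also have "\<dots> \<in> sets ?M" using measurable_succeeds[OF v] D by (auto simp: Measurable.pred_def)
    finally show ?thesis .
  qed
  have "emeasure ?M (late b \<xi> v x p N (Suc q)) \<le> emeasure ?M (\<Union>c\<in>?I. ?F c)"
    by (intro emeasure_mono late_Suc_subset sets.countable_UN' countable_late_index) (use F in blast)
  also have "\<dots> = (\<integral>\<^sup>+c. emeasure ?M (?F c) \<partial>count_space ?I)"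
  proof (rule emeasure_UN_countable[OF F countable_late_index])
    show "disjoint_family_on ?F ?I"
      using disjoint_late_occurrence[of b \<xi> v x p N q] unfolding disjoint_family_on_def by blast
  qed
  also have "\<dots> \<le> (\<integral>\<^sup>+c. ennreal (1 - eps) * emeasure ?M (?D c) \<partial>count_space ?I)"
    by (intro nn_integral_mono emeasure_late_occurrence_fails v x) simp
  also have "\<dots> = ennreal (1 - eps) * (\<integral>\<^sup>+c. emeasure ?M (?D c) \<partial>count_space ?I)"
    by (rule nn_integral_cmult) simp
  also have "(\<integral>\<^sup>+c. emeasure ?M (?D c) \<partial>count_space ?I) = emeasure ?M (late b \<xi> v x p N q)"
    unfolding late_def by (rule emeasure_UN_countable[symmetric, OF D countable_late_index disjoint_late_occurrence])
  also have "ennreal (1 - eps) * emeasure ?M (late b \<xi> v x p N q) \<le> ennreal (1 - eps) * ennreal ((1 - eps) ^ q)"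
    by (intro mult_left_mono Suc) simp
  also have "\<dots> = ennreal ((1 - eps) ^ Suc q)" using eps by (simp add: ennreal_mult[symmetric])
  finally show ?case .
qed

lemma AE_not_always_late:
  assumes v: "v \<in> B" and x: "x \<in> {-1, 1}"
  shows "AE \<omega> in glauber_measure k p. \<forall>N. \<exists>q. \<omega> \<notin> late b \<xi> v x p N q"
  unfolding AE_all_countable
proof
  fix N
  let ?M = "glauber_measure k p"
  interpret prob_space ?M by (rule prob_space_glauber_measure)
  have sets: "late b \<xi> v x p N q \<in> sets ?M" for q
    unfolding late_def
    by (intro sets.countable_UN' countable_late_index) (use sets_late_occurrence[OF v] in blast)
  have "AE \<omega> in ?M. eventually (\<lambda>q. \<omega> \<notin> late b \<xi> v x p N q) sequentially"
  proof (rule AE_eventually_not_in[OF sets])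
    have "(\<Sum>q. emeasure ?M (late b \<xi> v x p N q)) \<le> (\<Sum>q. ennreal ((1 - eps) ^ q))"
      by (intro suminf_le emeasure_late_le v x) auto
    also have "\<dots> < \<infinity>" using eps by (subst suminf_ennreal2) (auto intro!: summable_geometric)
    finally show "(\<Sum>q. emeasure ?M (late b \<xi> v x p N q)) < \<infinity>" .
  qed
  then show "AE \<omega> in ?M. \<exists>q. \<omega> \<notin> late b \<xi> v x p N q"
    by eventually_elim (auto simp: eventually_sequentially)
qed

lemma always_late:
  assumes \<omega>: "\<omega> \<in> space (glauber_measure k p)" "positive_waits k \<omega>"
    and inf: "infinite {c \<in> counts. occurs b \<xi> \<omega> c}"
    and fail: "\<And>c. c \<in> counts \<Longrightarrow> N \<le> sum c B \<Longrightarrow> \<not> succeeds b \<xi> v x \<omega> c"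
  shows "\<omega> \<in> late b \<xi> v x p N q"
proof -
  define Oc where "Oc = {c \<in> counts. occurs b \<xi> \<omega> c \<and> N \<le> sum c B}"
  have "finite {c \<in> counts. sum c B < N}"
  proof (rule finite_subset)
    show "{c \<in> counts. sum c B < N} \<subseteq> (\<Pi>\<^sub>E u\<in>B. {..<N})"
    proof
      fix c assume c: "c \<in> {c \<in> counts. sum c B < N}"
      have "c u < N" if "u \<in> B" for u
        using member_le_sum[of u B c] that B(1) c by simp
      then show "c \<in> (\<Pi>\<^sub>E u\<in>B. {..<N})" using c
        unfolding counts_def PiE_iff mem_Collect_eq lessThan_iff by blast
    qed
  qed (use B in \<open>auto intro: finite_PiE\<close>)
  moreover have "{c \<in> counts. occurs b \<xi> \<omega> c} \<subseteq> Oc \<union> {c \<in> counts. sum c B < N}" by (auto simp: Oc_def)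
  ultimately have "infinite Oc" using inf finite_subset by blast
  moreover have inj: "inj_on (\<lambda>c. sum c B) Oc"
    by (intro inj_onI sum_inj_on_current[OF \<omega>(2)]) (auto simp: Oc_def occurs_def)
  ultimately have "infinite ((\<lambda>c. sum c B) ` Oc)" using finite_imageD by blast
  then obtain c where c: "c \<in> Oc" "card {n \<in> (\<lambda>c. sum c B) ` Oc. n < sum c B} = q"
    using ex_element_with_card_below[of "(\<lambda>c. sum c B) ` Oc" q] by blast
  have "current \<omega> B c" "c \<in> counts" using c(1) by (auto simp: Oc_def occurs_def)
  then have e: "{c' \<in> earlier N c. occurs b \<xi> \<omega> c'} = {c' \<in> Oc. sum c' B < sum c B}"
    using earlier_occurrences[OF \<omega>(2), of c N b \<xi>] by (auto simp: Oc_def)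
  have "{n \<in> (\<lambda>c. sum c B) ` Oc. n < sum c B} = (\<lambda>c. sum c B) ` {c' \<in> Oc. sum c' B < sum c B}" by auto
  then have "card {c' \<in> earlier N c. occurs b \<xi> \<omega> c'} = q"
    unfolding e using c(2) card_image[OF inj_on_subset[OF inj], of "{c' \<in> Oc. sum c' B < sum c B}"] by simp
  then have "\<omega> \<in> late_occurrence b \<xi> v x p N q c"
    using \<omega> c(1) fail by (auto simp: late_occurrence_def Oc_def earlier_def)
  then show ?thesis using c(1) by (auto simp: late_def Oc_def)
qed

text \<open>If only finitely many occurrences succeeded, all of them would have a level below some
  \<open>N\<close>, and the sample would lie in \<open>late\<close> for this \<open>N\<close> and
  every \<open>q\<close>. By the geometric bound this has probability zero.\<close>

lemma AE_infinitely_many_successes: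
  assumes v: "v \<in> B" and x: "x \<in> {-1, 1}"
  shows "AE \<omega> in glauber_measure k p. infinite {c \<in> counts. occurs b \<xi> \<omega> c} \<longrightarrow> infinite {c \<in> counts. succeeds b \<xi> v x \<omega> c}"
  using AE_not_always_late[OF v x, where b = b and \<xi> = \<xi>] AE_good_sample[where b = b] AE_space
proof eventually_elim
  case (elim \<omega>)
  have pos: "positive_waits k \<omega>" using elim(2) by (auto simp: good_sample_def positive_waits_def)
  show ?case
  proof (intro impI notI)
    assume inf: "infinite {c \<in> counts. occurs b \<xi> \<omega> c}" and fin: "finite {c \<in> counts. succeeds b \<xi> v x \<omega> c}"
    obtain N where N: "\<And>c. c \<in> counts \<Longrightarrow> succeeds b \<xi> v x \<omega> c \<Longrightarrow> sum c B < N"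
      using finite_imageI[OF fin, of "\<lambda>c. sum c B"] unfolding finite_nat_set_iff_bounded by blast
    have "\<omega> \<in> late b \<xi> v x p N q" for q
      by (rule always_late[OF elim(3) pos inf]) (use N in \<open>auto simp: not_less[symmetric]\<close>)
    then show False using elim(1) by blast
  qed
qed

end

section \<open>Limit configurations\<close>

lemma (in ring_clock) rings_before_eqI:
  assumes "prev_ring \<omega> v n < t" "t \<le> ring_time \<omega> v n" "0 < t"
  shows "rings_before \<omega> v t = n"
proof (rule antisym)
  show "rings_before \<omega> v t \<le> n" using less_rings_before[of n t] assms(2) by (simp add: not_less[symmetric])
  show "n \<le> rings_before \<omega> v t" using less_rings_before[of "n - 1" t] assms(1) by (cases n) (auto simp: prev_ring_def)
qed

lemma (in good_path) positive_waits: "positive_waits k \<omega>"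
  using good by (auto simp: good_sample_def positive_waits_def)

lemma (in good_path) rings_until_other_ring:
  assumes "u \<in> slab k" "v \<in> slab k" "u \<noteq> v"
  shows "rings_until \<omega> u (ring_time \<omega> v m) = rings_before \<omega> u (ring_time \<omega> v m)"
proof -
  have "(ring_time \<omega> u i \<le> ring_time \<omega> v m) = (ring_time \<omega> u i < ring_time \<omega> v m)" for i
    using ring_time_distinct[OF assms, of i m] by linarith
  then show ?thesis by (simp add: rings_until_def rings_before_def)
qed

definition recurs_on :: "boundary \<Rightarrow> nat \<Rightarrow> sample \<Rightarrow> vertex set \<Rightarrow> (vertex \<Rightarrow> int) \<Rightarrow> bool" where
  "recurs_on b k \<omega> B \<xi> \<longleftrightarrow> (\<forall>T. \<exists>t\<ge>T. \<forall>u\<in>B. config_at b k \<omega> t u = \<xi> u)"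

text \<open>The accumulation points of the trajectory, as time tends to infinity, in the product
  topology of the slab; values off the slab are free.\<close>

definition limit_configs :: "boundary \<Rightarrow> nat \<Rightarrow> sample \<Rightarrow> (vertex \<Rightarrow> int) set" where
  "limit_configs b k \<omega> = {\<xi>. \<forall>B. finite B \<longrightarrow> B \<subseteq> slab k \<longrightarrow> recurs_on b k \<omega> B \<xi>}"

text \<open>The patterns are extensional functions on finite windows, so the last clause runs over
  countably many cases and its almost sure instances can be combined.\<close>

definition fair_sample :: "boundary \<Rightarrow> nat \<Rightarrow> sample \<Rightarrow> bool" where
  "fair_sample b k \<omega> \<longleftrightarrow> good_sample b k \<omega> \<and> (\<forall>v\<in>slab k. finite {m. lowering b k \<omega> v m}) \<and>
     (\<forall>B \<xi> v x. finite B \<longrightarrow> B \<subseteq> slab k \<longrightarrow> \<xi> \<in> (\<Pi>\<^sub>E u\<in>B. {-1, 1}) \<longrightarrow> v \<in> B \<longrightarrow> x \<in> {-1, 1} \<longrightarrow>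
        infinite {c \<in> finite_window.counts B. finite_window.occurs k B b \<xi> \<omega> c} \<longrightarrow>
        infinite {c \<in> finite_window.counts B. finite_window.succeeds k B b \<xi> v x \<omega> c})"

lemma AE_fair_sample:
  assumes k: "2 \<le> k"
  shows "AE \<omega> in glauber_measure k p. fair_sample b k \<omega>"
proof -
  let ?M = "glauber_measure k p"
  define I where "I = (SIGMA B : {B. finite B \<and> B \<subseteq> slab k}. (\<Pi>\<^sub>E u\<in>B. {-1, 1 :: int}) \<times> B \<times> {-1, 1 :: int})"
  have "{B. finite B \<and> B \<subseteq> slab k} \<subseteq> Collect finite" by blast
  then have "countable {B. finite B \<and> B \<subseteq> slab k}" by (rule countable_subset) (rule countable_Collect_finite)
  then have I: "countable I" unfolding I_def
    by (intro countable_SIGMA countable_PiE) auto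
  have "AE \<omega> in ?M. \<forall>(B, \<xi>, v, x)\<in>I. infinite {c \<in> finite_window.counts B. finite_window.occurs k B b \<xi> \<omega> c} \<longrightarrow>
        infinite {c \<in> finite_window.counts B. finite_window.succeeds k B b \<xi> v x \<omega> c}"
    unfolding AE_ball_countable[OF I]
  proof
    fix i assume "i \<in> I"
    then obtain B \<xi> v x where i: "i = (B, \<xi>, v, x)" "finite B" "B \<subseteq> slab k" "v \<in> B" "x \<in> {-1, 1}"
      by (auto simp: I_def)
    interpret finite_window k B using i by unfold_locales auto
    show "AE \<omega> in ?M. case i of (B, \<xi>, v, x) \<Rightarrow> infinite {c \<in> finite_window.counts B. finite_window.occurs k B b \<xi> \<omega> c} \<longrightarrow>
        infinite {c \<in> finite_window.counts B. finite_window.succeeds k B b \<xi> v x \<omega> c}"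
      unfolding i(1) prod.case by (rule AE_infinitely_many_successes[OF i(4,5)])
  qed
  with AE_good_sample[where b = b] AE_finite_lowering[OF k, where b = b] show ?thesis
  proof eventually_elim
    case (elim \<omega>)
    show ?case unfolding fair_sample_def
    proof (intro conjI allI impI)
      fix B \<xi> v x
      assume "finite B" "B \<subseteq> slab k" "\<xi> \<in> (\<Pi>\<^sub>E u\<in>B. {-1, 1 :: int})" "v \<in> B" "x \<in> {-1, 1 :: int}"
        and inf: "infinite {c \<in> finite_window.counts B. finite_window.occurs k B b \<xi> \<omega> c}"
      then have "(B, \<xi>, v, x) \<in> I" unfolding I_def by blast
      from bspec[OF elim(3) this] inf
      show "infinite {c \<in> finite_window.counts B. finite_window.succeeds k B b \<xi> v x \<omega> c}" by simp
    qed (use elim in blast)+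
  qed
qed

text \<open>Diagonal argument along an enumeration of the points: \<open>S n\<close> is an infinite
  set of indices on which the values at the first \<open>n\<close> points are constant.\<close>

lemma ex_accumulation_pattern:
  fixes f :: "nat \<Rightarrow> 'a :: countable \<Rightarrow> int"
  assumes f: "\<And>m u. f m u \<in> {-1, 1}" and I: "infinite I"
  obtains \<xi> where "\<And>B. finite B \<Longrightarrow> infinite {m \<in> I. \<forall>u\<in>B. f m u = \<xi> u}"
proof -
  define S where "S = rec_nat I (\<lambda>n A. if infinite {m \<in> A. f m (from_nat n) = 1}
     then {m \<in> A. f m (from_nat n) = 1} else {m \<in> A. f m (from_nat n) = -1})"
  have S_Suc: "S (Suc n) = (if infinite {m \<in> S n. f m (from_nat n) = 1}
     then {m \<in> S n. f m (from_nat n) = 1} else {m \<in> S n. f m (from_nat n) = -1})" for n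
    by (simp add: S_def)
  have inf: "infinite (S n)" for n
  proof (induction n)
    case (Suc n)
    have "S n = {m \<in> S n. f m (from_nat n) = 1} \<union> {m \<in> S n. f m (from_nat n) = -1}"
      using f[of _ "from_nat n"] by auto
    then have "infinite {m \<in> S n. f m (from_nat n) = 1} \<or> infinite {m \<in> S n. f m (from_nat n) = -1}"
      using Suc by (metis finite_UnI)
    then show ?case by (auto simp: S_Suc)
  qed (simp add: S_def I)
  have anti: "S n \<subseteq> S m" if "m \<le> n" for m n
    by (rule lift_Suc_antimono_le[of S, OF _ that]) (auto simp: S_Suc)
  define \<xi> where "\<xi> u = (if infinite {m \<in> S (to_nat u). f m u = 1} then 1 else -1 :: int)" for u
  have \<xi>: "f m u = \<xi> u" if "m \<in> S (Suc (to_nat u))" for m u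
    using that by (auto simp: S_Suc \<xi>_def split: if_splits)
  show ?thesis
  proof
    fix B :: "'a set" assume B: "finite B"
    then obtain N where N: "\<And>u. u \<in> B \<Longrightarrow> to_nat u < N"
      using finite_imageI[OF B, of to_nat] unfolding finite_nat_set_iff_bounded by blast
    have "S N \<subseteq> {m \<in> I. \<forall>u\<in>B. f m u = \<xi> u}"
    proof
      fix m assume m: "m \<in> S N"
      have "m \<in> S 0" using m anti[of 0 N] by auto
      moreover have "f m u = \<xi> u" if "u \<in> B" for u
        using \<xi>[of m u] m anti[of "Suc (to_nat u)" N] N[OF that] by auto
      ultimately show "m \<in> {m \<in> I. \<forall>u\<in>B. f m u = \<xi> u}" by (simp add: S_def)
    qed
    then show "infinite {m \<in> I. \<forall>u\<in>B. f m u = \<xi> u}" using inf infinite_super by blast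
  qed
qed

locale fair_path =
  fixes b k \<omega>
  assumes fair: "fair_sample b k \<omega>"

sublocale fair_path \<subseteq> good_path
  using fair by unfold_locales (simp add: fair_sample_def)

context fair_path
begin

lemma config_values: "config_at b k \<omega> t u \<in> {-1, 1}" "config_before b k \<omega> t u \<in> {-1, 1}"
  using ring_spin_values by (simp_all add: config_at_def config_before_def)

lemma recurs_on_values: "recurs_on b k \<omega> B \<xi> \<Longrightarrow> u \<in> B \<Longrightarrow> \<xi> u \<in> {-1, 1}"
  unfolding recurs_on_def using config_values by metis

lemma limit_config_values: "\<xi> \<in> limit_configs b k \<omega> \<Longrightarrow> u \<in> slab k \<Longrightarrow> \<xi> u \<in> {-1, 1}"
  unfolding limit_configs_def using recurs_on_values[of "{u}" \<xi> u] by blast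

text \<open>The pattern recurs at arbitrarily late times, hence in infinitely many states of the
  window, and infinitely many of these succeed. The count at \<open>v\<close> tells them apart: it
  fixes the time of the next ring of \<open>v\<close>, and the counts of the other vertices can be
  read off at that time. So the rings found have unbounded numbers.\<close>

lemma recurring_pattern_rings:
  assumes B: "finite B" "B \<subseteq> slab k" and v: "v \<in> B" and x: "x \<in> {-1, 1}" and rec: "recurs_on b k \<omega> B \<xi>"
  shows "\<exists>m\<ge>M. (\<forall>u\<in>B. config_before b k \<omega> (ring_time \<omega> v m) u = \<xi> u) \<and> coin \<omega> v m = x"
proof -
  interpret W: finite_window k B using B v by unfold_locales auto
  have vs: "v \<in> slab k" using v B by blast
  interpret V: ring_clock \<omega> v by (rule clock[OF vs])
  define \<xi>' where "\<xi>' = restrict \<xi> B"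
  define O' where "O' = {c \<in> W.counts. W.occurs b \<xi>' \<omega> c}"
  define S where "S = {c \<in> W.counts. W.succeeds b \<xi>' v x \<omega> c}"
  have unbounded_counts: "\<exists>c\<in>O'. m \<le> c v" for m
  proof -
    obtain T where T: "T \<ge> 0" "m \<le> rings_until \<omega> v T" using V.rings_until_ge by blast
    obtain t where t: "t \<ge> T" "\<And>u. u \<in> B \<Longrightarrow> config_at b k \<omega> t u = \<xi> u"
      using rec unfolding recurs_on_def by blast
    define c where "c = restrict (\<lambda>u. rings_until \<omega> u t) B"
    have prev: "prev_ring \<omega> u (c u) \<le> t" and nxt: "t < ring_time \<omega> u (c u)" if u: "u \<in> B" for u
    proof -
      have us: "u \<in> slab k" using u B by blast
      interpret U: ring_clock \<omega> u by (rule clock[OF us])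
      show "prev_ring \<omega> u (c u) \<le> t"
        using U.less_rings_until[of "rings_until \<omega> u t - 1" t] u T t by (auto simp: c_def prev_ring_def)
      show "t < ring_time \<omega> u (c u)"
        using U.less_rings_until[of "rings_until \<omega> u t" t] u by (auto simp: c_def)
    qed
    have "W.occurs b \<xi>' \<omega> c"
      unfolding W.occurs_def current_def
    proof (intro conjI ballI)
      fix u assume u: "u \<in> B"
      show "last_ring \<omega> B c < ring_time \<omega> u (c u)" using W.last_ring_le[OF prev] nxt[OF u] by (rule le_less_trans)
      show "ring_spin b k \<omega> u (c u) = \<xi>' u" using t(2)[OF u] u by (simp add: c_def \<xi>'_def config_at_def)
    qed
    moreover have "c \<in> W.counts" by (simp add: c_def W.counts_def)
    moreover have "m \<le> c v" using T(2) V.rings_until_mono[OF t(1)] v by (simp add: c_def)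
    ultimately show ?thesis by (auto simp: O'_def)
  qed
  have "infinite O'"
  proof
    assume fin: "finite O'"
    then obtain N where "\<And>c. c \<in> O' \<Longrightarrow> c v < N"
      using finite_imageI[OF fin, of "\<lambda>c. c v"] unfolding finite_nat_set_iff_bounded by blast
    then show False using unbounded_counts[of N] by (meson not_le)
  qed
  moreover have "\<xi>' \<in> (\<Pi>\<^sub>E u\<in>B. {-1, 1})"
    using recurs_on_values[OF rec] unfolding \<xi>'_def by (intro restrict_PiE_iff[THEN iffD2]) blast
  ultimately have inf: "infinite S"
    using fair B v x unfolding fair_sample_def S_def O'_def by blast
  have succ: "rings_before \<omega> u (ring_time \<omega> v (c v)) = c u" if c: "c \<in> S" and u: "u \<in> B" for c u
  proof (cases "u = v")
    case True
    then show ?thesis by simp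
  next
    case False
    have us: "u \<in> slab k" using u B by blast
    interpret U: ring_clock \<omega> u by (rule clock[OF us])
    have o: "W.rings_next \<omega> c v" "current \<omega> B c" using c by (auto simp: S_def W.succeeds_def W.occurs_def)
    show ?thesis
    proof (rule U.rings_before_eqI)
      show "prev_ring \<omega> u (c u) < ring_time \<omega> v (c v)"
        using W.prev_ring_le_last[OF u] W.currentD[OF o(2) v] by (rule le_less_trans)
      show "ring_time \<omega> v (c v) \<le> ring_time \<omega> u (c u)" using o(1) u False unfolding W.rings_next_def
        by (intro less_imp_le) blast
    qed (rule V.ring_pos)
  qed
  have "inj_on (\<lambda>c. c v) S"
  proof (rule inj_onI)
    fix c c' assume c: "c \<in> S" "c' \<in> S" "c v = c' v"
    show "c = c'"
    proof (rule W.counts_eqI)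
      fix u assume u: "u \<in> B"
      show "c u = c' u" using succ[OF c(1) u] succ[OF c(2) u] c(3) by simp
    qed (use c in \<open>auto simp: S_def\<close>)
  qed
  then have "infinite ((\<lambda>c. c v) ` S)" using inf finite_imageD by blast
  then obtain m where "m \<ge> M" "m \<in> (\<lambda>c. c v) ` S" unfolding infinite_nat_iff_unbounded_le by blast
  then obtain c where c: "c \<in> S" "c v \<ge> M" by blast
  have s: "W.occurs b \<xi>' \<omega> c" "coin \<omega> v (c v) = x" using c by (auto simp: S_def W.succeeds_def)
  have "config_before b k \<omega> (ring_time \<omega> v (c v)) u = \<xi> u" if "u \<in> B" for u
    using s(1) that succ[OF c(1) that] by (simp add: config_before_def W.occurs_def \<xi>'_def)
  then show ?thesis using c(2) s(2) by blast
qed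

lemma ex_ring_after:
  assumes "v \<in> slab k"
  obtains M where "\<And>m. m \<ge> M \<Longrightarrow> T \<le> ring_time \<omega> v m"
proof -
  interpret ring_clock \<omega> v by (rule clock[OF assms])
  obtain M where M: "T < ring_time \<omega> v M" using unbounded by blast
  show ?thesis
  proof
    fix m assume "m \<ge> M"
    then have "ring_time \<omega> v M \<le> ring_time \<omega> v m" by (simp add: ring_le_iff)
    then show "T \<le> ring_time \<omega> v m" using M by simp
  qed
qed

lemma window:
  assumes "finite B" "B \<subseteq> slab k" "v \<in> slab k"
  shows "finite (insert v (B \<union> neighbours b k v))" "insert v (B \<union> neighbours b k v) \<subseteq> slab k"
  using assms finite_neighbours neighbours_subset_slab by auto

text \<open>Otherwise the pattern around \<open>v\<close> would recur and be followed infinitely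
  often by a ring of \<open>v\<close>, each of them energy-lowering.\<close>

lemma limit_config_energy_le:
  assumes \<xi>: "\<xi> \<in> limit_configs b k \<omega>" and v: "v \<in> slab k"
  shows "energy b k \<xi> v \<le> 0"
proof (rule ccontr)
  assume pos: "\<not> energy b k \<xi> v \<le> 0"
  let ?B = "insert v ({} \<union> neighbours b k v)"
  note B = window[OF _ _ v, of "{}"]
  have "recurs_on b k \<omega> ?B \<xi>" using \<xi> B unfolding limit_configs_def by simp
  then have "\<exists>m\<ge>M. lowering b k \<omega> v m" for M
  proof -
    obtain m where m: "m \<ge> M" "\<And>u. u \<in> ?B \<Longrightarrow> config_before b k \<omega> (ring_time \<omega> v m) u = \<xi> u"
      using recurring_pattern_rings[OF _ _ _ _ \<open>recurs_on b k \<omega> ?B \<xi>\<close>, of v 1 M] B by auto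
    have "energy b k (config_before b k \<omega> (ring_time \<omega> v m)) v = energy b k \<xi> v"
      by (intro energy_cong m(2)) auto
    then show ?thesis using m(1) pos by (auto simp: lowering_def)
  qed
  then have "infinite {m. lowering b k \<omega> v m}" unfolding infinite_nat_iff_unbounded_le by simp
  then show False using fair v by (simp add: fair_sample_def)
qed

text \<open>The window recurs together with \<open>v\<close> and its neighbours, and infinitely
  often the next ring is one of \<open>v\<close> with coin \<open>- \<xi> v\<close>. At that ring
  time the window shows the flipped pattern.\<close>

lemma limit_config_flip:
  assumes \<xi>: "\<xi> \<in> limit_configs b k \<omega>" and v: "v \<in> slab k" and tie: "energy b k \<xi> v = 0"
  shows "\<xi>(v := - \<xi> v) \<in> limit_configs b k \<omega>"
  unfolding limit_configs_def mem_Collect_eq recurs_on_def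
proof (intro allI impI)
  fix A T assume A: "finite A" "A \<subseteq> slab k"
  let ?B = "insert v (A \<union> neighbours b k v)"
  note B = window[OF A v]
  have rec: "recurs_on b k \<omega> ?B \<xi>" using \<xi> B unfolding limit_configs_def by blast
  have x: "- \<xi> v \<in> {-1, 1}" using limit_config_values[OF \<xi> v] by auto
  obtain M where M: "\<And>m. m \<ge> M \<Longrightarrow> T \<le> ring_time \<omega> v m" using ex_ring_after[OF v, where T = T] by blast
  obtain m where m: "m \<ge> M" "\<And>u. u \<in> ?B \<Longrightarrow> config_before b k \<omega> (ring_time \<omega> v m) u = \<xi> u" "coin \<omega> v m = - \<xi> v"
    using recurring_pattern_rings[OF B _ x rec, of v M] by auto
  have e: "energy b k (config_before b k \<omega> (ring_time \<omega> v m)) v = 0"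
    unfolding tie[symmetric] by (intro energy_cong m(2)) auto
  interpret V: ring_clock \<omega> v by (rule clock[OF v])
  have "config_at b k \<omega> (ring_time \<omega> v m) u = (\<xi>(v := - \<xi> v)) u" if u: "u \<in> A" for u
  proof (cases "u = v")
    case True
    then show ?thesis using ring_spin_Suc[OF v, of m] e m(3) by (simp add: config_at_def updated_spin_def)
  next
    case False
    have us: "u \<in> slab k" using u A by blast
    then show ?thesis using m(2)[of u] u False rings_until_other_ring[OF us v False]
      by (simp add: config_at_def config_before_def)
  qed
  then show "\<exists>t\<ge>T. \<forall>u\<in>A. config_at b k \<omega> t u = (\<xi>(v := - \<xi> v)) u" using M[OF m(1)] by blast
qed

lemma ex_limit_config:
  assumes v: "v \<in> slab k" and I: "infinite I"
  obtains \<xi> where "\<xi> \<in> limit_configs b k \<omega>"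
    "\<And>B. finite B \<Longrightarrow> infinite {m \<in> I. \<forall>u\<in>B. config_at b k \<omega> (ring_time \<omega> v m) u = \<xi> u}"
proof -
  obtain \<xi> where \<xi>: "\<And>B. finite B \<Longrightarrow> infinite {m \<in> I. \<forall>u\<in>B. config_at b k \<omega> (ring_time \<omega> v m) u = \<xi> u}"
    by (rule ex_accumulation_pattern[of "\<lambda>m. config_at b k \<omega> (ring_time \<omega> v m)", OF config_values(1) I]) (rule that)
  have "recurs_on b k \<omega> B \<xi>" if B: "finite B" for B
    unfolding recurs_on_def
  proof
    fix T
    obtain M where M: "\<And>m. m \<ge> M \<Longrightarrow> T \<le> ring_time \<omega> v m" using ex_ring_after[OF v, where T = T] by blast
    obtain m where "m \<ge> M" "\<forall>u\<in>B. config_at b k \<omega> (ring_time \<omega> v m) u = \<xi> u"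
      using \<xi>[OF B] unfolding infinite_nat_iff_unbounded_le by blast
    then show "\<exists>t\<ge>T. \<forall>u\<in>B. config_at b k \<omega> t u = \<xi> u" using M by blast
  qed
  then have "\<xi> \<in> limit_configs b k \<omega>" by (simp add: limit_configs_def)
  then show ?thesis using \<xi> by (rule that)
qed

text \<open>Such a site flips infinitely often, and only finitely many of the flips lower the
  energy. The accumulation point is taken at the remaining flip rings, so it shows the neighbourhood
  just after a flip; there the energy is the negative of the one before, which is zero.\<close>

lemma ex_limit_config_tie:
  assumes k: "2 \<le> k" and v: "v \<in> slab k" and flips: "\<And>M. \<exists>m\<ge>M. ring_spin b k \<omega> v m \<noteq> ring_spin b k \<omega> v M"
  shows "\<exists>\<xi>\<in>limit_configs b k \<omega>. energy b k \<xi> v = 0"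
proof -
  interpret V: ring_clock \<omega> v by (rule clock[OF v])
  define I where "I = {m. ring_spin b k \<omega> v (Suc m) \<noteq> ring_spin b k \<omega> v m} - {m. lowering b k \<omega> v m}"
  have "\<exists>m\<ge>M. ring_spin b k \<omega> v (Suc m) \<noteq> ring_spin b k \<omega> v m" for M
  proof (rule ccontr)
    assume "\<not> (\<exists>m\<ge>M. ring_spin b k \<omega> v (Suc m) \<noteq> ring_spin b k \<omega> v m)"
    then have step: "ring_spin b k \<omega> v (Suc m) = ring_spin b k \<omega> v m" if "m \<ge> M" for m using that by blast
    have "ring_spin b k \<omega> v m = ring_spin b k \<omega> v M" if "m \<ge> M" for m
      using that by (induction m rule: dec_induct) (simp_all add: step)
    then show False using flips[of M] by blast
  qed
  then have "infinite {m. ring_spin b k \<omega> v (Suc m) \<noteq> ring_spin b k \<omega> v m}"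
    unfolding infinite_nat_iff_unbounded_le by simp
  then have I: "infinite I" unfolding I_def using fair v by (simp add: fair_sample_def)
  obtain \<xi> where \<xi>: "\<xi> \<in> limit_configs b k \<omega>"
    "\<And>B. finite B \<Longrightarrow> infinite {m \<in> I. \<forall>u\<in>B. config_at b k \<omega> (ring_time \<omega> v m) u = \<xi> u}"
    by (rule ex_limit_config[OF v I]) (rule that)
  have "infinite {m \<in> I. \<forall>u\<in>insert v (neighbours b k v). config_at b k \<omega> (ring_time \<omega> v m) u = \<xi> u}"
    by (intro \<xi>) (simp add: finite_neighbours)
  then obtain m where m: "m \<in> I" "\<And>u. u \<in> insert v (neighbours b k v) \<Longrightarrow> config_at b k \<omega> (ring_time \<omega> v m) u = \<xi> u"
    unfolding infinite_nat_iff_unbounded_le by blast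
  let ?\<eta> = "config_before b k \<omega> (ring_time \<omega> v m)"
  have before: "?\<eta> v = ring_spin b k \<omega> v m" by (simp add: config_before_def)
  have e: "energy b k ?\<eta> v = 0"
    using m(1) ring_spin_Suc[OF v, of m] before by (auto simp: I_def lowering_def updated_spin_def split: if_splits)
  have at: "\<xi> v = - ?\<eta> v"
  proof -
    have "\<xi> v = ring_spin b k \<omega> v (Suc m)" using m(2)[of v] by (simp add: config_at_def)
    then show ?thesis using m(1) before ring_spin_values[of v m] ring_spin_values[of v "Suc m"] by (auto simp: I_def)
  qed
  have "\<xi> w = ?\<eta> w" if w: "w \<in> neighbours b k v" "w \<noteq> v" for w
  proof -
    have "w \<in> slab k" using w(1) neighbours_subset_slab by blast
    from rings_until_other_ring[OF this v w(2), of m] show ?thesis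
      using m(2)[of w] w(1) by (simp add: config_at_def config_before_def)
  qed
  moreover have "v \<notin> neighbours b k v" using edge_mult_self[OF k] by (simp add: neighbours_def)
  ultimately have \<xi>_eq: "\<xi> w = ?\<eta> w" if "w \<in> neighbours b k v" for w using that by metis
  have "(\<Sum>w\<in>neighbours b k v. int (edge_mult b k v w) * (\<xi> v * \<xi> w))
      = (\<Sum>w\<in>neighbours b k v. - (int (edge_mult b k v w) * (?\<eta> v * ?\<eta> w)))"
  proof (intro sum.cong refl)
    fix w assume "w \<in> neighbours b k v"
    from \<xi>_eq[OF this] at
    show "int (edge_mult b k v w) * (\<xi> v * \<xi> w) = - (int (edge_mult b k v w) * (?\<eta> v * ?\<eta> w))" by simp
  qed
  then have "energy b k \<xi> v = - energy b k ?\<eta> v" by (simp add: energy_def sum_negf)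
  then show ?thesis using \<xi>(1) e by auto
qed

lemma limit_config_fixated:
  assumes const: "\<And>v. v \<in> slab k \<Longrightarrow> \<exists>M. \<forall>m\<ge>M. ring_spin b k \<omega> v m = ring_spin b k \<omega> v M"
    and \<xi>: "\<xi> \<in> limit_configs b k \<omega>" "\<xi>' \<in> limit_configs b k \<omega>" and v: "v \<in> slab k"
  shows "\<xi> v = \<xi>' v"
proof -
  interpret V: ring_clock \<omega> v by (rule clock[OF v])
  obtain M where M: "\<And>m. m \<ge> M \<Longrightarrow> ring_spin b k \<omega> v m = ring_spin b k \<omega> v M" using const[OF v] by blast
  have "\<zeta> v = ring_spin b k \<omega> v M" if \<zeta>: "\<zeta> \<in> limit_configs b k \<omega>" for \<zeta>
  proof -
    obtain T where T: "M \<le> rings_until \<omega> v T" using V.rings_until_ge by blast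
    have "recurs_on b k \<omega> {v} \<zeta>" using \<zeta> v unfolding limit_configs_def by blast
    then obtain t where t: "t \<ge> T" "config_at b k \<omega> t v = \<zeta> v" unfolding recurs_on_def by blast
    then show ?thesis using M[OF order.trans[OF T V.rings_until_mono[OF t(1)]]] by (simp add: config_at_def)
  qed
  from this[OF \<xi>(1)] this[OF \<xi>(2)] show ?thesis by (rule trans[OF _ sym])
qed

text \<open>If all sites fixate, any two limit configurations agree on the slab; but a tie could be
  flipped and would produce a second one.\<close>

lemma limit_config_of_fixation:
  assumes k: "0 < k" and const: "\<And>v. v \<in> slab k \<Longrightarrow> \<exists>M. \<forall>m\<ge>M. ring_spin b k \<omega> v m = ring_spin b k \<omega> v M"
  obtains \<xi> where "\<xi> \<in> limit_configs b k \<omega>" "\<And>v. v \<in> slab k \<Longrightarrow> energy b k \<xi> v < 0"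
proof -
  have o: "(0, 0, 0) \<in> slab k" using k by (simp add: slab_def)
  obtain \<xi> where \<xi>: "\<xi> \<in> limit_configs b k \<omega>" by (rule ex_limit_config[OF o infinite_UNIV_nat]) blast
  have "energy b k \<xi> v \<noteq> 0" if v: "v \<in> slab k" for v
  proof
    assume "energy b k \<xi> v = 0"
    from limit_config_fixated[OF const \<xi> limit_config_flip[OF \<xi> v this] v]
    have "\<xi> v = - \<xi> v" by simp
    then show False using limit_config_values[OF \<xi> v] by auto
  qed
  then show ?thesis using that \<xi> limit_config_energy_le[OF \<xi>] by (meson less_le)
qed

lemma limit_config_frozen:
  assumes v: "v \<in> slab k" and frozen: "\<And>n m. approx_spin b k n \<omega> v m = s"
    and \<xi>: "\<xi> \<in> limit_configs b k \<omega>"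
  shows "\<xi> v = s"
proof -
  have "ring_spin b k \<omega> v m = s" for m using approx_spin_tendsto[OF v, of m] frozen by auto
  moreover have "recurs_on b k \<omega> {v} \<xi>" using \<xi> v unfolding limit_configs_def by blast
  ultimately show ?thesis unfolding recurs_on_def config_at_def by (metis singletonI)
qed

end

section \<open>Ties in periodic slabs of width two and three\<close>

fun edge_ends :: "boundary \<Rightarrow> nat \<Rightarrow> vertex \<Rightarrow> vertex list" where
  "edge_ends b k (x, y, z) = [(x + 1, y, z), (x - 1, y, z), (x, y + 1, z), (x, y - 1, z)] @
     (if z + 1 < k then [(x, y, z + 1)] else if b = Periodic then [(x, y, 0)] else []) @
     (if 0 < z then [(x, y, z - 1)] else if b = Periodic then [(x, y, k - 1)] else [])"

lemma abs_sum_eq_1_iff: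
  fixes a b c :: int
  shows "\<bar>a\<bar> + \<bar>b\<bar> + \<bar>c\<bar> = 1 \<longleftrightarrow> (a = 1 \<or> a = -1) \<and> b = 0 \<and> c = 0 \<or> a = 0 \<and> (b = 1 \<or> b = -1) \<and> c = 0 \<or>
    a = 0 \<and> b = 0 \<and> (c = 1 \<or> c = -1)"
  by (cases "a = 0"; cases "b = 0"; cases "c = 0") auto

text \<open>The list carries multiplicities. In the periodic slab of width two the vertex above and
  the vertex below coincide and are listed twice, which is the double edge.\<close>

lemma count_edge_ends:
  assumes k: "2 \<le> k" and v: "v \<in> slab k" and w: "w \<in> slab k"
  shows "edge_mult b k v w = count_list (edge_ends b k v) w"
proof -
  obtain x y z x' y' z' where vw: "v = (x, y, z)" "w = (x', y', z')" by (cases v; cases w)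
  have z: "z < k" "z' < k" using v w by (auto simp: vw slab_def)
  define P where "P \<longleftrightarrow> w = (x + 1, y, z) \<or> w = (x - 1, y, z) \<or> w = (x, y + 1, z) \<or> w = (x, y - 1, z)"
  define U where "U \<longleftrightarrow> w = (x, y, z + 1)"
  define D where "D \<longleftrightarrow> 0 < z \<and> w = (x, y, z - 1)"
  have h: "l1_dist v w = 1 \<longleftrightarrow> P \<or> U \<or> D"
    unfolding vw l1_dist.simps abs_sum_eq_1_iff P_def U_def D_def by auto
  have hor: "count_list [(x + 1, y, z), (x - 1, y, z), (x, y + 1, z), (x, y - 1, z)] w = of_bool P"
    by (auto simp: P_def)
  have disj: "\<not> (P \<and> U)" "\<not> (P \<and> D)" "\<not> (U \<and> D)" by (auto simp: P_def U_def D_def)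
  have up: "count_list (if z + 1 < k then [(x, y, z + 1)] else if b = Periodic then [(x, y, 0)] else []) w
      = of_bool U + of_bool (b = Periodic \<and> z = k - 1 \<and> w = (x, y, 0))"
    using z k by (auto simp: U_def vw)
  have dn: "count_list (if 0 < z then [(x, y, z - 1)] else if b = Periodic then [(x, y, k - 1)] else []) w
      = of_bool D + of_bool (b = Periodic \<and> z = 0 \<and> w = (x, y, k - 1))"
    using z k by (auto simp: D_def vw)
  have wr: "wraps k v w \<longleftrightarrow> (z = k - 1 \<and> w = (x, y, 0)) \<or> (z = 0 \<and> w = (x, y, k - 1))"
    by (auto simp: vw)
  have "edge_ends b k v = [(x + 1, y, z), (x - 1, y, z), (x, y + 1, z), (x, y - 1, z)] @
     (if z + 1 < k then [(x, y, z + 1)] else if b = Periodic then [(x, y, 0)] else []) @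
     (if 0 < z then [(x, y, z - 1)] else if b = Periodic then [(x, y, k - 1)] else [])" by (simp only: vw edge_ends.simps)
  then show ?thesis
    unfolding edge_mult_def h wr using k disj by (simp only: count_list_append up dn hor) auto
qed

lemma set_edge_ends: "2 \<le> k \<Longrightarrow> v \<in> slab k \<Longrightarrow> set (edge_ends b k v) \<subseteq> slab k"
  by (cases v) (auto simp: slab_def)

lemma sum_list_eq_sum_count_list:
  fixes f :: "'a \<Rightarrow> int"
  assumes "finite X" "set ws \<subseteq> X"
  shows "(\<Sum>w\<leftarrow>ws. f w) = (\<Sum>w\<in>X. int (count_list ws w) * f w)"
  using assms(2)
proof (induction ws)
  case (Cons w ws)
  have "(\<Sum>u\<in>X. int (count_list (w # ws) u) * f u) = (\<Sum>u\<in>X. int (count_list ws u) * f u + (if u = w then f w else 0))"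
    by (intro sum.cong) (auto simp: algebra_simps)
  then show ?case using Cons assms(1) by (simp add: sum.distrib)
qed simp

lemma energy_eq_edge_ends:
  assumes k: "2 \<le> k" and v: "v \<in> slab k"
  shows "energy b k s v = - (\<Sum>w\<leftarrow>edge_ends b k v. s v * s w)"
proof -
  have "w \<in> neighbours b k v \<longleftrightarrow> w \<in> set (edge_ends b k v)" for w
  proof (cases "w \<in> slab k")
    case True
    have "(0 < count_list ws w) = (w \<in> set ws)" for ws :: "vertex list" by (induction ws) auto
    then show ?thesis using True count_edge_ends[OF k v True, of b] by (simp add: neighbours_def)
  next
    case False
    then show ?thesis using set_edge_ends[OF k v, of b] by (auto simp: neighbours_def)
  qed
  then have n: "neighbours b k v = set (edge_ends b k v)" by (rule set_eqI)
  have "(\<Sum>w\<leftarrow>edge_ends b k v. s v * s w) = (\<Sum>w\<in>set (edge_ends b k v). int (count_list (edge_ends b k v) w) * (s v * s w))"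
    by (rule sum_list_eq_sum_count_list) auto
  also have "\<dots> = (\<Sum>w\<in>neighbours b k v. int (edge_mult b k v w) * (s v * s w))"
    unfolding n
  proof (intro sum.cong refl)
    fix w assume "w \<in> set (edge_ends b k v)"
    then have "w \<in> slab k" using set_edge_ends[OF k v, of b] by blast
    from count_edge_ends[OF k v this, of b]
    show "int (count_list (edge_ends b k v) w) * (s v * s w) = int (edge_mult b k v w) * (s v * s w)" by simp
  qed
  finally show ?thesis by (simp add: energy_def)
qed

definition disagreements :: "boundary \<Rightarrow> nat \<Rightarrow> (vertex \<Rightarrow> 'a) \<Rightarrow> vertex \<Rightarrow> nat" where
  "disagreements b k t v = length (filter (\<lambda>w. t w \<noteq> t v) (edge_ends b k v))"

lemma energy_eq_disagreements:
  assumes k: "2 \<le> k" and v: "v \<in> slab k" and s: "\<And>w. w \<in> slab k \<Longrightarrow> s w \<in> {-1, 1}"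
  shows "energy b k s v = 2 * int (disagreements b k s v) - int (length (edge_ends b k v))"
proof -
  have "(\<Sum>w\<leftarrow>ws. s v * s w) = int (length ws) - 2 * int (length (filter (\<lambda>w. s w \<noteq> s v) ws))"
    if "set ws \<subseteq> slab k" for ws
    using that
  proof (induction ws)
    case (Cons w ws)
    then have "w \<in> slab k" by simp
    from s[OF this] s[OF v] have "s v * s w = (if s w \<noteq> s v then -1 else 1)" by auto
    then show ?case using Cons by simp
  qed simp
  from this[OF set_edge_ends[OF k v]] show ?thesis
    unfolding energy_eq_edge_ends[OF k v] disagreements_def by simp
qed

lemma length_edge_ends_periodic [simp]: "length (edge_ends Periodic k v) = 6"
  by (cases v) auto

lemma odd_length_edge_ends_free_2: "v \<in> slab 2 \<Longrightarrow> odd (length (edge_ends Free 2 v))"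
  by (cases v) (auto simp: slab_def less_2_cases_iff)

text \<open>From here on the spins of a configuration are also given as truth values.\<close>

definition tie_closed :: "nat \<Rightarrow> (vertex \<Rightarrow> bool) set \<Rightarrow> bool" where
  "tie_closed k K \<longleftrightarrow> (\<forall>t\<in>K. \<forall>v\<in>slab k. disagreements Periodic k t v \<le> 3 \<and>
     (disagreements Periodic k t v = 3 \<longrightarrow> t(v := \<not> t v) \<in> K))"

lemma tie_closed_flip:
  "tie_closed k K \<Longrightarrow> t \<in> K \<Longrightarrow> v \<in> slab k \<Longrightarrow> 3 \<le> disagreements Periodic k t v \<Longrightarrow> t(v := \<not> t v) \<in> K"
  unfolding tie_closed_def by (metis antisym)

lemma tie_closed_bound: "tie_closed k K \<Longrightarrow> t \<in> K \<Longrightarrow> v \<in> slab k \<Longrightarrow> disagreements Periodic k t v \<le> 3"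
  unfolding tie_closed_def by blast

lemma energy_eq_disagreements_up:
  assumes k: "2 \<le> k" and v: "v \<in> slab k" and s: "\<And>w. w \<in> slab k \<Longrightarrow> s w \<in> {-1, 1}"
  shows "energy Periodic k s v = 2 * int (disagreements Periodic k (\<lambda>v. s v = 1) v) - 6"
proof -
  have "disagreements Periodic k (\<lambda>v. s v = 1) v = disagreements Periodic k s v"
    unfolding disagreements_def
  proof (intro arg_cong[where f = length] filter_cong refl)
    fix w assume "w \<in> set (edge_ends Periodic k v)"
    then have "w \<in> slab k" using set_edge_ends[OF k v] by blast
    from s[OF this] s[OF v] show "((s w = 1) \<noteq> (s v = 1)) = (s w \<noteq> s v)" by auto
  qed
  then show ?thesis using energy_eq_disagreements[OF k v s] by simp
qed

lemma tie_closed_limit_configs: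
  assumes k: "2 \<le> k" and fair: "fair_sample Periodic k \<omega>"
  shows "tie_closed k ((\<lambda>\<xi> v. \<xi> v = 1) ` limit_configs Periodic k \<omega>)"
  unfolding tie_closed_def
proof (intro ballI)
  interpret fair_path Periodic k \<omega> using fair by unfold_locales
  fix t v assume t: "t \<in> (\<lambda>\<xi> v. \<xi> v = 1) ` limit_configs Periodic k \<omega>" and v: "v \<in> slab k"
  obtain \<xi> where \<xi>: "\<xi> \<in> limit_configs Periodic k \<omega>" "t = (\<lambda>v. \<xi> v = 1)" using t by blast
  note vals = limit_config_values[OF \<xi>(1)]
  have e: "energy Periodic k \<xi> v = 2 * int (disagreements Periodic k t v) - 6"
    unfolding \<xi>(2) by (rule energy_eq_disagreements_up[OF k v vals])
  have "disagreements Periodic k t v \<le> 3" using limit_config_energy_le[OF \<xi>(1) v] e by simp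
  moreover have "t(v := \<not> t v) \<in> (\<lambda>\<xi> v. \<xi> v = 1) ` limit_configs Periodic k \<omega>" if "disagreements Periodic k t v = 3"
  proof -
    have "\<xi>(v := - \<xi> v) \<in> limit_configs Periodic k \<omega>" using that e by (intro limit_config_flip \<xi> v) simp
    moreover have "t(v := \<not> t v) = (\<lambda>u. (\<xi>(v := - \<xi> v)) u = 1)" using vals[OF v] by (auto simp: \<xi>(2))
    ultimately show ?thesis by blast
  qed
  ultimately show "disagreements Periodic k t v \<le> 3 \<and> (disagreements Periodic k t v = 3 \<longrightarrow>
      t(v := \<not> t v) \<in> (\<lambda>\<xi> v. \<xi> v = 1) ` limit_configs Periodic k \<omega>)" by blast
qed

text \<open>From what the list \<^term>\<open>A\<close> says about a configuration it follows that the vertices of the path can be flipped one after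
  the other, the last one with a gain of energy.\<close>

fun forces_lowering :: "nat \<Rightarrow> (vertex \<times> bool) list \<Rightarrow> vertex list \<Rightarrow> bool" where
  "forces_lowering k A [] = False"
| "forces_lowering k A (v # vs) = (case map_of A v of None \<Rightarrow> False | Some s \<Rightarrow>
     (let d = length (filter (\<lambda>w. map_of A w = Some (\<not> s)) (edge_ends Periodic k v))
      in snd (snd v) < k \<and> (4 \<le> d \<or> 3 \<le> d \<and> forces_lowering k ((v, \<not> s) # A) vs)))"

text \<open>The disagreements recorded in \<open>A\<close> bound the true ones from below. Four are
  impossible in \<open>K\<close>, and three mean a tie, whose flip stays in \<open>K\<close>; the
  new value is put in front of \<open>A\<close>, where it overrides the old one.\<close>

lemma forces_lowering:
  assumes K: "tie_closed k K" and t: "t \<in> K" and A: "\<And>v s. map_of A v = Some s \<Longrightarrow> t v = s"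
  shows "\<not> forces_lowering k A vs"
  using t A
proof (induction vs arbitrary: A t)
  case (Cons v vs)
  show ?case
  proof
    assume f: "forces_lowering k A (v # vs)"
    then obtain s where s: "map_of A v = Some s" by (cases "map_of A v") auto
    define d where "d = length (filter (\<lambda>w. map_of A w = Some (\<not> s)) (edge_ends Periodic k v))"
    have vs: "v \<in> slab k" "4 \<le> d \<or> 3 \<le> d \<and> forces_lowering k ((v, \<not> s) # A) vs"
      using f s by (auto simp: d_def slab_def Let_def)
    have tv: "t v = s" by (rule Cons.prems(2)[OF s])
    have "length (filter (\<lambda>w. map_of A w = Some (\<not> s)) ws) \<le> length (filter (\<lambda>w. t w \<noteq> s) ws)" for ws
      using Cons.prems(2) by (induction ws) auto
    then have d: "d \<le> disagreements Periodic k t v" by (simp add: d_def disagreements_def tv)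
    then have "3 \<le> d \<and> forces_lowering k ((v, \<not> s) # A) vs"
      using vs(2) tie_closed_bound[OF K Cons.prems(1) vs(1)] by simp
    moreover from this have "t(v := \<not> t v) \<in> K" using d by (intro tie_closed_flip[OF K Cons.prems(1) vs(1)]) simp
    moreover have "(t(v := \<not> t v)) w = s'" if "map_of ((v, \<not> s) # A) w = Some s'" for w s'
      using that Cons.prems(2) tv by (auto split: if_splits)
    ultimately show False using Cons.IH by blast
  qed
qed simp

definition assignment :: "vertex list \<Rightarrow> vertex list \<Rightarrow> (vertex \<times> bool) list" where
  "assignment ps ms = map (\<lambda>v. (v, True)) ps @ map (\<lambda>v. (v, False)) ms"

lemma forces_lowering_assignment:
  assumes K: "tie_closed k K" "t \<in> K" and f: "forces_lowering k (assignment ps ms) vs"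
  shows "\<not> (list_all t ps \<and> list_all (\<lambda>v. \<not> t v) ms)"
proof
  assume h: "list_all t ps \<and> list_all (\<lambda>v. \<not> t v) ms"
  have "t v = s" if "map_of (assignment ps ms) v = Some s" for v s
    using map_of_SomeD[OF that] h by (auto simp: assignment_def list_all_iff)
  from forces_lowering[OF K this] f show False by blast
qed

text \<open>The certificates come from a computer search. In an entry \<open>(ps, ms, vs)\<close>, plus spins at \<open>ps\<close> and minus spins at
  \<open>ms\<close> permit the flips along \<open>vs\<close>, the last of which would lower the energy. Propositionally, the entries together
  refute the given tie.\<close>

definition certificate_2 :: "(vertex list \<times> vertex list \<times> vertex list) list" where
  "certificate_2 = [
    ([(-1, 0, 1), (-1, 1, 1), (0, 0, 0), (0, 1, 1)],
      [(0, 1, 0), (-1, 1, 0), (-1, 0, 0)],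
      [(-1, 0, 0), (-1, 1, 0), (0, 1, 0)]),
    ([(0, 0, 0), (0, 1, 1), (1, 0, 1), (1, 1, 1)],
      [(1, 1, 0), (1, 0, 0), (0, 1, 0)],
      [(0, 1, 0), (1, 0, 0), (1, 1, 0)]),
    ([(0, 0, 0), (0, 0, 1)],
      [(1, 0, 1), (1, 0, 0), (0, 1, 0), (-1, 0, 1), (-1, 0, 0)],
      [(0, 0, 0), (0, 0, 1)]),
    ([(0, 0, 0), (0, 0, 1)],
      [(1, 0, 0), (0, 1, 1), (0, 1, 0), (-1, 0, 1), (-1, 0, 0)],
      [(0, 0, 0), (0, 0, 1)]),
    ([(-1, -1, 1), (-1, 0, 1), (0, -1, 0), (0, 0, 0)],
      [(-1, 0, 0), (-1, -1, 0)],
      [(-1, -1, 0), (-1, 0, 0)]),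
    ([(0, -1, 0), (0, 0, 0), (1, -1, 1), (1, 0, 1)],
      [(1, 0, 0), (1, -1, 0)],
      [(1, -1, 0), (1, 0, 0)]),
    ([(-1, 0, 1), (-1, 1, 1)],
      [(0, 1, 1), (-1, 1, 0), (-1, 0, 0), (-1, -1, 1)],
      [(-1, 0, 1), (-1, 1, 1)]),
    ([(0, 0, 0), (1, -1, 0), (1, 0, 1)],
      [(1, 0, 0)],
      [(1, 0, 0)]),
    ([(-1, 0, 1)],
      [(-1, 1, 1), (-1, 0, 0), (-1, -1, 1)],
      [(-1, 0, 1)]),
    ([(1, 0, 1)],
      [(1, 1, 1), (1, 0, 0), (1, -1, 1)],
      [(1, 0, 1)]),
    ([(-1, -1, 0), (-1, 0, 1), (0, 0, 0)],
      [(-1, 0, 0)],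
      [(-1, 0, 0)]),
    ([(-1, 0, 1), (-1, 1, 0), (0, 0, 0)],
      [(-1, 0, 0)],
      [(-1, 0, 0)]),
    ([(0, 0, 0), (0, 1, 1), (1, 1, 0)],
      [(0, 1, 0)],
      [(0, 1, 0)])]"

lemma certificate_2: "list_all (\<lambda>(ps, ms, vs). forces_lowering 2 (assignment ps ms) vs) certificate_2"
  unfolding certificate_2_def by code_simp

text \<open>The normal form of a tie in width two: a uniform column over the origin, with exactly
  one agreeing horizontal neighbour in layer 0.\<close>

lemma no_tie_2:
  assumes K: "tie_closed 2 K" and t: "t \<in> K"
    and o: "t (0, 0, 0)" "t (0, 0, 1)" "\<not> t (1, 0, 0)" "\<not> t (-1, 0, 0)" "\<not> t (0, 1, 0)" "t (0, -1, 0)"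
  shows False
proof -
  have c: "list_all (\<lambda>(ps, ms, vs). \<not> (list_all t ps \<and> list_all (\<lambda>v. \<not> t v) ms)) certificate_2"
    using certificate_2 forces_lowering_assignment[OF K t] unfolding list_all_iff by blast
  \<comment> \<open>Each entry has become a clause about truth values of \<open>t\<close>; together
    with \<open>o\<close> the clauses are propositionally unsatisfiable.\<close>
  show False using c[unfolded certificate_2_def, simplified list.pred_inject prod.case simp_thms] o by sat
qed

definition certificate_3 :: "(vertex list \<times> vertex list \<times> vertex list) list" where
  "certificate_3 = [
    ([(0, -1, 0), (0, -1, 1), (0, -1, 2), (0, 0, 0)],
      [(1, 0, 0), (1, -1, 2), (1, -1, 1), (1, -1, 0), (0, 1, 0), (-1, 0, 0), (-1, -1, 2), (-1, -1, 1), (-1, -1, 0)],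
      [(0, 0, 0), (0, -1, 0), (0, -1, 1), (0, -1, 2)]),
    ([(0, -1, 0), (0, -1, 1), (0, 0, 0), (0, 0, 1)],
      [(1, 0, 1), (1, 0, 0), (1, -1, 1), (1, -1, 0), (0, 1, 1), (0, 1, 0), (-1, 0, 0), (-1, -1, 1), (-1, -1, 0)],
      [(0, 0, 0), (0, -1, 0), (0, -1, 1), (0, 0, 1)]),
    ([(0, -1, 0), (0, -1, 2), (0, 0, 0), (0, 0, 2)],
      [(1, 0, 0), (1, -1, 2), (1, -1, 0), (0, 1, 2), (0, 1, 0), (-1, 0, 2), (-1, 0, 0), (-1, -1, 2), (-1, -1, 0)],
      [(0, 0, 0), (0, -1, 0), (0, -1, 2), (0, 0, 2)]),
    ([(0, -1, 0), (0, -1, 1), (0, 0, 0), (0, 0, 1)],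
      [(1, 0, 0), (1, -1, 1), (1, -1, 0), (0, 1, 1), (0, 1, 0), (-1, 0, 1), (-1, 0, 0), (-1, -1, 1), (-1, -1, 0)],
      [(0, 0, 0), (0, -1, 0), (0, -1, 1), (0, 0, 1)]),
    ([(0, -1, 0), (0, -1, 2), (0, 0, 0), (0, 0, 2)],
      [(1, 0, 2), (1, 0, 0), (1, -1, 2), (1, -1, 0), (0, 1, 2), (0, 1, 0), (-1, 0, 0), (-1, -1, 2), (-1, -1, 0)],
      [(0, 0, 0), (0, -1, 0), (0, -1, 2), (0, 0, 2)]),
    ([(-1, 0, 1), (-1, 0, 2), (-1, 1, 2), (0, 1, 2)],
      [(1, 1, 2), (0, 1, 1), (0, 1, 0), (-1, 1, 1), (-1, 1, 0), (-1, 0, 0), (-1, -1, 2), (-1, -1, 1)],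
      [(-1, 0, 1), (-1, 0, 2), (-1, 1, 2), (0, 1, 2)]),
    ([(-1, 0, 1), (0, 0, 0), (0, 0, 1), (1, 0, 1)],
      [(1, 1, 1), (1, 0, 2), (1, 0, 0), (0, 1, 1), (0, 1, 0), (-1, 1, 1), (-1, 0, 0), (-1, -1, 1)],
      [(-1, 0, 1), (0, 0, 0), (0, 0, 1), (1, 0, 1)]),
    ([(0, 1, 2), (1, 0, 1), (1, 0, 2), (1, 1, 2)],
      [(1, 1, 1), (1, 1, 0), (1, 0, 0), (1, -1, 2), (1, -1, 1), (0, 1, 1), (0, 1, 0), (-1, 1, 2)],
      [(0, 1, 2), (1, 0, 1), (1, 0, 2), (1, 1, 2)]),
    ([(0, 0, 0), (0, 0, 1), (1, 0, 1), (1, 1, 1)],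
      [(1, 1, 2), (1, 1, 0), (1, 0, 2), (1, 0, 0), (0, 1, 1), (0, 1, 0), (-1, 0, 1), (-1, 0, 0)],
      [(0, 0, 0), (0, 0, 1), (1, 0, 1), (1, 1, 1)]),
    ([(-1, 0, 1), (-1, 1, 1), (0, 0, 0), (0, 0, 1)],
      [(1, 0, 1), (1, 0, 0), (0, 1, 1), (0, 1, 0), (-1, 1, 2), (-1, 1, 0), (-1, 0, 2), (-1, 0, 0)],
      [(-1, 1, 1), (-1, 0, 1), (0, 0, 0), (0, 0, 1)]),
    ([(-1, 0, 1), (-1, 0, 2), (-1, 1, 1), (-1, 1, 2), (0, 0, 0), (0, 0, 1), (0, 1, 2)],
      [(0, 1, 1), (0, 1, 0), (-1, 1, 0), (-1, 0, 0)],
      [(-1, 0, 0), (-1, 1, 0), (0, 1, 0), (0, 1, 1)]),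
    ([(-1, -1, 1), (-1, 0, 1), (-1, 1, 2), (0, -1, 0), (0, -1, 2), (0, 0, 0), (0, 0, 2)],
      [(-1, 0, 2), (-1, 0, 0), (-1, -1, 2), (-1, -1, 0)],
      [(-1, 0, 2), (-1, -1, 2), (-1, -1, 0), (-1, 0, 0)]),
    ([(0, 0, 0), (0, 0, 1), (0, 0, 2), (1, 0, 2)],
      [(1, 0, 1), (1, 0, 0), (1, -1, 2), (0, 1, 1), (0, 1, 0), (-1, 0, 2), (-1, 0, 0)],
      [(0, 0, 0), (0, 0, 1), (0, 0, 2), (1, 0, 2)]),
    ([(0, 0, 0), (0, 0, 1), (0, 1, 2), (1, 0, 1), (1, 0, 2), (1, 1, 1), (1, 1, 2)],
      [(1, 1, 0), (1, 0, 0), (0, 1, 1), (0, 1, 0)],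
      [(0, 1, 1), (0, 1, 0), (1, 0, 0), (1, 1, 0)]),
    ([(0, -1, 0), (0, -1, 2), (0, 0, 0), (0, 0, 2), (1, -1, 1), (1, 0, 1), (1, 1, 2)],
      [(1, 0, 2), (1, 0, 0), (1, -1, 2), (1, -1, 0)],
      [(1, 0, 2), (1, -1, 2), (1, -1, 0), (1, 0, 0)]),
    ([(0, 0, 0), (0, 0, 1), (0, 0, 2)],
      [(1, 0, 2), (1, 0, 1), (1, 0, 0), (0, 1, 1), (0, 1, 0), (-1, 0, 2), (-1, 0, 0)],
      [(0, 0, 0), (0, 0, 1), (0, 0, 2)]),
    ([(0, 0, 0), (0, 0, 1), (0, 0, 2)],
      [(1, 0, 2), (1, 0, 1), (1, 0, 0), (0, 1, 1), (0, 1, 0), (0, -1, 2), (-1, 0, 0)],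
      [(0, 0, 0), (0, 0, 1), (0, 0, 2)]),
    ([(0, 0, 0), (0, 0, 2), (0, 1, 2)],
      [(1, 1, 2), (1, 0, 2), (1, 0, 0), (0, 1, 1), (0, 1, 0), (0, -1, 2), (-1, 0, 0)],
      [(0, 0, 0), (0, 0, 2), (0, 1, 2)]),
    ([(-1, 0, 1), (0, 0, 0), (0, 0, 1)],
      [(1, 0, 1), (1, 0, 0), (0, 1, 1), (0, 1, 0), (-1, 1, 1), (-1, 0, 0), (-1, -1, 1)],
      [(-1, 0, 1), (0, 0, 0), (0, 0, 1)]),
    ([(0, 0, 0), (0, 0, 1), (0, 0, 2)],
      [(1, 0, 2), (1, 0, 1), (1, 0, 0), (0, 1, 2), (0, 1, 1), (0, 1, 0), (-1, 0, 0)],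
      [(0, 0, 0), (0, 0, 1), (0, 0, 2)]),
    ([(-1, 0, 1), (0, 0, 0), (0, 0, 1)],
      [(1, 0, 1), (1, 0, 0), (0, 1, 1), (0, 1, 0), (-1, 1, 1), (-1, 0, 2), (-1, 0, 0)],
      [(-1, 0, 1), (0, 0, 0), (0, 0, 1)]),
    ([(0, -1, 0), (0, 0, 0), (1, -1, 0)],
      [(1, 0, 0), (1, -1, 2), (1, -1, 1), (0, 1, 0), (0, -1, 2), (-1, 0, 0), (-1, -1, 0)],
      [(0, 0, 0), (0, -1, 0), (1, -1, 0)]),
    ([(0, 0, 0), (0, 0, 1), (1, 0, 1)],
      [(1, 1, 1), (1, 0, 2), (1, 0, 0), (0, 1, 1), (0, 1, 0), (-1, 0, 1), (-1, 0, 0)],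
      [(0, 0, 0), (0, 0, 1), (1, 0, 1)]),
    ([(0, 0, 0), (0, 0, 1), (0, 0, 2)],
      [(1, 0, 0), (0, 1, 2), (0, 1, 1), (0, 1, 0), (-1, 0, 2), (-1, 0, 1), (-1, 0, 0)],
      [(0, 0, 0), (0, 0, 1), (0, 0, 2)]),
    ([(-1, -1, 0), (0, -1, 0), (0, 0, 0)],
      [(1, 0, 0), (1, -1, 0), (0, 1, 0), (0, -1, 2), (-1, 0, 0), (-1, -1, 2), (-1, -1, 1)],
      [(-1, -1, 0), (0, -1, 0), (0, 0, 0)]),
    ([(0, 0, 0), (0, 0, 1), (0, 0, 2)],
      [(1, 0, 0), (0, 1, 1), (0, 1, 0), (0, -1, 2), (-1, 0, 2), (-1, 0, 1), (-1, 0, 0)],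
      [(0, 0, 0), (0, 0, 1), (0, 0, 2)]),
    ([(0, 0, 0), (0, 0, 1), (1, 0, 1)],
      [(1, 1, 1), (1, 0, 0), (1, -1, 1), (0, 1, 1), (0, 1, 0), (-1, 0, 1), (-1, 0, 0)],
      [(0, 0, 0), (0, 0, 1), (1, 0, 1)]),
    ([(0, 0, 0), (0, 0, 2), (0, 1, 2)],
      [(1, 0, 0), (0, 1, 1), (0, 1, 0), (0, -1, 2), (-1, 1, 2), (-1, 0, 2), (-1, 0, 0)],
      [(0, 0, 0), (0, 0, 2), (0, 1, 2)]),
    ([(0, 0, 0), (0, 0, 2), (0, 1, 2)],
      [(1, 1, 2), (1, 0, 2), (1, 0, 0), (0, 1, 1), (0, 1, 0), (-1, 0, 2), (-1, 0, 0)],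
      [(0, 0, 0), (0, 0, 2), (0, 1, 2)]),
    ([(0, 0, 0), (0, 0, 1), (0, 0, 2)],
      [(1, 0, 1), (1, 0, 0), (0, 1, 2), (0, 1, 1), (0, 1, 0), (-1, 0, 2), (-1, 0, 0)],
      [(0, 0, 0), (0, 0, 1), (0, 0, 2)]),
    ([(0, 0, 0), (0, 0, 1), (1, 0, 1)],
      [(1, 0, 2), (1, 0, 0), (1, -1, 1), (0, 1, 1), (0, 1, 0), (-1, 0, 1), (-1, 0, 0)],
      [(0, 0, 0), (0, 0, 1), (1, 0, 1)]),
    ([(0, 0, 0), (0, 0, 2), (0, 1, 2)],
      [(1, 0, 2), (1, 0, 0), (0, 1, 1), (0, 1, 0), (-1, 1, 2), (-1, 0, 2), (-1, 0, 0)],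
      [(0, 0, 0), (0, 0, 2), (0, 1, 2)]),
    ([(0, 0, 0), (0, 0, 1), (0, 0, 2)],
      [(1, 0, 2), (1, 0, 0), (0, 1, 2), (0, 1, 1), (0, 1, 0), (-1, 0, 1), (-1, 0, 0)],
      [(0, 0, 0), (0, 0, 1), (0, 0, 2)]),
    ([(-1, 1, 0), (-1, 1, 1), (0, 0, 0), (0, 0, 1), (0, 0, 2), (1, 1, 1), (1, 1, 2)],
      [(0, 1, 2), (0, 1, 1), (0, 1, 0)],
      [(0, 1, 1), (0, 1, 0), (0, 1, 2)]),
    ([(-1, -1, 1), (-1, 0, 1), (-1, 0, 2), (0, -1, 0), (0, -1, 2), (0, 0, 0)],
      [(-1, 0, 0), (-1, -1, 2), (-1, -1, 0)],
      [(-1, -1, 2), (-1, -1, 0), (-1, 0, 0)]),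
    ([(0, -1, 0), (0, -1, 2), (0, 0, 0), (1, -1, 1), (1, 0, 1), (1, 0, 2)],
      [(1, 0, 0), (1, -1, 2), (1, -1, 0)],
      [(1, -1, 2), (1, -1, 0), (1, 0, 0)]),
    ([(-1, -1, 2), (-1, 0, 1), (-1, 0, 2), (0, -1, 0), (0, -1, 1), (0, 0, 0)],
      [(-1, 0, 0), (-1, -1, 1), (-1, -1, 0)],
      [(-1, -1, 1), (-1, -1, 0), (-1, 0, 0)]),
    ([(-1, 0, 1), (-1, 0, 2), (-1, 1, 1)],
      [(0, 1, 1), (-1, 1, 2), (-1, 1, 0), (-1, 0, 0), (-1, -1, 2), (-1, -1, 1)],
      [(-1, 0, 2), (-1, 0, 1), (-1, 1, 1)]),
    ([(1, 0, 1), (1, 0, 2), (1, 1, 1)],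
      [(1, 1, 2), (1, 1, 0), (1, 0, 0), (1, -1, 2), (1, -1, 1), (0, 1, 1)],
      [(1, 0, 2), (1, 0, 1), (1, 1, 1)]),
    ([(0, -1, 0), (0, -1, 1), (0, 0, 0), (1, -1, 2), (1, 0, 1), (1, 0, 2)],
      [(1, 0, 0), (1, -1, 1), (1, -1, 0)],
      [(1, -1, 1), (1, -1, 0), (1, 0, 0)]),
    ([(-1, -1, 0), (-1, -1, 1), (-1, 0, 1), (0, -1, 2), (0, 0, 0), (0, 0, 2)],
      [(-1, 0, 2), (-1, 0, 0), (-1, -1, 2)],
      [(-1, -1, 2), (-1, 0, 0), (-1, 0, 2)]),
    ([(0, -1, 0), (0, 0, 0), (0, 0, 1), (1, -1, 1), (1, -1, 2), (1, 0, 2)],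
      [(1, 0, 1), (1, 0, 0), (1, -1, 0)],
      [(1, -1, 0), (1, 0, 0), (1, 0, 1)]),
    ([(0, -1, 2), (0, 0, 0), (0, 0, 2), (1, -1, 0), (1, -1, 1), (1, 0, 1)],
      [(1, 0, 2), (1, 0, 0), (1, -1, 2)],
      [(1, -1, 2), (1, 0, 0), (1, 0, 2)]),
    ([(-1, -1, 0), (-1, -1, 2), (-1, 0, 2), (0, -1, 1), (0, 0, 0), (0, 0, 1)],
      [(-1, 0, 1), (-1, 0, 0), (-1, -1, 1)],
      [(-1, -1, 1), (-1, 0, 0), (-1, 0, 1)]),
    ([(-1, -1, 1), (-1, -1, 2), (-1, 0, 1), (0, -1, 0), (0, 0, 0), (0, 0, 2)],
      [(-1, 0, 2), (-1, 0, 0), (-1, -1, 0)],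
      [(-1, -1, 0), (-1, 0, 0), (-1, 0, 2)]),
    ([(0, -1, 1), (0, 0, 0), (0, 0, 1), (1, -1, 0), (1, -1, 2), (1, 0, 2)],
      [(1, 0, 1), (1, 0, 0), (1, -1, 1)],
      [(1, -1, 1), (1, 0, 0), (1, 0, 1)]),
    ([(0, -1, 0), (0, 0, 0), (0, 0, 2), (1, -1, 1), (1, -1, 2), (1, 0, 1)],
      [(1, 0, 2), (1, 0, 0), (1, -1, 0)],
      [(1, -1, 0), (1, 0, 0), (1, 0, 2)]),
    ([(-1, -1, 1), (-1, -1, 2), (-1, 0, 2), (0, -1, 0), (0, 0, 0), (0, 0, 1)],
      [(-1, 0, 1), (-1, 0, 0), (-1, -1, 0)],
      [(-1, -1, 0), (-1, 0, 0), (-1, 0, 1)]),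
    ([(0, 0, 0), (0, 0, 1)],
      [(1, 0, 1), (1, 0, 0), (0, 1, 1), (0, 1, 0), (-1, 0, 1), (-1, 0, 0)],
      [(0, 0, 0), (0, 0, 1)]),
    ([(0, -1, 0), (0, 0, 0)],
      [(1, 0, 0), (1, -1, 0), (0, 1, 0), (0, -1, 2), (-1, 0, 0), (-1, -1, 0)],
      [(0, -1, 0), (0, 0, 0)]),
    ([(1, 0, 1), (1, 1, 1)],
      [(1, 1, 2), (1, 1, 0), (1, 0, 2), (1, 0, 0), (1, -1, 1), (0, 1, 1)],
      [(1, 0, 1), (1, 1, 1)]),
    ([(0, -1, 0), (0, 0, 0)],
      [(1, 0, 0), (1, -1, 0), (0, 1, 0), (0, -1, 1), (-1, 0, 0), (-1, -1, 0)],
      [(0, -1, 0), (0, 0, 0)]),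
    ([(0, 0, 0), (0, 0, 1)],
      [(1, 0, 1), (1, 0, 0), (0, 1, 1), (0, 1, 0), (0, -1, 1), (-1, 0, 0)],
      [(0, 0, 0), (0, 0, 1)]),
    ([(-1, 0, 1), (-1, 1, 1)],
      [(0, 1, 1), (-1, 1, 2), (-1, 1, 0), (-1, 0, 2), (-1, 0, 0), (-1, -1, 1)],
      [(-1, 0, 1), (-1, 1, 1)]),
    ([(-1, -1, 1), (-1, -1, 2), (-1, 0, 1), (-1, 0, 2), (0, -1, 0), (0, 0, 0)],
      [(-1, 0, 0), (-1, -1, 0)],
      [(-1, -1, 0), (-1, 0, 0)]),
    ([(-1, 1, 1), (-1, 1, 2), (0, 0, 1), (0, 0, 2), (1, 1, 1), (1, 1, 2)],
      [(0, 1, 2), (0, 1, 1)],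
      [(0, 1, 1), (0, 1, 2)]),
    ([(-1, 0, 2), (-1, 1, 2)],
      [(0, 1, 2), (-1, 1, 1), (-1, 1, 0), (-1, 0, 1), (-1, 0, 0), (-1, -1, 2)],
      [(-1, 0, 2), (-1, 1, 2)]),
    ([(0, 0, 0), (0, 0, 1)],
      [(1, 0, 0), (0, 1, 1), (0, 1, 0), (0, -1, 1), (-1, 0, 1), (-1, 0, 0)],
      [(0, 0, 0), (0, 0, 1)]),
    ([(0, 0, 0), (0, 0, 2)],
      [(1, 0, 2), (1, 0, 0), (0, 1, 2), (0, 1, 0), (0, -1, 2), (-1, 0, 0)],
      [(0, 0, 0), (0, 0, 2)]),
    ([(1, 0, 2), (1, 1, 2)],
      [(1, 1, 1), (1, 1, 0), (1, 0, 1), (1, 0, 0), (1, -1, 2), (0, 1, 2)],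
      [(1, 0, 2), (1, 1, 2)]),
    ([(0, 0, 0), (0, 0, 2)],
      [(1, 0, 0), (0, 1, 2), (0, 1, 0), (0, -1, 2), (-1, 0, 2), (-1, 0, 0)],
      [(0, 0, 0), (0, 0, 2)]),
    ([(0, -1, 0), (0, 0, 0), (1, -1, 1), (1, -1, 2), (1, 0, 1), (1, 0, 2)],
      [(1, 0, 0), (1, -1, 0)],
      [(1, -1, 0), (1, 0, 0)]),
    ([(-1, -1, 0), (-1, 0, 1), (-1, 1, 2), (0, 0, 0), (0, 0, 2)],
      [(-1, 0, 2), (-1, 0, 0)],
      [(-1, 0, 0), (-1, 0, 2)]),
    ([(-1, -1, 1), (-1, 0, 2), (-1, 1, 0), (0, 0, 0), (0, 0, 1)],
      [(-1, 0, 1), (-1, 0, 0)],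
      [(-1, 0, 0), (-1, 0, 1)]),
    ([(0, 0, 0), (0, 0, 1), (1, -1, 0), (1, -1, 1), (1, 0, 2)],
      [(1, 0, 1), (1, 0, 0)],
      [(1, 0, 0), (1, 0, 1)]),
    ([(0, 0, 0), (0, 0, 2), (1, -1, 0), (1, 0, 1), (1, 1, 2)],
      [(1, 0, 2), (1, 0, 0)],
      [(1, 0, 0), (1, 0, 2)]),
    ([(-1, 1, 0), (-1, 1, 1), (0, 0, 0), (0, 0, 1), (0, 1, 2)],
      [(0, 1, 1), (0, 1, 0)],
      [(0, 1, 0), (0, 1, 1)]),
    ([(0, 0, 0), (0, 0, 2), (1, -1, 0), (1, -1, 2), (1, 0, 1)],
      [(1, 0, 2), (1, 0, 0)],
      [(1, 0, 0), (1, 0, 2)]),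
    ([(-1, 1, 0), (0, 0, 0), (0, 0, 1), (0, 1, 2), (1, 1, 1)],
      [(0, 1, 1), (0, 1, 0)],
      [(0, 1, 0), (0, 1, 1)]),
    ([(0, 0, 0), (0, 0, 1), (1, -1, 1), (1, 0, 2), (1, 1, 0)],
      [(1, 0, 1), (1, 0, 0)],
      [(1, 0, 0), (1, 0, 1)]),
    ([(-1, -1, 0), (-1, -1, 1), (-1, 0, 2), (0, 0, 0), (0, 0, 1)],
      [(-1, 0, 1), (-1, 0, 0)],
      [(-1, 0, 0), (-1, 0, 1)]),
    ([(0, 0, 0), (0, 0, 1), (0, 1, 2), (1, 1, 0), (1, 1, 1)],
      [(0, 1, 1), (0, 1, 0)],
      [(0, 1, 0), (0, 1, 1)]),
    ([(0, 0, 0), (0, 0, 2), (1, -1, 2), (1, 0, 1), (1, 1, 0)],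
      [(1, 0, 2), (1, 0, 0)],
      [(1, 0, 0), (1, 0, 2)]),
    ([(-1, -1, 2), (-1, 0, 1), (-1, 1, 0), (0, 0, 0), (0, 0, 2)],
      [(-1, 0, 2), (-1, 0, 0)],
      [(-1, 0, 0), (-1, 0, 2)]),
    ([(-1, -1, 0), (-1, -1, 2), (-1, 0, 1), (0, 0, 0), (0, 0, 2)],
      [(-1, 0, 2), (-1, 0, 0)],
      [(-1, 0, 0), (-1, 0, 2)]),
    ([(0, 0, 0), (1, -1, 0), (1, 0, 1), (1, 0, 2)],
      [(1, 0, 0)],
      [(1, 0, 0)]),
    ([(0, 0, 0), (1, 0, 1), (1, 0, 2), (1, 1, 0)],
      [(1, 0, 0)],
      [(1, 0, 0)]),
    ([(-1, -1, 0), (-1, 0, 1), (-1, 1, 0), (0, 0, 0)],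
      [(-1, 0, 0)],
      [(-1, 0, 0)]),
    ([(-1, 0, 2)],
      [(-1, 1, 2), (-1, 0, 1), (-1, 0, 0), (-1, -1, 2)],
      [(-1, 0, 2)]),
    ([(0, 1, 2)],
      [(1, 1, 2), (0, 1, 1), (0, 1, 0), (-1, 1, 2)],
      [(0, 1, 2)]),
    ([(-1, -1, 0), (-1, 0, 1), (-1, 0, 2), (0, 0, 0)],
      [(-1, 0, 0)],
      [(-1, 0, 0)]),
    ([(1, 0, 1)],
      [(1, 1, 1), (1, 0, 2), (1, 0, 0), (1, -1, 1)],
      [(1, 0, 1)]),
    ([(-1, 0, 1)],
      [(-1, 1, 1), (-1, 0, 2), (-1, 0, 0), (-1, -1, 1)],
      [(-1, 0, 1)]),
    ([(0, 0, 2), (1, -1, 2), (1, 0, 1), (1, 1, 2)],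
      [(1, 0, 2)],
      [(1, 0, 2)]),
    ([(0, 0, 0), (1, -1, 0), (1, 0, 1), (1, 1, 0)],
      [(1, 0, 0)],
      [(1, 0, 0)]),
    ([(0, 0, 0), (1, -1, 0), (1, 0, 2), (1, 1, 0)],
      [(1, 0, 0)],
      [(1, 0, 0)]),
    ([(1, 0, 2)],
      [(1, 1, 2), (1, 0, 1), (1, 0, 0), (1, -1, 2)],
      [(1, 0, 2)]),
    ([(-1, -1, 0), (-1, 0, 2), (-1, 1, 0), (0, 0, 0)],
      [(-1, 0, 0)],
      [(-1, 0, 0)]),
    ([(-1, -1, 2), (-1, 0, 1), (-1, 1, 2), (0, 0, 2)],
      [(-1, 0, 2)],
      [(-1, 0, 2)])]"

lemma certificate_3: "list_all (\<lambda>(ps, ms, vs). forces_lowering 3 (assignment ps ms) vs) certificate_3"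
  unfolding certificate_3_def by code_simp

text \<open>The last hypothesis singles out the case that finitely many vertices refute. If it
  fails, and likewise in layer 2, then the tie passes on to the next column.\<close>

lemma no_tie_3:
  assumes K: "tie_closed 3 K" and t: "t \<in> K"
    and o: "t (0, 0, 0)" "t (0, 0, 1)" "t (0, 0, 2)"
      "\<not> t (1, 0, 0)" "\<not> t (-1, 0, 0)" "\<not> t (0, 1, 0)" "t (0, -1, 0)" "\<not> t (0, 1, 1)"
  shows False
proof -
  have c: "list_all (\<lambda>(ps, ms, vs). \<not> (list_all t ps \<and> list_all (\<lambda>v. \<not> t v) ms)) certificate_3"
    using certificate_3 forces_lowering_assignment[OF K t] unfolding list_all_iff by blast
  show False using c[unfolded certificate_3_def, simplified list.pred_inject prod.case simp_thms] o by sat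
qed

section \<open>Symmetries of the periodic slab\<close>

definition cell :: "int \<times> int \<Rightarrow> nat \<Rightarrow> vertex" where
  "cell p z = (fst p, snd p, z)"

text \<open>The pairs of orthogonal unit vectors, that is, the images of the two coordinate
  directions under the eight lattice symmetries that fix a point.\<close>

definition frames :: "((int \<times> int) \<times> (int \<times> int)) set" where
  "frames = {((1, 0), (0, 1)), ((1, 0), (0, -1)), ((-1, 0), (0, 1)), ((-1, 0), (0, -1)),
     ((0, 1), (1, 0)), ((0, 1), (-1, 0)), ((0, -1), (1, 0)), ((0, -1), (-1, 0))}"

text \<open>A multiset is compared because in width two the layers above and below coincide and have
  to be counted twice.\<close>

definition layers :: "nat \<Rightarrow> nat \<Rightarrow> nat \<Rightarrow> nat \<Rightarrow> bool" where
  "layers k z z1 z2 \<longleftrightarrow> {#z1, z2#} = {#if z + 1 < k then z + 1 else 0, if 0 < z then z - 1 else k - 1#}"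

lemma cell_eq_iff [simp]: "cell p z = cell q y \<longleftrightarrow> p = q \<and> z = y"
  by (auto simp: cell_def prod_eq_iff)

lemma cell_slab [simp]: "cell p z \<in> slab k \<longleftrightarrow> z < k"
  by (simp add: cell_def slab_def)

lemma mset_edge_ends:
  assumes "(e, f) \<in> frames" "layers k z z1 z2"
  shows "mset (edge_ends Periodic k (cell p z)) = {#cell (p + e) z, cell (p - e) z, cell (p + f) z, cell (p - f) z, cell p z1, cell p z2#}"
proof -
  obtain x y where p: "p = (x, y)" by (cases p)
  have "mset (edge_ends Periodic k (cell p z)) = {#(x + 1, y, z), (x - 1, y, z), (x, y + 1, z), (x, y - 1, z)#} +
      image_mset (cell p) {#if z + 1 < k then z + 1 else 0, if 0 < z then z - 1 else k - 1#}"
    by (auto simp: cell_def p)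
  also have "{#if z + 1 < k then z + 1 else 0, if 0 < z then z - 1 else k - 1#} = {#z1, z2#}"
    using assms(2) by (simp only: layers_def)
  also have "{#(x + 1, y, z), (x - 1, y, z), (x, y + 1, z), (x, y - 1, z)#} = {#cell (p + e) z, cell (p - e) z, cell (p + f) z, cell (p - f) z#}"
    using assms(1) unfolding frames_def p cell_def by (elim insertE emptyE) (simp_all add: add_mset_commute)
  finally show ?thesis by simp
qed

lemma disagreements_eq:
  assumes "(e, f) \<in> frames" "layers k z z1 z2"
  shows "disagreements Periodic k t (cell p z) =
     of_bool (t (cell (p + e) z) \<noteq> t (cell p z)) + of_bool (t (cell (p - e) z) \<noteq> t (cell p z)) +
     of_bool (t (cell (p + f) z) \<noteq> t (cell p z)) + of_bool (t (cell (p - f) z) \<noteq> t (cell p z)) +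
     of_bool (t (cell p z1) \<noteq> t (cell p z)) + of_bool (t (cell p z2) \<noteq> t (cell p z))"
proof -
  have size: "size (filter_mset P M) = (\<Sum>x\<in>#M. of_bool (P x))" for P and M :: "vertex multiset"
    by (induction M) auto
  have "disagreements Periodic k t (cell p z) = size (filter_mset (\<lambda>w. t w \<noteq> t (cell p z)) (mset (edge_ends Periodic k (cell p z))))"
    by (simp add: disagreements_def mset_filter[symmetric] del: mset_filter)
  then show ?thesis unfolding size mset_edge_ends[OF assms] by simp
qed

text \<open>Local coordinates at the column over \<^term>\<open>p\<close>, with the layers permuted.\<close>

fun chart :: "int \<times> int \<Rightarrow> int \<times> int \<Rightarrow> int \<times> int \<Rightarrow> nat list \<Rightarrow> vertex \<Rightarrow> vertex" where
  "chart p e f zs (x, y, z) = (fst p + x * fst e + y * fst f, snd p + x * snd e + y * snd f, zs ! z)"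

lemma disagreements_chart:
  assumes fr: "(e, f) \<in> frames" and k: "z < k"
    and zs: "layers k (zs ! z) (zs ! (if z + 1 < k then z + 1 else 0)) (zs ! (if 0 < z then z - 1 else k - 1))"
  shows "disagreements Periodic k (\<lambda>v. t (chart p e f zs v) = \<sigma>) (x, y, z)
    = disagreements Periodic k (t :: vertex \<Rightarrow> bool) (chart p e f zs (x, y, z))"
proof -
  define q where "q = (fst p + x * fst e + y * fst f, snd p + x * snd e + y * snd f)"
  have v: "chart p e f zs (x, y, z) = cell q (zs ! z)" by (simp add: q_def cell_def)
  have "((1, 0), (0, 1)) \<in> frames" by (simp add: frames_def)
  moreover have "layers k z (if z + 1 < k then z + 1 else 0) (if 0 < z then z - 1 else k - 1)" by (simp add: layers_def)
  moreover have "chart p e f zs (cell (x, y) z') = cell q (zs ! z')" for z' by (simp add: q_def cell_def)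
  moreover have "chart p e f zs (cell ((x, y) + (1, 0)) z) = cell (q + e) (zs ! z)"
    "chart p e f zs (cell ((x, y) - (1, 0)) z) = cell (q - e) (zs ! z)"
    "chart p e f zs (cell ((x, y) + (0, 1)) z) = cell (q + f) (zs ! z)"
    "chart p e f zs (cell ((x, y) - (0, 1)) z) = cell (q - f) (zs ! z)"
    by (simp_all add: q_def cell_def algebra_simps)
  moreover have "(x, y, z) = cell (x, y) z" by (simp add: cell_def)
  moreover have neq: "((a = \<sigma>) \<noteq> (c = \<sigma>)) = (a \<noteq> c)" for a c by auto
  ultimately show ?thesis
    unfolding v by (simp only: disagreements_eq[OF fr zs] disagreements_eq[of "(1, 0)" "(0, 1)"])
qed

lemma disagreements_cong:
  assumes "2 \<le> k" "v \<in> slab k" "\<And>w. w \<in> slab k \<Longrightarrow> s w = t w"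
  shows "disagreements b k s v = disagreements b k t v"
  unfolding disagreements_def
proof (intro arg_cong[where f = length] filter_cong refl)
  fix w assume "w \<in> set (edge_ends b k v)"
  then have "w \<in> slab k" using set_edge_ends[OF assms(1,2)] by blast
  then show "(s w \<noteq> s v) = (t w \<noteq> t v)" using assms(3)[of w] assms(3)[OF assms(2)] by simp
qed

lemma inj_chart:
  assumes fr: "(e, f) \<in> frames" and zs: "distinct zs" "length zs = k" and vw: "v \<in> slab k" "w \<in> slab k"
    and eq: "chart p e f zs v = chart p e f zs w"
  shows "v = w"
proof -
  obtain x y z x' y' z' where v: "v = (x, y, z)" "w = (x', y', z')" by (cases v; cases w)
  have "z = z'" using eq zs vw by (simp add: v slab_def nth_eq_iff_index_eq)
  then show ?thesis using eq fr unfolding v frames_def by (elim insertE emptyE) simp_all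
qed

text \<open>Translations, symmetries of the square lattice and permutations of the layers that
  respect their adjacency are automorphisms of the slab, and \<open>\<sigma>\<close> accounts for a
  global reversal of spins; none of them changes the number of disagreements. The certificates thus
  need to treat one position only.\<close>

lemma tie_closed_chart:
  assumes k: "2 \<le> k" and K: "tie_closed k K" and fr: "(e, f) \<in> frames" and zs: "distinct zs" "length zs = k" "set zs \<subseteq> {..<k}"
    and adj: "\<And>z. z < k \<Longrightarrow> layers k (zs ! z) (zs ! (if z + 1 < k then z + 1 else 0)) (zs ! (if 0 < z then z - 1 else k - 1))"
  shows "tie_closed k {s. \<exists>t\<in>K. \<forall>v\<in>slab k. s v = (t (chart p e f zs v) = \<sigma>)}"
  unfolding tie_closed_def
proof (intro ballI)
  fix s v assume "s \<in> {s. \<exists>t\<in>K. \<forall>v\<in>slab k. s v = (t (chart p e f zs v) = \<sigma>)}" and v: "v \<in> slab k"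
  then obtain t where t: "t \<in> K" "\<And>v. v \<in> slab k \<Longrightarrow> s v = (t (chart p e f zs v) = \<sigma>)" by blast
  obtain x y z where xyz: "v = (x, y, z)" "z < k" using v by (cases v) (auto simp: slab_def)
  have c: "chart p e f zs v \<in> slab k" using xyz zs nth_mem[of z zs] by (auto simp: slab_def simp del: nth_mem)
  have "disagreements Periodic k s v = disagreements Periodic k (\<lambda>v. t (chart p e f zs v) = \<sigma>) v"
    using k v t(2) by (rule disagreements_cong)
  also have "\<dots> = disagreements Periodic k t (chart p e f zs v)"
    unfolding xyz(1) by (rule disagreements_chart[OF fr xyz(2) adj[OF xyz(2)]])
  finally have d: "disagreements Periodic k s v = disagreements Periodic k t (chart p e f zs v)" .
  moreover have "s(v := \<not> s v) \<in> {s. \<exists>t\<in>K. \<forall>v\<in>slab k. s v = (t (chart p e f zs v) = \<sigma>)}"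
    if "t(chart p e f zs v := \<not> t (chart p e f zs v)) \<in> K"
  proof -
    have "(s(v := \<not> s v)) w = ((t(chart p e f zs v := \<not> t (chart p e f zs v))) (chart p e f zs w) = \<sigma>)" if "w \<in> slab k" for w
    proof (cases "w = v")
      case True
      then show ?thesis using t(2)[OF v] by auto
    next
      case False
      then show ?thesis using t(2)[OF that] inj_chart[OF fr zs(1,2) that v, of p] by auto
    qed
    then show ?thesis using that by blast
  qed
  ultimately show "disagreements Periodic k s v \<le> 3 \<and> (disagreements Periodic k s v = 3 \<longrightarrow>
      s(v := \<not> s v) \<in> {s. \<exists>t\<in>K. \<forall>v\<in>slab k. s v = (t (chart p e f zs v) = \<sigma>)})"
    using K t(1) c unfolding tie_closed_def by simp
qed

lemma chart_cell:
  "chart p e f zs (0, 0, y) = cell p (zs ! y)" "chart p e f zs (1, 0, y) = cell (p + e) (zs ! y)"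
  "chart p e f zs (-1, 0, y) = cell (p - e) (zs ! y)" "chart p e f zs (0, 1, y) = cell (p + f) (zs ! y)"
  "chart p e f zs (0, -1, y) = cell (p - f) (zs ! y)"
  by (simp_all add: cell_def)

lemma frame_shift:
  assumes "(e, f) \<in> frames"
  shows "p + e \<noteq> p" "p - e \<noteq> p" "p + f \<noteq> p" "p - f \<noteq> p"
  using assms by (auto simp: frames_def prod_eq_iff)

lemma layers_2: "z < 2 \<Longrightarrow> layers 2 z (1 - z) (1 - z)"
  by (auto simp: layers_def less_2_cases_iff)

lemma layers_3: "distinct [z, z1, z2] \<Longrightarrow> {z, z1, z2} \<subseteq> {..<3} \<Longrightarrow> layers 3 z z1 z2"
  by (auto simp: layers_def numeral_3_eq_3 less_Suc_eq add_mset_commute)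

section \<open>Ties with agreeing vertical neighbours\<close>

definition spike :: "nat \<Rightarrow> (vertex \<Rightarrow> bool) \<Rightarrow> int \<times> int \<Rightarrow> nat \<Rightarrow> int \<times> int \<Rightarrow> int \<times> int \<Rightarrow> bool" where
  "spike k t p z e f \<longleftrightarrow> (\<forall>y<k. t (cell p y) = t (cell p z)) \<and> t (cell (p + e) z) \<noteq> t (cell p z) \<and>
     t (cell (p - e) z) \<noteq> t (cell p z) \<and> t (cell (p + f) z) \<noteq> t (cell p z) \<and> t (cell (p - f) z) = t (cell p z)"

lemma of_bool_sum_eq_3:
  "of_bool A + of_bool B + of_bool C + of_bool D = (3 :: nat) \<longleftrightarrow>
     \<not> A \<and> B \<and> C \<and> D \<or> A \<and> \<not> B \<and> C \<and> D \<or> A \<and> B \<and> \<not> C \<and> D \<or> A \<and> B \<and> C \<and> \<not> D"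
  by (cases A; cases B; cases C; cases D) simp_all

text \<open>If the vertical neighbours agree with the vertex, three horizontal ones disagree, and
  the frame is turned so that the agreeing one lies at \<open>p - f\<close>. If they disagree with
  it, exactly one horizontal neighbour does so too; flipping the tie leads back to the first
  case.\<close>

lemma ex_spike:
  assumes K: "tie_closed k K" "t \<in> K" and z: "z < k" and ls: "layers k z z1 z2" "{..<k} \<subseteq> {z, z1, z2}" "z1 \<noteq> z" "z2 \<noteq> z"
    and v: "t (cell p z1) = t (cell p z2)" and tie: "disagreements Periodic k t (cell p z) = 3"
  shows "\<exists>t\<in>K. \<exists>(e, f)\<in>frames. spike k t p z e f"
proof -
  obtain e f where frs: "(e, f) \<in> frames" "(f, - e) \<in> frames" "(f, e) \<in> frames" "(e, - f) \<in> frames"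
    by (rule that[of "(1, 0)" "(0, 1)"]) (simp_all add: frames_def)
  note fr = frs(1)
  note d = disagreements_eq[OF fr ls(1)]
  have uniform: "\<exists>(e, f)\<in>frames. spike k s p z e f"
    if v: "s (cell p z1) = s (cell p z)" "s (cell p z2) = s (cell p z)" and tie: "disagreements Periodic k s (cell p z) = 3" for s
  proof -
    have u: "\<forall>y<k. s (cell p y) = s (cell p z)" using ls(2) v by (auto simp: subset_iff)
    have "of_bool (s (cell (p + e) z) \<noteq> s (cell p z)) + of_bool (s (cell (p - e) z) \<noteq> s (cell p z)) +
      of_bool (s (cell (p + f) z) \<noteq> s (cell p z)) + of_bool (s (cell (p - f) z) \<noteq> s (cell p z)) = (3 :: nat)"
      using tie[unfolded d] v by simp
    then have "spike k s p z f (- e) \<or> spike k s p z f e \<or> spike k s p z e (- f) \<or> spike k s p z e f"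
      unfolding of_bool_sum_eq_3 using u by (simp add: spike_def) blast
    then show ?thesis using frs by blast
  qed
  show ?thesis
  proof (cases "t (cell p z1) = t (cell p z)")
    case True
    then show ?thesis using uniform[of t] v tie K(2) by blast
  next
    case False
    let ?s = "t(cell p z := \<not> t (cell p z))"
    have "disagreements Periodic k ?s (cell p z) = 3"
      using tie[unfolded d] frame_shift[OF fr, of p] ls(3,4) unfolding d
      by (auto simp: of_bool_def split: if_splits)
    moreover have "?s \<in> K" using K tie z by (intro tie_closed_flip) auto
    ultimately show ?thesis using uniform[of ?s] False v ls(3,4) by auto
  qed
qed

text \<open>In width two both vertical edge ends lead to the same vertex, so every tie gives a
  spike, and a chart brings it into the position of \<open>no_tie_2\<close>.\<close>

theorem tie_closed_2:
  assumes K: "tie_closed 2 K" "t \<in> K" and v: "v \<in> slab 2"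
  shows "disagreements Periodic 2 t v \<noteq> 3"
proof
  assume tie: "disagreements Periodic 2 t v = 3"
  obtain x y z where "v = (x, y, z)" by (cases v)
  then obtain p where p: "v = cell p z" by (metis cell_def fst_conv snd_conv)
  have z: "z < 2" using v p by simp
  then have "{..<2} \<subseteq> {z, 1 - z, 1 - z}" "1 - z \<noteq> z" by (auto simp: less_2_cases_iff)
  from ex_spike[OF K z layers_2[OF z] this(1,2,2) refl tie[unfolded p]] obtain s e f
    where s: "s \<in> K" and fr: "(e, f) \<in> frames" and sp: "spike 2 s p z e f"
    by blast
  define zs where "zs = [z, 1 - z]"
  define \<sigma> where "\<sigma> = s (cell p z)"
  define s' where "s' v = (s (chart p e f zs v) = \<sigma>)" for v
  have "tie_closed 2 {s'. \<exists>s\<in>K. \<forall>v\<in>slab 2. s' v = (s (chart p e f zs v) = \<sigma>)}"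
  proof (rule tie_closed_chart[OF _ K(1) fr])
    fix y :: nat assume "y < 2"
    then show "layers 2 (zs ! y) (zs ! (if y + 1 < 2 then y + 1 else 0)) (zs ! (if 0 < y then y - 1 else 2 - 1))"
      using layers_2[of z] layers_2[of "1 - z"] z by (auto simp: zs_def less_2_cases_iff)
  qed (use z in \<open>auto simp: zs_def less_2_cases_iff\<close>)
  moreover have "s' \<in> {s'. \<exists>s\<in>K. \<forall>v\<in>slab 2. s' v = (s (chart p e f zs v) = \<sigma>)}" by (intro CollectI bexI[OF _ s] ballI) (rule s'_def)
  ultimately show False
  proof (rule no_tie_2)
    have "1 - z < 2" using z by simp
    then show "s' (0, 0, 0)" "s' (0, 0, 1)" "\<not> s' (1, 0, 0)" "\<not> s' (-1, 0, 0)" "\<not> s' (0, 1, 0)" "s' (0, -1, 0)"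
      using sp by (simp_all add: s'_def chart_cell zs_def \<sigma>_def spike_def del: chart.simps)
  qed
qed

text \<open>By \<open>no_tie_3\<close>, applied with the other two layers in either order, the
  column over \<open>p + f\<close> has the spin of the spike outside layer \<open>z\<close>. In
  layer \<open>z\<close> it therefore has three disagreements, two vertical ones and one towards
  \<open>p\<close>. The bound in \<open>K\<close> makes it agree with its remaining neighbours, and
  its flip produces the spike at \<open>p + f\<close>.\<close>

lemma spike_next:
  assumes K: "tie_closed 3 K" "t \<in> K" and fr: "(e, f) \<in> frames" and z: "z < 3" and sp: "spike 3 t p z e f"
  shows "\<exists>t\<in>K. spike 3 t (p + f) z e f"
proof -
  have *: "t (cell (p + f) z1) = t (cell p z)" if ls: "distinct [z, z1, z2]" "{z, z1, z2} \<subseteq> {..<3}" for z1 z2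
  proof (rule ccontr)
    assume neq: "t (cell (p + f) z1) \<noteq> t (cell p z)"
    define zs where "zs = [z, z1, z2]"
    define \<sigma> where "\<sigma> = t (cell p z)"
    define s' where "s' v = (t (chart p e f zs v) = \<sigma>)" for v
    have "z1 < 3" "z2 < 3" using ls by auto
    then have vals: "t (cell p z) = \<sigma>" "t (cell p z1) = \<sigma>" "t (cell p z2) = \<sigma>" "t (cell (p + e) z) \<noteq> \<sigma>"
      "t (cell (p - e) z) \<noteq> \<sigma>" "t (cell (p + f) z) \<noteq> \<sigma>" "t (cell (p - f) z) = \<sigma>"
      using sp unfolding spike_def \<sigma>_def by blast+
    have rot: "layers 3 z z1 z2" "layers 3 z1 z2 z" "layers 3 z2 z z1" by (rule layers_3; use ls in simp)+
    have "tie_closed 3 {s'. \<exists>s\<in>K. \<forall>v\<in>slab 3. s' v = (s (chart p e f zs v) = \<sigma>)}"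
    proof (rule tie_closed_chart[OF _ K(1) fr])
      fix y :: nat assume "y < 3"
      then consider "y = 0" | "y = 1" | "y = 2" by linarith
      then show "layers 3 (zs ! y) (zs ! (if y + 1 < 3 then y + 1 else 0)) (zs ! (if 0 < y then y - 1 else 3 - 1))"
        by cases (simp_all add: zs_def rot)
    qed (use ls in \<open>auto simp: zs_def\<close>)
    moreover have "s' \<in> {s'. \<exists>s\<in>K. \<forall>v\<in>slab 3. s' v = (s (chart p e f zs v) = \<sigma>)}" by (intro CollectI bexI[OF _ K(2)] ballI) (rule s'_def)
    ultimately show False
    proof (rule no_tie_3)
      show "s' (0, 0, 0)" "s' (0, 0, 1)" "s' (0, 0, 2)" "\<not> s' (1, 0, 0)" "\<not> s' (-1, 0, 0)" "\<not> s' (0, 1, 0)" "s' (0, -1, 0)" "\<not> s' (0, 1, 1)"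
        using vals neq by (simp_all add: s'_def chart_cell zs_def \<sigma>_def[symmetric] del: chart.simps)
    qed
  qed
  obtain z1 z2 where ls: "distinct [z, z1, z2]" "{z, z1, z2} = {..<3}"
  proof -
    consider "z = 0" | "z = 1" | "z = 2" using z by linarith
    moreover have "{..<3 :: nat} = {0, 1, 2}" by auto
    ultimately show ?thesis
      by cases (use that[of 1 2] that[of 0 2] that[of 0 1] in \<open>simp_all add: insert_commute\<close>)
  qed
  have z1: "t (cell (p + f) z1) = t (cell p z)" "t (cell (p + f) z2) = t (cell p z)"
    using *[of z1 z2] *[of z2 z1] ls by auto
  have zf: "t (cell (p + f) z) \<noteq> t (cell p z)" using sp unfolding spike_def by blast
  have l: "layers 3 z z1 z2" using ls by (intro layers_3) auto
  have "disagreements Periodic 3 t (cell (p + f) z) \<le> 3" using K z by (intro tie_closed_bound) auto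
  then have d: "t (cell (p + f + e) z) = t (cell (p + f) z)" "t (cell (p + f - e) z) = t (cell (p + f) z)"
     "t (cell (p + f + f) z) = t (cell (p + f) z)" "3 = disagreements Periodic 3 t (cell (p + f) z)"
    using z1 zf unfolding disagreements_eq[OF fr l] by (auto simp: of_bool_def split: if_splits)
  let ?s = "t(cell (p + f) z := \<not> t (cell (p + f) z))"
  have "?s \<in> K" using d(4) K z by (intro tie_closed_flip) auto
  moreover have "\<forall>y<3. ?s (cell (p + f) y) = ?s (cell (p + f) z)"
  proof (intro allI impI)
    fix y :: nat assume "y < 3"
    then have "y \<in> {z, z1, z2}" using ls(2) by simp
    then show "?s (cell (p + f) y) = ?s (cell (p + f) z)" using z1 zf ls(1) by auto
  qed
  then have "spike 3 ?s (p + f) z e f"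
    unfolding spike_def using d(1-3) zf frame_shift[OF fr, of "p + f"] frame_shift[OF fr, of p] by auto
  ultimately show ?thesis by blast
qed

section \<open>Width three with pinned columns on all half lines\<close>

definition dot :: "int \<times> int \<Rightarrow> int \<times> int \<Rightarrow> int" where
  "dot p q = fst p * fst q + snd p * snd q"

lemma dot_simps [simp]: "dot p (q + r) = dot p q + dot p r" "dot p (q - r) = dot p q - dot p r"
  by (simp_all add: dot_def algebra_simps)

lemma frame_dot: "(e, f) \<in> frames \<Longrightarrow> dot f f = 1" "(e, f) \<in> frames \<Longrightarrow> dot f e = 0"
  by (auto simp: frames_def dot_def)

lemma frame_swap: "(e, f) \<in> frames \<Longrightarrow> (f, e) \<in> frames"
  by (auto simp: frames_def)

text \<open>A column is pinned if all configurations of \<open>K\<close> agree on it. It can never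
  carry a tie, since the flip would stay in \<open>K\<close>; so anything that moves along a half
  line in the form of a tie is impossible.\<close>

locale pinned_slab_3 =
  fixes K :: "(vertex \<Rightarrow> bool) set"
  assumes closed: "tie_closed 3 K"
    and pinned: "\<And>p e f. (e, f) \<in> frames \<Longrightarrow>
      \<exists>n. \<forall>z<3. \<forall>s\<in>K. \<forall>t\<in>K. s (cell (((\<lambda>q. q + f) ^^ n) p) z) = t (cell (((\<lambda>q. q + f) ^^ n) p) z)"
begin

lemma no_tie_at_pinned:
  assumes "t \<in> K" "z < 3" "\<forall>z<3. \<forall>s\<in>K. \<forall>t\<in>K. s (cell p z) = t (cell p z)"
  shows "disagreements Periodic 3 t (cell p z) \<noteq> 3"
proof
  assume "disagreements Periodic 3 t (cell p z) = 3"
  then have "t(cell p z := \<not> t (cell p z)) \<in> K" using closed assms(1,2) by (intro tie_closed_flip) auto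
  then have "(t(cell p z := \<not> t (cell p z))) (cell p z) = t (cell p z)" using assms by blast
  then show False by simp
qed

lemma no_spike:
  assumes t: "t \<in> K" and fr: "(e, f) \<in> frames" and z: "z < 3" and ls: "layers 3 z z1 z2" "z1 < 3" "z2 < 3"
  shows "\<not> spike 3 t p z e f"
proof
  assume "spike 3 t p z e f"
  then have "\<exists>t\<in>K. spike 3 t (((\<lambda>q. q + f) ^^ n) p) z e f" for n
  proof (induction n)
    case (Suc n)
    then obtain s where "s \<in> K" "spike 3 s (((\<lambda>q. q + f) ^^ n) p) z e f" by blast
    from spike_next[OF closed this(1) fr z this(2)] show ?case by simp
  qed (use t in auto)
  moreover obtain n where n: "\<forall>z<3. \<forall>s\<in>K. \<forall>t\<in>K. s (cell (((\<lambda>q. q + f) ^^ n) p) z) = t (cell (((\<lambda>q. q + f) ^^ n) p) z)"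
    using pinned[OF fr] by blast
  ultimately obtain s where s: "s \<in> K" "spike 3 s (((\<lambda>q. q + f) ^^ n) p) z e f" by blast
  define q where "q = ((\<lambda>q. q + f) ^^ n) p"
  have sp: "spike 3 s q z e f" using s(2) by (simp add: q_def)
  have "s (cell q z1) = s (cell q z)" "s (cell q z2) = s (cell q z)" "s (cell (q + e) z) \<noteq> s (cell q z)"
     "s (cell (q - e) z) \<noteq> s (cell q z)" "s (cell (q + f) z) \<noteq> s (cell q z)" "s (cell (q - f) z) = s (cell q z)"
    using sp ls(2,3) unfolding spike_def by blast+
  then have "disagreements Periodic 3 s q' = 3" if "q' = cell q z" for q'
    unfolding that disagreements_eq[OF fr ls(1)] by (simp add: of_bool_def)
  then show False using no_tie_at_pinned[OF s(1) z n] by (simp add: q_def)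
qed

text \<open>Two vertical disagreements are already there. A third, horizontal one would complete a
  tie with agreeing vertical neighbours, hence a spike.\<close>

lemma minority_neighbours:
  assumes t: "t \<in> K" and fr: "(e, f) \<in> frames" and ls: "distinct [z, z1, z2]" "{z, z1, z2} = {..<3}"
    and v: "t (cell p z1) \<noteq> t (cell p z)" "t (cell p z2) \<noteq> t (cell p z)"
  shows "t (cell (p + e) z) = t (cell p z)" "t (cell (p - e) z) = t (cell p z)"
    "t (cell (p + f) z) = t (cell p z)" "t (cell (p - f) z) = t (cell p z)"
proof -
  have z: "z < 3" "z1 < 3" "z2 < 3" using ls(2) by auto
  have l: "layers 3 z z1 z2" using ls by (intro layers_3) auto
  have "disagreements Periodic 3 t (cell p z) \<noteq> 3"
  proof
    assume tie: "disagreements Periodic 3 t (cell p z) = 3"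
    have "\<exists>t\<in>K. \<exists>(e, f)\<in>frames. spike 3 t p z e f"
      by (rule ex_spike[OF closed t z(1) l _ _ _ _ tie]) (use ls v in auto)
    then show False using no_spike[OF _ _ z(1) l z(2,3)] by blast
  qed
  moreover have "disagreements Periodic 3 t (cell p z) \<le> 3" using closed t z(1) by (intro tie_closed_bound) auto
  ultimately show "t (cell (p + e) z) = t (cell p z)" "t (cell (p - e) z) = t (cell p z)"
    "t (cell (p + f) z) = t (cell p z)" "t (cell (p - f) z) = t (cell p z)"
    using v unfolding disagreements_eq[OF fr l] by (auto simp: of_bool_def split: if_splits)
qed

end

text \<open>A sea consists of the columns that are up in layer \<^term>\<open>z1\<close> and down in layer \<^term>\<open>z2\<close>; there layer \<^term>\<open>z\<close> evolves
  like a planar slab.\<close>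

locale sea = pinned_slab_3 +
  fixes z z1 z2 :: nat
  assumes layers: "distinct [z, z1, z2]" "{z, z1, z2} = {..<3}"
begin

lemma layers_less: "z < 3" "z1 < 3" "z2 < 3"
  using layers(2) by auto

lemma layers3: "layers 3 z z1 z2"
  using layers by (intro layers_3) auto

definition in_sea :: "(vertex \<Rightarrow> bool) \<Rightarrow> int \<times> int \<Rightarrow> bool" where
  "in_sea t p \<longleftrightarrow> t (cell p z1) \<and> \<not> t (cell p z2)"

lemma in_sea_upd [simp]: "in_sea (t(cell q z := a)) p \<longleftrightarrow> in_sea t p"
  using layers(1) by (auto simp: in_sea_def)

lemma sea_disagreements:
  assumes "(e, f) \<in> frames" "in_sea t p"
  shows "disagreements Periodic 3 t (cell p z) = of_bool (t (cell (p + e) z) \<noteq> t (cell p z)) +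
     of_bool (t (cell (p - e) z) \<noteq> t (cell p z)) + of_bool (t (cell (p + f) z) \<noteq> t (cell p z)) +
     of_bool (t (cell (p - f) z) \<noteq> t (cell p z)) + 1"
  unfolding disagreements_eq[OF assms(1) layers3] using assms(2) by (cases "t (cell p z)") (simp_all add: in_sea_def)

lemma sea_bound: "t \<in> K \<Longrightarrow> disagreements Periodic 3 t (cell p z) \<le> 3"
  using closed layers_less by (intro tie_closed_bound) auto

lemma sea_flip:
  assumes "t \<in> K" "3 \<le> disagreements Periodic 3 t (cell p z)"
  shows "t(cell p z := a) \<in> K"
proof (cases "a = t (cell p z)")
  case False
  then have "a = (\<not> t (cell p z))" by simp
  then show ?thesis using closed assms layers_less by (simp add: tie_closed_flip)
qed (use assms in \<open>simp add: fun_upd_idem\<close>)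

lemma sea_neighbour_up:
  assumes "t \<in> K" "(e, f) \<in> frames" "in_sea t p" "t (cell p z)" "q \<in> {p + e, p - e, p + f, p - f}"
  shows "\<not> t (cell q z2)"
proof -
  have "distinct [z2, z, z1]" "{z2, z, z1} = {..<3}" using layers by auto
  from minority_neighbours[OF assms(1,2) this, of p] assms(3-5) show ?thesis by (auto simp: in_sea_def)
qed

lemma sea_neighbour_down:
  assumes "t \<in> K" "(e, f) \<in> frames" "in_sea t p" "\<not> t (cell p z)" "q \<in> {p + e, p - e, p + f, p - f}"
  shows "t (cell q z1)"
proof -
  have "distinct [z1, z, z2]" "{z1, z, z2} = {..<3}" using layers by auto
  from minority_neighbours[OF assms(1,2) this, of p] assms(3-5) show ?thesis by (auto simp: in_sea_def)
qed

text \<open>At a tie both values of the vertex are realised in \<open>K\<close>. With the value up,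
  layer \<open>z2\<close> is the minority of the column, with the value down it is layer
  \<open>z1\<close>; in both cases the neighbours in the minority layer must agree with it.\<close>

lemma sea_neighbour:
  assumes t: "t \<in> K" and fr: "(e, f) \<in> frames" and p: "in_sea t p" and tie: "3 \<le> disagreements Periodic 3 t (cell p z)"
    and q: "q \<in> {p + e, p - e, p + f, p - f}"
  shows "in_sea t q"
proof -
  have "\<not> (t(cell p z := True)) (cell q z2)" "(t(cell p z := False)) (cell q z1)"
    using sea_neighbour_up[OF sea_flip[OF t tie, of True] fr _ _ q] sea_neighbour_down[OF sea_flip[OF t tie, of False] fr _ _ q] p
    by simp_all
  then show ?thesis using layers(1) by (simp add: in_sea_def)
qed

text \<open>The contour between the two spins of layer \<open>z\<close> turns at \<open>p\<close>.
  The spin of \<open>p\<close> is left open: either value disagrees with exactly two horizontal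
  neighbours.\<close>

definition corner :: "(vertex \<Rightarrow> bool) \<Rightarrow> int \<times> int \<Rightarrow> int \<times> int \<Rightarrow> int \<times> int \<Rightarrow> bool \<Rightarrow> bool" where
  "corner t p e f a \<longleftrightarrow> in_sea t p \<and> t (cell (p + e) z) = a \<and> t (cell (p - f) z) = a \<and>
     t (cell (p - e) z) = (\<not> a) \<and> t (cell (p + f) z) = (\<not> a)"

lemma corner_tie: "(e, f) \<in> frames \<Longrightarrow> corner t p e f a \<Longrightarrow> disagreements Periodic 3 t (cell p z) = 3"
  unfolding corner_def by (subst sea_disagreements) (auto simp: of_bool_def)

lemma corner_upd [simp]: "(e, f) \<in> frames \<Longrightarrow> corner (t(cell p z := x)) p e f a \<longleftrightarrow> corner t p e f a"
  using frame_shift[of e f p] by (auto simp: corner_def)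

text \<open>Half of a corner is enough: two horizontal disagreements and the vertical one of the sea
  make three, so the bound in \<open>K\<close> determines the remaining two neighbours.\<close>

lemma cornerI:
  assumes t: "t \<in> K" and fr: "(e, f) \<in> frames" and p: "in_sea t p"
    and v: "t (cell p z) = (\<not> a) \<and> t (cell (p + e) z) = a \<and> t (cell (p - f) z) = a \<or>
       t (cell p z) = a \<and> t (cell (p - e) z) = (\<not> a) \<and> t (cell (p + f) z) = (\<not> a)"
  shows "corner t p e f a"
  using sea_bound[OF t, of p] v p unfolding sea_disagreements[OF fr p] corner_def
  by (auto simp: of_bool_def split: if_splits)

lemma corner_neighbour:
  assumes "t \<in> K" "(e, f) \<in> frames" "corner t p e f a" "q \<in> {p + e, p - e, p + f, p - f}"
  shows "in_sea t q"
  using assms(3) by (intro sea_neighbour[OF assms(1,2) _ _ assms(4)]) (auto simp: corner_tie[OF assms(2)] corner_def)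

lemma corner_flip: "t \<in> K \<Longrightarrow> (e, f) \<in> frames \<Longrightarrow> corner t p e f a \<Longrightarrow> t(cell p z := x) \<in> K"
  by (intro sea_flip) (simp_all add: corner_tie)

text \<open>Once \<open>p\<close> is set to \<open>a\<close>, the vertex \<open>p + f\<close> of
  spin opposite to \<open>a\<close> has \<open>p\<close> and the diagonal vertex as neighbours of
  spin \<open>a\<close>.\<close>

lemma corner_step_f:
  assumes t: "t \<in> K" and fr: "(e, f) \<in> frames" and c: "corner t p e f a" and w: "t (cell (p + e + f) z) = a"
  shows "corner (t(cell p z := a)) (p + f) e f a"
proof (rule cornerI[OF corner_flip[OF t fr c] fr])
  show "in_sea (t(cell p z := a)) (p + f)" using corner_neighbour[OF t fr c] by simp
  have eq: "p + f + e = p + e + f" by (simp add: algebra_simps)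
  show "(t(cell p z := a)) (cell (p + f) z) = (\<not> a) \<and> (t(cell p z := a)) (cell (p + f + e) z) = a \<and>
      (t(cell p z := a)) (cell (p + f - f) z) = a \<or>
      (t(cell p z := a)) (cell (p + f) z) = a \<and> (t(cell p z := a)) (cell (p + f - e) z) = (\<not> a) \<and>
      (t(cell p z := a)) (cell (p + f + f) z) = (\<not> a)"
    unfolding eq using c w frame_shift[OF fr, of p] by (auto simp: corner_def)
qed

text \<open>The mirror image of the preceding step: \<open>p + e\<close> has spin \<open>a\<close>,
  and both \<open>p\<close> and the diagonal vertex now have the opposite spin.\<close>

lemma corner_step_e:
  assumes t: "t \<in> K" and fr: "(e, f) \<in> frames" and c: "corner t p e f a" and w: "t (cell (p + e + f) z) = (\<not> a)"
  shows "corner (t(cell p z := \<not> a)) (p + e) e f a"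
proof (rule cornerI[OF corner_flip[OF t fr c] fr])
  show "in_sea (t(cell p z := \<not> a)) (p + e)" using corner_neighbour[OF t fr c] by simp
  have "p + e + f \<noteq> p" using frame_dot[OF fr] by (metis add.right_neutral add.commute add_left_cancel dot_simps(1) zero_neq_one)
  then show "(t(cell p z := \<not> a)) (cell (p + e) z) = (\<not> a) \<and> (t(cell p z := \<not> a)) (cell (p + e + e) z) = a \<and>
      (t(cell p z := \<not> a)) (cell (p + e - f) z) = a \<or>
      (t(cell p z := \<not> a)) (cell (p + e) z) = a \<and> (t(cell p z := \<not> a)) (cell (p + e - e) z) = (\<not> a) \<and>
      (t(cell p z := \<not> a)) (cell (p + e + f) z) = (\<not> a)"
    using c w frame_shift[OF fr, of p] by (auto simp: corner_def)
qed

text \<open>If the diagonal vertex has spin \<^term>\<open>a\<close>, then \<^term>\<open>p + f\<close> becomes a corner after setting \<^term>\<open>p\<close>; this is repeated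
  until a pinned column is near, and the diagonal vertices are then flipped on the way back.\<close>

lemma lower_diagonal:
  assumes fr: "(e, f) \<in> frames"
    and stop: "\<forall>z<3. \<forall>s\<in>K. \<forall>t\<in>K. s (cell (((\<lambda>q. q + f) ^^ n) p) z) = t (cell (((\<lambda>q. q + f) ^^ n) p) z)"
    and "t \<in> K" "corner t p e f a"
  shows "\<exists>s\<in>K. corner s p e f a \<and> s (cell (p + e + f) z) = (\<not> a) \<and>
    (\<forall>q y. y \<noteq> z \<or> q \<noteq> p \<and> dot f q \<le> dot f p \<longrightarrow> s (cell q y) = t (cell q y))"
  using stop assms(3,4)
proof (induction n arbitrary: p t)
  \<comment> \<open>Here the column over \<open>p\<close> is itself pinned, whereas a corner is a
    tie.\<close>
  case 0
  then show ?case using no_tie_at_pinned[OF 0(2) layers_less(1), of p] corner_tie[OF fr 0(3)] by simp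
next
  case (Suc n)
  note t = Suc.prems(2) and c = Suc.prems(3)
  show ?case
  proof (cases "t (cell (p + e + f) z) = a")
    case False
    then show ?thesis using t c by auto
  next
    case True
    define t1 where "t1 = t(cell p z := a)"
    have t1: "t1 \<in> K" "corner t1 (p + f) e f a"
      unfolding t1_def using corner_flip[OF t fr c] corner_step_f[OF t fr c True] by auto
    have "\<forall>z<3. \<forall>s\<in>K. \<forall>t\<in>K. s (cell (((\<lambda>q. q + f) ^^ n) (p + f)) z) = t (cell (((\<lambda>q. q + f) ^^ n) (p + f)) z)"
      using Suc.prems(1) by (simp add: funpow_Suc_right del: funpow.simps)
    from Suc.IH[OF this t1] obtain s where s: "s \<in> K" "corner s (p + f) e f a" "s (cell (p + f + e + f) z) = (\<not> a)"
      "\<And>q y. y \<noteq> z \<or> q \<noteq> p + f \<and> dot f q \<le> dot f (p + f) \<Longrightarrow> s (cell q y) = t1 (cell q y)" by blast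
    \<comment> \<open>The way back: the corner at \<open>p + f\<close> allows resetting this vertex
      to the spin opposite to \<open>a\<close>. Then the diagonal vertex \<open>w\<close> disagrees
      with \<open>p + f\<close>, with \<open>w + f\<close> and with one vertical neighbour, so it
      can be flipped. The other neighbours of \<open>p\<close> are not higher than \<open>p\<close>
      in the direction \<open>f\<close> and have kept their spins, so \<open>p\<close> is still a
      corner.\<close>
    define s1 where "s1 = s(cell (p + f) z := \<not> a)"
    have s1: "s1 \<in> K" "corner s1 (p + f) e f a" unfolding s1_def using corner_flip[OF s(1) fr s(2)] s(2) fr by auto
    have d: "dot f e = 0" "dot f f = 1" using frame_dot[OF fr] by auto
    define w where "w = p + e + f"
    have w: "w = p + f + e" "w - e = p + f" "w + f = p + f + e + f" "dot f w = dot f p + 1"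
      by (simp_all add: w_def algebra_simps d)
    have sea: "in_sea s1 w" using corner_neighbour[OF s1(1) fr s1(2)] by (simp add: w(1))
    have ne: "p + f \<noteq> w" "p + f + e + f \<noteq> p + f" "p + f + e + f \<noteq> w" "w \<noteq> p"
    proof -
      show "p + f \<noteq> w" using frame_shift(1)[OF fr, of "p + f"] by (simp add: w(1))
      have "dot f (p + f + e + f) \<noteq> dot f (p + f)" "dot f (p + f + e + f) \<noteq> dot f w" "dot f w \<noteq> dot f p"
        using d by (simp_all add: w(1))
      then show "p + f + e + f \<noteq> p + f" "p + f + e + f \<noteq> w" "w \<noteq> p" by metis+
    qed
    have ws: "s1 (cell w z) = a"
      using s(4)[of z w] ne True d by (simp add: s1_def t1_def w_def[symmetric] w(4))
    have "3 \<le> disagreements Periodic 3 s1 (cell w z)"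
      unfolding sea_disagreements[OF fr sea] ws w(2,3) using s(3) ne by (simp add: s1_def of_bool_def)
    then have s2: "s1(cell w z := \<not> a) \<in> K" by (intro sea_flip s1)
    have same: "(s1(cell w z := \<not> a)) (cell q y) = t (cell q y)" if "y \<noteq> z \<or> q \<noteq> p \<and> dot f q \<le> dot f p" for q y
    proof (cases "y = z")
      case True
      then have q: "q \<noteq> p" "dot f q \<le> dot f p" using that by auto
      then have "dot f q \<noteq> dot f (p + f)" "dot f q \<noteq> dot f w" using d w(4) by simp_all
      then have "q \<noteq> p + f" "q \<noteq> w" by metis+
      then show ?thesis using q s(4)[of z q] True d by (simp add: s1_def t1_def)
    next
      case False
      then show ?thesis using s(4)[of y q] by (simp add: s1_def t1_def)
    qed
    have "corner (s1(cell w z := \<not> a)) p e f a"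
    proof -
      have "in_sea (s1(cell w z := \<not> a)) p"
        using c same[of z1 p] same[of z2 p] layers(1) unfolding in_sea_def corner_def by auto
      moreover have "(s1(cell w z := \<not> a)) (cell q z) = t (cell q z)" if "q \<in> {p + e, p - e, p - f}" for q
        by (rule same) (use that d frame_shift[OF fr, of p] in auto)
      moreover have "(s1(cell w z := \<not> a)) (cell (p + f) z) = (\<not> a)" using ne by (simp add: s1_def)
      ultimately show ?thesis using c unfolding corner_def by auto
    qed
    moreover have "(s1(cell w z := \<not> a)) (cell (p + e + f) z) = (\<not> a)" by (simp add: w_def)
    ultimately show ?thesis using s2 same by blast
  qed
qed

text \<open>After \<open>lower_diagonal\<close> the corner can always be moved from \<open>p\<close>
  to \<open>p + e\<close>. Repetition carries it into a pinned column, which admits no tie.\<close>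

lemma no_corner:
  assumes t: "t \<in> K" and fr: "(e, f) \<in> frames"
  shows "\<not> corner t p e f a"
proof
  assume "corner t p e f a"
  have "\<exists>t\<in>K. corner t (((\<lambda>q. q + e) ^^ n) p) e f a" for n
  proof (induction n)
    case 0
    then show ?case using t \<open>corner t p e f a\<close> by auto
  next
    case (Suc n)
    define q where "q = ((\<lambda>q. q + e) ^^ n) p"
    obtain s where s: "s \<in> K" "corner s q e f a" using Suc by (auto simp: q_def)
    obtain m where "\<forall>z<3. \<forall>s\<in>K. \<forall>t\<in>K. s (cell (((\<lambda>q. q + f) ^^ m) q) z) = t (cell (((\<lambda>q. q + f) ^^ m) q) z)"
      using pinned[OF fr] by blast
    from lower_diagonal[OF fr this s] obtain s' where s': "s' \<in> K" "corner s' q e f a" "s' (cell (q + e + f) z) = (\<not> a)" by blast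
    have "corner (s'(cell q z := \<not> a)) (q + e) e f a" by (rule corner_step_e[OF s'(1) fr s'(2,3)])
    moreover have "s'(cell q z := \<not> a) \<in> K" by (rule corner_flip[OF s'(1) fr s'(2)])
    ultimately show ?case by (auto simp: q_def)
  qed
  moreover obtain n where "\<forall>z<3. \<forall>s\<in>K. \<forall>t\<in>K. s (cell (((\<lambda>q. q + e) ^^ n) p) z) = t (cell (((\<lambda>q. q + e) ^^ n) p) z)"
    using pinned[OF frame_swap[OF fr]] by blast
  ultimately show False using no_tie_at_pinned[OF _ layers_less(1)] corner_tie[OF fr] by metis
qed

text \<open>Exactly two horizontal neighbours disagree. If opposite neighbours differ,
  \<open>p\<close> is a corner. Otherwise \<open>p + e\<close> and \<open>p + f\<close> have
  different spins, and giving \<open>p\<close> the spin of the diagonal vertex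
  \<open>p + e + f\<close> makes a corner at whichever of the two has the other spin.\<close>

lemma no_sea_tie:
  assumes t: "t \<in> K" and p: "in_sea t p" and tie: "disagreements Periodic 3 t (cell p z) = 3"
  shows False
proof -
  obtain e f where frs: "(e, f) \<in> frames" "(e, - f) \<in> frames"
    by (rule that[of "(1, 0)" "(0, 1)"]) (simp_all add: frames_def)
  note fr = frs(1)
  define E W N S where "E = t (cell (p + e) z)" and "W = t (cell (p - e) z)" and "N = t (cell (p + f) z)" and "S = t (cell (p - f) z)"
  have two: "of_bool (E \<noteq> t (cell p z)) + of_bool (W \<noteq> t (cell p z)) + of_bool (N \<noteq> t (cell p z)) + of_bool (S \<noteq> t (cell p z)) = (2 :: nat)"
    using tie unfolding sea_disagreements[OF fr p] by (simp add: E_def W_def N_def S_def)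
  show False
  proof (cases "E = W")
    case False
    then have "N \<noteq> S" using two by (auto simp: of_bool_def split: if_splits)
    then have "corner t p e f E \<or> corner t p e (- f) E"
      using False p by (auto simp: corner_def E_def W_def N_def S_def)
    then show False using no_corner[OF t] frs by blast
  next
    case True
    then have NS: "N = (\<not> E)" "S = (\<not> E)" using two by (auto simp: of_bool_def split: if_splits)
    define s where "s = t(cell p z := t (cell (p + e + f) z))"
    have s: "s \<in> K" unfolding s_def using tie by (intro sea_flip t) simp
    have nb: "in_sea s (p + e)" "in_sea s (p + f)" unfolding s_def
      using sea_neighbour[OF t fr p, of "p + e"] sea_neighbour[OF t fr p, of "p + f"] tie by simp_all
    have ne: "p + e + f \<noteq> p"
    proof
      assume "p + e + f = p"
      then have "dot f (p + e + f) = dot f p" by (rule arg_cong)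
      then show False using frame_dot[OF fr] by simp
    qed
    have eq: "p + f + e = p + e + f" by (simp add: algebra_simps)
    have v: "s (cell p z) = t (cell (p + e + f) z)" "s (cell (p + e) z) = E" "s (cell (p + f) z) = (\<not> E)"
      "s (cell (p + e + f) z) = t (cell (p + e + f) z)" "s (cell (p + f + e) z) = t (cell (p + e + f) z)"
      unfolding eq using NS frame_shift[OF fr, of p] ne by (auto simp: s_def E_def N_def)
    show False
    proof (cases "t (cell (p + e + f) z) = E")
      case True
      then have "corner s (p + f) e f E" using v by (intro cornerI[OF s fr nb(2)]) (simp add: eq)
      then show False using no_corner[OF s fr] by blast
    next
      case False
      then have "corner s (p + e) e f E" using v by (intro cornerI[OF s fr nb(1)]) simp
      then show False using no_corner[OF s fr] by blast
    qed
  qed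
qed

end

text \<open>Equal vertical neighbours lead to a spike, different ones to a sea, if necessary with
  \<open>z1\<close> and \<open>z2\<close> exchanged.\<close>

theorem (in pinned_slab_3) no_tie:
  assumes t: "t \<in> K" and v: "v \<in> slab 3"
  shows "disagreements Periodic 3 t v \<noteq> 3"
proof
  assume tie: "disagreements Periodic 3 t v = 3"
  obtain x y z where "v = (x, y, z)" by (cases v)
  then obtain p where p: "v = cell p z" by (metis cell_def fst_conv snd_conv)
  have z: "z < 3" using v p by simp
  obtain z1 z2 where ls: "distinct [z, z1, z2]" "{z, z1, z2} = {..<3}"
  proof -
    consider "z = 0" | "z = 1" | "z = 2" using z by linarith
    moreover have "{..<3 :: nat} = {0, 1, 2}" by auto
    ultimately show ?thesis
      by cases (use that[of 1 2] that[of 0 2] that[of 0 1] in \<open>simp_all add: insert_commute\<close>)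
  qed
  have zs: "z1 < 3" "z2 < 3" using ls(2) by auto
  show False
  proof (cases "t (cell p z1) = t (cell p z2)")
    case True
    have l: "layers 3 z z1 z2" using ls by (intro layers_3) auto
    have "\<exists>t\<in>K. \<exists>(e, f)\<in>frames. spike 3 t p z e f"
      by (rule ex_spike[OF closed t z l _ _ _ True tie[unfolded p]]) (use ls in auto)
    then show False using no_spike[OF _ _ z l zs] by blast
  next
    case False
    interpret up: sea K z z1 z2 using ls by unfold_locales
    interpret down: sea K z z2 z1 using ls by unfold_locales auto
    have "up.in_sea t p \<or> down.in_sea t p" using False by (auto simp: up.in_sea_def down.in_sea_def)
    then show False using up.no_sea_tie[OF t] down.no_sea_tie[OF t] tie p by blast
  qed
qed

section \<open>Frozen patterns\<close>

text \<open>The specified vertices support each other: a strict majority of the edge ends of each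
  leads to vertices specified with the same spin, so none can flip whatever happens
  elsewhere.\<close>

definition stable :: "boundary \<Rightarrow> nat \<Rightarrow> (vertex \<Rightarrow> int option) \<Rightarrow> bool" where
  "stable b k g \<longleftrightarrow> (\<forall>v\<in>slab k. \<forall>s. g v = Some s \<longrightarrow>
     length (edge_ends b k v) < 2 * length (filter (\<lambda>w. g w = Some s) (edge_ends b k v)))"

text \<open>Induction on the depth, for all ring numbers at once. The supporting neighbours have
  their specified spins after any number of rings, so the order of the rings plays no part in the
  argument.\<close>

lemma (in good_path) approx_spin_stable:
  assumes k: "2 \<le> k" and g: "stable b k g" and init: "\<And>v s. v \<in> slab k \<Longrightarrow> g v = Some s \<Longrightarrow> initial_spin \<omega> v = s"
    and v: "v \<in> slab k" "g v = Some s"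
  shows "approx_spin b k n \<omega> v m = s"
  using v
proof (induction n arbitrary: v s m)
  case 0
  then show ?case by (simp add: init)
next
  case (Suc n)
  show ?case
  proof (cases m)
    case 0
    then show ?thesis using Suc.prems by (simp add: init)
  next
    case (Suc m')
    define \<eta> where "\<eta> = (\<lambda>u. approx_spin b k n \<omega> u (rings_before \<omega> u (ring_time \<omega> v m')))"
    have \<eta>: "\<eta> u = r" if "u \<in> slab k" "g u = Some r" for u r
      unfolding \<eta>_def using Suc.IH[OF that] .
    let ?ws = "edge_ends b k v"
    have "length (filter (\<lambda>w. g w = Some s) ws) + length (filter (\<lambda>w. \<eta> w \<noteq> \<eta> v) ws) \<le> length ws" if "set ws \<subseteq> slab k" for ws
      using that
    proof (induction ws)
      case (Cons w ws)
      have "g w = Some s \<Longrightarrow> \<eta> w = \<eta> v" using \<eta>[of w s] \<eta>[OF Suc.prems] Cons.prems by simp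
      then show ?case using Cons by auto
    qed simp
    from this[OF set_edge_ends[OF k Suc.prems(1), of b]]
    have "2 * disagreements b k \<eta> v < length ?ws"
      using g Suc.prems unfolding stable_def disagreements_def by force
    moreover have "energy b k \<eta> v = 2 * int (disagreements b k \<eta> v) - int (length ?ws)"
      by (rule energy_eq_disagreements[OF k Suc.prems(1)]) (unfold \<eta>_def, rule approx_spin_values)
    ultimately have "energy b k \<eta> v < 0" by linarith
    then have "updated_spin (\<eta> v) (energy b k \<eta> v) (coin \<omega> v m') = \<eta> v" by (simp add: updated_spin_def)
    moreover have "approx_spin b k (Suc n) \<omega> v m = updated_spin (\<eta> v) (energy b k \<eta> v) (coin \<omega> v m')"
      by (simp only: Suc approx_spin.simps Let_def \<eta>_def)
    ultimately show ?thesis using \<eta>[OF Suc.prems] by simp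
  qed
qed

lemma (in fair_path) limit_config_stable:
  assumes "2 \<le> k" "stable b k g" "\<And>v s. v \<in> slab k \<Longrightarrow> g v = Some s \<Longrightarrow> initial_spin \<omega> v = s"
    and "v \<in> slab k" "g v = Some s" "\<xi> \<in> limit_configs b k \<omega>"
  shows "\<xi> v = s"
  using limit_config_frozen[OF assms(4) approx_spin_stable[OF assms(1-5)] assms(6)] .

section \<open>Initial patterns of positive probability\<close>

lemma measurable_site_spin [measurable]: "fst \<in> measurable (site_measure p) (count_space UNIV)"
  by (simp add: site_measure_def)

lemma sets_site_spin: "{y. fst y = s} \<in> sets (site_measure p)"
proof -
  have "fst -` {s} \<inter> space (site_measure p) \<in> sets (site_measure p)" by measurable
  moreover have "fst -` {s} \<inter> space (site_measure p) = {y. fst y = s}" by auto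
  ultimately show ?thesis by simp
qed

lemma prob_site_spin:
  assumes p: "0 < p" "p < 1" and s: "s \<in> {-1, 1}" and v: "v \<in> slab k"
  shows "measure (glauber_measure k p) ((\<lambda>\<omega>. \<omega> v) -` {y. fst y = s} \<inter> space (glauber_measure k p)) = (if s = 1 then p else 1 - p)"
proof -
  have A: "fst -` {s} \<inter> space (site_measure p) = {y. fst y = s}" by auto
  have "measure (glauber_measure k p) ((\<lambda>\<omega>. \<omega> v) -` {y. fst y = s} \<inter> space (glauber_measure k p))
      = measure (distr (glauber_measure k p) (site_measure p) (\<lambda>\<omega>. \<omega> v)) {y. fst y = s}"
    by (rule measure_distr[symmetric, OF measurable_site[OF v] sets_site_spin])
  also have "\<dots> = measure (site_measure p) (fst -` {s} \<inter> space (site_measure p))" unfolding distr_site[OF v] A ..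
  also have "\<dots> = measure (distr (site_measure p) (measure_pmf (spin_pmf p)) fst) {s}"
    by (rule measure_distr[symmetric]) (simp_all add: site_measure_def)
  also have "distr (site_measure p) (measure_pmf (spin_pmf p)) fst = measure_pmf (spin_pmf p)"
    unfolding site_measure_def by (intro prob_space.distr_pair_fst prob_space_PiM prob_space_ring_measure)
  also have "measure (measure_pmf (spin_pmf p)) {s} = pmf (spin_pmf p) s" by (simp add: pmf.rep_eq)
  also have "\<dots> = (if s = 1 then p else 1 - p)"
  proof -
    have inj: "inj (\<lambda>b. if b then 1 else -1 :: int)" by (auto simp: inj_def split: if_splits)
    have "s = (if s = 1 then 1 else -1)" using s by auto
    then have "pmf (spin_pmf p) s = pmf (bernoulli_pmf p) (s = 1)"
      unfolding spin_pmf_def using pmf_map_inj'[OF inj, of "bernoulli_pmf p" "s = 1"] by simp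
    then show ?thesis using p by (cases "s = 1") simp_all
  qed
  finally show "measure (glauber_measure k p) ((\<lambda>\<omega>. \<omega> v) -` {y. fst y = s} \<inter> space (glauber_measure k p)) = (if s = 1 then p else 1 - p)" .
qed

lemma prob_initial_pattern:
  assumes p: "0 < p" "p < 1" and V: "finite V" "V \<noteq> {}" "V \<subseteq> slab k" and f: "\<And>v. v \<in> V \<Longrightarrow> f v \<in> {-1, 1}"
  shows "measure (glauber_measure k p) {\<omega> \<in> space (glauber_measure k p). \<forall>v\<in>V. initial_spin \<omega> v = f v}
    = (\<Prod>v\<in>V. if f v = 1 then p else 1 - p)"
proof -
  let ?M = "glauber_measure k p"
  interpret prob_space ?M by (rule prob_space_glauber_measure)
  have "slab k \<noteq> {}" using V by auto
  note ind = indep_vars_sites[OF this, of p]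
  have "{\<omega> \<in> space ?M. \<forall>v\<in>V. initial_spin \<omega> v = f v} = (\<Inter>v\<in>V. (\<lambda>\<omega>. \<omega> v) -` {y. fst y = f v} \<inter> space ?M)"
    using V(2) unfolding initial_spin_def by blast
  also have "prob \<dots> = (\<Prod>v\<in>V. prob ((\<lambda>\<omega>. \<omega> v) -` {y. fst y = f v} \<inter> space ?M))"
    by (rule indep_varsD[OF ind V(2,1,3)]) (rule sets_site_spin)
  also have "\<dots> = (\<Prod>v\<in>V. if f v = 1 then p else 1 - p)"
  proof (intro prod.cong refl)
    fix v assume v: "v \<in> V"
    show "prob ((\<lambda>\<omega>. \<omega> v) -` {y. fst y = f v} \<inter> space ?M) = (if f v = 1 then p else 1 - p)"
      by (rule prob_site_spin[OF p f[OF v]]) (use V(3) v in blast)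
  qed
  finally show ?thesis .
qed

definition block :: "nat \<Rightarrow> int \<times> int \<Rightarrow> vertex set" where
  "block k q = {fst q..fst q + 1} \<times> {snd q..snd q + 1} \<times> {..<k}"

lemma block_props: "finite (block k q)" "block k q \<subseteq> slab k" "card (block k q) = 4 * k"
proof -
  have "card {a..a + 1 :: int} = 2" for a by simp
  then show "card (block k q) = 4 * k" by (simp add: block_def card_cartesian_product)
qed (auto simp: block_def slab_def)

text \<open>Two of the four horizontal edge ends and both vertical ones stay in the block: four out
  of six.\<close>

lemma stable_block:
  assumes "2 \<le> k"
  shows "stable Periodic k (\<lambda>v. if v \<in> block k q then Some 1 else None)"
  unfolding stable_def
proof (intro ballI allI impI)
  fix v s assume "v \<in> slab k" and g: "(if v \<in> block k q then Some 1 else None) = Some (s :: int)"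
  obtain x y z where v: "v = (x, y, z)" by (cases v)
  have s: "s = 1" and b: "v \<in> block k q" using g by (auto split: if_splits)
  have f: "(\<lambda>w. (if w \<in> block k q then Some 1 else None) = Some s) = (\<lambda>w. w \<in> block k q)" by (auto simp: s)
  have z: "z < k" using b by (simp add: v block_def)
  have "z - Suc 0 < k" using z by simp
  note z = z this
  have "x = fst q \<or> x = fst q + 1" "y = snd q \<or> y = snd q + 1" using b by (auto simp: v block_def)
  then have "4 \<le> length (filter (\<lambda>w. w \<in> block k q) (edge_ends Periodic k v))"
    using z assms by (elim disjE) (simp_all add: v block_def)
  then show "length (edge_ends Periodic k v) < 2 * length (filter (\<lambda>w. (if w \<in> block k q then Some 1 else None) = Some s) (edge_ends Periodic k v))"
    unfolding f by simp
qed

lemma shift_eq: "((\<lambda>q. q + f) ^^ n) r = (fst r + int n * fst f, snd r + int n * snd f)"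
  by (induction n) (auto simp: algebra_simps prod_eq_iff)

lemma disjoint_blocks:
  assumes fr: "(e, f) \<in> frames" and v: "v \<in> block k (((\<lambda>q. q + f) ^^ (2 * i)) r)" "v \<in> block k (((\<lambda>q. q + f) ^^ (2 * j)) r)"
  shows "i = j"
proof -
  obtain x y z where xyz: "v = (x, y, z)" by (cases v)
  have "f = (1, 0) \<or> f = (-1, 0) \<or> f = (0, 1) \<or> f = (0, -1)" using fr by (auto simp: frames_def)
  then show ?thesis using v unfolding shift_eq xyz block_def by (elim disjE) auto
qed

text \<open>Blocks have side two, so those at even shifts are disjoint and independent, and each of
  them is entirely plus with probability \<open>p ^ (4 * k)\<close>. The probability that the first
  \<open>J + 1\<close> of them fail, \<open>G J\<close>, decays geometrically.\<close>

lemma AE_block_ahead: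
  assumes p: "0 < p" "p < 1" and k: "0 < k" and fr: "(e, f) \<in> frames"
  shows "AE \<omega> in glauber_measure k p. \<exists>n. \<forall>v\<in>block k (((\<lambda>q. q + f) ^^ n) r). initial_spin \<omega> v = 1"
proof -
  let ?M = "glauber_measure k p"
  interpret prob_space ?M by (rule prob_space_glauber_measure)
  define V where "V j = block k (((\<lambda>q. q + f) ^^ (2 * j)) r)" for j :: nat
  note V = block_props[where k = k and q = "((\<lambda>q. q + f) ^^ (2 * j)) r" for j, folded V_def]
  have ne: "V j \<noteq> {}" for j using V(3)[of j] k by auto
  define E where "E j = {y \<in> space (\<Pi>\<^sub>M v\<in>V j. site_measure p). \<not> (\<forall>v\<in>V j. fst (y v) = 1)}" for j
  define c where "c = p ^ (4 * k)"
  have c: "0 < c" "c \<le> 1" using p by (auto simp: c_def power_le_one)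
  have sets_E: "E j \<in> sets (\<Pi>\<^sub>M v\<in>V j. site_measure p)" for j
  proof -
    have "Measurable.pred (\<Pi>\<^sub>M v\<in>V j. site_measure p) (\<lambda>y. \<not> (\<forall>v\<in>V j. fst (y v) = 1))"
    proof (intro pred_intros_logic pred_intros_finite V(1))
      fix v assume "v \<in> V j"
      then have [measurable]: "(\<lambda>y. y v) \<in> measurable (\<Pi>\<^sub>M v\<in>V j. site_measure p) (site_measure p)" by simp
      show "Measurable.pred (\<Pi>\<^sub>M v\<in>V j. site_measure p) (\<lambda>y. fst (y v) = 1)" by measurable
    qed
    then show ?thesis by (simp add: E_def Measurable.pred_def)
  qed
  have "slab k \<noteq> {}" using V(2) ne by blast
  note ind = indep_vars_sites[OF this, of p]
  have "disjoint_family V" unfolding disjoint_family_on_def V_def using disjoint_blocks[OF fr] by blast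
  from indep_vars_restrict[OF ind, of UNIV V, OF V(2) this]
  have ind: "indep_vars (\<lambda>j. \<Pi>\<^sub>M v\<in>V j. site_measure p) (\<lambda>j \<omega>. restrict \<omega> (V j)) UNIV" by simp
  define F where "F j = (\<lambda>\<omega>. restrict \<omega> (V j)) -` E j \<inter> space ?M" for j
  have F: "F j = space ?M - {\<omega> \<in> space ?M. \<forall>v\<in>V j. initial_spin \<omega> v = 1}" for j
    by (auto simp: F_def E_def space_PiM initial_spin_def)
  have events: "F j \<in> events" for j
    unfolding F_def using ind sets_E by (auto simp: indep_vars_def intro: measurable_sets)
  have prob_F: "prob (F j) = 1 - c" for j
  proof -
    have "{\<omega> \<in> space ?M. \<forall>v\<in>V j. initial_spin \<omega> v = 1} = space ?M - F j" unfolding F by blast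
    then have "{\<omega> \<in> space ?M. \<forall>v\<in>V j. initial_spin \<omega> v = 1} \<in> events" using events by simp
    then have "prob (F j) = 1 - prob {\<omega> \<in> space ?M. \<forall>v\<in>V j. initial_spin \<omega> v = 1}"
      unfolding F by (rule prob_compl)
    then show ?thesis using prob_initial_pattern[OF p V(1) ne V(2), of j "\<lambda>_. 1"] V(3)[of j] by (simp add: c_def)
  qed
  define G where "G J = (\<Inter>j\<in>{..J}. F j)" for J
  have "prob (G J) = (1 - c) ^ Suc J" for J
    unfolding G_def F_def using indep_varsD[OF ind, of "{..J}" E] sets_E
    by (simp add: F_def[symmetric] prob_F)
  then have G: "emeasure ?M (G J) = ennreal ((1 - c) ^ Suc J)" for J by (simp add: emeasure_eq_measure)
  have "AE \<omega> in ?M. eventually (\<lambda>J. \<omega> \<notin> G J) sequentially"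
  proof (rule AE_eventually_not_in)
    show "G J \<in> events" for J unfolding G_def using events by (intro sets.finite_INT) auto
    have "(\<Sum>J. emeasure ?M (G J)) = (\<Sum>J. ennreal ((1 - c) ^ Suc J))" unfolding G ..
    also have "\<dots> < \<infinity>"
      using c by (subst suminf_ennreal2) (auto intro!: summable_mult summable_geometric simp: power_Suc)
    finally show "(\<Sum>J. emeasure ?M (G J)) < \<infinity>" .
  qed
  then show ?thesis using AE_space
  proof eventually_elim
    case (elim \<omega>)
    then obtain J where "\<omega> \<notin> G J" by (auto simp: eventually_sequentially)
    then obtain j where "\<forall>v\<in>V j. initial_spin \<omega> v = 1" using elim(2) unfolding G_def F by blast
    then show ?case unfolding V_def by blast
  qed
qed

section \<open>The widths that fixate\<close>

lemma slab_fixatesI: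
  assumes k: "2 \<le> k"
    and no_tie: "AE \<omega> in glauber_measure k p. \<forall>\<xi>\<in>limit_configs b k \<omega>. \<forall>v\<in>slab k. energy b k \<xi> v \<noteq> 0"
  shows "slab_fixates b k p"
  unfolding slab_fixates_iff
  using no_tie AE_fair_sample[OF k, where b = b]
proof eventually_elim
  case (elim \<omega>)
  interpret fair_path b k \<omega> using elim(2) by unfold_locales
  show ?case
  proof (intro ballI, rule ccontr)
    fix v assume v: "v \<in> slab k" "\<not> (\<exists>M. \<forall>m\<ge>M. ring_spin b k \<omega> v m = ring_spin b k \<omega> v M)"
    then have "\<exists>m\<ge>M. ring_spin b k \<omega> v m \<noteq> ring_spin b k \<omega> v M" for M by blast
    from ex_limit_config_tie[OF k v(1) this] show False using elim(1) v(1) by blast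
  qed
qed

lemma slab_fixates_free_2: "slab_fixates Free 2 p"
proof (rule slab_fixatesI)
  show "AE \<omega> in glauber_measure 2 p. \<forall>\<xi>\<in>limit_configs Free 2 \<omega>. \<forall>v\<in>slab 2. energy Free 2 \<xi> v \<noteq> 0"
    using AE_fair_sample[OF order.refl, where b = Free]
  proof eventually_elim
    case (elim \<omega>)
    interpret fair_path Free 2 \<omega> using elim by unfold_locales
    show ?case
    proof (intro ballI notI)
      fix \<xi> v assume \<xi>: "\<xi> \<in> limit_configs Free 2 \<omega>" and v: "v \<in> slab 2" and "energy Free 2 \<xi> v = 0"
      then have "2 * int (disagreements Free 2 \<xi> v) = int (length (edge_ends Free 2 v))"
        using energy_eq_disagreements[OF order.refl v limit_config_values[OF \<xi>], where b = Free] by simp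
      then have "2 * disagreements Free 2 \<xi> v = length (edge_ends Free 2 v)" by linarith
      then show False using odd_length_edge_ends_free_2[OF v] by (metis dvd_triv_left)
    qed
  qed
qed simp

lemma (in fair_path) no_tie_limit_configs:
  assumes b: "b = Periodic" and k: "2 \<le> k"
    and no_tie: "\<And>t v. t \<in> (\<lambda>\<xi> v. \<xi> v = 1) ` limit_configs b k \<omega> \<Longrightarrow> v \<in> slab k \<Longrightarrow> disagreements b k t v \<noteq> 3"
    and \<xi>: "\<xi> \<in> limit_configs b k \<omega>" and v: "v \<in> slab k"
  shows "energy b k \<xi> v \<noteq> 0"
  using energy_eq_disagreements_up[OF k v limit_config_values[OF \<xi>]] no_tie[OF imageI[OF \<xi>] v] b by simp

lemma slab_fixates_periodic_2: "slab_fixates Periodic 2 p"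
proof (rule slab_fixatesI)
  show "AE \<omega> in glauber_measure 2 p. \<forall>\<xi>\<in>limit_configs Periodic 2 \<omega>. \<forall>v\<in>slab 2. energy Periodic 2 \<xi> v \<noteq> 0"
    using AE_fair_sample[OF order.refl, where b = Periodic]
  proof eventually_elim
    case (elim \<omega>)
    interpret fair_path Periodic 2 \<omega> using elim by unfold_locales
    show ?case
      by (intro ballI no_tie_limit_configs refl order.refl tie_closed_2[OF tie_closed_limit_configs[OF order.refl elim]])
  qed
qed simp

lemma slab_fixates_periodic_3:
  assumes p: "0 < p" "p < 1"
  shows "slab_fixates Periodic 3 p"
proof (rule slab_fixatesI)
  have k: "2 \<le> (3 :: nat)" by simp
  have "finite frames" by (simp add: frames_def)
  have "AE \<omega> in glauber_measure 3 p. \<forall>r. \<forall>ef\<in>frames. \<exists>n. \<forall>v\<in>block 3 (((\<lambda>q. q + snd ef) ^^ n) r). initial_spin \<omega> v = 1"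
    unfolding AE_all_countable AE_ball_countable[OF countable_finite[OF \<open>finite frames\<close>]]
  proof (intro allI ballI)
    fix r ef assume "ef \<in> frames"
    then have "(fst ef, snd ef) \<in> frames" by simp
    from AE_block_ahead[OF p _ this, of 3 r]
    show "AE \<omega> in glauber_measure 3 p. \<exists>n. \<forall>v\<in>block 3 (((\<lambda>q. q + snd ef) ^^ n) r). initial_spin \<omega> v = 1" by simp
  qed
  then show "AE \<omega> in glauber_measure 3 p. \<forall>\<xi>\<in>limit_configs Periodic 3 \<omega>. \<forall>v\<in>slab 3. energy Periodic 3 \<xi> v \<noteq> 0"
    using AE_fair_sample[OF k, where b = Periodic]
  proof eventually_elim
    case (elim \<omega>)
    interpret fair_path Periodic 3 \<omega> using elim(2) by unfold_locales
    interpret pinned_slab_3 "(\<lambda>\<xi> v. \<xi> v = 1) ` limit_configs Periodic 3 \<omega>"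
    proof
      show "tie_closed 3 ((\<lambda>\<xi> v. \<xi> v = 1) ` limit_configs Periodic 3 \<omega>)" by (rule tie_closed_limit_configs[OF k elim(2)])
      fix r e f assume fr: "(e, f) \<in> frames"
      from bspec[OF spec[OF elim(1), of r] fr]
      obtain n where n: "\<forall>v\<in>block 3 (((\<lambda>q. q + f) ^^ n) r). initial_spin \<omega> v = 1" by auto
      define q where "q = ((\<lambda>q. q + f) ^^ n) r"
      have "\<xi> (cell q z) = 1" if "\<xi> \<in> limit_configs Periodic 3 \<omega>" "z < 3" for \<xi> z
      proof (rule limit_config_stable[OF k stable_block[OF k, of q] _ _ _ that(1)])
        fix v and s :: int assume "(if v \<in> block 3 q then Some 1 else None) = Some s"
        then show "initial_spin \<omega> v = s" using n by (auto simp: q_def split: if_splits)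
      qed (use that(2) in \<open>auto simp: block_def cell_def slab_def\<close>)
      then have "\<forall>z<3. \<forall>s\<in>(\<lambda>\<xi> v. \<xi> v = 1) ` limit_configs Periodic 3 \<omega>. \<forall>t\<in>(\<lambda>\<xi> v. \<xi> v = 1) ` limit_configs Periodic 3 \<omega>.
          s (cell q z) = t (cell q z)" by simp
      then show "\<exists>n. \<forall>z<3. \<forall>s\<in>(\<lambda>\<xi> v. \<xi> v = 1) ` limit_configs Periodic 3 \<omega>. \<forall>t\<in>(\<lambda>\<xi> v. \<xi> v = 1) ` limit_configs Periodic 3 \<omega>.
          s (cell (((\<lambda>q. q + f) ^^ n) r) z) = t (cell (((\<lambda>q. q + f) ^^ n) r) z)" unfolding q_def by blast
    qed
    show ?case by (intro ballI no_tie_limit_configs refl k no_tie)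
  qed
qed simp

text \<open>With positive probability the initial spins contain the pattern \<open>g\<close>, which
  then persists in every limit configuration. Fixation would give a limit configuration of negative
  energy everywhere, which \<open>conflict\<close> excludes.\<close>

lemma not_slab_fixates:
  assumes p: "0 < p" "p < 1" and k: "2 \<le> k" and g: "stable b k g" "finite (dom g)" "dom g \<noteq> {}" "dom g \<subseteq> slab k" "ran g \<subseteq> {-1, 1}"
    and conflict: "\<And>\<xi>. (\<And>v. v \<in> slab k \<Longrightarrow> \<xi> v \<in> {-1, 1}) \<Longrightarrow> (\<And>v s. g v = Some s \<Longrightarrow> \<xi> v = s) \<Longrightarrow>
      (\<And>v. v \<in> slab k \<Longrightarrow> energy b k \<xi> v < 0) \<Longrightarrow> False"
  shows "\<not> slab_fixates b k p"
proof
  let ?M = "glauber_measure k p"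
  interpret prob_space ?M by (rule prob_space_glauber_measure)
  define A where "A = {\<omega> \<in> space ?M. \<forall>v\<in>dom g. initial_spin \<omega> v = the (g v)}"
  have vals: "the (g v) \<in> {-1, 1}" if "v \<in> dom g" for v
  proof -
    obtain s where s: "g v = Some s" using \<open>v \<in> dom g\<close> by blast
    then have "s \<in> ran g" by (rule ranI[of g v])
    then show ?thesis using g(5) by (auto simp: s)
  qed
  assume "slab_fixates b k p"
  then have AE: "AE \<omega> in ?M. \<omega> \<notin> A" unfolding slab_fixates_iff using AE_fair_sample[OF k, where b = b]
  proof eventually_elim
    case (elim \<omega>)
    interpret fair_path b k \<omega> using elim(2) by unfold_locales
    show ?case
    proof
      assume A: "\<omega> \<in> A"
      have init: "initial_spin \<omega> v = s" if g: "g v = Some s" for v s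
      proof -
        have "v \<in> dom g" using g by blast
        then have "initial_spin \<omega> v = the (g v)" using A unfolding A_def by blast
        then show ?thesis by (simp add: g)
      qed
      have "0 < k" using k by simp
      from limit_config_of_fixation[OF this] elim(1)
      obtain \<xi> where \<xi>: "\<xi> \<in> limit_configs b k \<omega>" "\<And>v. v \<in> slab k \<Longrightarrow> energy b k \<xi> v < 0" by blast
      show False
      proof (rule conflict)
        fix v s assume gv: "g v = Some s"
        then have "v \<in> slab k" using g(4) by (auto simp: dom_def)
        from limit_config_stable[OF k g(1) init this gv \<xi>(1)] show "\<xi> v = s" .
      qed (use limit_config_values[OF \<xi>(1)] \<xi>(2) in blast)+
    qed
  qed
  have "prob A = (\<Prod>v\<in>dom g. if the (g v) = 1 then p else 1 - p)"
    unfolding A_def by (rule prob_initial_pattern[OF p g(2-4) vals])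
  also have "0 < \<dots>" by (rule prod_pos) (use p in auto)
  finally have pos: "0 < prob A" .
  \<comment> \<open>A set outside the sigma-algebra has \<open>measure\<close> zero by convention,
    so positivity yields measurability.\<close>
  then have "A \<in> events" using measure_notin_sets by fastforce
  moreover have "{\<omega> \<in> space ?M. \<not> \<omega> \<notin> A} = A" by (auto simp: A_def)
  ultimately have "emeasure ?M A = 0" using AE by (simp add: AE_iff_measurable)
  then show False using pos by (simp add: emeasure_eq_measure)
qed

section \<open>Patterns that prevent fixation, given by rectangles\<close>

fun rect_value :: "('a \<times> int \<times> int \<times> int \<times> int) list \<Rightarrow> 'a \<Rightarrow> int \<times> int \<Rightarrow> 'a" where
  "rect_value [] d q = d"
| "rect_value ((c, x0, x1, y0, y1) # rs) d q =
     (if x0 \<le> fst q \<and> fst q \<le> x1 \<and> y0 \<le> snd q \<and> snd q \<le> y1 then c else rect_value rs d q)"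

definition on_rects :: "(int \<times> int \<Rightarrow> bool) \<Rightarrow> ('a \<times> int \<times> int \<times> int \<times> int) list \<Rightarrow> bool" where
  "on_rects P rs \<longleftrightarrow> list_all P (concat (map (\<lambda>(c, x0, x1, y0, y1). List.product [x0..x1] [y0..y1]) rs))"

lemma on_rects_Cons:
  "on_rects P ((c, x0, x1, y0, y1) # rs) \<longleftrightarrow> (\<forall>x\<in>{x0..x1}. \<forall>y\<in>{y0..y1}. P (x, y)) \<and> on_rects P rs"
proof -
  have "list_all P (List.product [x0..x1] [y0..y1]) \<longleftrightarrow> (\<forall>x\<in>{x0..x1}. \<forall>y\<in>{y0..y1}. P (x, y))"
    by (auto simp: list_all_iff)
  then show ?thesis by (simp only: on_rects_def list.map concat.simps prod.case list_all_append)
qed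

text \<open>Rectangles may overlap, the first one being decisive; a finite check of their points
  still covers every point whose value differs from the default.\<close>

lemma on_rectsD: "on_rects P rs \<Longrightarrow> rect_value rs d (x, y) \<noteq> d \<Longrightarrow> P (x, y)"
proof (induction rs)
  case (Cons r rs)
  obtain c x0 x1 y0 y1 where r: "r = (c, x0, x1, y0, y1)" by (cases r)
  show ?case using Cons by (cases "x0 \<le> x \<and> x \<le> x1 \<and> y0 \<le> y \<and> y \<le> y1") (simp_all add: r on_rects_Cons)
qed simp

lemma finite_rects: "finite {q. rect_value rs d q \<noteq> d}"
proof (induction rs)
  case (Cons r rs)
  obtain c x0 x1 y0 y1 where r: "r = (c, x0, x1, y0, y1)" by (cases r)
  have "{q. rect_value (r # rs) d q \<noteq> d} \<subseteq> {x0..x1} \<times> {y0..y1} \<union> {q. rect_value rs d q \<noteq> d}" by (auto simp: r)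
  from finite_subset[OF this] show ?case using Cons by simp
qed simp

fun nbrs :: "int \<times> int \<Rightarrow> (int \<times> int) list" where
  "nbrs (x, y) = [(x + 1, y), (x - 1, y), (x, y + 1), (x, y - 1)]"

fun pattern :: "nat \<Rightarrow> (nat \<Rightarrow> 'a \<Rightarrow> int) \<Rightarrow> (int \<times> int \<Rightarrow> 'a) \<Rightarrow> vertex \<Rightarrow> int option" where
  "pattern k f c (x, y, z) = (if z < k \<and> f z (c (x, y)) \<noteq> 0 then Some (f z (c (x, y))) else None)"

lemma dom_pattern:
  assumes "finite {q. c q \<noteq> d}" "\<And>z. f z d = 0"
  shows "finite (dom (pattern k f c))" "dom (pattern k f c) \<subseteq> slab k"
proof -
  have "dom (pattern k f c) \<subseteq> (\<lambda>((x, y), z). (x, y, z)) ` ({q. c q \<noteq> d} \<times> {..<k})"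
  proof
    fix v assume v: "v \<in> dom (pattern k f c)"
    obtain x y z where xyz: "v = (x, y, z)" by (cases v)
    have "z < k" "c (x, y) \<noteq> d" using v assms(2) by (auto simp: xyz split: if_splits)
    then show "v \<in> (\<lambda>((x, y), z). (x, y, z)) ` ({q. c q \<noteq> d} \<times> {..<k})"
      by (intro image_eqI[of _ _ "((x, y), z)"]) (simp_all add: xyz)
  qed
  then show "finite (dom (pattern k f c))" by (rule finite_subset) (use assms(1) in simp)
qed (auto simp: slab_def split: if_splits)

text \<open>The height of the minus spins is \<^term>\<open>0\<close> in columns of kind \<^term>\<open>0 :: nat\<close>, the full width in kind \<^term>\<open>1 :: nat\<close>,
  and \<^term>\<open>h\<close> and \<^term>\<open>h + 1\<close> in kinds \<^term>\<open>2 :: nat\<close> and \<^term>\<open>3 :: nat\<close>. The column of kind \<^term>\<open>4 :: nat\<close> is left open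
  (value \<^term>\<open>0 :: int\<close>) in layer \<^term>\<open>h\<close>; \<^term>\<open>r\<close> is \<^term>\<open>0\<close>, \<^term>\<open>1\<close> or \<^term>\<open>2\<close> below, in and above this layer.\<close>

definition height_spin :: "nat \<Rightarrow> nat \<Rightarrow> int" where
  "height_spin r \<tau> = (if \<tau> = 0 then 1 else if \<tau> = 1 then -1 else if \<tau> = 2 then (if r = 0 then -1 else 1)
     else if \<tau> = 3 then (if r = 2 then 1 else -1) else if \<tau> = 4 then int r - 1 else 0)"

definition side :: "nat \<Rightarrow> nat \<Rightarrow> nat" where
  "side h z = (if z < h then 0 else if z = h then 1 else 2)"

text \<open>The columns next to the origin have the kinds 3, 2, 0 and 1, which in layer
  \<open>h\<close> means two spins of either sign. The extent of the rectangles and the ones further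
  out supply the horizontal agreement that keeps these columns frozen. Kind 5, the default used
  below, specifies nothing.\<close>

definition kinds :: "(nat \<times> int \<times> int \<times> int \<times> int) list" where
  "kinds = [
    (4, 0, 0, 0, 0),
    (2, -2, -1, -1, 0),
    (3, 1, 2, 0, 1),
    (0, -2, 0, 1, 2),
    (0, 3, 4, 0, 1),
    (0, -2, -1, -3, -2),
    (1, 0, 2, -2, -1),
    (1, -4, -3, -1, 0),
    (1, 1, 2, 2, 3)]"

text \<open>Uniform columns agree with all their vertical neighbours and need two horizontal
  agreements; the others are asked for three, since only one vertical agreement is guaranteed for
  them.\<close>

definition kinds_agree :: "nat \<Rightarrow> nat list \<Rightarrow> bool" where
  "kinds_agree \<tau> ts \<longleftrightarrow> list_all (\<lambda>r. height_spin r \<tau> = 0 \<or>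
     (if \<tau> \<le> 1 then 2 else 3) \<le> length (filter (\<lambda>t. height_spin r t = height_spin r \<tau>) ts)) [0, 1, 2]"

definition kind_stable :: "int \<times> int \<Rightarrow> bool" where
  "kind_stable q \<longleftrightarrow> kinds_agree (rect_value kinds 5 q) (map (rect_value kinds 5) (nbrs q))"

lemma kinds_stable: "on_rects kind_stable kinds"
  by code_simp

text \<open>A column that is not uniform is constant below and above layer \<open>h\<close>, and
  layer \<open>h\<close> joins one of the sides unless it is open. With two layers on either side,
  as for \<open>h = 2\<close> and \<open>5 \<le> k\<close>, every specified layer has an equal
  vertical neighbour, which makes four agreements out of six. At a free boundary there is only one
  vertical end, and three out of five suffice; hence \<open>h = 1\<close> is enough there.\<close>

lemma vertical_agreement:
  assumes hk: "b = Free \<and> h = 1 \<and> 3 \<le> k \<or> b = Periodic \<and> h = 2 \<and> 5 \<le> k" and z: "z < k" and s: "height_spin (side h z) \<tau> \<noteq> 0"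
    and ws: "ws = (if z + 1 < k then [z + 1] else if b = Periodic then [0] else []) @
      (if 0 < z then [z - 1] else if b = Periodic then [k - 1] else [])"
  shows "4 + length ws < 2 * ((if \<tau> \<le> 1 then 2 else 3) +
    length (filter (\<lambda>y. height_spin (side h y) \<tau> = height_spin (side h z) \<tau>) ws))"
proof -
  let ?f = "\<lambda>y. height_spin (side h y) \<tau>"
  have len: "0 < length ws" "length ws \<le> 2" using hk z by (auto simp: ws)
  show ?thesis
  proof (cases "\<tau> \<le> 1")
    case True
    then have "?f y = ?f z" for y by (auto simp: height_spin_def)
    then have "filter (\<lambda>y. ?f y = ?f z) ws = ws" by simp
    then show ?thesis using True len by simp
  next
    case False
    have up: "z + 1 \<in> set ws" if "z + 1 < k" using that by (simp add: ws)
    have dn: "z - 1 \<in> set ws" if "0 < z" using that by (simp add: ws)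
    have h: "0 < h" "h + 1 < k" using hk by auto
    consider "z = h" | "z < h" | "h < z" by linarith
    then have "length ws \<le> 1 \<or> (\<exists>y\<in>set ws. ?f y = ?f z)"
    proof cases
      case 1
      have "?f (z + 1) = ?f z \<or> ?f (z - 1) = ?f z"
        using s False h unfolding 1 by (simp add: height_spin_def side_def split: if_splits)
      then show ?thesis using up dn 1 h by blast
    next
      case 2
      then have "z = 0 \<or> z = 1 \<and> h = 2" using hk by auto
      then show ?thesis
      proof
        assume z0: "z = 0"
        show ?thesis
        proof (cases "h = 1")
          case True
          then have "length ws \<le> 1" using hk z0 by (auto simp: ws)
          then show ?thesis ..
        next
          case False
          then have "side h (z + 1) = side h z" using hk z0 by (auto simp: side_def)
          then have "?f (z + 1) = ?f z" by (rule arg_cong[where f = "\<lambda>r. height_spin r \<tau>"])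
          moreover have "z + 1 \<in> set ws" using up h z0 by simp
          ultimately show ?thesis by blast
        qed
      next
        assume "z = 1 \<and> h = 2"
        then have "side h (z - 1) = side h z" "0 < z" by (auto simp: side_def)
        then show ?thesis using dn by metis
      qed
    next
      case 3
      show ?thesis
      proof (cases "z + 1 < k")
        case True
        have "side h (z + 1) = side h z" using 3 by (simp add: side_def)
        then show ?thesis using up[OF True] by metis
      next
        case last: False
        show ?thesis
        proof (cases "b = Free")
          case True
          then have "length ws \<le> 1" using last by (simp add: ws)
          then show ?thesis ..
        next
          case False
          then have "h < z - 1" "0 < z" using hk last z by auto
          then have "side h (z - 1) = side h z" using 3 by (simp add: side_def)
          then show ?thesis using dn[OF \<open>0 < z\<close>] by metis
        qed
      qed
    qed
    moreover define n where "n = length (filter (\<lambda>y. ?f y = ?f z) ws)"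
    ultimately have "length ws \<le> 1 \<or> 0 < n" by (auto simp: filter_empty_conv)
    then have "4 + length ws < 2 * (3 + n)" using len(2) by presburger
    then show ?thesis by (simp only: n_def False if_False)
  qed
qed

lemma add_less_double:
  fixes F A B L w m :: nat
  assumes "F = A + B" "L = 4 + w" "4 + w < 2 * (m + B)" "m \<le> A"
  shows "L < 2 * F"
proof -
  have "m + B \<le> F" using assms(1,4) by simp
  then have "2 * (m + B) \<le> 2 * F" by simp
  with assms(3) have "4 + w < 2 * F" by (rule less_le_trans)
  then show ?thesis unfolding assms(2) .
qed

lemma edge_ends_eq:
  "edge_ends b k (x, y, z) = map (\<lambda>q. (fst q, snd q, z)) (nbrs (x, y)) @
     map (\<lambda>z'. (x, y, z')) ((if z + 1 < k then [z + 1] else if b = Periodic then [0] else []) @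
       (if 0 < z then [z - 1] else if b = Periodic then [k - 1] else []))"
  by simp

lemma stable_heights:
  assumes hk: "b = Free \<and> h = 1 \<and> 3 \<le> k \<or> b = Periodic \<and> h = 2 \<and> 5 \<le> k"
  shows "stable b k (pattern k (\<lambda>z. height_spin (side h z)) (rect_value kinds 5))"
  unfolding stable_def
proof (intro ballI allI impI)
  let ?g = "pattern k (\<lambda>z. height_spin (side h z)) (rect_value kinds 5)"
  fix v s assume v: "v \<in> slab k" and g: "?g v = Some s"
  obtain x y z where xyz: "v = (x, y, z)" by (cases v)
  define \<tau> where "\<tau> = rect_value kinds 5 (x, y)"
  have z: "z < k" and s: "s = height_spin (side h z) \<tau>" "s \<noteq> 0" using g by (auto simp: xyz \<tau>_def split: if_splits)
  have "\<tau> \<noteq> 5" using s by (auto simp: height_spin_def)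
  then have "list_all (\<lambda>r. height_spin r \<tau> = 0 \<or> (if \<tau> \<le> 1 then 2 else 3) \<le>
      length (filter (\<lambda>t. height_spin r t = height_spin r \<tau>) (map (rect_value kinds 5) (nbrs (x, y))))) [0, 1, 2]"
    using on_rectsD[OF kinds_stable, of 5 x y] unfolding \<tau>_def kind_stable_def kinds_agree_def by blast
  moreover have "side h z \<in> set [0, 1, 2]" by (simp add: side_def)
  ultimately have hor: "(if \<tau> \<le> 1 then 2 else 3) \<le> length (filter (\<lambda>t. height_spin (side h z) t = s) (map (rect_value kinds 5) (nbrs (x, y))))"
    using s unfolding list_all_iff by metis
  define ws where "ws = (if z + 1 < k then [z + 1] else if b = Periodic then [0] else []) @
      (if 0 < z then [z - 1] else if b = Periodic then [k - 1] else [])"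
  define m :: nat where "m = (if \<tau> \<le> 1 then 2 else 3)"
  have wk: "set ws \<subseteq> {..<k}" using z hk by (auto simp: ws_def)
  have A: "length (filter (\<lambda>t. height_spin (side h z) t = s) (map (rect_value kinds 5) qs))
      = length (filter (\<lambda>w. ?g w = Some s) (map (\<lambda>q. (fst q, snd q, z)) qs))" for qs
    using s(2) z by (induction qs) auto
  have B: "length (filter (\<lambda>y. height_spin (side h y) \<tau> = s) us) = length (filter (\<lambda>w. ?g w = Some s) (map (\<lambda>z'. (x, y, z')) us))"
    if "set us \<subseteq> {..<k}" for us
    using s(2) that by (induction us) (auto simp: \<tau>_def)
  have "length (filter (\<lambda>w. ?g w = Some s) (edge_ends b k v)) =
      length (filter (\<lambda>t. height_spin (side h z) t = s) (map (rect_value kinds 5) (nbrs (x, y)))) +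
      length (filter (\<lambda>y. height_spin (side h y) \<tau> = s) ws)"
    unfolding xyz edge_ends_eq ws_def[symmetric] filter_append length_append A B[OF wk] ..
  moreover have "length (edge_ends b k v) = 4 + length ws" unfolding xyz edge_ends_eq ws_def[symmetric] by simp
  moreover have "4 + length ws < 2 * ((if \<tau> \<le> 1 then 2 else 3) + length (filter (\<lambda>y. height_spin (side h y) \<tau> = s) ws))"
    using vertical_agreement[OF hk z _ ws_def, of \<tau>] s by simp
  ultimately show "length (edge_ends b k v) < 2 * length (filter (\<lambda>w. ?g w = Some s) (edge_ends b k v))"
    using hor unfolding m_def[symmetric] by (rule add_less_double)
qed

lemma kinds_at:
  "rect_value kinds 5 (0, 0) = 4" "rect_value kinds 5 (1, 0) = 3" "rect_value kinds 5 (-1, 0) = 2"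
  "rect_value kinds 5 (0, 1) = 0" "rect_value kinds 5 (0, -1) = 1"
  by (simp_all add: kinds_def)

lemma not_slab_fixates_heights:
  fixes h :: nat
  assumes p: "0 < p" "p < 1" and hk: "b = Free \<and> h = 1 \<and> 3 \<le> k \<or> b = Periodic \<and> h = 2 \<and> 5 \<le> k"
  shows "\<not> slab_fixates b k p"
proof -
  let ?g = "pattern k (\<lambda>z. height_spin (side h z)) (rect_value kinds 5)"
  have k: "2 \<le> k" using hk by auto
  have d: "finite (dom ?g)" "dom ?g \<subseteq> slab k"
    by (rule dom_pattern[OF finite_rects[of kinds 5]], simp add: height_spin_def)+
  have "?g (0, 1, 0) = Some 1" using k by (simp add: kinds_at height_spin_def)
  then have ne: "dom ?g \<noteq> {}" by blast
  have ran: "ran ?g \<subseteq> {-1, 1}"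
  proof
    fix s assume "s \<in> ran ?g"
    then obtain v where "?g v = Some s" unfolding ran_def by blast
    then show "s \<in> {-1, 1}" by (cases v) (auto simp: height_spin_def side_def split: if_splits)
  qed
  show ?thesis
  proof (rule not_slab_fixates[OF p k stable_heights[OF hk] d(1) ne d(2) ran])
    fix \<xi> :: "vertex \<Rightarrow> int"
    assume \<xi>: "\<And>v s. ?g v = Some s \<Longrightarrow> \<xi> v = s" and e: "\<And>v. v \<in> slab k \<Longrightarrow> energy b k \<xi> v < 0"
    have h: "0 < h" "h + 1 < k" using hk by auto
    then have o: "(0, 0, h) \<in> slab k" by (simp add: slab_def)
    \<comment> \<open>Three neighbours of either sign: the open vertex has energy zero whatever its
      own spin is.\<close>
    have "\<xi> (1, 0, h) = -1" "\<xi> (-1, 0, h) = 1" "\<xi> (0, 1, h) = 1" "\<xi> (0, -1, h) = -1" "\<xi> (0, 0, h + 1) = 1" "\<xi> (0, 0, h - 1) = -1"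
      by (rule \<xi>; use h in \<open>simp add: kinds_at height_spin_def side_def\<close>)+
    then show False using e[OF o] h unfolding energy_eq_edge_ends[OF k o] by simp
  qed
qed

text \<open>A computer search found this pattern. In width four each column is given by its four spins, with \<^term>\<open>0 :: int\<close> for the four adjacent vertices left open.\<close>

definition columns_4 :: "(int list \<times> int \<times> int \<times> int \<times> int) list" where
  "columns_4 = [
    ([0, 1, 1, -1], 0, 0, 0, 1),
    ([1, 1, 1, -1], -2, -1, -4, 1),
    ([-1, 1, 1, -1], 0, 1, -4, -3),
    ([-1, 1, 1, -1], -4, -3, -4, 1),
    ([1, 1, -1, -1], -2, -1, -6, -5),
    ([1, 1, -1, -1], -2, -1, 2, 3),
    ([-1, -1, -1, -1], 0, 2, -2, -1),
    ([1, 1, 1, 1], 2, 3, -4, -3),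
    ([-1, -1, -1, -1], 0, 1, -6, -5),
    ([1, 1, 1, 1], -2, -1, -8, -7),
    ([-1, -1, -1, -1], -4, -3, -6, -5),
    ([1, 1, 1, 1], -6, -5, -4, 1),
    ([-1, -1, -1, -1], -4, -3, 2, 3),
    ([0, 1, -1, -1], 0, 0, 2, 3),
    ([-1, 1, -1, -1], 1, 2, 2, 7),
    ([1, 1, -1, -1], -1, 0, 6, 7),
    ([1, 1, -1, -1], 3, 4, 2, 7),
    ([-1, 1, 1, -1], 1, 2, 8, 9),
    ([-1, 1, 1, -1], 1, 2, 0, 1),
    ([1, 1, 1, 1], -2, 0, 4, 5),
    ([-1, -1, -1, -1], -3, -2, 6, 7),
    ([1, 1, 1, 1], -1, 0, 8, 9),
    ([-1, -1, -1, -1], 1, 2, 10, 11),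
    ([1, 1, 1, 1], 3, 4, 8, 9),
    ([-1, -1, -1, -1], 5, 6, 2, 7),
    ([1, 1, 1, 1], 3, 4, 0, 1)]"

definition column_4 :: "int \<times> int \<Rightarrow> int list" where
  "column_4 = rect_value columns_4 [0, 0, 0, 0]"

text \<open>A strict majority of six edge ends is at least four; the layers are taken cyclically,
  and the entry 0 specifies nothing.\<close>

definition columns_agree :: "int list \<Rightarrow> int list list \<Rightarrow> bool" where
  "columns_agree c cs \<longleftrightarrow> list_all (\<lambda>z. c ! z = 0 \<or> 4 \<le> length (filter (\<lambda>d. d ! z = c ! z) cs) +
     (if c ! (if z + 1 < 4 then z + 1 else 0) = c ! z then 1 else 0) + (if c ! (if 0 < z then z - 1 else 3) = c ! z then 1 else 0)) [0, 1, 2, 3]"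

definition column_4_stable :: "int \<times> int \<Rightarrow> bool" where
  "column_4_stable q \<longleftrightarrow> columns_agree (column_4 q) (map column_4 (nbrs q))"

lemma columns_4_stable: "on_rects column_4_stable columns_4"
  by code_simp

lemma column_4_spins: "set (column_4 q) \<subseteq> {-1, 0, 1}" "length (column_4 q) = 4"
proof -
  have "set (rect_value rs [0, 0, 0, 0] q) \<subseteq> {-1, 0, 1 :: int} \<and> length (rect_value rs [0, 0, 0, 0] q) = 4"
    if "list_all (\<lambda>(c, _). set c \<subseteq> {-1, 0, 1} \<and> length c = 4) rs" for rs
    using that by (induction rs) (auto simp: subset_iff split: if_splits)
  moreover have "list_all (\<lambda>(c, _). set c \<subseteq> {-1, 0, 1} \<and> length c = 4) columns_4" by (simp add: columns_4_def)
  ultimately have "set (rect_value columns_4 [0, 0, 0, 0] q) \<subseteq> {-1, 0, 1} \<and> length (rect_value columns_4 [0, 0, 0, 0] q) = 4" by blast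
  then show "set (column_4 q) \<subseteq> {-1, 0, 1}" "length (column_4 q) = 4" by (simp_all add: column_4_def)
qed

lemma stable_columns_4: "stable Periodic 4 (pattern 4 (\<lambda>z c. c ! z) column_4)"
  unfolding stable_def
proof (intro ballI allI impI)
  let ?g = "pattern 4 (\<lambda>z c. c ! z) column_4"
  fix v s assume v: "v \<in> slab 4" and g: "?g v = Some s"
  obtain x y z where xyz: "v = (x, y, z)" by (cases v)
  have z: "z < 4" and s: "s = column_4 (x, y) ! z" "s \<noteq> 0" using g by (auto simp: xyz split: if_splits)
  have "z - Suc 0 < 4" using z by simp
  have "z \<in> set [0, 1, 2, 3]" using z by auto
  moreover have "column_4 (x, y) \<noteq> [0, 0, 0, 0]" using s z by (auto simp: less_Suc_eq numeral_eq_Suc)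
  then have "columns_agree (column_4 (x, y)) (map column_4 (nbrs (x, y)))"
    using on_rectsD[OF columns_4_stable, of "[0, 0, 0, 0]" x y] unfolding column_4_def column_4_stable_def by blast
  ultimately have a: "4 \<le> length (filter (\<lambda>d. d ! z = s) (map column_4 (nbrs (x, y)))) +
     (if column_4 (x, y) ! (if z + 1 < 4 then z + 1 else 0) = s then 1 else 0) +
     (if column_4 (x, y) ! (if 0 < z then z - 1 else 3) = s then 1 else 0)"
    using s unfolding columns_agree_def list_all_iff by blast
  have g_eq: "?g (x', y', z') = Some s \<longleftrightarrow> z' < 4 \<and> column_4 (x', y') ! z' = s" for x' y' z' using s(2) by auto
  have "length (filter (\<lambda>d. d ! z = s) (map column_4 qs)) = length (filter (\<lambda>w. ?g w = Some s) (map (\<lambda>q. (fst q, snd q, z)) qs))" for qs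
    using s(2) z by (induction qs) auto
  then have "length (filter (\<lambda>w. ?g w = Some s) (edge_ends Periodic 4 v)) = length (filter (\<lambda>d. d ! z = s) (map column_4 (nbrs (x, y)))) +
     (if column_4 (x, y) ! (if z + 1 < 4 then z + 1 else 0) = s then 1 else 0) +
     (if column_4 (x, y) ! (if 0 < z then z - 1 else 3) = s then 1 else 0)"
    unfolding xyz edge_ends_eq filter_append length_append using z \<open>z - Suc 0 < 4\<close> by (simp add: g_eq del: pattern.simps)
  then show "length (edge_ends Periodic 4 v) < 2 * length (filter (\<lambda>w. ?g w = Some s) (edge_ends Periodic 4 v))"
    using a by simp
qed

lemma column_4_at:
  "map (\<lambda>i. column_4 (1, i) ! 0) [0, 1, 2, 3] = [-1, -1, -1, -1]" "map (\<lambda>i. column_4 (-1, i) ! 0) [0, 1, 2, 3] = [1, 1, 1, 1]"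
  "map (\<lambda>i. column_4 (0, i) ! 1) [0, 1, 2, 3] = [1, 1, 1, 1]" "map (\<lambda>i. column_4 (0, i) ! 3) [0, 1, 2, 3] = [-1, -1, -1, -1]"
  "column_4 (0, -1) ! 0 = -1" "column_4 (0, 4) ! 0 = 1"
  by code_simp+

lemma not_slab_fixates_periodic_4:
  assumes p: "0 < p" "p < 1"
  shows "\<not> slab_fixates Periodic 4 p"
proof -
  let ?g = "pattern 4 (\<lambda>z c. c ! z) column_4"
  have c: "pattern 4 (\<lambda>z c. c ! z) column_4 = pattern 4 (\<lambda>z c. if z < 4 then c ! z else 0) (rect_value columns_4 [0, 0, 0, 0])"
    by (auto simp: fun_eq_iff column_4_def)
  have "(if z < 4 then [0, 0, 0, 0] ! z else 0) = (0 :: int)" for z :: nat by (cases "z < 4") (auto simp: less_Suc_eq numeral_eq_Suc)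
  note d = dom_pattern[where c = "rect_value columns_4 [0, 0, 0, 0]" and d = "[0, 0, 0, 0]" and
      f = "\<lambda>z c. if z < 4 then c ! z else 0" and k = 4, OF finite_rects this, folded c]
  have "?g (0, 4, 0) = Some 1" using column_4_at(6) by simp
  then have ne: "dom ?g \<noteq> {}" by blast
  have ran: "ran ?g \<subseteq> {-1, 1}"
  proof
    fix s assume "s \<in> ran ?g"
    then obtain v where v: "?g v = Some s" unfolding ran_def by blast
    obtain x y z where xyz: "v = (x, y, z)" by (cases v)
    have s: "z < 4" "s \<noteq> 0" "s = column_4 (x, y) ! z" using v by (auto simp: xyz split: if_splits)
    then have "s \<in> set (column_4 (x, y))" using column_4_spins(2)[of "(x, y)"] by simp
    then show "s \<in> {-1, 1}" using column_4_spins(1)[of "(x, y)"] s(2) by auto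
  qed
  show ?thesis
  proof (rule not_slab_fixates[OF p _ stable_columns_4 d(1) ne d(2) ran])
    fix \<xi> :: "vertex \<Rightarrow> int"
    assume v: "\<And>v. v \<in> slab 4 \<Longrightarrow> \<xi> v \<in> {-1, 1}" and \<xi>: "\<And>v s. ?g v = Some s \<Longrightarrow> \<xi> v = s" and e: "\<And>v. v \<in> slab 4 \<Longrightarrow> energy Periodic 4 \<xi> v < 0"
    have s: "(0, i, 0) \<in> slab 4" for i by (simp add: slab_def)
    have "\<xi> (1, i, 0) = -1 \<and> \<xi> (-1, i, 0) = 1 \<and> \<xi> (0, i, 1) = 1 \<and> \<xi> (0, i, 3) = -1" if "i \<in> {0, 1, 2, 3}" for i
      by (intro conjI \<xi>) (use that column_4_at in auto)
    \<comment> \<open>At each open vertex the contributions of the two sides and of the two vertical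
      neighbours cancel, so only its neighbours in the row count. Negative energy would make it
      agree with both of them, along the whole row, but the ends of the row have opposite
      spins.\<close>
    then have "0 < \<xi> (0, i, 0) * (\<xi> (0, i + 1, 0) + \<xi> (0, i - 1, 0))" if "i \<in> {0, 1, 2, 3}" for i
      using e[OF s[of i]] that unfolding energy_eq_edge_ends[OF _ s, of Periodic, simplified] by (simp add: algebra_simps)
    from this[of 0] this[of 1] this[of 2] this[of 3]
    have "0 < \<xi> (0, 0, 0) * (\<xi> (0, 1, 0) + \<xi> (0, -1, 0))" "0 < \<xi> (0, 1, 0) * (\<xi> (0, 2, 0) + \<xi> (0, 0, 0))"
      "0 < \<xi> (0, 2, 0) * (\<xi> (0, 3, 0) + \<xi> (0, 1, 0))" "0 < \<xi> (0, 3, 0) * (\<xi> (0, 4, 0) + \<xi> (0, 2, 0))" by simp_all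
    moreover have "\<xi> (0, -1, 0) = -1" "\<xi> (0, 4, 0) = 1" by (rule \<xi>; use column_4_at in simp)+
    ultimately show False using v[OF s[of 0]] v[OF s[of 1]] v[OF s[of 2]] v[OF s[of 3]] by auto
  qed simp
qed

theorem mainTheorem3:
  fixes p :: real and k :: nat
  assumes "0 < p" and "p < 1" and "k \<ge> 2"
  shows "(slab_fixates Free k p \<longleftrightarrow> k = 2) \<and> (slab_fixates Periodic k p \<longleftrightarrow> k \<le> 3)"
proof
  show "slab_fixates Free k p \<longleftrightarrow> k = 2"
    using slab_fixates_free_2 not_slab_fixates_heights[OF assms(1,2), of Free 1 k] assms(3) by (cases "k = 2") auto
  consider "k = 2" | "k = 3" | "k = 4" | "5 \<le> k" using assms(3) by linarith
  then show "slab_fixates Periodic k p \<longleftrightarrow> k \<le> 3"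
  proof cases
    case 4
    then show ?thesis using not_slab_fixates_heights[OF assms(1,2), of Periodic 2 k] by simp
  qed (use slab_fixates_periodic_2 slab_fixates_periodic_3[OF assms(1,2)] not_slab_fixates_periodic_4[OF assms(1,2)] in simp_all)
qed

end
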